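(* Let $\Omega\subset\mathbb{C}$ be a domain. Then $$c_B^2(z)\ \ge\ \frac{\pi}{v(\Omega)},\qquad z\in\Omega.$$ Moreover, for $z_0\in\Omega$, equality holds at $z_0$ if and only if either of the following holds true: 1. $v(\Omega)<\infty$ and $\Omega=\mathbb{D}(z_0,\sqrt{\pi^{-1}v(\Omega)})\setminus P$, where $P$ satisfies $$P\cap\overline{\mathbb{D}(z_0,s)}\in\mathcal{N}_B\quad\text{for all } s<\sqrt{\pi^{-1}v(\Omega)};$$ if additionally $c_\beta^2(z_0)=\pi/v(\Omega)$, then this $P$ is a relatively closed polar set (in the disk); 2. $v(\Omega)=\infty$ and $\Omega=\mathbb{C}\setminus P$, where $P\in\mathcal{N}_B$.
   Context: $v(\cdot)$ is the Euclidean area (two-dimensional Lebesgue measure) on $\mathbb{C}$, with the convention $v^{-1}(\Omega)=0$ (so $\pi/v(\Omega)=0$) when $v(\Omega)=\infty$. $\mathbb{D}(z_0,r)=\{z\in\mathbb{C}:|z-z_0|<r\}$, $\mathbb{D}=\mathbb{D}(0,1)$, $\mathbb{C}_\infty=\mathbb{C}\cup\{\infty\}$. In $\mathbb{D}(z_0,r)\setminus P$, the set $P$ is understood to be a (possibly empty) subset of $\mathbb{D}(z_0,r)$. Analytic capacity: $c_B(z_0)=\sup\{|f'(z_0)|: f:\Omega\to\mathbb{D}\text{ holomorphic}, f(z_0)=0\}$. Green's function (negative): $G(z,z_0)=\sup\{u(z): u \text{ negative subharmonic on }\Omega,\ \limsup_{z\to z_0}(u(z)-\log|z-z_0|)<\infty\}$;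 it exists in particular when $v(\Omega)<\infty$. Logarithmic capacity: $c_\beta(z_0)=\lim_{z\to z_0}\exp(G(z,z_0)-\log|z-z_0|)$. A compact set $E\subset\mathbb{C}_\infty$ is a null set of class $\mathcal{N}_B$ if all bounded holomorphic functions on $\mathbb{C}_\infty\setminus E$ are constant. (In item 2, $P$ is a compact subset of $\mathbb{C}_\infty$, possibly containing $\infty$.) A Borel set $P$ is polar if there is a subharmonic function $u$ (not identically $-\infty$ on any component) on a neighbourhood of $P$ with $P\subset\{u=-\infty\}$. *)

theory Defs
  imports "HOL-Analysis.Analysis"
begin

section \<open>Area\<close>

definition inv_area :: "complex set \<Rightarrow> real"
  where "inv_area \<Omega> = (if emeasure lborel \<Omega> = \<infinity> then 0 else 1 / measure lborel \<Omega>)"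


section \<open>Analytic capacity\<close>

(* For open \<Omega> containing z0 the set is nonempty (f = 0) and, by the Cauchy estimate on a disk in \<Omega>
   around z0, bounded above, so the real supremum is the true one. *)
definition analytic_capacity :: "complex set \<Rightarrow> complex \<Rightarrow> real"
  where "analytic_capacity \<Omega> z0 =
    Sup {cmod (deriv f z0) | f. f holomorphic_on \<Omega> \<and> f ` \<Omega> \<subseteq> ball 0 1 \<and> f z0 = 0}"


section \<open>The Riemann sphere and null sets of class N_B\<close>

(* The sphere is the one-point compactification of the plane: Some z is the finite point z and
   None is the point at infinity. *)
abbreviation riemann_sphere :: "complex option topology"
  where "riemann_sphere \<equiv> Alexandroff_compactification euclidean"

(* The chart w = 1/z around infinity. *)
definition chart_infinity :: "complex \<Rightarrow> complex option"
  where "chart_infinity w = (if w = 0 then None else Some (1 / w))"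

(* Holomorphy in the two standard charts; meant for open U. *)
definition sphere_holomorphic_on :: "(complex option \<Rightarrow> complex) \<Rightarrow> complex option set \<Rightarrow> bool"
  where "sphere_holomorphic_on f U \<longleftrightarrow>
    (f \<circ> Some) holomorphic_on (Some -` U) \<and>
    (f \<circ> chart_infinity) holomorphic_on (chart_infinity -` U)"

definition null_set_NB :: "complex option set \<Rightarrow> bool"
  where "null_set_NB E \<longleftrightarrow> compactin riemann_sphere E \<and>
    (\<forall>f. sphere_holomorphic_on f (- E) \<and> bounded (f ` (- E)) \<longrightarrow> f constant_on (- E))"


section \<open>Subharmonic functions and polar sets\<close>

(* The mean over a circle as an extended real: integral of the positive part minus integral of the
   negative part (e2ennreal sends negative values to 0).  For upper semicontinuous u < \<infinity> the
   positive part is bounded on the circle, so the difference is never \<infinity> - \<infinity>. *)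
definition circle_mean :: "(complex \<Rightarrow> ereal) \<Rightarrow> complex \<Rightarrow> real \<Rightarrow> ereal"
  where "circle_mean u a r =
    (enn2ereal (\<integral>\<^sup>+t\<in>{0..2 * pi}. e2ennreal (u (a + of_real r * cis t)) \<partial>lborel) -
     enn2ereal (\<integral>\<^sup>+t\<in>{0..2 * pi}. e2ennreal (- u (a + of_real r * cis t)) \<partial>lborel)) /
    ereal (2 * pi)"

(* Upper semicontinuity and the local submean inequality, for open \<Omega>.  The value -\<infinity> is allowed,
   and so is the constant function -\<infinity>. *)
definition subharmonic_on :: "(complex \<Rightarrow> ereal) \<Rightarrow> complex set \<Rightarrow> bool"
  where "subharmonic_on u \<Omega> \<longleftrightarrow>
    (\<forall>z\<in>\<Omega>. u z < \<infinity>) \<and>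
    (\<forall>c::real. open {z \<in> \<Omega>. u z < ereal c}) \<and>
    (\<forall>a\<in>\<Omega>. \<exists>\<rho>>0. ball a \<rho> \<subseteq> \<Omega> \<and> (\<forall>r. 0 < r \<and> r < \<rho> \<longrightarrow> u a \<le> circle_mean u a r))"

definition polar :: "complex set \<Rightarrow> bool"
  where "polar P \<longleftrightarrow> P \<in> sets borel \<and>
    (\<exists>U u. open U \<and> P \<subseteq> U \<and> subharmonic_on u U \<and>
      (\<forall>C\<in>components U. \<exists>z\<in>C. u z \<noteq> -\<infinity>) \<and> (\<forall>z\<in>P. u z = -\<infinity>))"


section \<open>Green's function and logarithmic capacity\<close>

definition green_function :: "complex set \<Rightarrow> complex \<Rightarrow> complex \<Rightarrow> ereal"
  where "green_function \<Omega> z z0 =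
    (SUP u \<in> {u. subharmonic_on u \<Omega> \<and> (\<forall>z\<in>\<Omega>. u z < 0) \<and>
                Limsup (at z0) (\<lambda>z. u z - ereal (ln (cmod (z - z0)))) < \<infinity>}. u z)"

(* exp (-\<infinity>) = 0; the value -\<infinity> of Green's function at z \<noteq> z0 means that it does not exist.  The value
   \<infinity> does not occur for z in \<Omega>, because the functions in the supremum are negative there. *)
definition log_capacity :: "complex set \<Rightarrow> complex \<Rightarrow> real"
  where "log_capacity \<Omega> z0 =
    Lim (at z0) (\<lambda>z. if green_function \<Omega> z z0 = -\<infinity> then 0
                     else exp (real_of_ereal (green_function \<Omega> z z0) - ln (cmod (z - z0))))"

end

theory Submission
  imports Defs "HOL-Complex_Analysis.Complex_Analysis"
begin

text \<open>
  Inverting the plane at \<open>z0\<close> sends the complement of \<open>\<Omega>\<close> to a compact set \<open>K\<close>. Its Cauchy transform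
  is bounded by \<open>sqrt (pi * \<bar>K\<bar>)\<close> (Ahlfors--Beurling), so that \<open>c\<^sub>B\<^sup>2 \<ge> \<bar>K\<bar> / pi\<close>; and among all domains of
  given area the disc centred at \<open>z0\<close> minimizes \<open>\<bar>K\<bar>\<close>. In the case of equality \<open>\<Omega>\<close> is therefore a disc
  minus a set \<open>P\<close> of measure zero. If a compact piece of \<open>P\<close> admitted a nonconstant bounded function on
  its complement, that function could be used to improve the linear competitor; conversely, null sets
  of class \<open>N_B\<close> are removable, so the Cauchy estimate of the full disc applies. If finally \<open>P\<close> were not
  polar, some compact piece of it would carry a bounded Green potential, positive at \<open>z0\<close>. A small
  multiple of this potential can be added to \<open>ln (\<bar>z - z0\<bar> / R)\<close>, which shows \<open>c\<^sub>\<beta> > 1 / R\<close>.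
\<close>

section \<open>Integrals over circles\<close>

text \<open>The disc is extremal because inversion has Jacobian \<open>1 / norm z ^ 4\<close>, which
  decreases with the distance from the centre: compared with the disc of equal area, the complement
  of the domain loses some area outside the disc and gains the same amount inside, where inversion
  magnifies more. In the equality case only compact pieces of P are known to be null sets, while
  competitors live on the disc minus all of P; singularities near the centre must be separated from
  those near the boundary before the null set property can be applied. The limit that defines the
  logarithmic capacity has to be shown to exist: near \<open>z0\<close> each competitor is raised to
  a logarithm plus a Poisson integral, and these Poisson integrals vary near \<open>z0\<close> by an
  amount that is the same for all competitors. No equilibrium measure is constructed. Finite
  configurations of almost minimal energy take its place, and its potential is replaced by a limsup
  of averaged Green functions. The limsup keeps only a one-sided mean value inequality, which is the
  one that a subharmonic competitor needs.\<close>

lemma holomorphic_on_integral_parameter: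
  fixes f :: "complex \<Rightarrow> 'a \<Rightarrow> complex"
  assumes "open S"
    and meas: "\<And>z. z \<in> S \<Longrightarrow> f z \<in> borel_measurable M"
    and hol: "\<And>x. x \<in> space M \<Longrightarrow> (\<lambda>z. f z x) holomorphic_on S"
    and dom: "\<And>z. z \<in> S \<Longrightarrow> \<exists>r>0. \<exists>g. integrable M g \<and> ball z r \<subseteq> S \<and>
                (\<forall>w\<in>ball z r. \<forall>x\<in>space M. norm (f w x) \<le> g x)"
  shows "(\<lambda>z. \<integral>x. f z x \<partial>M) holomorphic_on S"
proof -
  have "\<exists>D. ((\<lambda>z. \<integral>x. f z x \<partial>M) has_field_derivative D) (at z)" if z: "z \<in> S" for z
  proof -
    obtain r g where r: "r > 0" and g: "integrable M g" and rS: "ball z r \<subseteq> S"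
      and le: "\<And>w x. w \<in> ball z r \<Longrightarrow> x \<in> space M \<Longrightarrow> norm (f w x) \<le> g x"
      using dom[OF z] by blast
    let ?D = "\<lambda>x. deriv (\<lambda>z. f z x) z"
    \<comment> \<open>Cauchy's estimate on circles of radius \<open>r/4\<close> bounds the
      derivative by \<open>4 / r * g x\<close>; domination of the functions thus becomes domination
      of the difference quotients.\<close>
    have diff: "norm (f w x - f z x) \<le> (4 / r * g x) * norm (w - z)"
      if w: "w \<in> ball z (r/2)" and x: "x \<in> space M" for w x
    proof (rule field_differentiable_bound)
      show "convex (ball z (r/2))" by simp
      show "w \<in> ball z (r/2)" "z \<in> ball z (r/2)" using w r by auto
      fix y assume y: "y \<in> ball z (r/2)"
      then have sub: "cball y (r/4) \<subseteq> ball z r"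
      proof -
        have "dist z u < r" if "dist y u \<le> r/4" for u
          using y that dist_triangle[of z u y] r by auto
        then show ?thesis by auto
      qed
      have h: "(\<lambda>z. f z x) holomorphic_on ball z r"
        using hol[OF x] rS holomorphic_on_subset by blast
      have yr: "y \<in> ball z r" using y r by auto
      show "((\<lambda>z. f z x) has_field_derivative deriv (\<lambda>z. f z x) y) (at y within ball z (r/2))"
        using h yr by (meson has_field_derivative_at_within holomorphic_derivI open_ball)
      have "norm ((deriv ^^ 1) (\<lambda>z. f z x) y) \<le> fact 1 * g x / (r/4) ^ 1"
      proof (rule Cauchy_inequality)
        show "(\<lambda>z. f z x) holomorphic_on ball y (r/4)"
          using h sub ball_subset_cball holomorphic_on_subset by (meson subset_trans)
        show "continuous_on (cball y (r/4)) (\<lambda>z. f z x)"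
          using h sub holomorphic_on_imp_continuous_on holomorphic_on_subset by blast
        show "0 < r/4" using r by simp
        fix u assume "norm (y - u) = r/4"
        then have "u \<in> ball z r" using sub by (auto simp: dist_norm subset_iff)
        then show "norm (f u x) \<le> g x" using le x by blast
      qed
      then show "norm (deriv (\<lambda>z. f z x) y) \<le> 4 / r * g x" by (simp add: mult.commute)
    qed
    have "((\<lambda>w. ((\<integral>x. f w x \<partial>M) - (\<integral>x. f z x \<partial>M)) / (w - z)) \<longlongrightarrow> (\<integral>x. ?D x \<partial>M)) (at z)"
      unfolding tendsto_at_iff_sequentially
    proof (intro allI impI)
      fix X :: "nat \<Rightarrow> complex"
      assume X: "\<forall>i. X i \<in> UNIV - {z}" and Xz: "X \<longlonglongrightarrow> z"
      have "\<forall>\<^sub>F n in sequentially. X n \<in> ball z (r/2)"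
        by (rule topological_tendstoD[OF Xz]) (use r in auto)
      then obtain N where N: "\<And>n. n \<ge> N \<Longrightarrow> X n \<in> ball z (r/2)"
        unfolding eventually_sequentially by blast
      let ?Y = "\<lambda>n. X (n + N)"
      have Y: "?Y n \<in> ball z (r/2)" "?Y n \<in> S" "?Y n \<in> ball z r" "?Y n \<noteq> z" for n
        using N[of "n+N"] X rS r by auto
      have int: "integrable M (f w)" if "w \<in> ball z r" for w
        using that rS g le meas by (intro Bochner_Integration.integrable_bound[OF g]) (auto intro!: AE_I2 intro: order_trans[OF _ abs_ge_self])
      have lim: "(\<lambda>n. (f (?Y n) x - f z x) / (?Y n - z)) \<longlonglongrightarrow> ?D x" if x: "x \<in> space M" for x
      proof -
        have "((\<lambda>z. f z x) has_field_derivative ?D x) (at z)"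
          using hol[OF x] z \<open>open S\<close> holomorphic_derivI by blast
        then have "((\<lambda>w. (f w x - f z x) / (w - z)) \<longlongrightarrow> ?D x) (at z)"
          by (simp add: has_field_derivative_iff)
        moreover have "?Y \<longlonglongrightarrow> z" using Xz LIMSEQ_ignore_initial_segment by blast
        ultimately show ?thesis
          using X unfolding tendsto_at_iff_sequentially by (auto simp: o_def)
      qed
      have meas': "(\<lambda>x. (f (?Y n) x - f z x) / (?Y n - z)) \<in> borel_measurable M" for n
        using meas[OF Y(2)[of n]] meas[OF z] by measurable
      have "(\<lambda>n. \<integral>x. (f (?Y n) x - f z x) / (?Y n - z) \<partial>M) \<longlonglongrightarrow> (\<integral>x. ?D x \<partial>M)"
      proof (rule integral_dominated_convergence[where w = "\<lambda>x. 4 / r * g x"])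
        show "?D \<in> borel_measurable M"
          by (rule borel_measurable_LIMSEQ_metric[OF meas' lim])
        show "integrable M (\<lambda>x. 4 / r * g x)" using g by simp
        show "AE x in M. (\<lambda>n. (f (?Y n) x - f z x) / (?Y n - z)) \<longlonglongrightarrow> ?D x"
          using lim by (intro AE_I2)
        fix n
        show "AE x in M. norm ((f (?Y n) x - f z x) / (?Y n - z)) \<le> 4 / r * g x"
          using diff[OF Y(1)] Y(4) by (intro AE_I2) (auto simp: norm_divide divide_simps split: if_splits)
        show "(\<lambda>x. (f (?Y n) x - f z x) / (?Y n - z)) \<in> borel_measurable M" by (rule meas')
      qed
      moreover have "(\<integral>x. (f (?Y n) x - f z x) / (?Y n - z) \<partial>M) =
          ((\<integral>x. f (?Y n) x \<partial>M) - (\<integral>x. f z x \<partial>M)) / (?Y n - z)" for n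
        using int[OF Y(3)[of n]] int[of z] r by simp
      ultimately have "(\<lambda>n. ((\<integral>x. f (?Y n) x \<partial>M) - (\<integral>x. f z x \<partial>M)) / (?Y n - z)) \<longlonglongrightarrow> (\<integral>x. ?D x \<partial>M)"
        by (simp only:)
      from LIMSEQ_offset[of "\<lambda>n. ((\<integral>x. f (X n) x \<partial>M) - (\<integral>x. f z x \<partial>M)) / (X n - z)", OF this]
      show "((\<lambda>w. ((\<integral>x. f w x \<partial>M) - (\<integral>x. f z x \<partial>M)) / (w - z)) \<circ> X) \<longlonglongrightarrow> (\<integral>x. ?D x \<partial>M)"
        by (simp add: o_def)
    qed
    then show ?thesis by (auto simp: has_field_derivative_iff)
  qed
  then show ?thesis
    using \<open>open S\<close> by (auto simp: holomorphic_on_open)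
qed

text \<open>A finite measure of its own, so that Fubini and dominated convergence apply directly. It
  is not normalized: its mass is \<open>2 * pi\<close>, and this factor accompanies every mean value
  below.\<close>

definition circle_measure :: "real measure"
  where "circle_measure = restrict_space lborel {0..2 * pi}"

lemma space_circle_measure [simp]: "space circle_measure = {0..2 * pi}"
  by (simp add: circle_measure_def space_restrict_space)

lemma emeasure_circle_measure: "emeasure circle_measure (space circle_measure) = ennreal (2 * pi)"
  by (simp add: circle_measure_def emeasure_restrict_space space_restrict_space)

interpretation circle_measure: finite_measure circle_measure
  by standard (simp add: emeasure_circle_measure del: space_circle_measure)

lemma measure_circle_measure [simp]: "measure circle_measure {0..2 * pi} = 2 * pi"
  using emeasure_circle_measure by (simp add: measure_def)

lemma borel_measurable_circle_measure [measurable (raw)]: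
  "f \<in> borel_measurable borel \<Longrightarrow> f \<in> borel_measurable circle_measure"
  by (simp add: circle_measure_def measurable_restrict_space1)

lemma continuous_imp_integrable_circle_measure:
  fixes f :: "real \<Rightarrow> 'a::euclidean_space"
  assumes "continuous_on {0..2 * pi} f"
  shows "integrable circle_measure f" "(f has_integral (\<integral>t. f t \<partial>circle_measure)) {0..2 * pi}"
proof -
  have si: "set_integrable lborel {0..2 * pi} f"
    by (rule borel_integrable_compact[OF compact_Icc assms, folded set_integrable_def])
  then show "integrable circle_measure f"
    by (simp add: circle_measure_def integrable_restrict_space set_integrable_def)
  have "(\<integral>t. f t \<partial>circle_measure) = (LINT t:{0..2 * pi}|lborel. f t)"
    by (simp add: circle_measure_def integral_restrict_space set_lebesgue_integral_def)
  then show "(f has_integral (\<integral>t. f t \<partial>circle_measure)) {0..2 * pi}"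
    using set_borel_integral_eq_integral[OF si] by (simp add: has_integral_integrable_integral)
qed

lemma Cauchy_integral_circle_measure:
  fixes f :: "complex \<Rightarrow> complex"
  assumes "continuous_on (cball a r) f" "f holomorphic_on ball a r" "w \<in> ball a r"
  shows "(\<integral>t. f (a + r * cis t) * (r * cis t) / (a + r * cis t - w) \<partial>circle_measure) = 2 * pi * f w"
proof -
  have r: "r > 0" using assms(3) ball_eq_empty by fastforce
  have ne: "a + r * cis t - w \<noteq> 0" for t
  proof
    assume "a + r * cis t - w = 0"
    then have "w - a = r * cis t" by (simp add: algebra_simps)
    then have "norm (w - a) = r" using r by (simp add: norm_mult)
    then show False using assms(3) by (simp add: dist_norm norm_minus_commute)
  qed
  have c1: "continuous_on {0..2 * pi} (\<lambda>t. f (a + r * cis t))"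
  proof (rule continuous_on_compose2[OF assms(1)])
    show "continuous_on {0..2 * pi} (\<lambda>t. a + r * cis t)" by (intro continuous_intros)
    show "(\<lambda>t. a + r * cis t) ` {0..2 * pi} \<subseteq> cball a r" using r by (simp add: image_subset_iff dist_norm norm_mult)
  qed
  have cont: "continuous_on {0..2 * pi} (\<lambda>t. f (a + r * cis t) * (r * cis t) / (a + r * cis t - w))"
    by (intro continuous_intros c1 ballI ne)
  have "((\<lambda>u. f u / (u - w)) has_contour_integral (2 * of_real pi * \<i> * f w)) (circlepath a r)"
    using assms by (intro Cauchy_integral_circlepath) (auto simp: dist_norm norm_minus_commute)
  then have "((\<lambda>t. f (a + r * cis t) / (a + r * cis t - w) * r * \<i> * cis t) has_integral (2 * of_real pi * \<i> * f w)) {0..2 * pi}"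
    unfolding circlepath_def using has_contour_integral_part_circlepath_iff[of 0 "2*pi"] by (simp)
  then have "((\<lambda>t. f (a + r * cis t) / (a + r * cis t - w) * r * \<i> * cis t / \<i>) has_integral (2 * of_real pi * \<i> * f w / \<i>)) {0..2 * pi}"
    by (rule has_integral_divide)
  then have "((\<lambda>t. f (a + r * cis t) * (r * cis t) / (a + r * cis t - w)) has_integral (2 * of_real pi * f w)) {0..2 * pi}"
    by (simp add: algebra_simps)
  from has_integral_unique[OF continuous_imp_integrable_circle_measure(2)[OF cont] this]
  show ?thesis by simp
qed

lemma mean_value_circle_measure:
  fixes f :: "complex \<Rightarrow> complex"
  assumes "continuous_on (cball a r) f" "f holomorphic_on ball a r" "r > 0"
  shows "(\<integral>t. f (a + r * cis t) \<partial>circle_measure) = 2 * pi * f a"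
proof -
  have "(\<integral>t. f (a + r * cis t) * (r * cis t) / (a + r * cis t - a) \<partial>circle_measure) = 2 * pi * f a"
    using assms by (intro Cauchy_integral_circle_measure) auto
  then show ?thesis using assms(3) by simp
qed

text \<open>On the circle the integrand is \<open>(u - a) / (u - w)\<close>, which is holomorphic on
  the closed disc and vanishes at its centre.\<close>

lemma Cauchy_integral_circle_measure_outside:
  assumes "0 < r" "norm (w - a) > r"
  shows "(\<integral>t. (r * cis t) / (a + r * cis t - w) \<partial>circle_measure) = 0"
proof -
  have "(\<integral>t. (\<lambda>u. (u - a) / (u - w)) (a + r * cis t) \<partial>circle_measure) = 2 * pi * ((\<lambda>u. (u - a) / (u - w)) a)"
  proof (rule mean_value_circle_measure)
    have ne: "u \<noteq> w" if "u \<in> cball a r" for u using that assms by (auto simp: dist_norm norm_minus_commute)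
    show "continuous_on (cball a r) (\<lambda>u. (u - a) / (u - w))" using ne by (intro continuous_intros) auto
    show "(\<lambda>u. (u - a) / (u - w)) holomorphic_on ball a r" using ne by (intro holomorphic_intros) auto
  qed fact
  then show ?thesis by simp
qed

section \<open>Area of holomorphic images\<close>

text \<open>The change of variables theorems of HOL-Analysis are available on \<^typ>\<open>real^2\<close> only.\<close>

definition vec2_of_complex :: "complex \<Rightarrow> real^2"
  where "vec2_of_complex z = vector [Re z, Im z]"

definition complex_of_vec2 :: "real^2 \<Rightarrow> complex"
  where "complex_of_vec2 v = Complex (v $ 1) (v $ 2)"

lemma vec2_of_complex_inverse [simp]: "complex_of_vec2 (vec2_of_complex z) = z"
  by (simp add: complex_of_vec2_def vec2_of_complex_def complex_eq_iff)

lemma complex_of_vec2_inverse [simp]: "vec2_of_complex (complex_of_vec2 v) = v"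
  by (simp add: complex_of_vec2_def vec2_of_complex_def vec_eq_iff forall_2)

lemma bounded_linear_vec2_of_complex: "bounded_linear vec2_of_complex"
proof -
  have "linear vec2_of_complex"
    by (rule linearI) (auto simp: vec2_of_complex_def vec_eq_iff forall_2)
  then show ?thesis by (simp add: linear_conv_bounded_linear)
qed

lemma bounded_linear_complex_of_vec2: "bounded_linear complex_of_vec2"
proof -
  have "linear complex_of_vec2"
    by (rule linearI) (auto simp: complex_of_vec2_def complex_eq_iff)
  then show ?thesis by (simp add: linear_conv_bounded_linear)
qed

lemma measurable_vec2_of_complex [measurable]: "vec2_of_complex \<in> borel_measurable borel"
  by (intro borel_measurable_continuous_onI linear_continuous_on bounded_linear_vec2_of_complex)

lemma measurable_complex_of_vec2 [measurable]: "complex_of_vec2 \<in> borel_measurable borel"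
  by (intro borel_measurable_continuous_onI linear_continuous_on bounded_linear_complex_of_vec2)

lemma lborel_vec2: "(lborel :: (real^2) measure) = distr lborel borel vec2_of_complex"
proof (rule lborel_eqI)
  fix l u :: "real^2"
  assume lu: "\<And>b. b \<in> Basis \<Longrightarrow> l \<bullet> b \<le> u \<bullet> b"
  have B: "(Basis :: (real^2) set) = {axis 1 1, axis 2 1}"
    by (auto simp: Basis_vec_def UNIV_2)
  have ne: "axis 1 1 \<noteq> (axis 2 1 :: real^2)"
    by (simp add: axis_eq_axis)
  have le: "l $ 1 \<le> u $ 1" "l $ 2 \<le> u $ 2"
    using lu[of "axis 1 1"] lu[of "axis 2 1"] by (auto simp: B inner_axis)
  have box: "vec2_of_complex -` box l u = box (complex_of_vec2 l) (complex_of_vec2 u)"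
    by (auto simp: box_def B inner_axis vec2_of_complex_def complex_of_vec2_def Basis_complex_def)
  have "emeasure (distr lborel borel vec2_of_complex) (box l u) = emeasure lborel (box (complex_of_vec2 l) (complex_of_vec2 u))"
    by (subst emeasure_distr) (auto simp: box)
  also have "\<dots> = ennreal (\<Prod>b\<in>Basis. (complex_of_vec2 u - complex_of_vec2 l) \<bullet> b)"
    using le by (intro emeasure_lborel_box) (auto simp: Basis_complex_def complex_of_vec2_def)
  also have "\<dots> = (\<Prod>b\<in>Basis. (u - l) \<bullet> b)"
    using ne by (auto simp: Basis_complex_def complex_of_vec2_def B inner_axis)
  finally show "emeasure (distr lborel borel vec2_of_complex) (box l u) = (\<Prod>b\<in>Basis. (u - l) \<bullet> b)" .
qed simp

lemma emeasure_vec2_image: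
  assumes "S \<in> sets borel"
  shows "vec2_of_complex ` S \<in> sets borel" "emeasure lborel (vec2_of_complex ` S) = emeasure lborel S"
proof -
  have eq: "vec2_of_complex ` S = complex_of_vec2 -` S"
    by (auto simp: image_iff) (metis complex_of_vec2_inverse)
  then show b: "vec2_of_complex ` S \<in> sets borel"
    using measurable_sets[OF measurable_complex_of_vec2 assms] by simp
  have "vec2_of_complex -` vec2_of_complex ` S = S"
    by (auto simp: eq)
  then show "emeasure lborel (vec2_of_complex ` S) = emeasure lborel S"
    using b by (subst lborel_vec2, subst emeasure_distr) auto
qed

lemma det_matrix_complex_mult:
  "det (matrix (\<lambda>h. vec2_of_complex (c * complex_of_vec2 h))) = (norm c)\<^sup>2"
  by (simp add: det_2 matrix_def vec2_of_complex_def complex_of_vec2_def axis_def cmod_power2)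
     (simp add: power2_eq_square)

text \<open>The real Jacobian determinant of f is the square of \<open>norm (f' z)\<close>. Only the
  upper bound is recorded; for rotations and for inversion the reverse bound comes from applying it
  to the inverse map.\<close>

lemma emeasure_holomorphic_image_le:
  fixes f f' :: "complex \<Rightarrow> complex"
  assumes S: "S \<in> sets borel" and fS: "f ` S \<in> sets borel" and "B > 0"
    and der: "\<And>z. z \<in> S \<Longrightarrow> (f has_field_derivative f' z) (at z)"
    and cont: "continuous_on S f'"
    and bnd: "\<And>z. z \<in> S \<Longrightarrow> (norm (f' z))\<^sup>2 \<le> B"
  shows "emeasure lborel (f ` S) \<le> ennreal B * emeasure lborel S"
proof (cases "emeasure lborel S = \<infinity>")
  case True
  then show ?thesis using \<open>B > 0\<close> by (simp add: ennreal_mult_eq_top_iff)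
next
  case False
  let ?T = "vec2_of_complex ` S"
  let ?F = "\<lambda>v. vec2_of_complex (f (complex_of_vec2 v))"
  let ?F' = "\<lambda>v h. vec2_of_complex (f' (complex_of_vec2 v) * complex_of_vec2 h)"
  have T: "?T \<in> sets borel" "emeasure lborel ?T = emeasure lborel S"
    using emeasure_vec2_image[OF S] by auto
  then have Tl: "?T \<in> lmeasurable"
    using False by (simp add: fmeasurable_def less_top)
  have F: "?F ` ?T = vec2_of_complex ` (f ` S)" by (simp add: image_image)
  have d: "(?F has_derivative ?F' v) (at v within ?T)" if "v \<in> ?T" for v
  proof -
    from that obtain z where z: "z \<in> S" "v = vec2_of_complex z" by auto
    have 1: "(f has_derivative (\<lambda>h. f' z * h)) (at (complex_of_vec2 v))"
      using der[OF z(1)] z(2) by (simp add: has_field_derivative_def)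
    have 2: "(complex_of_vec2 has_derivative complex_of_vec2) (at v)"
      by (simp add: bounded_linear_complex_of_vec2 bounded_linear_imp_has_derivative)
    have "((\<lambda>v. f (complex_of_vec2 v)) has_derivative (\<lambda>h. f' z * complex_of_vec2 h)) (at v)"
      using has_derivative_compose[OF 2 1] by simp
    from bounded_linear.has_derivative[OF bounded_linear_vec2_of_complex this]
    show ?thesis using z(2) by (simp add: has_derivative_at_withinI)
  qed
  have b: "\<bar>det (matrix (?F' v))\<bar> \<le> B" if "v \<in> ?T" for v
    using that bnd by (auto simp: det_matrix_complex_mult)
  have cont': "continuous_on ?T (\<lambda>v. (norm (f' (complex_of_vec2 v)))\<^sup>2)"
  proof -
    have "continuous_on ?T (\<lambda>v. f' (complex_of_vec2 v))"
      by (rule continuous_on_compose2[OF cont linear_continuous_on[OF bounded_linear_complex_of_vec2]]) auto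
    then show ?thesis by (intro continuous_intros)
  qed
  have "integrable (lebesgue_on ?T) (\<lambda>v. (norm (f' (complex_of_vec2 v)))\<^sup>2)"
  proof (rule finite_measure.integrable_const_bound[where B = B])
    show "finite_measure (lebesgue_on ?T)" using Tl by (rule finite_measure_lebesgue_on)
    show "AE x in lebesgue_on ?T. norm ((cmod (f' (complex_of_vec2 x)))\<^sup>2) \<le> B"
      by (intro AE_I2) (use bnd T in \<open>auto simp: space_restrict_space\<close>)
    show "(\<lambda>v. (cmod (f' (complex_of_vec2 v)))\<^sup>2) \<in> borel_measurable (lebesgue_on ?T)"
      using cont' T by (intro continuous_imp_measurable_on_sets_lebesgue) auto
  qed
  then have i: "(\<lambda>v. \<bar>det (matrix (?F' v))\<bar>) integrable_on ?T"
    using integrable_on_lebesgue_on[OF _ fmeasurableD[OF Tl]] by (simp add: det_matrix_complex_mult)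
  have fin: "?F ` ?T \<in> lmeasurable" and le: "measure lebesgue (?F ` ?T) \<le> B * measure lebesgue ?T"
    using measurable_bounded_differentiable_image[OF Tl d i b] measure_bounded_differentiable_image[OF Tl d i b] by auto
  have "emeasure lborel (f ` S) = emeasure lebesgue (?F ` ?T)"
    using emeasure_vec2_image[OF fS] F by simp
  also have "\<dots> = ennreal (measure lebesgue (?F ` ?T))"
    using fin by (simp add: emeasure_eq_measure2)
  also have "\<dots> \<le> ennreal (B * measure lebesgue ?T)" using le by (rule ennreal_leI)
  also have "\<dots> = ennreal B * emeasure lebesgue ?T"
    using \<open>B > 0\<close> Tl by (simp add: ennreal_mult emeasure_eq_measure2)
  also have "emeasure lebesgue ?T = emeasure lborel S"
    using T by simp
  finally show ?thesis .
qed

lemma distr_lborel_rotation: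
  assumes "norm (c :: complex) = 1"
  shows "distr lborel lborel ((*) c) = lborel"
proof -
  have le: "emeasure lborel ((*) a ` S) \<le> emeasure lborel S" if "S \<in> sets borel" "norm a = 1" for a :: complex and S
  proof -
    have "(*) a ` S = (\<lambda>z. z / a) -` S"
      using that(2) by (force simp: image_iff field_simps)
    then have b: "(*) a ` S \<in> sets borel"
      using measurable_sets[of "\<lambda>z::complex. z / a" borel borel S] that(1) by simp
    have "emeasure lborel ((*) a ` S) \<le> ennreal 1 * emeasure lborel S"
      by (rule emeasure_holomorphic_image_le[where f' = "\<lambda>_. a"])
         (use that b in \<open>auto intro!: derivative_eq_intros continuous_intros\<close>)
    then show ?thesis by simp
  qed
  have c0: "c \<noteq> 0" using assms by auto
  show ?thesis
  proof (rule measure_eqI)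
    fix S assume "S \<in> sets (distr lborel lborel ((*) c))"
    then have S: "S \<in> sets borel" by simp
    let ?V = "(*) c -` S"
    have V: "?V \<in> sets borel" using measurable_sets[of "(*) c" borel borel S] S by simp
    have 1: "(*) c ` ?V = S" using c0 by (auto simp: image_iff intro!: exI[of _ "_ / c"])
    have 2: "(*) (1/c) ` S = ?V" using c0 by (auto simp: image_iff intro!: bexI[of _ "c * _"])
    have "emeasure lborel ?V = emeasure lborel S"
      using le[OF V assms] le[OF S, of "1/c"] assms unfolding 1 2 by (simp add: norm_divide)
    then show "emeasure (distr lborel lborel ((*) c)) S = emeasure lborel S"
      using S by (subst emeasure_distr) auto
  qed simp
qed

lemma emeasure_inverse_image_le:
  fixes S :: "complex set"
  assumes S: "S \<in> sets borel" "0 \<notin> S" and "B > 0" and bnd: "\<And>z. z \<in> S \<Longrightarrow> 1 / norm z ^ 4 \<le> B"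
  shows "inverse ` S \<in> sets borel" "emeasure lborel (inverse ` S) \<le> ennreal B * emeasure lborel S"
proof -
  have "inverse ` S = inverse -` S" by (force simp: image_iff)
  then show b: "inverse ` S \<in> sets borel"
    using measurable_sets[of "inverse :: complex \<Rightarrow> _" borel borel S] S by simp
  show "emeasure lborel (inverse ` S) \<le> ennreal B * emeasure lborel S"
  proof (rule emeasure_holomorphic_image_le[where f' = "\<lambda>z. - (inverse z)\<^sup>2"])
    show "(inverse has_field_derivative - (inverse z)\<^sup>2) (at z)" if "z \<in> S" for z
      using that S by (auto intro!: derivative_eq_intros simp: power2_eq_square)
    show "continuous_on S (\<lambda>z. - (inverse z)\<^sup>2)" using S by (intro continuous_intros) auto
    show "(cmod (- (inverse z)\<^sup>2))\<^sup>2 \<le> B" if "z \<in> S" for z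
    proof -
      have "(cmod (- (inverse z)\<^sup>2))\<^sup>2 = 1 / norm z ^ 4"
        by (simp add: norm_inverse norm_power power_inverse divide_inverse flip: power_mult)
      then show ?thesis using bnd[OF that] by simp
    qed
  qed (use S b \<open>B > 0\<close> in auto)
qed

section \<open>The Ahlfors--Beurling inequality\<close>

lemma emeasure_ball_complex: "r \<ge> 0 \<Longrightarrow> emeasure lborel (ball (c::complex) r) = ennreal (pi * r\<^sup>2)"
  by (simp add: emeasure_ball unit_ball_vol_2)

lemma measure_ball_complex: "r \<ge> 0 \<Longrightarrow> measure lborel (ball (c::complex) r) = pi * r\<^sup>2"
  by (simp add: measure_def emeasure_ball_complex)

text \<open>Dyadic discs replace polar coordinates: where \<open>norm (\<eta> - w)\<close> lies
  between \<open>r / 2 ^ (k + 1)\<close> and \<open>r / 2 ^ k\<close> the integrand is at most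
  \<open>2 ^ (k + 1) / r\<close>. The exact value is \<open>2 * pi * r\<close>; what matters is a
  bound that is uniform in w.\<close>

lemma nn_integral_inverse_norm_ball_le:
  fixes w :: complex
  assumes "r > 0"
  shows "(\<integral>\<^sup>+\<eta>\<in>ball w r. ennreal (1 / norm (\<eta> - w)) \<partial>lborel) \<le> ennreal (4 * pi * r)"
proof -
  let ?g = "\<lambda>k \<eta>. ennreal (2 ^ (k + 1) / r) * indicator (ball w (r / 2 ^ k)) \<eta>"
  have "(\<integral>\<^sup>+\<eta>\<in>ball w r. ennreal (1 / norm (\<eta> - w)) \<partial>lborel) \<le> (\<integral>\<^sup>+\<eta>. (\<Sum>k. ?g k \<eta>) \<partial>lborel)"
  proof (rule nn_integral_mono)
    fix \<eta>
    show "ennreal (1 / norm (\<eta> - w)) * indicator (ball w r) \<eta> \<le> (\<Sum>k. ?g k \<eta>)"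
    proof (cases "\<eta> \<in> ball w r \<and> \<eta> \<noteq> w")
      case True
      define x where "x = r / norm (\<eta> - w)"
      have x: "x > 1" "norm (\<eta> - w) = r / x"
        using True assms by (auto simp: x_def dist_norm norm_minus_commute)
      have "\<exists>n. x < 2 ^ n" by (rule real_arch_pow) simp
      define n where "n = (LEAST n. x \<le> 2 ^ n)"
      have n: "x \<le> 2 ^ n"
        using \<open>\<exists>n. x < 2 ^ n\<close> unfolding n_def by (metis (mono_tags, lifting) LeastI less_le)
      have "n \<noteq> 0" using n x(1) by (intro notI) auto
      then obtain k where k: "n = Suc k" by (cases n) auto
      have "\<not> x \<le> 2 ^ k" using not_less_Least[of k "\<lambda>n. x \<le> 2 ^ n"] k by (simp add: n_def)
      then have "\<eta> \<in> ball w (r / 2 ^ k)"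
        using x assms by (simp add: dist_norm norm_minus_commute divide_strict_left_mono)
      then have "ennreal (1 / norm (\<eta> - w)) * indicator (ball w r) \<eta> \<le> ?g k \<eta>"
        using n k x assms True by (auto intro!: ennreal_leI divide_right_mono)
      also have "\<dots> \<le> (\<Sum>k. ?g k \<eta>)"
      proof -
        define f where "f = (\<lambda>k. ?g k \<eta>)"
        have "sum f {k} \<le> suminf f" by (rule sum_le_suminf) auto
        then have "f k \<le> suminf f" by simp
        then show ?thesis by (simp only: f_def)
      qed
      finally show ?thesis .
    qed auto
  qed
  also have "\<dots> = (\<Sum>k. \<integral>\<^sup>+\<eta>. ?g k \<eta> \<partial>lborel)"
  proof (rule nn_integral_suminf)
    have [measurable]: "ball w (r / 2 ^ k) \<in> sets borel" for k by simp
    show "?g k \<in> borel_measurable lborel" for k by measurable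
  qed
  also have "\<dots> = (\<Sum>k. ennreal (2 * pi * r * (1/2) ^ k))"
  proof (rule suminf_cong)
    fix k
    have "(\<integral>\<^sup>+\<eta>. ?g k \<eta> \<partial>lborel) = ennreal (2 ^ (k + 1) / r) * ennreal (pi * (r / 2 ^ k)\<^sup>2)"
      using assms by (simp add: nn_integral_cmult_indicator emeasure_ball_complex)
    also have "\<dots> = ennreal (2 * pi * r * (1/2) ^ k)"
      using assms by (subst ennreal_mult[symmetric]) (auto simp: field_simps power2_eq_square)
    finally show "(\<integral>\<^sup>+\<eta>. ?g k \<eta> \<partial>lborel) = ennreal (2 * pi * r * (1/2) ^ k)" .
  qed
  also have "\<dots> = ennreal (\<Sum>k. 2 * pi * r * (1/2) ^ k)"
    using assms by (intro suminf_ennreal2 summable_mult summable_geometric) auto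
  also have "(\<Sum>k. 2 * pi * r * (1/2::real) ^ k) = 4 * pi * r"
    using suminf_mult[OF summable_geometric, of "1/2::real" "2 * pi * r"] suminf_geometric[of "1/2::real"] by simp
  finally show ?thesis .
qed

lemma nn_integral_inverse_norm_le:
  fixes w :: complex
  assumes S: "S \<in> sets borel" "emeasure lborel S < \<infinity>"
  shows "(\<integral>\<^sup>+\<eta>\<in>S. ennreal (1 / norm (\<eta> - w)) \<partial>lborel) \<le> ennreal (4 * pi + measure lborel S)"
proof -
  have "(\<integral>\<^sup>+\<eta>\<in>S. ennreal (1 / norm (\<eta> - w)) \<partial>lborel) \<le>
        (\<integral>\<^sup>+\<eta>. ennreal (1 / norm (\<eta> - w)) * indicator (ball w 1) \<eta> + indicator S \<eta> \<partial>lborel)"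
  proof (rule nn_integral_mono)
    fix \<eta>
    show "ennreal (1 / norm (\<eta> - w)) * indicator S \<eta> \<le>
        ennreal (1 / norm (\<eta> - w)) * indicator (ball w 1) \<eta> + indicator S \<eta>"
    proof (cases "\<eta> \<in> ball w 1")
      case True
      then show ?thesis by (auto simp: indicator_def)
    next
      case False
      then have "1 / norm (\<eta> - w) \<le> 1" by (auto simp: dist_norm norm_minus_commute divide_simps)
      then show ?thesis by (auto simp: indicator_def ennreal_le_1)
    qed
  qed
  also have "\<dots> = (\<integral>\<^sup>+\<eta>\<in>ball w 1. ennreal (1 / norm (\<eta> - w)) \<partial>lborel) + emeasure lborel S"
  proof -
    have [measurable]: "ball w 1 \<in> sets borel" "S \<in> sets borel" using S by auto
    have "(\<lambda>\<eta>. ennreal (1 / cmod (\<eta> - w)) * indicator (ball w 1) \<eta>) \<in> borel_measurable lborel"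
      by measurable
    then show ?thesis using S by (subst nn_integral_add) auto
  qed
  also have "\<dots> \<le> ennreal (4 * pi * 1) + emeasure lborel S"
    by (intro add_right_mono nn_integral_inverse_norm_ball_le) simp
  also have "\<dots> = ennreal (4 * pi + measure lborel S)"
    using S by (simp add: emeasure_eq_ennreal_measure less_top)
  finally show ?thesis .
qed

lemma set_integrable_Cauchy_kernel:
  fixes w :: complex
  assumes S: "S \<in> sets borel" "emeasure lborel S < \<infinity>"
  shows "set_integrable lborel S (\<lambda>\<eta>. 1 / (\<eta> - w))"
  unfolding set_integrable_def
proof (rule integrableI_bounded)
  have "(\<integral>\<^sup>+\<eta>. ennreal (norm (indicat_real S \<eta> *\<^sub>R (1 / (\<eta> - w)))) \<partial>lborel) =
        (\<integral>\<^sup>+\<eta>\<in>S. ennreal (1 / norm (\<eta> - w)) \<partial>lborel)"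
    by (intro nn_integral_cong) (auto simp: indicator_def norm_divide)
  also have "\<dots> < \<infinity>"
    using nn_integral_inverse_norm_le[OF S, of w] by (auto simp: less_top[symmetric] top_unique)
  finally show "(\<integral>\<^sup>+\<eta>. ennreal (norm (indicat_real S \<eta> *\<^sub>R (1 / (\<eta> - w)))) \<partial>lborel) < \<infinity>" .
qed (use S in measurable)

section \<open>Translations and rotations in area integrals\<close>

lemma integral_lborel_translation:
  fixes f :: "complex \<Rightarrow> complex"
  assumes "f \<in> borel_measurable borel"
  shows "(\<integral>x. f (c + x) \<partial>lborel) = (\<integral>x. f x \<partial>lborel)"
  using assms by (subst (2) lborel_distr_plus[symmetric, of c], subst integral_distr) auto

text \<open>Fubini and the rotation invariance of area. Over a disc or an annulus about 0 this
  reduces an area integral to mean values on circles, where Cauchy's formula is available.\<close>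

lemma integral_rotation_average:
  fixes g :: "complex \<Rightarrow> complex"
  assumes g: "integrable lborel g"
  shows "(\<integral>\<xi>. (\<integral>t. g (cis t * \<xi>) \<partial>circle_measure) \<partial>lborel) = 2 * pi * (\<integral>\<xi>. g \<xi> \<partial>lborel)"
proof -
  have m: "g \<in> borel_measurable lborel" by (rule borel_measurable_integrable[OF g])
  have rot: "integrable lborel (\<lambda>\<xi>. g (cis t * \<xi>))" "(\<integral>\<xi>. g (cis t * \<xi>) \<partial>lborel) = (\<integral>\<xi>. g \<xi> \<partial>lborel)"
    "(\<integral>\<xi>. norm (g (cis t * \<xi>)) \<partial>lborel) = (\<integral>\<xi>. norm (g \<xi>) \<partial>lborel)" for t
  proof -
    have D: "distr lborel lborel ((*) (cis t)) = lborel" by (rule distr_lborel_rotation) simp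
    have "integrable (distr lborel lborel ((*) (cis t))) g" using g D by simp
    then show "integrable lborel (\<lambda>\<xi>. g (cis t * \<xi>))"
      by (subst (asm) integrable_distr_eq) (use m in auto)
    have "integral\<^sup>L (distr lborel lborel ((*) (cis t))) g = (\<integral>\<xi>. g (cis t * \<xi>) \<partial>lborel)"
      using m by (subst integral_distr) auto
    then show "(\<integral>\<xi>. g (cis t * \<xi>) \<partial>lborel) = (\<integral>\<xi>. g \<xi> \<partial>lborel)" by (simp add: D)
    have "(\<integral>\<xi>. norm (g \<xi>) \<partial>distr lborel lborel ((*) (cis t))) = (\<integral>\<xi>. norm (g (cis t * \<xi>)) \<partial>lborel)"
      using m by (subst integral_distr) auto
    then show "(\<integral>\<xi>. norm (g (cis t * \<xi>)) \<partial>lborel) = (\<integral>\<xi>. norm (g \<xi>) \<partial>lborel)" by (simp add: D)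
  qed
  interpret P: pair_sigma_finite circle_measure lborel
    by (intro pair_sigma_finite.intro circle_measure.sigma_finite_measure_axioms lborel.sigma_finite_measure_axioms)
  have 1: "(\<lambda>x::real \<times> complex. cis (fst x)) \<in> borel_measurable (circle_measure \<Otimes>\<^sub>M lborel)"
    by (rule measurable_compose[OF measurable_fst])
       (intro borel_measurable_circle_measure borel_measurable_continuous_onI continuous_intros)
  have 2: "snd \<in> borel_measurable (circle_measure \<Otimes>\<^sub>M (lborel :: complex measure))"
    using measurable_snd[of circle_measure lborel] by simp
  have meas: "(\<lambda>(t, \<xi>). g (cis t * \<xi>)) \<in> borel_measurable (circle_measure \<Otimes>\<^sub>M lborel)"
    unfolding case_prod_beta
    by (rule measurable_compose[of _ _ borel, OF borel_measurable_times[OF 1 2]]) (use m in simp)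
  have int: "integrable (circle_measure \<Otimes>\<^sub>M lborel) (\<lambda>(t, \<xi>). g (cis t * \<xi>))"
    by (rule P.Fubini_integrable[OF meas]) (auto simp: rot)
  have "(\<integral>\<xi>. (\<integral>t. g (cis t * \<xi>) \<partial>circle_measure) \<partial>lborel) = (\<integral>t. (\<integral>\<xi>. g (cis t * \<xi>) \<partial>lborel) \<partial>circle_measure)"
    using P.Fubini_integral[OF int] .
  also have "\<dots> = 2 * pi * (\<integral>\<xi>. g \<xi> \<partial>lborel)"
    by (simp add: rot scaleR_conv_of_real)
  finally show ?thesis .
qed

text \<open>Averaging over the rotations of the disc reduces the area integral to the mean value
  property of \<^term>\<open>\<lambda>u. 1 / (u * \<xi> + d)\<close> on the unit circle.\<close>

lemma integral_Cauchy_kernel_ball_boundary: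
  fixes c w :: complex
  assumes r: "r > 0" "norm (c - w) = r"
  shows "(LINT \<eta>:ball c r|lborel. 1 / (\<eta> - w)) = pi * r\<^sup>2 / (c - w)"
proof -
  define d where "d = c - w"
  have d: "norm d = r" "d \<noteq> 0" using r by (auto simp: d_def)
  define g where "g = (\<lambda>\<xi>. indicat_real (ball 0 r) \<xi> *\<^sub>R (1 / (\<xi> + d)))"
  have g_int: "integrable lborel g"
  proof -
    have "set_integrable lborel (ball 0 r) (\<lambda>\<eta>. 1 / (\<eta> - (- d)))"
      using r by (intro set_integrable_Cauchy_kernel) (auto simp: emeasure_ball_complex)
    then show ?thesis by (simp add: g_def set_integrable_def)
  qed
  have "2 * pi * integral\<^sup>L lborel g = (\<integral>\<xi>. (\<integral>t. g (cis t * \<xi>) \<partial>circle_measure) \<partial>lborel)"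
    by (rule integral_rotation_average[OF g_int, symmetric])
  also have "\<dots> = (\<integral>\<xi>. indicat_real (ball 0 r) \<xi> *\<^sub>R (2 * pi / d) \<partial>(lborel :: complex measure))"
  proof (rule arg_cong[where f = "integral\<^sup>L lborel"], rule ext)
    fix \<xi> :: complex
    show "(\<integral>t. g (cis t * \<xi>) \<partial>circle_measure) = indicat_real (ball 0 r) \<xi> *\<^sub>R (2 * pi / d)"
    proof (cases "\<xi> \<in> ball 0 r")
      case True
      have ne: "u * \<xi> + d \<noteq> 0" if "u \<in> cball 0 1" for u
      proof
        assume "u * \<xi> + d = 0"
        then have "d = - (u * \<xi>)" by (simp add: eq_neg_iff_add_eq_0 add.commute)
        then have "norm d = norm u * norm \<xi>" by (simp add: norm_mult)
        also have "\<dots> \<le> 1 * norm \<xi>" using that by (intro mult_right_mono) auto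
        finally show False using True d by simp
      qed
      have "(\<integral>t. (\<lambda>u. 1 / (u * \<xi> + d)) (0 + of_real 1 * cis t) \<partial>circle_measure) = 2 * pi * (\<lambda>u. 1 / (u * \<xi> + d)) 0"
      proof (rule mean_value_circle_measure)
        show "continuous_on (cball 0 1) (\<lambda>u. 1 / (u * \<xi> + d))" using ne by (intro continuous_intros) auto
        have "u * \<xi> + d \<noteq> 0" if "u \<in> ball 0 1" for u using ne that by auto
        then show "(\<lambda>u. 1 / (u * \<xi> + d)) holomorphic_on ball 0 1" by (intro holomorphic_intros)
      qed simp
      then show ?thesis using True by (simp add: g_def norm_mult)
    qed (auto simp: g_def norm_mult)
  qed
  also have "\<dots> = (pi * r\<^sup>2) *\<^sub>R (2 * pi / d)"
    using r by (simp add: measure_ball_complex emeasure_ball_complex)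
  finally have "complex_of_real (2 * pi) * integral\<^sup>L lborel g = complex_of_real (2 * pi) * (pi * r\<^sup>2 / d)"
    by (simp add: scaleR_conv_of_real)
  then have I: "integral\<^sup>L lborel g = pi * r\<^sup>2 / d"
    by (simp only: mult_cancel_left) simp
  have "(LINT \<eta>:ball c r|lborel. 1 / (\<eta> - w)) = (\<integral>\<eta>. indicat_real (ball c r) (c + \<eta>) *\<^sub>R (1 / (c + \<eta> - w)) \<partial>lborel)"
    unfolding set_lebesgue_integral_def
    by (rule integral_lborel_translation[symmetric])
      (intro borel_measurable_scaleR borel_measurable_indicator borel_measurable_divide borel_measurable_diff; simp)
  also have "\<dots> = integral\<^sup>L lborel g"
    by (intro Bochner_Integration.integral_cong) (auto simp: g_def d_def indicator_def dist_norm algebra_simps)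
  finally show ?thesis using I by (simp add: d_def)
qed

text \<open>Bathtub principle: among all sets of a given area, the real part of the Cauchy kernel
  (rotated by \<open>e\<close>) has the largest integral over one of its superlevel sets, which are discs.\<close>

lemma Ahlfors_Beurling_inequality:
  fixes w :: complex
  assumes S: "S \<in> sets borel" "emeasure lborel S < \<infinity>"
  shows "norm (LINT \<eta>:S|lborel. 1 / (\<eta> - w)) \<le> sqrt (pi * measure lborel S)"
proof (cases "(LINT \<eta>:S|lborel. 1 / (\<eta> - w)) = 0 \<or> measure lborel S = 0")
  case True
  moreover have "(LINT \<eta>:S|lborel. 1 / (\<eta> - w)) = 0" if "measure lborel S = 0"
  proof -
    have "emeasure lborel S = 0" using that S by (simp add: emeasure_eq_ennreal_measure less_top)
    then have "AE \<eta> in lborel. \<eta> \<notin> S" using S by (intro AE_not_in) (auto simp: null_sets_def)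
    then have "(LINT \<eta>:S|lborel. 1 / (\<eta> - w)) = (\<integral>\<eta>. (0::complex) \<partial>(lborel :: complex measure))"
      unfolding set_lebesgue_integral_def using S
      by (intro integral_cong_AE) (auto elim!: eventually_mono)
    then show ?thesis by simp
  qed
  ultimately show ?thesis by auto
next
  case False
  define I where "I = (LINT \<eta>:S|lborel. 1 / (\<eta> - w))"
  define m where "m = measure lborel S"
  define r where "r = sqrt (m / pi)"
  \<comment> \<open>The unimodular factor that makes \<open>e * I\<close> equal to
    \<open>norm I\<close>, so that a bound on the real part of the rotated kernel bounds the modulus
    of I.\<close>
  define e where "e = cnj I / norm I"
  have I0: "I \<noteq> 0" using False I_def by auto
  have m: "m > 0" using False m_def measure_nonneg[of lborel S] by linarith
  have r: "r > 0" "pi * r\<^sup>2 = m" using m by (auto simp: r_def)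
  have e: "norm e = 1" "e * I = norm I"
    using I0 by (auto simp: e_def norm_divide complex_norm_square[symmetric] mult.commute power2_eq_square)
  define B where "B = ball (w + r * e) r"
  define \<phi> where "\<phi> = (\<lambda>\<eta>. Re (e / (\<eta> - w)))"
  \<comment> \<open>At this level the superlevel set is B, a disc with w on its boundary and with
    area \<open>pi * r\<^sup>2 = m\<close>, the area of S.\<close>
  define k where "k = 1 / (2 * r)"
  have level: "\<phi> \<eta> > k \<longleftrightarrow> \<eta> \<in> B" for \<eta>
  proof (cases "\<eta> = w")
    case True
    then show ?thesis using r e by (auto simp: \<phi>_def k_def B_def dist_norm norm_mult)
  next
    case False
    define \<zeta> where "\<zeta> = \<eta> - w"
    have z: "norm \<zeta> > 0" using False by (simp add: \<zeta>_def)
    have "\<phi> \<eta> = (Re e * Re \<zeta> + Im e * Im \<zeta>) / (norm \<zeta>)\<^sup>2"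
      by (simp add: \<phi>_def \<zeta>_def Re_divide cmod_power2)
    then have "\<phi> \<eta> > k \<longleftrightarrow> (norm \<zeta>)\<^sup>2 < 2 * r * (Re e * Re \<zeta> + Im e * Im \<zeta>)"
    proof -
      have "1 / (2 * r) < x / n \<longleftrightarrow> n < 2 * r * x" if "n > 0" for x n
        using that r by (simp add: field_simps)
      then show ?thesis using z by (simp add: \<open>\<phi> \<eta> = _\<close> k_def)
    qed
    also have "\<dots> \<longleftrightarrow> (norm (\<zeta> - r * e))\<^sup>2 < r\<^sup>2"
    proof -
      have "(Re e)\<^sup>2 + (Im e)\<^sup>2 = 1" using e(1) by (simp add: cmod_def)
      moreover have "(norm (\<zeta> - r * e))\<^sup>2 =
          (norm \<zeta>)\<^sup>2 - 2 * r * (Re e * Re \<zeta> + Im e * Im \<zeta>) + r\<^sup>2 * ((Re e)\<^sup>2 + (Im e)\<^sup>2)"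
        unfolding cmod_power2 by (simp add: power2_eq_square algebra_simps)
      ultimately show ?thesis by (simp only: mult_1_right) linarith
    qed
    also have "\<dots> \<longleftrightarrow> norm (\<zeta> - r * e) < r"
      using r by (metis abs_le_square_iff abs_norm_cancel abs_of_pos not_le)
    also have "\<dots> \<longleftrightarrow> \<eta> \<in> B"
      by (simp add: B_def dist_norm \<zeta>_def norm_minus_commute algebra_simps)
    finally show ?thesis .
  qed
  have Bs: "B \<in> sets borel" "emeasure lborel B < \<infinity>" "measure lborel B = m"
    using r by (auto simp: B_def emeasure_ball_complex measure_ball_complex)
  have phi_int: "set_integrable lborel T \<phi>" and phi_eq: "(LINT \<eta>:T|lborel. \<phi> \<eta>) = Re (e * (LINT \<eta>:T|lborel. 1 / (\<eta> - w)))"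
    if T: "T \<in> sets borel" "emeasure lborel T < \<infinity>" for T
  proof -
    have i: "integrable lborel (\<lambda>\<eta>. e * (indicat_real T \<eta> *\<^sub>R (1 / (\<eta> - w))))"
      using set_integrable_Cauchy_kernel[OF T, of w] unfolding set_integrable_def
      by (rule integrable_mult_right[rotated])
    have eq: "Re (e * (indicat_real T \<eta> *\<^sub>R (1 / (\<eta> - w)))) = indicat_real T \<eta> *\<^sub>R \<phi> \<eta>" for \<eta>
      by (simp add: \<phi>_def indicator_def)
    show "set_integrable lborel T \<phi>"
      using integrable_Re[OF i] unfolding set_integrable_def eq .
    show "(LINT \<eta>:T|lborel. \<phi> \<eta>) = Re (e * (LINT \<eta>:T|lborel. 1 / (\<eta> - w)))"
      using integral_Re[OF i] unfolding eq set_lebesgue_integral_def integral_mult_right_zero by simp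
  qed
  have const: "set_integrable lborel T (\<lambda>_. k)" "(LINT \<eta>:T|lborel. k) = k * measure lborel T"
    if T: "T \<in> sets borel" "emeasure lborel T < \<infinity>" for T :: "complex set"
    using T by (auto simp: set_integrable_def set_lebesgue_integral_def)
  \<comment> \<open>\<open>\<phi> - k\<close> is positive exactly on B, so its integral over S
    cannot exceed the one over B. As S and B have the same area, the constant k then
    cancels.\<close>
  have "(LINT \<eta>:S|lborel. \<phi> \<eta> - k) \<le> (LINT \<eta>:B|lborel. \<phi> \<eta> - k)"
    unfolding set_lebesgue_integral_def
  proof (rule integral_mono)
    show "integrable lborel (\<lambda>\<eta>. indicat_real S \<eta> *\<^sub>R (\<phi> \<eta> - k))"
      using set_integral_diff(1)[OF phi_int[OF S] const(1)[OF S]] by (simp add: set_integrable_def)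
    show "integrable lborel (\<lambda>\<eta>. indicat_real B \<eta> *\<^sub>R (\<phi> \<eta> - k))"
      using set_integral_diff(1)[OF phi_int[OF Bs(1,2)] const(1)[OF Bs(1,2)]] by (simp add: set_integrable_def)
    show "indicat_real S \<eta> *\<^sub>R (\<phi> \<eta> - k) \<le> indicat_real B \<eta> *\<^sub>R (\<phi> \<eta> - k)" for \<eta>
      using level[of \<eta>] by (auto simp: indicator_def)
  qed
  then have "(LINT \<eta>:S|lborel. \<phi> \<eta>) - k * m \<le> (LINT \<eta>:B|lborel. \<phi> \<eta>) - k * m"
    by (simp add: set_integral_diff phi_int[OF S] phi_int[OF Bs(1,2)] const[OF S] const[OF Bs(1,2)] Bs(3) m_def)
  then have "norm I \<le> (LINT \<eta>:B|lborel. \<phi> \<eta>)"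
    using phi_eq[OF S] e by (simp add: I_def[symmetric])
  also have "\<dots> = Re (e * (LINT \<eta>:B|lborel. 1 / (\<eta> - w)))"
    by (rule phi_eq[OF Bs(1,2)])
  also have "(LINT \<eta>:B|lborel. 1 / (\<eta> - w)) = pi * r\<^sup>2 / (w + r * e - w)"
    unfolding B_def using r e by (intro integral_Cauchy_kernel_ball_boundary) (auto simp: norm_mult)
  also have "Re (e * (pi * r\<^sup>2 / (w + r * e - w))) = pi * r"
  proof -
    have "e * (pi * r\<^sup>2 / (w + r * e - w)) = of_real (pi * r)"
      using r e by (auto simp: field_simps power2_eq_square)
    then show ?thesis by simp
  qed
  also have "\<dots> = sqrt (pi * m)"
    using r m by (intro real_sqrt_unique[symmetric]) (auto simp: power2_eq_square)
  finally show ?thesis by (simp add: I_def m_def)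
qed

section \<open>Analytic capacity and area\<close>

lemma Cauchy_estimate_unit_ball:
  assumes "ball z0 d \<subseteq> \<Omega>" "d > 0" "f holomorphic_on \<Omega>" "f ` \<Omega> \<subseteq> ball 0 1"
  shows "cmod (deriv f z0) \<le> 2 / d"
proof -
  have "norm ((deriv ^^ 1) f z0) \<le> fact 1 * 1 / (d/2) ^ 1"
  proof (rule Cauchy_inequality)
    have sub: "cball z0 (d/2) \<subseteq> \<Omega>" using assms(1,2) by (force simp: subset_iff)
    show "f holomorphic_on ball z0 (d/2)"
      using sub assms(3) ball_subset_cball holomorphic_on_subset by (meson subset_trans)
    show "continuous_on (cball z0 (d/2)) f"
      using sub assms(3) holomorphic_on_imp_continuous_on holomorphic_on_subset by blast
    show "0 < d/2" using assms by simp
    fix x assume "norm (z0 - x) = d/2"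
    then have "x \<in> \<Omega>" using sub by (auto simp: dist_norm)
    then show "norm (f x) \<le> 1" using assms(4) by (auto simp: subset_iff less_imp_le)
  qed
  then show ?thesis by simp
qed

lemma analytic_capacity_upper:
  assumes "open \<Omega>" "z0 \<in> \<Omega>" "f holomorphic_on \<Omega>" "f ` \<Omega> \<subseteq> ball 0 1" "f z0 = 0"
  shows "cmod (deriv f z0) \<le> analytic_capacity \<Omega> z0"
  unfolding analytic_capacity_def
proof (rule cSup_upper)
  show "cmod (deriv f z0) \<in> {cmod (deriv f z0) |f. f holomorphic_on \<Omega> \<and> f ` \<Omega> \<subseteq> ball 0 1 \<and> f z0 = 0}"
    using assms by blast
  obtain d where "d > 0" "ball z0 d \<subseteq> \<Omega>"
    using assms openE by blast
  then show "bdd_above {cmod (deriv f z0) |f. f holomorphic_on \<Omega> \<and> f ` \<Omega> \<subseteq> ball 0 1 \<and> f z0 = 0}"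
    unfolding bdd_above_def using Cauchy_estimate_unit_ball by blast
qed

lemma analytic_capacity_least:
  assumes "\<And>f. f holomorphic_on \<Omega> \<Longrightarrow> f ` \<Omega> \<subseteq> ball 0 1 \<Longrightarrow> f z0 = 0 \<Longrightarrow> cmod (deriv f z0) \<le> B"
  shows "analytic_capacity \<Omega> z0 \<le> B"
  unfolding analytic_capacity_def
proof (rule cSup_least)
  have "(\<lambda>_. 0::complex) holomorphic_on \<Omega> \<and> (\<lambda>_. 0::complex) ` \<Omega> \<subseteq> ball 0 1 \<and> (\<lambda>_. 0::complex) z0 = 0"
    by auto
  then show "{cmod (deriv f z0) |f. f holomorphic_on \<Omega> \<and> f ` \<Omega> \<subseteq> ball 0 1 \<and> f z0 = 0} \<noteq> {}"
    by blast
qed (use assms in auto)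

lemma analytic_capacity_nonneg:
  assumes "open \<Omega>" "z0 \<in> \<Omega>"
  shows "0 \<le> analytic_capacity \<Omega> z0"
  using analytic_capacity_upper[OF assms, of "\<lambda>_. 0"] by (auto simp: image_subset_iff)

lemma analytic_capacity_ge_of_bounded:
  assumes "open \<Omega>" "z0 \<in> \<Omega>" "f holomorphic_on \<Omega>" "f z0 = 0"
    and B: "B > 0" "\<And>z. z \<in> \<Omega> \<Longrightarrow> norm (f z) \<le> B"
  shows "cmod (deriv f z0) / B \<le> analytic_capacity \<Omega> z0"
proof (rule field_le_mult_one_interval)
  fix t :: real assume t: "0 < t" "t < 1"
  \<comment> \<open>f may attain the modulus B, while competitors must map into the open disc; the
    factor \<open>t < 1\<close> makes the inequality strict and tends to 1 in the end.\<close>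
  define c where "c = complex_of_real (t / B)"
  have c: "norm c = t / B" unfolding c_def norm_of_real using t B by simp
  have "cmod (deriv (\<lambda>z. c * f z) z0) \<le> analytic_capacity \<Omega> z0"
  proof (rule analytic_capacity_upper)
    show "(\<lambda>z. c * f z) ` \<Omega> \<subseteq> ball 0 1"
    proof (rule image_subsetI)
      fix z assume "z \<in> \<Omega>"
      then have "t * norm (f z) \<le> t * B" using B(2) t by (intro mult_left_mono) auto
      also have "\<dots> < B" using t B(1) by simp
      finally show "c * f z \<in> ball 0 1" using B(1) by (simp add: norm_mult c)
    qed
  qed (use assms in \<open>auto intro!: holomorphic_intros\<close>)
  moreover have "deriv (\<lambda>z. c * f z) z0 = c * deriv f z0"
    using assms by (intro deriv_cmult) (auto simp: holomorphic_on_open field_differentiable_def)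
  ultimately show "t * (cmod (deriv f z0) / B) \<le> analytic_capacity \<Omega> z0"
    by (simp add: norm_mult c)
qed

text \<open>\<^term>\<open>inverted_complement \<Omega> z0\<close> is the complement of \<open>\<Omega>\<close> on the sphere, seen in the coordinate
  \<open>w = 1 / (z - z0)\<close>.\<close>

definition inverted_complement :: "complex set \<Rightarrow> complex \<Rightarrow> complex set"
  where "inverted_complement \<Omega> z0 = {w. w = 0 \<or> z0 + 1 / w \<notin> \<Omega>}"

lemma compact_inverted_complement:
  assumes "open \<Omega>" "z0 \<in> \<Omega>"
  shows "compact (inverted_complement \<Omega> z0)"
proof -
  have "open ((- {0}) \<inter> (\<lambda>w. z0 + 1 / w) -` \<Omega>)"
    by (intro continuous_open_preimage continuous_intros) (use assms in auto)
  moreover have "- inverted_complement \<Omega> z0 = (- {0}) \<inter> (\<lambda>w. z0 + 1 / w) -` \<Omega>"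
    by (auto simp: inverted_complement_def)
  ultimately have "closed (inverted_complement \<Omega> z0)"
    by (simp add: closed_def)
  moreover obtain d where d: "d > 0" "ball z0 d \<subseteq> \<Omega>"
    using assms openE by blast
  have "inverted_complement \<Omega> z0 \<subseteq> cball 0 (1 / d)"
  proof
    fix w assume w: "w \<in> inverted_complement \<Omega> z0"
    show "w \<in> cball 0 (1/d)"
    proof (cases "w = 0")
      case False
      with w have "z0 + 1 / w \<notin> ball z0 d" using d by (auto simp: inverted_complement_def)
      then have "d \<le> 1 / norm w" by (simp add: dist_norm norm_divide)
      then show ?thesis using False d(1) by (simp add: field_simps)
    qed (use d in auto)
  qed
  ultimately show ?thesis
    by (meson bounded_cball bounded_subset compact_eq_bounded_closed)
qed

text \<open>The competitor is the Cauchy transform of K evaluated at \<open>1 / (z - z0)\<close>. It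
  vanishes at \<open>z0\<close>, its derivative there has modulus m, and by Ahlfors--Beurling it is
  bounded by \<open>sqrt (pi * m)\<close>; the square of \<open>m / sqrt (pi * m)\<close> is
  \<open>m / pi\<close>.\<close>

lemma analytic_capacity_ge_measure:
  assumes \<Omega>: "open \<Omega>" "z0 \<in> \<Omega>"
  shows "(analytic_capacity \<Omega> z0)\<^sup>2 \<ge> measure lborel (inverted_complement \<Omega> z0) / pi"
proof -
  define K where "K = inverted_complement \<Omega> z0"
  define m where "m = measure lborel K"
  have cK: "compact K" unfolding K_def by (rule compact_inverted_complement[OF \<Omega>])
  have K: "K \<in> sets borel" "emeasure lborel K < \<infinity>"
    using cK emeasure_bounded_finite[OF compact_imp_bounded[OF cK]] by (auto simp: compact_imp_closed)
  show ?thesis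
  proof (cases "m = 0")
    case True
    then show ?thesis by (simp add: m_def K_def)
  next
    case False
    then have m: "m > 0" by (simp add: m_def zero_less_measure_iff)
    \<comment> \<open>The transform equals \<open>(z - z0) * J z\<close> for
      \<open>z \<noteq> z0\<close>; in this form it is visibly holomorphic at \<open>z0\<close>,
      where its argument \<open>1 / (z - z0)\<close> becomes infinite.\<close>
    define J where "J = (\<lambda>z. LINT \<eta>:K|lborel. 1 / (\<eta> * (z - z0) - 1))"
    have ne: "\<eta> * (z - z0) - 1 \<noteq> 0" if "\<eta> \<in> K" "z \<in> \<Omega>" for \<eta> z
    proof
      assume *: "\<eta> * (z - z0) - 1 = 0"
      then have "\<eta> \<noteq> 0" by auto
      moreover from * this have "z = z0 + 1 / \<eta>" by (simp add: field_simps)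
      ultimately show False using that by (auto simp: K_def inverted_complement_def)
    qed
    have J: "J holomorphic_on \<Omega>"
      unfolding J_def set_lebesgue_integral_def
    proof (rule holomorphic_on_integral_parameter)
      fix z assume z: "z \<in> \<Omega>"
      show "(\<lambda>\<eta>. indicat_real K \<eta> *\<^sub>R (1 / (\<eta> * (z - z0) - 1))) \<in> borel_measurable lborel"
        using K by measurable
      obtain r where r: "r > 0" "cball z r \<subseteq> \<Omega>" using z \<Omega>(1) open_contains_cball by blast
      have "compact ((\<lambda>(w, \<eta>). 1 / (\<eta> * (w - z0) - 1)) ` (cball z r \<times> K))"
      proof (rule compact_continuous_image)
        show "continuous_on (cball z r \<times> K) (\<lambda>(w, \<eta>). 1 / (\<eta> * (w - z0) - 1))"
          unfolding case_prod_beta by (intro continuous_intros) (use r ne in auto)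
      qed (use cK in \<open>auto intro: compact_Times\<close>)
      then obtain C where C: "\<And>w \<eta>. w \<in> cball z r \<Longrightarrow> \<eta> \<in> K \<Longrightarrow> norm (1 / (\<eta> * (w - z0) - 1)) \<le> C"
        by (fastforce dest: compact_imp_bounded simp: bounded_iff)
      show "\<exists>r>0. \<exists>g. integrable lborel g \<and> ball z r \<subseteq> \<Omega> \<and>
         (\<forall>w\<in>ball z r. \<forall>\<eta>\<in>space lborel. norm (indicat_real K \<eta> *\<^sub>R (1 / (\<eta> * (w - z0) - 1))) \<le> g \<eta>)"
      proof (intro exI conjI ballI)
        show "integrable lborel (\<lambda>\<eta>. C * indicat_real K \<eta>)" using K by simp
        show "norm (indicat_real K \<eta> *\<^sub>R (1 / (\<eta> * (w - z0) - 1))) \<le> C * indicat_real K \<eta>" if "w \<in> ball z r" for w \<eta>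
          using C[of w \<eta>] that by (auto simp: indicator_def)
      qed (use r in auto)
    next
      fix \<eta>
      show "(\<lambda>z. indicat_real K \<eta> *\<^sub>R (1 / (\<eta> * (z - z0) - 1))) holomorphic_on \<Omega>"
        using ne[of \<eta>] by (cases "\<eta> \<in> K") (auto intro!: holomorphic_intros)
    qed (rule \<Omega>(1))
    have J0: "J z0 = - m"
      using K by (simp add: J_def set_lebesgue_integral_def m_def scaleR_conv_of_real)
    define f where "f = (\<lambda>z. (z - z0) * J z)"
    have f: "f holomorphic_on \<Omega>" unfolding f_def by (intro holomorphic_intros J)
    have "cmod (deriv f z0) / sqrt (pi * m) \<le> analytic_capacity \<Omega> z0"
    proof (rule analytic_capacity_ge_of_bounded[OF \<Omega> f])
      show "norm (f z) \<le> sqrt (pi * m)" if "z \<in> \<Omega>" for z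
      proof (cases "z = z0")
        case False
        have "f z = (LINT \<eta>:K|lborel. 1 / (\<eta> - 1 / (z - z0)))"
          unfolding f_def J_def set_integral_mult_right[symmetric]
          by (intro set_lebesgue_integral_cong) (use K False in \<open>auto simp: field_simps\<close>)
        then show ?thesis using Ahlfors_Beurling_inequality[OF K] by (simp add: m_def)
      qed (use m in \<open>simp add: f_def\<close>)
    qed (use m in \<open>auto simp: f_def\<close>)
    moreover have "deriv f z0 = J z0"
    proof -
      have "(J has_field_derivative deriv J z0) (at z0)"
        using J \<Omega> by (intro holomorphic_derivI) auto
      then show ?thesis unfolding f_def by (intro DERIV_imp_deriv) (auto intro!: derivative_eq_intros)
    qed
    ultimately have "m / sqrt (pi * m) \<le> analytic_capacity \<Omega> z0" using m J0 by simp
    then have "(m / sqrt (pi * m))\<^sup>2 \<le> (analytic_capacity \<Omega> z0)\<^sup>2"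
      using m by (intro power_mono) auto
    moreover have "(m / sqrt (pi * m))\<^sup>2 = m / pi"
      using m by (simp add: power_divide power2_eq_square)
    ultimately show ?thesis by (simp add: m_def K_def)
  qed
qed

section \<open>Area of the inverted complement: comparison with a disc\<close>

lemma measure_Diff_Int:
  assumes "A \<in> fmeasurable M" "B \<in> sets M"
  shows "measure M (A - B) = measure M A - measure M (A \<inter> B)"
proof -
  have "A - B = A - A \<inter> B" by auto
  moreover have "measure M (A - A \<inter> B) = measure M A - measure M (A \<inter> B)"
    using assms by (intro measure_Diff) (auto simp: fmeasurable_def)
  ultimately show ?thesis by simp
qed

lemma emeasure_inverse_image_ge:
  fixes S :: "complex set"
  assumes S: "S \<in> sets borel" "0 \<notin> S" "S \<subseteq> ball 0 r" "r > 0"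
  shows "emeasure lborel S \<le> ennreal (r ^ 4) * emeasure lborel (inverse ` S)"
proof -
  have "inverse ` S = inverse -` S" by (force simp: image_iff)
  then have b: "inverse ` S \<in> sets borel"
    using measurable_sets[of "inverse :: complex \<Rightarrow> _" borel borel S] S by simp
  have eq: "inverse ` inverse ` S = S" by (simp add: image_image)
  have bnd: "1 / norm z ^ 4 \<le> r ^ 4" if z: "z \<in> inverse ` S" for z
  proof -
    obtain y where y: "y \<in> S" "z = inverse y" using z by auto
    then have "norm y ^ 4 \<le> r ^ 4" using S(3) by (intro power_mono) auto
    then show ?thesis by (simp add: y norm_inverse power_inverse divide_inverse)
  qed
  have "0 \<notin> inverse ` S" using S(2) by auto
  then show ?thesis
    using emeasure_inverse_image_le(2)[OF b _ _ bnd] S by (simp add: eq)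
qed

text \<open>U and the disc D have equal area, hence so do \<open>U - D\<close> and
  \<open>D - U\<close>. Inversion has Jacobian at most \<open>1 / R ^ 4\<close> on the former and at
  least that on the latter, so replacing the complement of D by the complement of U does not
  decrease the area of the inverse. Equality leaves no mass strictly inside the disc, where the
  Jacobian is larger.\<close>

lemma
  fixes U :: "complex set"
  assumes U: "open U" "0 \<in> U" "R > 0" "emeasure lborel U = ennreal (pi * R\<^sup>2)"
  shows measure_inverse_complement_ge: "measure lborel (inverse ` (- U)) \<ge> pi / R\<^sup>2"
    and measure_inverse_complement_eq:
      "measure lborel (inverse ` (- U)) = pi / R\<^sup>2 \<Longrightarrow> measure lborel (ball 0 R - U) = 0"
proof -
  define T where "T = - U"
  define D where "D = (ball 0 R :: complex set)"
  let ?\<mu> = "measure (lborel :: complex measure)"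
  have Ub: "U \<in> sets borel" "T \<in> sets borel" "D \<in> sets borel" using U by (auto simp: T_def D_def)
  obtain d where d: "d > 0" "ball 0 d \<subseteq> U" using U openE by blast
  have inv: "inverse ` S \<in> sets borel" "emeasure lborel (inverse ` S) \<noteq> \<infinity>"
    if S: "S \<in> sets borel" "e > 0" "\<And>z. z \<in> S \<Longrightarrow> e \<le> norm z" for S :: "complex set" and e
  proof -
    have "inverse ` S = inverse -` S" by (force simp: image_iff)
    then show "inverse ` S \<in> sets borel"
      using measurable_sets[of "inverse :: complex \<Rightarrow> _" borel borel S] S by simp
    have "inverse ` S \<subseteq> cball 0 (1 / e)"
      using le_imp_inverse_le[OF S(3) S(2)] by (auto simp: norm_inverse norm_divide inverse_eq_divide)
    then have "bounded (inverse ` S)" using bounded_cball bounded_subset by blast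
    then show "emeasure lborel (inverse ` S) \<noteq> \<infinity>" using emeasure_bounded_finite by force
  qed
  define S2 where "S2 = U - D"
  define S3 where "S3 = D - U"
  have b: "S2 \<in> sets borel" "S3 \<in> sets borel" "- D \<in> sets borel" using Ub by (auto simp: S2_def S3_def)
  have inv1: "inverse ` (- D) \<in> sets borel" "emeasure lborel (inverse ` (- D)) \<noteq> \<infinity>"
    by (intro inv[where e = R]; use b U in \<open>auto simp: D_def\<close>)+
  have inv2: "inverse ` S2 \<in> sets borel" "emeasure lborel (inverse ` S2) \<noteq> \<infinity>"
    by (intro inv[where e = R]; use b U in \<open>auto simp: S2_def D_def\<close>)+
  have S3d: "d \<le> norm z" if "z \<in> S3" for z
    using that d(2) by (force simp: S3_def not_less[symmetric] subset_iff)
  have inv3: "inverse ` S \<in> sets borel" "emeasure lborel (inverse ` S) \<noteq> \<infinity>"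
    if "S \<in> sets borel" "S \<subseteq> S3" for S
    by (intro inv[where e = d]; use that d S3d in auto)+
  have fin: "emeasure lborel U \<noteq> \<infinity>" "emeasure lborel D \<noteq> \<infinity>" "emeasure lborel S2 \<noteq> \<infinity>" "emeasure lborel S3 \<noteq> \<infinity>"
  proof -
    show 1: "emeasure lborel U \<noteq> \<infinity>" using U by simp
    show 2: "emeasure lborel D \<noteq> \<infinity>" using U by (simp add: D_def emeasure_ball_complex)
    show "emeasure lborel S2 \<noteq> \<infinity>"
      using emeasure_mono[of S2 U lborel] 1 Ub by (auto simp: S2_def top_unique)
    show "emeasure lborel S3 \<noteq> \<infinity>"
      using emeasure_mono[of S3 D lborel] 2 Ub by (auto simp: S3_def top_unique)
  qed
  define \<delta> where "\<delta> = ?\<mu> S3"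
  have \<mu>S2: "?\<mu> S2 = \<delta>"
  proof -
    have "?\<mu> U = ?\<mu> D" using U by (simp add: measure_def D_def emeasure_ball_complex)
    moreover have "?\<mu> S2 = ?\<mu> U - ?\<mu> (U \<inter> D)" "?\<mu> S3 = ?\<mu> D - ?\<mu> (D \<inter> U)"
      unfolding S2_def S3_def using fin Ub by (auto intro!: measure_Diff_Int simp: fmeasurable_def less_top)
    ultimately show ?thesis by (simp add: \<delta>_def Int_commute)
  qed
  have \<mu>1: "?\<mu> (inverse ` (- D)) = pi / R\<^sup>2"
  proof -
    have eq: "inverse ` (- D) = cball 0 (1 / R) - {0}"
    proof (intro set_eqI iffI)
      fix w assume "w \<in> cball 0 (1 / R) - {0 :: complex}"
      then have "inverse w \<in> - D" "w = inverse (inverse w)"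
        using U(3) by (auto simp: D_def norm_inverse norm_divide field_simps)
      then show "w \<in> inverse ` (- D)" by blast
    next
      fix w assume "w \<in> inverse ` (- D)"
      then obtain x where x: "w = inverse x" "R \<le> norm x" by (auto simp: D_def not_less)
      then have "inverse (norm x) \<le> inverse R" "x \<noteq> 0" using U(3) by (auto intro: le_imp_inverse_le)
      then show "w \<in> cball 0 (1 / R) - {0 :: complex}"
        using x by (simp add: norm_inverse norm_divide inverse_eq_divide)
    qed
    have "emeasure lborel (cball 0 (1 / R) - {0 :: complex}) = emeasure lborel (cball (0::complex) (1 / R))"
      by (rule emeasure_Diff_null_set) auto
    also have "\<dots> = ennreal (pi / R\<^sup>2)"
      using U(3) by (simp add: emeasure_cball unit_ball_vol_2 power_divide)
    finally show ?thesis using U(3) by (simp add: measure_def eq)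
  qed
  have \<mu>2: "?\<mu> (inverse ` S2) \<le> \<delta> / R ^ 4"
  proof -
    have "emeasure lborel (inverse ` S2) \<le> ennreal (1 / R ^ 4) * emeasure lborel S2"
    proof (rule emeasure_inverse_image_le)
      fix z assume "z \<in> S2"
      then have Rz: "R \<le> norm z" by (simp add: S2_def D_def)
      then have "R ^ 4 \<le> norm z ^ 4" using U(3) by (intro power_mono) auto
      moreover have "norm z > 0" using Rz U(3) by linarith
      ultimately show "1 / norm z ^ 4 \<le> 1 / R ^ 4" using U(3) by (intro divide_left_mono mult_pos_pos) auto
    qed (use b U in \<open>auto simp: S2_def D_def\<close>)
    also have "\<dots> = ennreal (1 / R ^ 4 * \<delta>)"
      using fin U(3) \<mu>S2 by (subst ennreal_mult) (auto simp: emeasure_eq_ennreal_measure \<delta>_def)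
    finally show ?thesis
      using inv2 U(3) by (simp add: emeasure_eq_ennreal_measure \<delta>_def ennreal_le_iff)
  qed
  have \<mu>3: "?\<mu> S \<le> r ^ 4 * ?\<mu> (inverse ` S)" if S: "S \<in> sets borel" "S \<subseteq> S3" "S \<subseteq> ball 0 r" "r > 0" for S r
  proof -
    have "emeasure lborel S \<noteq> \<infinity>"
      using emeasure_mono[of S S3 lborel] fin(4) b S by (auto simp: top_unique)
    moreover have "emeasure lborel S \<le> ennreal (r ^ 4) * emeasure lborel (inverse ` S)"
      by (rule emeasure_inverse_image_ge) (use S S3d[of 0] d(1) in auto)
    ultimately show ?thesis
      using inv3[OF S(1,2)] S(4)
      by (simp add: emeasure_eq_ennreal_measure ennreal_mult''[symmetric] ennreal_le_iff)
  qed
  have split: "?\<mu> (inverse ` (- U)) = pi / R\<^sup>2 - ?\<mu> (inverse ` S2) + ?\<mu> (inverse ` S3)"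
  proof -
    have eq: "inverse ` (- U) = (inverse ` (- D) - inverse ` S2) \<union> inverse ` S3"
      by (auto simp: S2_def S3_def)
    have sub: "inverse ` S2 \<subseteq> inverse ` (- D)" by (auto simp: S2_def)
    have "?\<mu> (inverse ` (- U)) = ?\<mu> (inverse ` (- D) - inverse ` S2) + ?\<mu> (inverse ` S3)"
      unfolding eq
    proof (rule measure_Union)
      show "emeasure lborel (inverse ` (- D) - inverse ` S2) \<noteq> \<infinity>"
        using emeasure_mono[of "inverse ` (- D) - inverse ` S2" "inverse ` (- D)" lborel] inv1 by (auto simp: top_unique)
      show "(inverse ` (- D) - inverse ` S2) \<inter> inverse ` S3 = {}"
        by (auto simp: S3_def)
    qed (use inv1 inv2 inv3[OF b(2)] in auto)
    also have "?\<mu> (inverse ` (- D) - inverse ` S2) = ?\<mu> (inverse ` (- D)) - ?\<mu> (inverse ` S2)"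
      using inv1 inv2 sub by (intro measure_Diff) auto
    finally show ?thesis by (simp add: \<mu>1)
  qed
  have 3: "\<delta> / R ^ 4 \<le> ?\<mu> (inverse ` S3)"
    using \<mu>3[of S3 R] b U(3) by (simp add: \<delta>_def S3_def D_def field_simps)
  show "?\<mu> (inverse ` (- U)) \<ge> pi / R\<^sup>2"
    using split \<mu>2 3 by simp
  assume "?\<mu> (inverse ` (- U)) = pi / R\<^sup>2"
  then have eq3: "?\<mu> (inverse ` S3) = \<delta> / R ^ 4" using split \<mu>2 3 by simp
  \<comment> \<open>On \<open>ball 0 r\<close> the Jacobian exceeds
    \<open>1 / r ^ 4 > 1 / R ^ 4\<close>, so positive area of \<open>S3\<close> there would make the
    comparison strict.\<close>
  have null: "S3 \<inter> ball 0 r \<in> null_sets lborel" if r: "0 < r" "r < R" for r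
  proof -
    have m: "S3 \<inter> ball 0 r \<in> sets borel" "S3 - ball 0 r \<in> sets borel" using b by auto
    have eq: "inverse ` S3 = inverse ` (S3 \<inter> ball 0 r) \<union> inverse ` (S3 - ball 0 r)" by auto
    have "?\<mu> (inverse ` S3) = ?\<mu> (inverse ` (S3 \<inter> ball 0 r)) + ?\<mu> (inverse ` (S3 - ball 0 r))"
      unfolding eq by (rule measure_Union) (use inv3[of "S3 \<inter> ball 0 r"] inv3[of "S3 - ball 0 r"] m in auto)
    moreover have "?\<mu> (S3 \<inter> ball 0 r) / r ^ 4 \<le> ?\<mu> (inverse ` (S3 \<inter> ball 0 r))"
      using \<mu>3[of "S3 \<inter> ball 0 r" r] m r by (simp add: field_simps)
    moreover have "?\<mu> (S3 - ball 0 r) / R ^ 4 \<le> ?\<mu> (inverse ` (S3 - ball 0 r))"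
      using \<mu>3[of "S3 - ball 0 r" R] m U(3) by (auto simp: S3_def D_def field_simps)
    moreover have "?\<mu> (S3 - ball 0 r) = \<delta> - ?\<mu> (S3 \<inter> ball 0 r)"
      unfolding \<delta>_def using fin b by (intro measure_Diff_Int) (auto simp: fmeasurable_def less_top)
    ultimately have "?\<mu> (S3 \<inter> ball 0 r) / r ^ 4 + (\<delta> - ?\<mu> (S3 \<inter> ball 0 r)) / R ^ 4 \<le> \<delta> / R ^ 4"
      using eq3 by simp
    then have "?\<mu> (S3 \<inter> ball 0 r) * (1 / r ^ 4 - 1 / R ^ 4) \<le> 0"
      by (simp add: algebra_simps diff_divide_distrib)
    moreover have "1 / R ^ 4 < 1 / r ^ 4"
      using r by (intro divide_strict_left_mono power_strict_mono) auto
    ultimately have "?\<mu> (S3 \<inter> ball 0 r) = 0"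
      by (smt (verit) measure_nonneg mult_pos_pos)
    moreover have "emeasure lborel (S3 \<inter> ball 0 r) \<noteq> \<infinity>"
      using emeasure_mono[of "S3 \<inter> ball 0 r" S3 lborel] fin(4) b by (auto simp: top_unique)
    ultimately show ?thesis using m by (simp add: null_sets_def emeasure_eq_ennreal_measure)
  qed
  \<comment> \<open>The shift by 2 keeps the exhausting radii positive; the first one is
    \<open>R / 2\<close>.\<close>
  have "S3 = (\<Union>n. S3 \<inter> ball 0 (R * (1 - 1 / real (n + 2))))"
  proof (intro equalityI subsetI)
    fix z assume z: "z \<in> S3"
    then have "norm z / R < 1" using U(3) by (simp add: S3_def D_def)
    then obtain n where n: "1 / real (Suc n) < 1 - norm z / R"
      using nat_approx_posE[of "1 - norm z / R"] by auto
    have "1 / real (n + 2) \<le> 1 / real (Suc n)" by (intro divide_left_mono) auto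
    then have "norm z / R < 1 - 1 / real (n + 2)" using n by linarith
    then have "norm z < R * (1 - 1 / real (n + 2))" using U(3) by (simp add: pos_divide_less_eq mult.commute)
    then show "z \<in> (\<Union>n. S3 \<inter> ball 0 (R * (1 - 1 / real (n + 2))))" using z by auto
  qed auto
  also have "\<dots> \<in> null_sets lborel"
    using U(3) by (intro null_sets_UN null) (auto simp: field_simps intro: add_pos_nonneg)
  finally show "?\<mu> (ball 0 R - U) = 0"
    by (simp add: S3_def D_def null_sets_def measure_def)
qed

theorem analytic_capacity_ge_area:
  assumes \<Omega>: "open \<Omega>" "z0 \<in> \<Omega>" and fin: "emeasure lborel \<Omega> < \<infinity>"
  shows "(analytic_capacity \<Omega> z0)\<^sup>2 \<ge> pi / measure lborel \<Omega>"
    and "(analytic_capacity \<Omega> z0)\<^sup>2 = pi / measure lborel \<Omega> \<Longrightarrow>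
      measure lborel (ball z0 (sqrt (measure lborel \<Omega> / pi)) - \<Omega>) = 0 \<and> \<Omega> \<subseteq> ball z0 (sqrt (measure lborel \<Omega> / pi))"
proof -
  define v where "v = measure lborel \<Omega>"
  define R where "R = sqrt (v / pi)"
  define U where "U = (+) z0 -` \<Omega>"
  obtain d where d: "d > 0" "ball z0 d \<subseteq> \<Omega>" using \<Omega> openE by blast
  have \<Omega>b: "\<Omega> \<in> sets borel" using \<Omega> by simp
  have "emeasure lborel (ball z0 d) \<le> emeasure lborel \<Omega>" using d \<Omega>b by (intro emeasure_mono) auto
  then have v: "v > 0" "emeasure lborel \<Omega> = ennreal v"
  proof -
    assume le: "emeasure lborel (ball z0 d) \<le> emeasure lborel \<Omega>"
    show 1: "emeasure lborel \<Omega> = ennreal v" using fin by (simp add: v_def emeasure_eq_ennreal_measure)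
    have "0 < pi * d\<^sup>2" using d by simp
    moreover have "pi * d\<^sup>2 \<le> v"
      using le d 1 by (simp add: emeasure_ball_complex ennreal_le_iff v_def)
    ultimately show "v > 0" by linarith
  qed
  have R: "R > 0" "pi * R\<^sup>2 = v" using v by (auto simp: R_def)
  have oU: "open U" unfolding U_def by (intro open_vimage \<Omega>(1) continuous_intros)
  have tr: "emeasure lborel ((+) z0 -` X) = emeasure lborel X" if "X \<in> sets borel" for X
    using emeasure_distr[of "(+) z0" lborel borel X] that by (simp add: lborel_distr_plus)
  have eU: "emeasure lborel U = ennreal (pi * R\<^sup>2)"
    using tr[OF \<Omega>b] v(2) R(2) by (simp add: U_def)
  have U0: "0 \<in> U" using \<Omega>(2) by (simp add: U_def)
  have K: "inverted_complement \<Omega> z0 = inverse ` (- U) \<union> {0}"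
  proof (intro set_eqI iffI)
    fix w assume w: "w \<in> inverted_complement \<Omega> z0"
    show "w \<in> inverse ` (- U) \<union> {0}"
    proof (cases "w = 0")
      case False
      then have "inverse w \<in> - U" using w by (auto simp: inverted_complement_def U_def inverse_eq_divide)
      then have "inverse (inverse w) \<in> inverse ` (- U)" by blast
      then show ?thesis by simp
    qed auto
  qed (auto simp: inverted_complement_def U_def inverse_eq_divide)
  have "inverse ` (- U) = inverse -` (- U)" by (force simp: image_iff)
  then have "inverse ` (- U) \<in> sets borel"
    using measurable_sets[of "inverse :: complex \<Rightarrow> _" borel borel "- U"] oU by auto
  then have \<mu>K: "measure lborel (inverted_complement \<Omega> z0) = measure lborel (inverse ` (- U))"
    unfolding K by (intro measure_Un_null_set) auto
  have le: "pi / v \<le> measure lborel (inverted_complement \<Omega> z0) / pi"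
  proof -
    have "pi / v = (pi / R\<^sup>2) / pi" using R(1) by (simp add: R(2)[symmetric])
    also have "\<dots> \<le> measure lborel (inverse ` (- U)) / pi"
      by (intro divide_right_mono measure_inverse_complement_ge[OF oU U0 R(1) eU]) simp
    finally show ?thesis by (simp add: \<mu>K)
  qed
  then show "(analytic_capacity \<Omega> z0)\<^sup>2 \<ge> pi / measure lborel \<Omega>"
    using analytic_capacity_ge_measure[OF \<Omega>] by (simp add: v_def)
  assume "(analytic_capacity \<Omega> z0)\<^sup>2 = pi / measure lborel \<Omega>"
  then have "measure lborel (inverted_complement \<Omega> z0) / pi = pi / v"
    using analytic_capacity_ge_measure[OF \<Omega>] le by (simp add: v_def)
  then have "measure lborel (inverse ` (- U)) = pi / R\<^sup>2"
    using R(1) unfolding R(2)[symmetric] \<mu>K by (simp add: field_simps)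
  then have null: "measure lborel (ball 0 R - U) = 0"
    using measure_inverse_complement_eq[OF oU U0 R(1) eU] by blast
  have e1: "emeasure lborel (ball z0 R - \<Omega>) = emeasure lborel (ball 0 R - U)"
  proof -
    have "(+) z0 -` (ball z0 R - \<Omega>) = ball 0 R - U" by (auto simp: U_def dist_norm)
    then show ?thesis using tr[of "ball z0 R - \<Omega>"] \<Omega>b by simp
  qed
  then have m1: "measure lborel (ball z0 R - \<Omega>) = 0" using null by (simp add: measure_def)
  have ball: "emeasure lborel (ball z0 R) = ennreal v" using R by (simp add: emeasure_ball_complex)
  have "emeasure lborel (ball z0 R - \<Omega>) \<noteq> \<infinity>"
    using emeasure_mono[of "ball z0 R - \<Omega>" "ball z0 R" lborel] ball by (auto simp: top_unique)
  have "measure lborel (\<Omega> - ball z0 R) = 0"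
  proof -
    have "measure lborel (ball z0 R) = v" using ball v by (simp add: measure_def)
    moreover have "measure lborel (\<Omega> - ball z0 R) = v - measure lborel (\<Omega> \<inter> ball z0 R)"
      unfolding v_def using fin \<Omega>b by (intro measure_Diff_Int) (auto simp: fmeasurable_def)
    moreover have "measure lborel (ball z0 R - \<Omega>) = measure lborel (ball z0 R) - measure lborel (ball z0 R \<inter> \<Omega>)"
      using ball \<Omega>b by (intro measure_Diff_Int) (auto simp: fmeasurable_def)
    ultimately show ?thesis using m1 by (simp add: Int_commute)
  qed
  moreover have "emeasure lborel (\<Omega> - ball z0 R) \<noteq> \<infinity>"
    using emeasure_mono[of "\<Omega> - ball z0 R" \<Omega> lborel] v(2) \<Omega>b by (auto simp: top_unique)
  ultimately have z: "emeasure lborel (\<Omega> - ball z0 R) = 0"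
    by (simp add: emeasure_eq_ennreal_measure)
  \<comment> \<open>Equal areas give the inclusion only up to a null set. An open set without
    interior points outside the closed disc lies in the closed disc, and then in its
    interior.\<close>
  have "\<Omega> - cball z0 R = {}"
  proof (rule ccontr)
    assume "\<Omega> - cball z0 R \<noteq> {}"
    then obtain x where "x \<in> \<Omega> - cball z0 R" by blast
    moreover have "open (\<Omega> - cball z0 R)" using \<Omega>(1) by (intro open_Diff) auto
    ultimately obtain e where e: "e > 0" "ball x e \<subseteq> \<Omega> - cball z0 R" using openE by blast
    have "emeasure lborel (ball x e) \<le> emeasure lborel (\<Omega> - ball z0 R)"
      using e \<Omega>b by (intro emeasure_mono) auto
    then show False using z e by (simp add: emeasure_ball_complex)
  qed
  then have "\<Omega> \<subseteq> interior (cball z0 R)" using \<Omega>(1) by (intro interior_maximal) auto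
  then have "\<Omega> \<subseteq> ball z0 R" by (simp add: interior_cball)
  with m1 show "measure lborel (ball z0 (sqrt (measure lborel \<Omega> / pi)) - \<Omega>) = 0 \<and> \<Omega> \<subseteq> ball z0 (sqrt (measure lborel \<Omega> / pi))"
    by (simp add: R_def v_def)
qed

section \<open>Null sets of class N_B\<close>

lemma closedin_riemann_sphere_if_compactin:
  "compactin riemann_sphere E \<Longrightarrow> closedin riemann_sphere E"
  by (rule compactin_imp_closedin)
     (simp_all add: Hausdorff_space_Alexandroff_compactification locally_compact_space_euclidean)

lemma compactin_riemann_sphere_cases:
  assumes "compactin riemann_sphere E"
  obtains K where "compact K" "E = Some ` K" | "None \<in> E" "open {z. Some z \<notin> E}"
proof -
  from closedin_riemann_sphere_if_compactin[OF assms]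
  consider K where "compact K" "E = Some ` K" | U where "open U" "E = insert None (range Some) - Some ` U"
    by (auto simp: closedin_Alexandroff_compactification)
  then show ?thesis
  proof cases
    case (2 U)
    then have "None \<in> E" "{z. Some z \<notin> E} = U" by auto
    then show ?thesis using 2 that(2) by auto
  qed (use that(1) in auto)
qed

lemma compactin_riemann_sphere_Some: "compact K \<Longrightarrow> compactin riemann_sphere (Some ` K)"
  by (rule image_compactin[OF _ continuous_map_Some]) simp

text \<open>The definition speaks of functions on the sphere. If infinity lies outside E, Riemann's
  theorem in the chart \<open>w = 1 / z\<close> extends the bounded f there, and c is the value of
  the extension; if infinity belongs to E, any c will do.\<close>

lemma null_set_NB_imp_constant:
  assumes NB: "null_set_NB E" and f: "f holomorphic_on {z. Some z \<notin> E}" and bd: "bounded (f ` {z. Some z \<notin> E})"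
  shows "f constant_on {z. Some z \<notin> E}"
proof -
  have "\<exists>c. sphere_holomorphic_on (case_option c f) (- E)"
  proof -
    have fin: "(case_option c f \<circ> Some) holomorphic_on (Some -` (- E))" for c
      using f by (auto simp: o_def vimage_def)
    have cE: "compactin riemann_sphere E" using NB by (simp add: null_set_NB_def)
    let ?V = "chart_infinity -` (- E)"
    have off: "(case_option c f \<circ> chart_infinity) holomorphic_on (?V - {0})" for c
    proof -
      have "(f \<circ> (\<lambda>w. 1 / w)) holomorphic_on (?V - {0})"
        by (rule holomorphic_on_compose_gen[OF _ f]) (auto intro!: holomorphic_intros simp: chart_infinity_def)
      then show ?thesis
        by (rule holomorphic_transform) (auto simp: chart_infinity_def)
    qed
    from cE show ?thesis
    proof (cases rule: compactin_riemann_sphere_cases)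
      case (1 K)
      obtain r where r: "r > 0" "K \<subseteq> ball 0 r"
        using bounded_subset_ballD[OF compact_imp_bounded[OF 1(1)]] by blast
      have sub: "1 / w \<notin> K" if "w \<in> ball 0 (1 / r)" "w \<noteq> 0" for w
      proof
        assume "1 / w \<in> K"
        then have "1 / norm w < r" using r by (auto simp: norm_divide)
        then show False using that r(1) by (simp add: field_simps)
      qed
      have "(\<lambda>w. f (1 / w)) holomorphic_on (ball 0 (1 / r) - {0})"
        using 1 sub by (intro holomorphic_on_compose_gen[OF _ f, of "\<lambda>w. 1 / w", unfolded o_def]) (auto intro!: holomorphic_intros)
      moreover obtain B where B: "\<And>z. Some z \<notin> E \<Longrightarrow> norm (f z) \<le> B" using bd by (auto simp: bounded_iff)
      have "\<forall>\<^sub>F w in at 0. norm (f (1 / w)) \<le> B"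
        unfolding eventually_at using r(1) 1(2) sub by (intro exI[of _ "1 / r"]) (auto intro!: B)
      ultimately obtain H where H: "H holomorphic_on ball 0 (1 / r)" "\<And>w. w \<in> ball 0 (1 / r) - {0} \<Longrightarrow> H w = f (1 / w)"
        using holomorphic_on_extend_bounded[of "\<lambda>w. f (1 / w)" "ball 0 (1 / r)" 0] r(1) by auto
      let ?g = "case_option (H 0) f"
      have "(?g \<circ> chart_infinity) holomorphic_on ball 0 (1 / r)"
        using H by (rule_tac holomorphic_transform[OF H(1)]) (auto simp: chart_infinity_def)
      moreover have "open (?V - {0})"
      proof -
        have "open ((- {0}) \<inter> (\<lambda>w::complex. 1 / w) -` (- K))"
          by (intro continuous_open_preimage continuous_intros) (use 1 compact_imp_closed in auto)
        moreover have "?V - {0} = (- {0}) \<inter> (\<lambda>w. 1 / w) -` (- K)"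
          using 1 by (auto simp: chart_infinity_def)
        ultimately show ?thesis by simp
      qed
      ultimately have "(?g \<circ> chart_infinity) holomorphic_on ((?V - {0}) \<union> ball 0 (1 / r))"
        using off by (intro holomorphic_on_Un) auto
      then have "(?g \<circ> chart_infinity) holomorphic_on ?V"
        by (rule holomorphic_on_subset) (use r in auto)
      then have "sphere_holomorphic_on ?g (- E)"
        using fin unfolding sphere_holomorphic_on_def by blast
      then show ?thesis by blast
    next
      case 2
      then have V: "?V - {0} = ?V" by (auto simp: chart_infinity_def)
      have "sphere_holomorphic_on (case_option 0 f) (- E)"
        using fin[of 0] off[of 0, unfolded V] unfolding sphere_holomorphic_on_def by blast
      then show ?thesis by blast
    qed
  qed
  then obtain c where c: "sphere_holomorphic_on (case_option c f) (- E)" by blast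
  have "bounded (case_option c f ` (- E))"
  proof (rule bounded_subset)
    show "bounded (insert c (f ` {z. Some z \<notin> E}))" using bd by simp
    show "case_option c f ` (- E) \<subseteq> insert c (f ` {z. Some z \<notin> E})"
      by (auto split: option.splits)
  qed
  with NB c have "case_option c f constant_on (- E)" by (simp add: null_set_NB_def)
  then obtain d where d: "\<forall>x\<in>- E. case_option c f x = d" unfolding constant_on_def by blast
  have "f z = d" if "Some z \<notin> E" for z using bspec[OF d, of "Some z"] that by simp
  then show ?thesis unfolding constant_on_def by blast
qed

text \<open>It suffices to test functions on the plane: if infinity lies outside E, a punctured
  neighbourhood of it is free of E, and continuity in the chart transfers the constant to
  \<open>g None\<close>.\<close>

lemma null_set_NB_intro:
  assumes cE: "compactin riemann_sphere E"
    and const: "\<And>f. f holomorphic_on {z. Some z \<notin> E} \<Longrightarrow> bounded (f ` {z. Some z \<notin> E}) \<Longrightarrow> f constant_on {z. Some z \<notin> E}"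
  shows "null_set_NB E"
  unfolding null_set_NB_def
proof (intro conjI allI impI cE, elim conjE)
  fix g assume g: "sphere_holomorphic_on g (- E)" "bounded (g ` (- E))"
  have "(g \<circ> Some) constant_on {z. Some z \<notin> E}"
  proof (rule const)
    show "(g \<circ> Some) holomorphic_on {z. Some z \<notin> E}"
      using g(1) by (simp add: sphere_holomorphic_on_def vimage_def)
    show "bounded ((g \<circ> Some) ` {z. Some z \<notin> E})"
      by (rule bounded_subset[OF g(2)]) auto
  qed
  then obtain c where c: "\<And>z. Some z \<notin> E \<Longrightarrow> g (Some z) = c" by (auto simp: constant_on_def)
  have "g None = c" if "None \<notin> E"
    using cE
  proof (cases rule: compactin_riemann_sphere_cases)
    case (1 K)
    let ?V = "chart_infinity -` (- E) :: complex set"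
    obtain r where r: "r > 0" "K \<subseteq> ball 0 r"
      using bounded_subset_ballD[OF compact_imp_bounded[OF 1(1)]] by blast
    have sub: "ball 0 (1 / r) \<subseteq> ?V"
    proof
      fix w :: complex assume w: "w \<in> ball 0 (1 / r)"
      show "w \<in> ?V"
      proof (cases "w = 0")
        case False
        have "1 / w \<notin> K"
        proof
          assume "1 / w \<in> K"
          then have "1 / norm w < r" using r by (auto simp: norm_divide)
          then show False using w False r(1) by (simp add: field_simps)
        qed
        then show ?thesis using 1(2) False by (auto simp: chart_infinity_def)
      qed (use that in \<open>auto simp: chart_infinity_def\<close>)
    qed
    have "continuous_on (ball 0 (1 / r)) (g \<circ> chart_infinity)"
      using g(1) sub by (meson holomorphic_on_imp_continuous_on holomorphic_on_subset sphere_holomorphic_on_def)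
    then have "isCont (g \<circ> chart_infinity) 0"
      using r(1) by (simp add: continuous_on_eq_continuous_at o_def)
    then have lim: "((g \<circ> chart_infinity) \<longlongrightarrow> (g \<circ> chart_infinity) 0) (at 0)" by (simp add: isCont_def)
    have "\<forall>\<^sub>F w in at 0. (g \<circ> chart_infinity) w = c"
      unfolding eventually_at
    proof (intro exI[of _ "1 / r"] conjI ballI impI)
      fix w :: complex assume "w \<noteq> 0 \<and> dist w 0 < 1 / r"
      then have "w \<in> ?V" "w \<noteq> 0" using sub by auto
      then show "(g \<circ> chart_infinity) w = c" using c[of "1 / w"] by (simp add: chart_infinity_def)
    qed (use r in auto)
    then have "((g \<circ> chart_infinity) \<longlongrightarrow> c) (at 0)" by (rule tendsto_eventually)
    from tendsto_unique[OF _ lim this] show ?thesis by (simp add: chart_infinity_def)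
  next
    case 2
    then show ?thesis using that by simp
  qed
  with c have "g x = c" if "x \<in> - E" for x using that by (cases x) auto
  then show "g constant_on (- E)" by (auto simp: constant_on_def)
qed

section \<open>Vanishing capacity and better competitors\<close>

text \<open>If \<open>f - f z0\<close> has a zero of order n, division by the power
  \<open>n - 1\<close> of \<open>z - z0\<close> leaves a simple zero. The quotient is still bounded:
  near \<open>z0\<close> by continuity, elsewhere because the denominator stays away from 0.\<close>

lemma analytic_capacity_pos:
  assumes \<Omega>: "open \<Omega>" "connected \<Omega>" "z0 \<in> \<Omega>" and f: "f holomorphic_on \<Omega>" "bounded (f ` \<Omega>)" "\<not> f constant_on \<Omega>"
  shows "analytic_capacity \<Omega> z0 > 0"
proof -
  define f1 where "f1 = (\<lambda>z. f z - f z0)"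
  have f1: "f1 holomorphic_on \<Omega>" unfolding f1_def by (intro holomorphic_intros f)
  have nc: "\<not> f1 constant_on \<Omega>"
  proof
    assume "f1 constant_on \<Omega>"
    then obtain c where "\<forall>z\<in>\<Omega>. f z - f z0 = c" unfolding constant_on_def f1_def by blast
    then have "\<forall>z\<in>\<Omega>. f z = c + f z0" by (simp add: diff_eq_eq)
    then show False using f(3) unfolding constant_on_def by blast
  qed
  obtain g r n where n: "0 < n" and r: "0 < r" "ball z0 r \<subseteq> \<Omega>" and g: "g holomorphic_on ball z0 r"
     and fac: "\<And>w. w \<in> ball z0 r \<Longrightarrow> f1 w = (w - z0) ^ n * g w" and gne: "\<And>w. w \<in> ball z0 r \<Longrightarrow> g w \<noteq> 0"
    by (rule holomorphic_factor_zero_nonconstant[OF f1 \<Omega>(1,2,3) _ nc]) (simp add: f1_def, blast)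
  define h where "h = (\<lambda>z. if z = z0 then 0 else f1 z / (z - z0) ^ (n - 1))"
  have hg: "h w = (w - z0) * g w" if "w \<in> ball z0 r" for w
    using fac[OF that] n by (cases n) (auto simp: h_def)
  have h1: "h holomorphic_on ball z0 r"
    by (rule holomorphic_transform[of "\<lambda>w. (w - z0) * g w"]) (use g hg in \<open>auto intro!: holomorphic_intros\<close>)
  have "h holomorphic_on (\<Omega> - {z0})"
    by (rule holomorphic_transform[of "\<lambda>z. f1 z / (z - z0) ^ (n - 1)"])
       (auto simp: h_def intro!: holomorphic_intros holomorphic_on_subset[OF f1])
  then have "h holomorphic_on ((\<Omega> - {z0}) \<union> ball z0 r)"
    using h1 \<Omega>(1) by (intro holomorphic_on_Un) auto
  then have h: "h holomorphic_on \<Omega>" by (rule holomorphic_on_subset) (use r in auto)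
  obtain A where A: "\<And>z. z \<in> \<Omega> \<Longrightarrow> norm (f z) \<le> A" using f(2) by (auto simp: bounded_iff)
  have "continuous_on (cball z0 (r/2)) h"
    by (rule holomorphic_on_imp_continuous_on, rule holomorphic_on_subset[OF h1]) (use r in auto)
  then have "bounded (h ` cball z0 (r/2))"
    by (intro compact_imp_bounded compact_continuous_image) auto
  then obtain B1 where B1: "\<And>z. z \<in> cball z0 (r/2) \<Longrightarrow> norm (h z) \<le> B1" unfolding bounded_iff by blast
  define B where "B = max 1 (max B1 (2 * A / (r/2) ^ (n - 1)))"
  have hB: "norm (h z) \<le> B" if z: "z \<in> \<Omega>" for z
  proof (cases "z \<in> cball z0 (r/2)")
    case False
    then have d: "r / 2 \<le> norm (z - z0)" "z \<noteq> z0" using r by (auto simp: dist_norm norm_minus_commute)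
    have "norm (f1 z) \<le> 2 * A" using A[OF z] A[OF \<Omega>(3)] norm_triangle_ineq4[of "f z" "f z0"] by (simp add: f1_def)
    then have "norm (f1 z) / norm (z - z0) ^ (n - 1) \<le> 2 * A / (r/2) ^ (n - 1)"
      using d r order_trans[OF norm_ge_zero A[OF \<Omega>(3)]] by (intro frac_le power_mono) auto
    then show ?thesis using d by (simp add: h_def norm_divide norm_power B_def)
  qed (use B1 in \<open>auto simp: B_def le_max_iff_disj\<close>)
  have "(h has_field_derivative g z0) (at z0)"
  proof (rule has_field_derivative_transform_within_open[where S = "ball z0 r"])
    show "((\<lambda>w. (w - z0) * g w) has_field_derivative g z0) (at z0)"
      using g r by (auto intro!: derivative_eq_intros holomorphic_derivI[OF g])
  qed (use hg r in auto)
  then have "deriv h z0 = g z0" by (rule DERIV_imp_deriv)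
  moreover have "cmod (deriv h z0) / B \<le> analytic_capacity \<Omega> z0"
    by (rule analytic_capacity_ge_of_bounded[OF \<Omega>(1,3) h _ _ hB]) (auto simp: h_def B_def)
  moreover have "norm (g z0) > 0" "B > 0" using gne[of z0] r by (auto simp: B_def)
  then have "0 < norm (g z0) / B" by (rule divide_pos_pos)
  ultimately show ?thesis by simp
qed

text \<open>For infinite area the lower bound is 0, so this settles that half of the equality case.
  The witness P is the full complement on the sphere and hence contains infinity; in the converse
  direction P may omit it.\<close>

theorem analytic_capacity_eq_0_iff:
  assumes \<Omega>: "open \<Omega>" "connected \<Omega>" "z0 \<in> \<Omega>"
  shows "analytic_capacity \<Omega> z0 = 0 \<longleftrightarrow> (\<exists>P. null_set_NB P \<and> \<Omega> = {z. Some z \<notin> P})"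
proof
  assume 0: "analytic_capacity \<Omega> z0 = 0"
  define P where "P = - (Some ` \<Omega>)"
  have eq: "{z. Some z \<notin> P} = \<Omega>" by (auto simp: P_def)
  have "closedin riemann_sphere P"
    unfolding closedin_Alexandroff_compactification using \<Omega>(1)
    by (intro disjI2 exI[of _ \<Omega>]) (simp add: P_def UNIV_option_conv[symmetric] Compl_eq_Diff_UNIV)
  then have "compactin riemann_sphere P"
    by (simp add: closedin_compact_space)
  moreover have "f constant_on \<Omega>" if "f holomorphic_on \<Omega>" "bounded (f ` \<Omega>)" for f
    using analytic_capacity_pos[OF \<Omega> that] 0 by auto
  ultimately have "null_set_NB P" by (intro null_set_NB_intro) (auto simp: eq)
  then show "\<exists>P. null_set_NB P \<and> \<Omega> = {z. Some z \<notin> P}" using eq by blast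
next
  assume "\<exists>P. null_set_NB P \<and> \<Omega> = {z. Some z \<notin> P}"
  then obtain P where P: "null_set_NB P" "\<Omega> = {z. Some z \<notin> P}" by blast
  have "analytic_capacity \<Omega> z0 \<le> 0"
  proof (rule analytic_capacity_least)
    fix f assume f: "f holomorphic_on \<Omega>" "f ` \<Omega> \<subseteq> ball 0 1"
    then have "bounded (f ` \<Omega>)" using bounded_ball bounded_subset by blast
    then have "f constant_on \<Omega>" using null_set_NB_imp_constant[OF P(1)] f(1) P(2) by simp
    then obtain c where c: "\<forall>z\<in>\<Omega>. f z = c" unfolding constant_on_def by blast
    have "((\<lambda>_. c) has_field_derivative 0) (at z0)" by simp
    then have "(f has_field_derivative 0) (at z0)"
    proof (rule has_field_derivative_transform_within_open)
      show "c = f w" if "w \<in> \<Omega>" for w using c that by (rule_tac sym) blast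
    qed (use \<Omega> in blast)+
    then show "cmod (deriv f z0) \<le> 0" by (simp add: DERIV_imp_deriv)
  qed
  then show "analytic_capacity \<Omega> z0 = 0" using analytic_capacity_nonneg[OF \<Omega>(1,3)] by simp
qed

text \<open>If \<open>g\<close> is bounded and nonconstant off \<open>K\<close>, then \<open>\<phi> = z ^ n * (g - g \<infinity>)\<close> satisfies \<open>\<phi> 0 = 0\<close> and, for
  suitable \<open>n\<close>, \<open>\<phi> \<infinity> = a \<noteq> 0\<close>. Subtracting the reflection of \<open>\<phi> / a\<close> in the unit circle gives a function whose
  real part vanishes on the circle but not at the origin; it is the direction in which the identity
  map can be improved.\<close>

lemma exists_better_competitor:
  assumes K: "compact K" "K \<subseteq> ball 0 1" "0 \<notin> K" "connected (- K)"
    and g: "g holomorphic_on (- K)" "bounded (g ` (- K))" "\<not> g constant_on (- K)"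
  shows "\<exists>f. f holomorphic_on (ball 0 1 - K) \<and> f ` (ball 0 1 - K) \<subseteq> ball 0 1 \<and> f 0 = 0 \<and> cmod (deriv f 0) > 1"
proof -
  have oK: "open (- K)" using K(1) compact_imp_closed by auto
  \<comment> \<open>K lies strictly inside the unit disc, so g is holomorphic beyond the circle
    \<open>norm z = \<sigma>\<close> and everything below is defined on a neighbourhood of the unit
    circle.\<close>
  obtain \<sigma> where \<sigma>: "0 < \<sigma>" "\<sigma> < 1" "K \<subseteq> ball 0 \<sigma>"
  proof -
    have "\<exists>t<1. 0 < t \<and> (\<forall>z\<in>K. norm z < t)"
    proof (cases "K = {}")
      case True
      then show ?thesis by (intro exI[of _ "1/2"]) auto
    next
      case False
      then obtain x where x: "x \<in> K" "\<And>z. z \<in> K \<Longrightarrow> norm z \<le> norm x"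
        using continuous_attains_sup[OF K(1) False, of norm] by (auto intro: continuous_intros)
      have "norm x < 1" using x K(2) by auto
      then obtain t where t: "norm x < t" "t < 1" using dense by blast
      then have "0 < t" "\<forall>z\<in>K. norm z < t" using le_less_trans[OF norm_ge_zero t(1)] le_less_trans[OF x(2) t(1)] by auto
      with t(2) show ?thesis by blast
    qed
    then show ?thesis using that by (auto simp: subset_iff)
  qed
  have out: "1 / w \<notin> K" if "w \<in> ball 0 (1 / \<sigma>)" "w \<noteq> 0" for w
  proof
    assume "1 / w \<in> K"
    then have "1 / norm w < \<sigma>" using \<sigma> by (auto simp: norm_divide)
    then show False using that \<sigma>(1) by (simp add: field_simps)
  qed
  obtain B where B: "\<And>z. z \<notin> K \<Longrightarrow> norm (g z) \<le> B" using g(2) unfolding bounded_iff by blast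
  have "(\<lambda>w. g (1 / w)) holomorphic_on (ball 0 (1 / \<sigma>) - {0})"
    using out by (intro holomorphic_on_compose_gen[OF _ g(1), of "\<lambda>w. 1 / w", unfolded o_def]) (auto intro!: holomorphic_intros)
  moreover have "\<forall>\<^sub>F w in at 0. norm (g (1 / w)) \<le> B"
    unfolding eventually_at using \<sigma>(1) out by (intro exI[of _ "1 / \<sigma>"]) (auto intro!: B)
  ultimately obtain G where G: "G holomorphic_on ball 0 (1 / \<sigma>)" "\<And>w. w \<in> ball 0 (1 / \<sigma>) - {0} \<Longrightarrow> G w = g (1 / w)"
    using holomorphic_on_extend_bounded[of "\<lambda>w. g (1 / w)" "ball 0 (1 / \<sigma>)" 0] \<sigma>(1) by auto
  define G0 where "G0 = (\<lambda>w. G w - G 0)"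
  have G0: "G0 holomorphic_on ball 0 (1 / \<sigma>)" unfolding G0_def by (intro holomorphic_intros G)
  \<comment> \<open>If g were constant near infinity, it would be constant on all of
    \<open>- K\<close> by connectedness.\<close>
  have nc: "\<not> G0 constant_on ball 0 (1 / \<sigma>)"
  proof
    assume "G0 constant_on ball 0 (1 / \<sigma>)"
    then obtain c where c: "\<And>w. w \<in> ball 0 (1 / \<sigma>) \<Longrightarrow> G0 w = c" by (auto simp: constant_on_def)
    have gc: "g z = c + G 0" if "norm z > \<sigma>" for z
    proof -
      have "norm z > 0" using that \<sigma>(1) by linarith
      moreover from this have "1 / norm z < 1 / \<sigma>" using that \<sigma>(1) by (intro divide_strict_left_mono mult_pos_pos) auto
      ultimately have "z \<noteq> 0" "1 / z \<in> ball 0 (1 / \<sigma>) - {0}" by (auto simp: norm_divide)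
      then show ?thesis using c[of "1 / z"] G(2)[of "1 / z"] by (simp add: G0_def algebra_simps)
    qed
    have "g z = c + G 0" if "z \<in> - K" for z
    proof (rule analytic_continuation_open[where s = "{z. norm z > \<sigma>}" and s' = "- K" and f = g and g = "\<lambda>_. c + G 0"])
      show "open {z::complex. norm z > \<sigma>}" by (intro open_Collect_less continuous_intros)
      have "of_real (\<sigma> + 1) \<in> {z::complex. norm z > \<sigma>}" using \<sigma> by (simp add: norm_of_real del: of_real_add)
      then show "{z::complex. norm z > \<sigma>} \<noteq> {}" by blast
      show "{z. norm z > \<sigma>} \<subseteq> - K" using \<sigma>(3) by auto
    qed (use oK K g that gc in auto)
    then show False using g(3) by (auto simp: constant_on_def)
  qed
  have mem: "0 \<in> ball 0 (1 / \<sigma>)" and G00: "G0 0 = 0" using \<sigma>(1) by (auto simp: G0_def)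
  obtain H r n where n: "0 < n" and r: "0 < r" "ball (0::complex) r \<subseteq> ball 0 (1 / \<sigma>)" and H: "H holomorphic_on ball 0 r"
     and fac: "\<And>w. w \<in> ball 0 r \<Longrightarrow> G0 w = (w - 0) ^ n * H w" and Hne: "\<And>w. w \<in> ball 0 r \<Longrightarrow> H w \<noteq> 0"
    by (rule holomorphic_factor_zero_nonconstant[OF G0 open_ball connected_ball mem G00 nc]) (rule that)
  define a where "a = H 0"
  have a: "a \<noteq> 0" using Hne r by (simp add: a_def)
  \<comment> \<open>The function \<phi> read through \<open>1 / w\<close>. The order n of the zero
    of \<open>G0\<close> makes it regular at 0 with the value \<open>a \<noteq> 0\<close>.\<close>
  define \<Phi> where "\<Phi> = (\<lambda>w. if w = 0 then a else G0 w / w ^ n)"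
  have \<Phi>H: "\<Phi> w = H w" if "w \<in> ball 0 r" for w using fac[OF that] by (auto simp: \<Phi>_def a_def)
  have "\<Phi> holomorphic_on (ball 0 (1 / \<sigma>) - {0})"
    by (rule holomorphic_transform[of "\<lambda>w. G0 w / w ^ n"])
       (auto simp: \<Phi>_def intro!: holomorphic_intros holomorphic_on_subset[OF G0])
  moreover have "\<Phi> holomorphic_on ball 0 r" using H by (rule holomorphic_transform) (simp add: \<Phi>H)
  ultimately have "\<Phi> holomorphic_on ((ball 0 (1 / \<sigma>) - {0}) \<union> ball 0 r)" by (intro holomorphic_on_Un) auto
  then have \<Phi>: "\<Phi> holomorphic_on ball 0 (1 / \<sigma>)" by (rule holomorphic_on_subset) (use r in auto)
  define \<phi> where "\<phi> = (\<lambda>z. z ^ n * (g z - G 0))"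
  have \<phi>: "\<phi> holomorphic_on (- K)" unfolding \<phi>_def by (intro holomorphic_intros g)
  \<comment> \<open>\<open>\<psi> z\<close> is \<open>cnj (\<phi> (1 / cnj z))\<close>, the
    reflection in the unit circle. Expressed through \<Phi> it is holomorphic on a full disc of
    radius larger than 1, so the reflection introduces no singularities inside.\<close>
  define \<psi> where "\<psi> = cnj \<circ> \<Phi> \<circ> cnj"
  have \<psi>: "\<psi> holomorphic_on ball 0 (1 / \<sigma>)"
    unfolding \<psi>_def
  proof (rule holomorphic_on_compose_cnj_cnj)
    have "cnj ` ball 0 (1 / \<sigma>) \<subseteq> ball 0 (1 / \<sigma>)" by auto
    then show "\<Phi> holomorphic_on cnj ` ball 0 (1 / \<sigma>)" using \<Phi> holomorphic_on_subset by blast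
  qed simp
  have \<sigma>1: "1 < 1 / \<sigma>" using \<sigma> by simp
  define h where "h = (\<lambda>z. \<phi> z / a - \<psi> z / cnj a)"
  have h: "h holomorphic_on (ball 0 (1 / \<sigma>) - K)"
    unfolding h_def using a
    by (intro holomorphic_intros holomorphic_on_subset[OF \<phi>] holomorphic_on_subset[OF \<psi>]) auto
  have h_circle: "Re (h z) = 0" if "norm z = 1" for z
  proof -
    have "z * cnj z = 1" using complex_norm_square[of z] that by simp
    moreover from this have "z \<noteq> 0" by auto
    ultimately have z: "z \<noteq> 0" "cnj z = 1 / z" by (simp_all add: nonzero_eq_divide_eq mult.commute)
    have "cnj z \<in> ball 0 (1 / \<sigma>) - {0}" using that \<sigma>1 z(1) by auto
    then have "\<Phi> (cnj z) = \<phi> z"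
      using G(2)[of "1 / z"] z by (simp add: \<Phi>_def \<phi>_def G0_def power_one_over)
    then have "h z = \<phi> z / a - cnj (\<phi> z / a)" by (simp add: h_def \<psi>_def)
    moreover have "Re (w - cnj w) = 0" for w by simp
    ultimately show ?thesis by (simp only:)
  qed
  \<comment> \<open>Here \<open>\<phi> 0 = 0\<close> needs \<open>n > 0\<close>, and
    \<open>\<psi> 0 = cnj a\<close> is the value at infinity.\<close>
  have h0: "h 0 = -1" using n a by (simp add: h_def \<phi>_def \<psi>_def \<Phi>_def)
  obtain M where M: "M \<ge> 1" "\<And>z. z \<in> ball 0 1 - K \<Longrightarrow> norm (h z) + 1/2 \<le> M"
  proof -
    have "continuous_on (cball 0 1) \<psi>"
      by (rule holomorphic_on_imp_continuous_on, rule holomorphic_on_subset[OF \<psi>]) (use \<sigma>1 in auto)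
    then have "bounded (\<psi> ` cball 0 1)" by (intro compact_imp_bounded compact_continuous_image) auto
    then obtain B1 where B1: "\<And>z. z \<in> cball 0 1 \<Longrightarrow> norm (\<psi> z) \<le> B1" unfolding bounded_iff by blast
    have "norm (h z) \<le> (B + norm (G 0)) / norm a + B1 / norm a" if z: "z \<in> ball 0 1 - K" for z
    proof -
      have "norm (\<phi> z) \<le> 1 * (B + norm (G 0))"
        unfolding \<phi>_def norm_mult norm_power
        using z by (intro mult_mono power_le_one order_trans[OF norm_triangle_ineq4] add_right_mono B) auto
      then have "norm (\<phi> z / a) \<le> (B + norm (G 0)) / norm a" "norm (\<psi> z / cnj a) \<le> B1 / norm a"
        using B1[of z] z by (auto simp: norm_divide intro!: divide_right_mono)
      then show ?thesis unfolding h_def by (intro order_trans[OF norm_triangle_ineq4] add_mono)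
    qed
    then show ?thesis
      by (intro that[of "max 1 ((B + norm (G 0)) / norm a + B1 / norm a + 1/2)"]) (auto simp: le_max_iff_disj)
  qed
  \<comment> \<open>The real part of h vanishes on the unit circle, and h is uniformly continuous on
    a closed annulus up to it; comparison with the radial projection \<open>z / norm z\<close> gives
    the bound.\<close>
  obtain r0 where r0: "0 < r0" "r0 < 1" "\<And>z. r0 \<le> norm z \<Longrightarrow> norm z < 1 \<Longrightarrow> Re (h z) \<ge> -1/4"
  proof -
    define A where "A = cball 0 1 - ball (0::complex) \<sigma>"
    have cA: "compact A" unfolding A_def by (intro compact_diff) auto
    have "continuous_on A h"
      by (rule holomorphic_on_imp_continuous_on, rule holomorphic_on_subset[OF h]) (use \<sigma> in \<open>auto simp: A_def intro: le_less_trans[OF _ \<sigma>1]\<close>)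
    then have "uniformly_continuous_on A h" using cA by (rule compact_uniformly_continuous)
    then obtain d where d: "d > 0" "\<And>x y. x \<in> A \<Longrightarrow> y \<in> A \<Longrightarrow> dist y x < d \<Longrightarrow> dist (h y) (h x) < 1/4"
      unfolding uniformly_continuous_on_def by (metis zero_less_divide_1_iff zero_less_numeral)
    define r0 where "r0 = max \<sigma> (1 - d / 2)"
    have "Re (h z) \<ge> -1/4" if z: "r0 \<le> norm z" "norm z < 1" for z
    proof -
      have n0: "norm z \<ge> \<sigma>" "1 - norm z < d" using z d(1) by (auto simp: r0_def)
      then have z0: "norm z > 0" using \<sigma> by linarith
      define z' where "z' = z / norm z"
      have z': "norm z' = 1" using z0 by (simp add: z'_def norm_divide)
      have "z - z' = (1 - 1 / norm z) * z" using z0 by (simp add: z'_def algebra_simps)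
      then have "norm (z - z') = norm (complex_of_real (1 - 1 / norm z)) * norm z" by (simp add: norm_mult)
      also have "\<dots> = (1 / norm z - 1) * norm z"
        unfolding norm_of_real using z z0 by (simp add: abs_if field_simps)
      also have "\<dots> = 1 - norm z" using z0 by (simp add: field_simps)
      finally have "dist z z' < d" using n0 by (simp add: dist_norm)
      then have "dist (h z) (h z') < 1/4" using d(2)[of z' z] n0 z z' \<sigma> by (auto simp: A_def)
      then have "\<bar>Re (h z - h z')\<bar> < 1/4" using abs_Re_le_cmod[of "h z - h z'"] by (simp add: dist_norm)
      then show ?thesis using h_circle[OF z'] by simp
    qed
    moreover have "0 < r0" "r0 < 1" using \<sigma> d(1) by (auto simp: r0_def)
    ultimately show ?thesis using that by blast
  qed
  \<comment> \<open>The shift by \<open>1/2\<close> splits the gap between 0 on the circle and -1 at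
    the origin: \<open>q 0 = 1/2\<close> raises the derivative of
    \<open>z * (1 + \<epsilon> * q z)\<close> at 0, while near the circle the real part of q is at
    most \<open>-1/4\<close>, which keeps the values in the disc.\<close>
  define q where "q = (\<lambda>z. - h z - 1/2)"
  have qM: "norm (q z) \<le> M" if "z \<in> ball 0 1 - K" for z
    using M(2)[OF that] norm_triangle_ineq4[of "- h z" "1/2"] by (simp add: q_def)
  have qR: "Re (q z) \<le> -1/4" if "r0 \<le> norm z" "norm z < 1" for z using r0(3)[OF that] by (simp add: q_def)
  \<comment> \<open>The first entry makes the quadratic term
    \<open>\<epsilon>\<^sup>2 * M\<^sup>2\<close> at most \<open>\<epsilon> / 4\<close>, less than
    the linear gain \<open>\<epsilon> / 2\<close> near the circle. The second keeps the perturbation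
    below \<open>(1 - r0) / 2\<close> where \<open>norm z < r0\<close>.\<close>
  define \<epsilon> where "\<epsilon> = min (1 / (4 * M\<^sup>2)) ((1 - r0) / (2 * M))"
  have \<epsilon>: "\<epsilon> > 0" "\<epsilon> * M\<^sup>2 \<le> 1/4" "\<epsilon> * M \<le> (1 - r0) / 2"
  proof -
    show "\<epsilon> > 0" using M(1) r0 by (simp add: \<epsilon>_def)
    have "\<epsilon> * M\<^sup>2 \<le> 1 / (4 * M\<^sup>2) * M\<^sup>2" unfolding \<epsilon>_def by (intro mult_right_mono) auto
    then show "\<epsilon> * M\<^sup>2 \<le> 1/4" using M(1) by simp
    have "\<epsilon> * M \<le> (1 - r0) / (2 * M) * M" unfolding \<epsilon>_def using M(1) by (intro mult_right_mono) auto
    then show "\<epsilon> * M \<le> (1 - r0) / 2" using M(1) by simp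
  qed
  define f where "f = (\<lambda>z. z * (1 + of_real \<epsilon> * q z))"
  have q: "q holomorphic_on (ball 0 1 - K)"
    unfolding q_def using \<sigma>1 by (intro holomorphic_intros holomorphic_on_subset[OF h]) auto
  have f: "f holomorphic_on (ball 0 1 - K)" unfolding f_def by (intro holomorphic_intros q)
  have "norm (f z) < 1" if z: "z \<in> ball 0 1 - K" for z
  proof (cases "r0 \<le> norm z")
    case True
    have nz: "norm z < 1" using z by simp
    have "(norm (1 + of_real \<epsilon> * q z))\<^sup>2 = 1 + 2 * \<epsilon> * Re (q z) + \<epsilon>\<^sup>2 * (norm (q z))\<^sup>2"
      unfolding cmod_power2 by (simp add: power2_eq_square algebra_simps)
    also have "\<dots> \<le> 1 + 2 * \<epsilon> * (-1/4) + \<epsilon>\<^sup>2 * M\<^sup>2"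
      using qR[OF True nz] qM[OF z] \<epsilon>(1) by (intro add_mono mult_left_mono power_mono) auto
    also have "\<epsilon>\<^sup>2 * M\<^sup>2 \<le> \<epsilon> * (1/4)"
      using mult_left_mono[OF \<epsilon>(2), of \<epsilon>] \<epsilon>(1) by (simp add: power2_eq_square mult.assoc)
    finally have "(norm (1 + of_real \<epsilon> * q z))\<^sup>2 \<le> 1\<^sup>2" using \<epsilon>(1) by simp
    then have "norm (1 + of_real \<epsilon> * q z) \<le> 1" by (rule power2_le_imp_le) simp
    then have "norm z * norm (1 + of_real \<epsilon> * q z) \<le> norm z * 1" by (intro mult_left_mono) auto
    then show ?thesis using nz by (simp add: f_def norm_mult)
  next
    case False
    have "norm (of_real \<epsilon> * q z) \<le> \<epsilon> * M"
      using qM[OF z] \<epsilon>(1) by (simp add: norm_mult)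
    then have "norm (of_real \<epsilon> * q z) \<le> (1 - r0) / 2" using \<epsilon>(3) by (rule order_trans)
    then have "norm (1 + of_real \<epsilon> * q z) \<le> 1 + (1 - r0) / 2"
      using norm_triangle_ineq[of 1 "of_real \<epsilon> * q z"] by (intro order_trans[OF norm_triangle_ineq]) simp
    then have "norm (f z) \<le> r0 * (1 + (1 - r0) / 2)"
      unfolding f_def norm_mult using False r0 by (intro mult_mono) auto
    also have "\<dots> = r0 + r0 * ((1 - r0) / 2)" by (simp add: algebra_simps)
    also have "\<dots> \<le> r0 + 1 * ((1 - r0) / 2)" using r0 by (intro add_left_mono mult_right_mono) auto
    also have "\<dots> < 1" using r0(2) by (simp add: field_simps)
    finally show ?thesis .
  qed
  moreover have "cmod (deriv f 0) > 1"
  proof -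
    have "(q has_field_derivative deriv q 0) (at 0)"
      using q K(3) K(1) by (intro holomorphic_derivI[OF q]) (auto intro!: open_Diff compact_imp_closed)
    then have "(f has_field_derivative (1 + of_real \<epsilon> * q 0)) (at 0)"
      unfolding f_def by (auto intro!: derivative_eq_intros)
    then have "deriv f 0 = 1 + of_real \<epsilon> * q 0" by (rule DERIV_imp_deriv)
    also have "\<dots> = of_real (1 + \<epsilon> / 2)" by (simp add: q_def h0)
    finally show ?thesis using \<epsilon>(1) by (simp add: norm_of_real del: of_real_add)
  qed
  ultimately show ?thesis using f by (intro exI[of _ f]) (auto simp: f_def)
qed

section \<open>Extremal domains of finite area\<close>

text \<open>A null set contains no disc. The resulting density serves twice: for the connectedness
  of the complement of a compact piece of P, and for passing bounds from \<Omega> to the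
  disc.\<close>

lemma ball_subset_closure_of_null_complement:
  fixes S :: "complex set"
  assumes "S \<in> sets borel" and null: "emeasure lborel (ball z0 R - S) = 0"
  shows "ball z0 R \<subseteq> closure (ball z0 R \<inter> S)"
proof
  fix x assume x: "x \<in> ball z0 R"
  show "x \<in> closure (ball z0 R \<inter> S)"
    unfolding closure_approachable
  proof (intro allI impI)
    fix e :: real assume "e > 0"
    obtain d where d: "d > 0" "ball x d \<subseteq> ball z0 R" using x openE[OF open_ball] by blast
    define m where "m = min d e"
    have m: "m > 0" "m \<le> d" "m \<le> e" using d \<open>e > 0\<close> by (auto simp: m_def)
    have "\<exists>y\<in>S. y \<in> ball x m"
    proof (rule ccontr)
      assume "\<not> ?thesis"
      then have "ball x m \<subseteq> ball z0 R - S" using d m by (auto simp: subset_iff)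
      then have "emeasure lborel (ball x m) \<le> emeasure lborel (ball z0 R - S)"
        using assms(1) by (intro emeasure_mono) auto
      then show False using null m by (simp add: emeasure_ball_complex)
    qed
    then obtain y where "y \<in> S" "y \<in> ball x m" by blast
    then show "\<exists>y\<in>ball z0 R \<inter> S. dist y x < e"
      using d m by (intro bexI[of _ y]) (auto simp: dist_commute subset_iff)
  qed
qed

text \<open>A nonconstant bounded function off the compact piece K would give, after rescaling to
  the unit disc, a competitor on the disc minus K with derivative larger than \<open>1 / R\<close>;
  restricted to \<Omega> it contradicts \<open>le\<close>.\<close>

lemma null_set_NB_of_extremal:
  assumes \<Omega>: "open \<Omega>" "connected \<Omega>" "z0 \<in> \<Omega>" and R: "R > 0" "\<Omega> \<subseteq> ball z0 R"
    and null: "emeasure lborel (ball z0 R - \<Omega>) = 0"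
    and le: "analytic_capacity \<Omega> z0 \<le> 1 / R"
    and s: "s < R"
  shows "null_set_NB (Some ` ((ball z0 R - \<Omega>) \<inter> cball z0 s))"
proof -
  define K where "K = (ball z0 R - \<Omega>) \<inter> cball z0 s"
  have "K = cball z0 s - \<Omega>" using s by (auto simp: K_def)
  then have cK: "compact K" using \<Omega>(1) by (simp add: compact_diff)
  \<comment> \<open>A lies between the connected set \<Omega> and its closure, as the removed set is
    null. The exterior B of the disc of radius s is connected too, and the two overlap because
    \<open>s < R\<close>.\<close>
  have conn: "connected (- K)"
  proof -
    define A where "A = ball z0 R - K"
    define B where "B = - cball z0 s"
    have A: "connected A"
    proof (rule connected_intermediate_closure[OF \<Omega>(2)])
      show "\<Omega> \<subseteq> A" using R(2) by (auto simp: A_def K_def)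
      have "ball z0 R \<inter> \<Omega> = \<Omega>" using R(2) by auto
      then show "A \<subseteq> closure \<Omega>"
        using ball_subset_closure_of_null_complement[OF _ null] \<Omega>(1) by (auto simp: A_def)
    qed
    have B: "connected B" unfolding B_def by (rule connected_complement_bounded_convex) auto
    \<comment> \<open>s may be negative; the maximum with 0 keeps the test point strictly between s
      and R at a positive distance.\<close>
    define t where "t = (max s 0 + R) / 2"
    have t: "s < t" "0 < t" "t < R" using s R(1) by (auto simp: t_def max_def field_simps)
    have "z0 + of_real t \<in> A \<inter> B" using t by (auto simp: A_def B_def K_def dist_norm)
    then have "A \<inter> B \<noteq> {}" by blast
    then have "connected (A \<union> B)" by (rule connected_Un[OF A B])
    moreover have "A \<union> B = - K" using s by (auto simp: A_def B_def K_def)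
    ultimately show ?thesis by simp
  qed
  have "null_set_NB (Some ` K)"
  proof (rule null_set_NB_intro)
    show "compactin riemann_sphere (Some ` K)" by (rule compactin_riemann_sphere_Some[OF cK])
    have eq: "{z. Some z \<notin> Some ` K} = - K" by auto
    fix g assume g: "g holomorphic_on {z. Some z \<notin> Some ` K}" "bounded (g ` {z. Some z \<notin> Some ` K})"
    show "g constant_on {z. Some z \<notin> Some ` K}"
      unfolding eq
    proof (rule ccontr)
      assume nc: "\<not> g constant_on - K"
      define T where "T = (\<lambda>w. z0 + of_real R * w)"
      define K1 where "K1 = T -` K"
      have Tinv: "T ((z - z0) / of_real R) = z" for z using R(1) by (simp add: T_def)
      have K1_eq: "K1 = (\<lambda>z. (z - z0) / of_real R) ` K"
        using R(1) Tinv by (force simp: K1_def T_def image_iff)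
      have Ceq: "- K1 = (\<lambda>z. (z - z0) / of_real R) ` (- K)"
        using R(1) Tinv by (force simp: K1_def T_def image_iff)
      have "\<exists>f. f holomorphic_on (ball 0 1 - K1) \<and> f ` (ball 0 1 - K1) \<subseteq> ball 0 1 \<and> f 0 = 0 \<and> cmod (deriv f 0) > 1"
      proof (rule exists_better_competitor)
        show "compact K1" unfolding K1_eq using R(1) by (intro compact_continuous_image continuous_intros cK) auto
        show "K1 \<subseteq> ball 0 1" using R(1) by (auto simp: K1_eq K_def dist_norm norm_divide norm_minus_commute)
        show "0 \<notin> K1" using \<Omega>(3) by (auto simp: K1_def T_def K_def)
        show "connected (- K1)" unfolding Ceq using R(1) by (intro connected_continuous_image continuous_intros conn) auto
        show "(g \<circ> T) holomorphic_on - K1"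
          by (rule holomorphic_on_compose_gen[OF _ g(1)]) (auto simp: T_def K1_def intro!: holomorphic_intros)
        show "bounded ((g \<circ> T) ` (- K1))"
          by (rule bounded_subset[OF g(2)]) (auto simp: K1_def)
        show "\<not> (g \<circ> T) constant_on - K1"
        proof
          assume "(g \<circ> T) constant_on - K1"
          then obtain c where c: "\<forall>w\<in>- K1. g (T w) = c" unfolding constant_on_def o_def by blast
          have "g z = c" if "z \<in> - K" for z
            using bspec[OF c, of "(z - z0) / of_real R"] that Tinv[of z] by (simp add: K1_def)
          then show False using nc unfolding constant_on_def by blast
        qed
      qed
      then obtain f where f: "f holomorphic_on (ball 0 1 - K1)" "f ` (ball 0 1 - K1) \<subseteq> ball 0 1" "f 0 = 0" "cmod (deriv f 0) > 1"
        by blast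
      define F where "F = (\<lambda>z. f ((z - z0) / of_real R))"
      have sub: "(z - z0) / of_real R \<in> ball 0 1 - K1" if "z \<in> \<Omega>" for z
        using that R Tinv[of z] by (auto simp: K1_def K_def norm_divide dist_norm norm_minus_commute subset_iff)
      have "cmod (deriv F z0) \<le> analytic_capacity \<Omega> z0"
      proof (rule analytic_capacity_upper[OF \<Omega>(1,3)])
        show "F holomorphic_on \<Omega>"
          unfolding F_def using sub R(1)
          by (intro holomorphic_on_compose_gen[OF _ f(1), of "\<lambda>z. (z - z0) / of_real R", unfolded o_def])
             (auto intro!: holomorphic_intros)
        show "F ` \<Omega> \<subseteq> ball 0 1" using f(2) sub by (auto simp: F_def)
        show "F z0 = 0" using f(3) by (simp add: F_def)
      qed
      moreover have "deriv F z0 = deriv f 0 / of_real R"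
      proof -
        have "0 \<in> ball 0 1 - K1" using sub[OF \<Omega>(3)] by simp
        moreover have "open (ball 0 1 - K1)"
          unfolding K1_eq using R(1) by (intro open_Diff compact_imp_closed compact_continuous_image continuous_intros cK) auto
        ultimately have "(f has_field_derivative deriv f 0) (at 0)"
          using f(1) holomorphic_derivI by blast
        then have "(f has_field_derivative deriv f 0) (at ((z0 - z0) / of_real R))" by simp
        then have "((\<lambda>z. f ((z - z0) / of_real R)) has_field_derivative deriv f 0 * (1 / of_real R)) (at z0)"
          by (rule DERIV_chain2) (use R(1) in \<open>auto intro!: derivative_eq_intros\<close>)
        then show ?thesis unfolding F_def by (simp add: DERIV_imp_deriv)
      qed
      ultimately have "cmod (deriv f 0) / R \<le> 1 / R" using le R(1) by (simp add: norm_divide)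
      then show False using f(4) R(1) by (simp add: divide_le_cancel)
    qed
  qed
  then show ?thesis by (simp add: K_def)
qed

section \<open>Localization of singularities and removability\<close>

text \<open>After averaging over rotations the kernel becomes Cauchy's integral of the constant 1
  over a circle, which is 1 for points inside and 0 for points outside. Hence the transform of the
  annulus is a smooth substitute for an indicator function of the inner disc, up to the factor given
  by the area.\<close>

lemma integral_annulus_kernel:
  fixes z :: complex
  assumes s: "0 < s1" "s1 < s2"
  defines "A \<equiv> {\<xi>. s1 < norm \<xi> \<and> norm \<xi> < s2}"
  shows "norm z < s1 \<Longrightarrow> (LINT \<xi>:A|lborel. \<xi> / (\<xi> - z)) = measure lborel A"
    and "norm z > s2 \<Longrightarrow> (LINT \<xi>:A|lborel. \<xi> / (\<xi> - z)) = 0"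
proof -
  have A: "A \<in> sets borel" "emeasure lborel A < \<infinity>"
  proof -
    have "open A" unfolding A_def by (intro open_Collect_conj open_Collect_less continuous_intros)
    then show "A \<in> sets borel" by simp
    have "A \<subseteq> ball 0 s2" by (auto simp: A_def)
    then show "emeasure lborel A < \<infinity>" using bounded_subset[OF bounded_ball] emeasure_bounded_finite by blast
  qed
  define g where "g = (\<lambda>\<xi>. indicat_real A \<xi> *\<^sub>R (\<xi> / (\<xi> - z)))"
  have g: "integrable lborel g"
  proof (rule Bochner_Integration.integrable_bound)
    show "integrable lborel (\<lambda>\<xi>. s2 *\<^sub>R (indicat_real A \<xi> *\<^sub>R (1 / (\<xi> - z))))"
      using set_integrable_Cauchy_kernel[OF A, of z] unfolding set_integrable_def by (intro integrable_scaleR_right) auto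
    show "g \<in> borel_measurable lborel" using A(1) unfolding g_def by measurable
    show "AE \<xi> in lborel. norm (g \<xi>) \<le> norm (s2 *\<^sub>R (indicat_real A \<xi> *\<^sub>R (1 / (\<xi> - z))))"
      using s by (intro AE_I2) (auto simp: g_def indicator_def A_def norm_divide intro!: divide_right_mono)
  qed
  have avg: "(LINT \<xi>:A|lborel. \<xi> / (\<xi> - z)) = c * measure lborel A"
    if c: "\<And>\<xi>. \<xi> \<in> A \<Longrightarrow> (\<integral>t. cis t * \<xi> / (cis t * \<xi> - z) \<partial>circle_measure) = 2 * pi * c" for c :: complex
  proof -
    have "2 * pi * (\<integral>\<xi>. g \<xi> \<partial>lborel) = (\<integral>\<xi>. (\<integral>t. g (cis t * \<xi>) \<partial>circle_measure) \<partial>lborel)"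
      by (rule integral_rotation_average[OF g, symmetric])
    also have "\<dots> = (\<integral>\<xi>. indicat_real A \<xi> *\<^sub>R (2 * pi * c) \<partial>lborel)"
    proof (rule arg_cong[where f = "integral\<^sup>L lborel"], rule ext)
      fix \<xi> show "(\<integral>t. g (cis t * \<xi>) \<partial>circle_measure) = indicat_real A \<xi> *\<^sub>R (2 * pi * c)"
        using c[of \<xi>] by (cases "\<xi> \<in> A") (auto simp: g_def A_def norm_mult)
    qed
    also have "\<dots> = measure lborel A *\<^sub>R (2 * pi * c)" using A by simp
    finally have "complex_of_real (2 * pi) * (\<integral>\<xi>. g \<xi> \<partial>lborel) = complex_of_real (2 * pi) * (c * measure lborel A)"
      by (simp add: scaleR_conv_of_real)
    then have "(\<integral>\<xi>. g \<xi> \<partial>lborel) = c * measure lborel A" by (simp only: mult_cancel_left) simp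
    then show ?thesis by (simp add: g_def set_lebesgue_integral_def)
  qed
  show "(LINT \<xi>:A|lborel. \<xi> / (\<xi> - z)) = measure lborel A" if z: "norm z < s1"
  proof -
    have "(LINT \<xi>:A|lborel. \<xi> / (\<xi> - z)) = (1::complex) * measure lborel A"
    proof (rule avg)
      fix \<xi> assume "\<xi> \<in> A"
      then have x: "norm z < norm \<xi>" "\<xi> \<noteq> 0" using z s by (auto simp: A_def)
      have "(\<integral>t. (\<lambda>_. 1::complex) (0 + of_real 1 * cis t) * (of_real 1 * cis t) / (0 + of_real 1 * cis t - z / \<xi>) \<partial>circle_measure) = 2 * pi * (\<lambda>_. 1::complex) (z / \<xi>)"
        by (rule Cauchy_integral_circle_measure) (use x in \<open>auto simp: norm_divide intro!: continuous_intros holomorphic_intros\<close>)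
      moreover have "cis t / (cis t - z / \<xi>) = cis t * \<xi> / (cis t * \<xi> - z)" for t
        using x(2) by (simp add: field_simps)
      ultimately show "(\<integral>t. cis t * \<xi> / (cis t * \<xi> - z) \<partial>circle_measure) = 2 * pi * (1::complex)" by simp
    qed
    then show ?thesis by simp
  qed
  show "(LINT \<xi>:A|lborel. \<xi> / (\<xi> - z)) = 0" if z: "norm z > s2"
  proof -
    have "(LINT \<xi>:A|lborel. \<xi> / (\<xi> - z)) = (0::complex) * measure lborel A"
    proof (rule avg)
      fix \<xi> assume "\<xi> \<in> A"
      then have x: "norm z > norm \<xi>" "\<xi> \<noteq> 0" using z s by (auto simp: A_def)
      have "(\<integral>t. (of_real 1 * cis t) / (0 + of_real 1 * cis t - z / \<xi>) \<partial>circle_measure) = 0"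
        by (rule Cauchy_integral_circle_measure_outside) (use x in \<open>auto simp: norm_divide\<close>)
      moreover have "cis t / (cis t - z / \<xi>) = cis t * \<xi> / (cis t * \<xi> - z)" for t
        using x(2) by (simp add: field_simps)
      ultimately show "(\<integral>t. cis t * \<xi> / (cis t * \<xi> - z) \<partial>circle_measure) = 2 * pi * (0::complex)" by simp
    qed
    then show ?thesis by simp
  qed
qed

text \<open>Vitushkin localization: with the radial kernel of the previous lemma, the Cauchy transform of \<open>f\<close>
  restricted to an annulus splits off the singularities of \<open>f\<close> inside the annulus from those outside.\<close>

lemma removable_of_null_set_NB:
  assumes \<Omega>: "open \<Omega>" "\<Omega> = ball z0 R - P" and s: "0 < s1" "s1 < s2" "s2 < R"
    and NB: "null_set_NB (Some ` (P \<inter> cball z0 s2))"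
    and f: "f holomorphic_on \<Omega>" "\<And>z. z \<in> \<Omega> \<Longrightarrow> norm (f z) \<le> B"
  shows "\<exists>h. h holomorphic_on ball z0 s1 \<and> (\<forall>z\<in>\<Omega> \<inter> ball z0 s1. h z = f z)"
proof -
  define A where "A = {\<zeta>. s1 < norm (\<zeta> - z0) \<and> norm (\<zeta> - z0) < s2}"
  define A0 where "A0 = {\<xi>::complex. s1 < norm \<xi> \<and> norm \<xi> < s2}"
  define m where "m = measure lborel A0"
  have oA: "open A" "open A0" unfolding A_def A0_def by (intro open_Collect_conj open_Collect_less continuous_intros)+
  have A: "A \<in> sets borel" "emeasure lborel A < \<infinity>"
  proof -
    show "A \<in> sets borel" using oA by simp
    have "A \<subseteq> ball z0 s2" by (auto simp: A_def dist_norm norm_minus_commute)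
    then show "emeasure lborel A < \<infinity>" using bounded_subset[OF bounded_ball] emeasure_bounded_finite by blast
  qed
  have m: "m > 0"
  proof -
    define p where "p = complex_of_real ((s1 + s2) / 2)"
    have "norm p = (s1 + s2) / 2" unfolding p_def norm_of_real using s by simp
    then have "p \<in> A0" using s by (simp add: A0_def)
    then obtain d where d: "d > 0" "ball p d \<subseteq> A0" using oA(2) openE by blast
    have "A0 \<subseteq> ball 0 s2" by (auto simp: A0_def)
    then have fin: "emeasure lborel A0 < \<infinity>" using bounded_subset[OF bounded_ball] emeasure_bounded_finite by blast
    have "emeasure lborel (ball p d) \<le> emeasure lborel A0"
      using d oA by (intro emeasure_mono) auto
    then have "pi * d\<^sup>2 \<le> m" using d fin
      by (simp add: measure_ball_complex m_def emeasure_eq_ennreal_measure emeasure_ball_complex ennreal_le_iff)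
    moreover have "0 < pi * d\<^sup>2" using d(1) by simp
    ultimately show ?thesis by linarith
  qed
  \<comment> \<open>Extension by 0 gives a bounded Borel function on the plane; no smallness of P is
    used in forming the transform.\<close>
  define f0 where "f0 = (\<lambda>\<zeta>. if \<zeta> \<in> \<Omega> then f \<zeta> else 0)"
  define B' where "B' = max B 0"
  have f0B: "norm (f0 \<zeta>) \<le> B'" for \<zeta> using f(2)[of \<zeta>] by (auto simp: f0_def B'_def le_max_iff_disj)
  have f0_meas [measurable]: "f0 \<in> borel_measurable borel"
  proof -
    have "continuous_on \<Omega> f" by (rule holomorphic_on_imp_continuous_on[OF f(1)])
    then have "(\<lambda>\<zeta>. indicat_real \<Omega> \<zeta> *\<^sub>R f \<zeta>) \<in> borel_measurable borel"
      using borel_measurable_continuous_on_indicator[of \<Omega> f] \<Omega>(1) by simp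
    moreover have "f0 = (\<lambda>\<zeta>. indicat_real \<Omega> \<zeta> *\<^sub>R f \<zeta>)" by (auto simp: f0_def)
    ultimately show ?thesis by simp
  qed
  define C where "C = (\<lambda>z. LINT \<zeta>:A|lborel. f0 \<zeta> * ((\<zeta> - z0) / (\<zeta> - z)))"
  define X where "X = (\<lambda>z. LINT \<zeta>:A|lborel. (\<zeta> - z0) / (\<zeta> - z))"
  have kbound: "norm (indicat_real A \<zeta> *\<^sub>R (u * ((\<zeta> - z0) / (\<zeta> - z)))) \<le> (b * s2) * norm (indicat_real A \<zeta> *\<^sub>R (1 / (\<zeta> - z)))"
    if "norm u \<le> b" for u b \<zeta> z
  proof (cases "\<zeta> \<in> A")
    case True
    then have "norm u * norm (\<zeta> - z0) \<le> b * s2" using that s by (intro mult_mono) (auto simp: A_def intro: order_trans[OF norm_ge_zero])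
    then show ?thesis using True by (simp add: norm_mult norm_divide divide_right_mono)
  qed simp
  have kint: "integrable lborel (\<lambda>\<zeta>. indicat_real A \<zeta> *\<^sub>R (u \<zeta> * ((\<zeta> - z0) / (\<zeta> - z))))"
    if "u \<in> borel_measurable borel" "\<And>\<zeta>. norm (u \<zeta>) \<le> b" for u b z
  proof (rule Bochner_Integration.integrable_bound)
    show "integrable lborel (\<lambda>\<zeta>. (b * s2) *\<^sub>R (indicat_real A \<zeta> *\<^sub>R (1 / (\<zeta> - z))))"
      using set_integrable_Cauchy_kernel[OF A, of z] unfolding set_integrable_def by (intro integrable_scaleR_right) auto
    show "(\<lambda>\<zeta>. indicat_real A \<zeta> *\<^sub>R (u \<zeta> * ((\<zeta> - z0) / (\<zeta> - z)))) \<in> borel_measurable lborel"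
      using that(1) A(1) by measurable
    show "AE \<zeta> in lborel. norm (indicat_real A \<zeta> *\<^sub>R (u \<zeta> * ((\<zeta> - z0) / (\<zeta> - z)))) \<le> norm ((b * s2) *\<^sub>R (indicat_real A \<zeta> *\<^sub>R (1 / (\<zeta> - z))))"
      unfolding norm_scaleR
      by (intro AE_I2 order_trans[OF kbound[OF that(2), unfolded norm_scaleR]] mult_right_mono[OF abs_ge_self]) simp
  qed
  have Cbound: "norm (LINT \<zeta>:A|lborel. u \<zeta> * ((\<zeta> - z0) / (\<zeta> - z))) \<le> (b * s2) * (4 * pi + measure lborel A)"
    if "u \<in> borel_measurable borel" "\<And>\<zeta>. norm (u \<zeta>) \<le> b" for u b z
  proof -
    have b: "b \<ge> 0" using that(2) norm_ge_zero order_trans by blast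
    have i: "integrable lborel (\<lambda>\<zeta>. indicat_real A \<zeta> *\<^sub>R (1 / (\<zeta> - z)))"
      using set_integrable_Cauchy_kernel[OF A, of z] unfolding set_integrable_def .
    have "ennreal (\<integral>\<zeta>. norm (indicat_real A \<zeta> *\<^sub>R (1 / (\<zeta> - z))) \<partial>lborel) = (\<integral>\<^sup>+\<zeta>\<in>A. ennreal (1 / norm (\<zeta> - z)) \<partial>lborel)"
      by (subst nn_integral_eq_integral[OF integrable_norm[OF i], symmetric])
         (auto intro!: nn_integral_cong simp: indicator_def norm_divide)
    also have "\<dots> \<le> ennreal (4 * pi + measure lborel A)" by (rule nn_integral_inverse_norm_le[OF A])
    finally have le: "(\<integral>\<zeta>. norm (indicat_real A \<zeta> *\<^sub>R (1 / (\<zeta> - z))) \<partial>lborel) \<le> 4 * pi + measure lborel A"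
      by (subst (asm) ennreal_le_iff) (auto intro: add_nonneg_nonneg)
    have "norm (LINT \<zeta>:A|lborel. u \<zeta> * ((\<zeta> - z0) / (\<zeta> - z))) \<le> (\<integral>\<zeta>. norm (indicat_real A \<zeta> *\<^sub>R (u \<zeta> * ((\<zeta> - z0) / (\<zeta> - z)))) \<partial>lborel)"
      unfolding set_lebesgue_integral_def by (rule integral_norm_bound)
    also have "\<dots> \<le> (\<integral>\<zeta>. (b * s2) * norm (indicat_real A \<zeta> *\<^sub>R (1 / (\<zeta> - z))) \<partial>lborel)"
      using kint[OF that] i kbound[OF that(2)] by (intro integral_mono integrable_norm integrable_mult_right) auto
    also have "\<dots> = (b * s2) * (\<integral>\<zeta>. norm (indicat_real A \<zeta> *\<^sub>R (1 / (\<zeta> - z))) \<partial>lborel)" by simp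
    also have "\<dots> \<le> (b * s2) * (4 * pi + measure lborel A)" using le b s by (intro mult_left_mono) auto
    finally show ?thesis .
  qed
  have f0m: "f0 \<in> borel_measurable borel" by (rule f0_meas)
  define M where "M = (B' * s2) * (4 * pi + measure lborel A)"
  have CM: "norm (C z) \<le> M" for z using Cbound[OF f0m f0B] by (simp add: C_def M_def)
  have XM: "norm (X z) \<le> (1 * s2) * (4 * pi + measure lborel A)" for z
    using Cbound[of "\<lambda>_. 1" 1 z] by (simp add: X_def)
  have Xtr: "X z = (LINT \<xi>:A0|lborel. \<xi> / (\<xi> - (z - z0)))" for z
  proof -
    have "(\<integral>\<xi>. indicat_real A (z0 + \<xi>) *\<^sub>R ((z0 + \<xi> - z0) / (z0 + \<xi> - z)) \<partial>lborel) = X z"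
      unfolding X_def set_lebesgue_integral_def
      by (rule integral_lborel_translation)
         (intro borel_measurable_scaleR borel_measurable_indicator borel_measurable_divide borel_measurable_diff; simp add: A(1))
    moreover have "indicat_real A (z0 + \<xi>) = indicat_real A0 \<xi>" for \<xi> by (simp add: A_def A0_def indicator_def)
    moreover have "z0 + \<xi> - z = \<xi> - (z - z0)" for \<xi> by simp
    ultimately show ?thesis by (simp add: set_lebesgue_integral_def)
  qed
  have Xin: "X z = m" if "norm (z - z0) < s1" for z
    using integral_annulus_kernel(1)[OF s(1,2) that] by (simp add: Xtr A0_def m_def)
  have Xout: "X z = 0" if "norm (z - z0) > s2" for z
    using integral_annulus_kernel(2)[OF s(1,2) that] by (simp add: Xtr A0_def)
  have Chol: "C holomorphic_on S" if S: "open S" "S \<inter> {\<zeta>. s1 \<le> norm (\<zeta> - z0) \<and> norm (\<zeta> - z0) \<le> s2} = {}" for S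
    unfolding C_def set_lebesgue_integral_def
  proof (rule holomorphic_on_integral_parameter[OF S(1)])
    fix z assume z: "z \<in> S"
    show "(\<lambda>\<zeta>. indicat_real A \<zeta> *\<^sub>R (f0 \<zeta> * ((\<zeta> - z0) / (\<zeta> - z)))) \<in> borel_measurable lborel"
      using kint[OF f0m f0B] by (rule borel_measurable_integrable)
    obtain d where d: "d > 0" "ball z d \<subseteq> S" using z S(1) openE by blast
    show "\<exists>r>0. \<exists>g. integrable lborel g \<and> ball z r \<subseteq> S \<and>
        (\<forall>w\<in>ball z r. \<forall>\<zeta>\<in>space lborel. norm (indicat_real A \<zeta> *\<^sub>R (f0 \<zeta> * ((\<zeta> - z0) / (\<zeta> - w)))) \<le> g \<zeta>)"
    proof (intro exI conjI ballI)
      show "integrable lborel (\<lambda>\<zeta>. (B' * s2 * (2 / d)) * indicat_real A \<zeta>)" using A by simp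
      fix w \<zeta> assume w: "w \<in> ball z (d/2)"
      show "norm (indicat_real A \<zeta> *\<^sub>R (f0 \<zeta> * ((\<zeta> - z0) / (\<zeta> - w)))) \<le> (B' * s2 * (2 / d)) * indicat_real A \<zeta>"
      proof (cases "\<zeta> \<in> A")
        case True
        then have "\<zeta> \<notin> S" using S(2) by (auto simp: A_def)
        then have "\<zeta> \<notin> ball z d" using d(2) by blast
        then have "d / 2 \<le> norm (\<zeta> - w)"
          using w norm_triangle_ineq[of "\<zeta> - w" "w - z"] by (auto simp: dist_norm norm_minus_commute)
        moreover from this d(1) have "0 < norm (\<zeta> - w)" by linarith
        ultimately have "1 / norm (\<zeta> - w) \<le> 1 / (d / 2)" using d(1) by (intro divide_left_mono mult_pos_pos) auto
        then have "1 / norm (\<zeta> - w) \<le> 2 / d" by simp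
        moreover have "B' \<ge> 0" by (simp add: B'_def)
        ultimately have "(B' * s2) * (1 / norm (\<zeta> - w)) \<le> (B' * s2) * (2 / d)" using s by (intro mult_left_mono) auto
        then show ?thesis using kbound[OF f0B, of \<zeta> \<zeta> w] True by (auto simp: norm_divide)
      qed simp
    qed (use d in auto)
  next
    fix \<zeta>
    show "(\<lambda>z. indicat_real A \<zeta> *\<^sub>R (f0 \<zeta> * ((\<zeta> - z0) / (\<zeta> - z)))) holomorphic_on S"
      using S(2) by (cases "\<zeta> \<in> A") (auto simp: A_def intro!: holomorphic_intros)
  qed
  \<comment> \<open>In the inner disc \<open>X = m\<close>, and C is holomorphic, so F is C minus a
    multiple of f; beyond the annulus \<open>X = 0\<close> and \<open>F = C\<close>. In the annulus
    the singularities of the two terms cancel at points of \<Omega>. So F is holomorphic off the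
    compact piece K of P, and the null set property applies to it.\<close>
  define F where "F = (\<lambda>z. C z - f0 z * X z)"
  have F\<Omega>: "F holomorphic_on \<Omega>"
  proof -
    \<comment> \<open>F is the integral of \<open>(\<zeta> - z0) * dq \<zeta> z\<close>, with a
      difference quotient in place of the singular kernel. Its value at \<open>z = \<zeta>\<close>
      is filled in by the derivative, which makes it holomorphic in z for every \<zeta>.\<close>
    define dq where "dq = (\<lambda>\<zeta> z. if z = \<zeta> then deriv f \<zeta> else (f z - f0 \<zeta>) / (z - \<zeta>))"
    have dq_hol: "(\<lambda>z. dq \<zeta> z) holomorphic_on \<Omega>" for \<zeta>
    proof (cases "\<zeta> \<in> \<Omega>")
      case True
      show ?thesis
        by (rule holomorphic_transform[OF pole_lemma_open[OF f(1) \<Omega>(1), of \<zeta>]]) (use True in \<open>simp add: dq_def f0_def\<close>)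
    next
      case False
      have "(\<lambda>z. (f z - f0 \<zeta>) / (z - \<zeta>)) holomorphic_on \<Omega>" using False by (intro holomorphic_intros f(1)) auto
      then show ?thesis by (rule holomorphic_transform) (use False in \<open>auto simp: dq_def\<close>)
    qed
    have dq_meas: "(\<lambda>\<zeta>. dq \<zeta> z) \<in> borel_measurable borel" for z
    proof -
      have "(\<lambda>\<zeta>. if \<zeta> \<in> {z} then deriv f z else (f z - f0 \<zeta>) / (z - \<zeta>)) \<in> borel_measurable borel"
        by (intro measurable_If_set) (use f0m in \<open>auto intro: borel_measurable_divide borel_measurable_diff\<close>)
      moreover have "(\<lambda>\<zeta>. dq \<zeta> z) = (\<lambda>\<zeta>. if \<zeta> \<in> {z} then deriv f z else (f z - f0 \<zeta>) / (z - \<zeta>))"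
        by (auto simp: dq_def fun_eq_iff)
      ultimately show ?thesis by simp
    qed
    have "(\<lambda>z. \<integral>\<zeta>. indicat_real A \<zeta> *\<^sub>R ((\<zeta> - z0) * dq \<zeta> z) \<partial>lborel) holomorphic_on \<Omega>"
    proof (rule holomorphic_on_integral_parameter[OF \<Omega>(1)])
      fix z assume z: "z \<in> \<Omega>"
      show "(\<lambda>\<zeta>. indicat_real A \<zeta> *\<^sub>R ((\<zeta> - z0) * dq \<zeta> z)) \<in> borel_measurable lborel"
        using dq_meas[of z] A(1) by measurable
      obtain d where d: "d > 0" "cball z d \<subseteq> \<Omega>" using z \<Omega>(1) open_contains_cball by blast
      have "continuous_on (cball z d) (deriv f)"
        using holomorphic_deriv[OF f(1) \<Omega>(1)] d(2) holomorphic_on_imp_continuous_on holomorphic_on_subset by blast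
      then have "bounded (deriv f ` cball z d)" by (intro compact_imp_bounded compact_continuous_image) auto
      then obtain L where L: "\<And>w. w \<in> cball z d \<Longrightarrow> norm (deriv f w) \<le> L" unfolding bounded_iff by blast
      \<comment> \<open>L bounds the quotient for \<zeta> within d of z, by the mean value
        inequality; otherwise the numerator is at most \<open>2 * B'\<close> and the denominator at
        least \<open>d / 2\<close>.\<close>
      define G where "G = max L (4 * B' / d)"
      have G: "norm (dq \<zeta> w) \<le> G" if w: "w \<in> ball z (d/2)" for w \<zeta>
      proof (cases "\<zeta> \<in> ball z d")
        case True
        have wd: "w \<in> ball z d" using w d(1) by auto
        have \<zeta>\<Omega>: "\<zeta> \<in> \<Omega>" using True d by auto
        have "norm (f w - f \<zeta>) \<le> L * norm (w - \<zeta>)"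
        proof (rule field_differentiable_bound[where S = "ball z d"])
          show "(f has_field_derivative deriv f u) (at u within ball z d)" if "u \<in> ball z d" for u
            using f(1) \<Omega>(1) d that by (meson ball_subset_cball has_field_derivative_at_within holomorphic_derivI subsetD)
          show "norm (deriv f u) \<le> L" if "u \<in> ball z d" for u using L[of u] that by auto
        qed (use True wd in auto)
        then have "norm (dq \<zeta> w) \<le> L"
          using L[of \<zeta>] True \<zeta>\<Omega> by (auto simp: dq_def f0_def norm_divide pos_divide_le_eq)
        then show ?thesis by (simp add: G_def)
      next
        case False
        then have dist: "d / 2 \<le> norm (w - \<zeta>)"
          using w norm_triangle_ineq[of "z - w" "w - \<zeta>"] by (auto simp: dist_norm)
        have w\<Omega>: "w \<in> \<Omega>" using w d by (auto simp: subset_iff)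
        have "norm (f w - f0 \<zeta>) \<le> norm (f0 w) + norm (f0 \<zeta>)" using w\<Omega> norm_triangle_ineq4[of "f w" "f0 \<zeta>"] by (simp add: f0_def)
        also have "\<dots> \<le> B' + B'" by (intro add_mono f0B)
        finally have "norm (f w - f0 \<zeta>) / norm (w - \<zeta>) \<le> (B' + B') / (d / 2)"
          using dist d(1) by (intro frac_le) (auto simp: B'_def)
        moreover have "w \<noteq> \<zeta>" using dist d(1) by auto
        ultimately show ?thesis by (simp add: dq_def norm_divide G_def)
      qed
      show "\<exists>r>0. \<exists>g. integrable lborel g \<and> ball z r \<subseteq> \<Omega> \<and>
          (\<forall>w\<in>ball z r. \<forall>\<zeta>\<in>space lborel. norm (indicat_real A \<zeta> *\<^sub>R ((\<zeta> - z0) * dq \<zeta> w)) \<le> g \<zeta>)"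
      proof (intro exI conjI ballI)
        show "integrable lborel (\<lambda>\<zeta>. (s2 * G) * indicat_real A \<zeta>)" using A by simp
        fix w \<zeta> assume w: "w \<in> ball z (d/2)"
        show "norm (indicat_real A \<zeta> *\<^sub>R ((\<zeta> - z0) * dq \<zeta> w)) \<le> (s2 * G) * indicat_real A \<zeta>"
          using G[OF w, of \<zeta>] s by (auto simp: indicator_def A_def norm_mult intro!: mult_mono)
      qed (use d in \<open>auto simp: subset_iff\<close>)
    next
      fix \<zeta>
      show "(\<lambda>z. indicat_real A \<zeta> *\<^sub>R ((\<zeta> - z0) * dq \<zeta> z)) holomorphic_on \<Omega>"
        unfolding scaleR_conv_of_real by (intro holomorphic_intros dq_hol)
    qed
    then show ?thesis
    proof (rule holomorphic_transform)
      fix z assume z: "z \<in> \<Omega>"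
      have i1: "integrable lborel (\<lambda>\<zeta>. indicat_real A \<zeta> *\<^sub>R (f0 \<zeta> * ((\<zeta> - z0) / (\<zeta> - z))))" by (rule kint[OF f0m f0B])
      have i2: "integrable lborel (\<lambda>\<zeta>. indicat_real A \<zeta> *\<^sub>R ((\<zeta> - z0) / (\<zeta> - z)))" using kint[of "\<lambda>_. 1" 1 z] by simp
      have "F z = (\<integral>\<zeta>. indicat_real A \<zeta> *\<^sub>R (f0 \<zeta> * ((\<zeta> - z0) / (\<zeta> - z))) - f0 z * (indicat_real A \<zeta> *\<^sub>R ((\<zeta> - z0) / (\<zeta> - z))) \<partial>lborel)"
        by (subst Bochner_Integration.integral_diff[OF i1 integrable_mult_right[OF i2]])
           (simp only: F_def C_def X_def set_lebesgue_integral_def integral_mult_right_zero)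
      also have "\<dots> = (\<integral>\<zeta>. indicat_real A \<zeta> *\<^sub>R ((\<zeta> - z0) * dq \<zeta> z) \<partial>lborel)"
      proof (rule integral_cong_AE)
        show "(\<lambda>\<zeta>. indicat_real A \<zeta> *\<^sub>R (f0 \<zeta> * ((\<zeta> - z0) / (\<zeta> - z))) - f0 z * (indicat_real A \<zeta> *\<^sub>R ((\<zeta> - z0) / (\<zeta> - z)))) \<in> borel_measurable lborel"
          using i1 i2 by (intro borel_measurable_diff borel_measurable_times borel_measurable_const borel_measurable_integrable)
        show "(\<lambda>\<zeta>. indicat_real A \<zeta> *\<^sub>R ((\<zeta> - z0) * dq \<zeta> z)) \<in> borel_measurable lborel"
          using dq_meas[of z] A(1) by measurable
        have "AE \<zeta> in lborel. \<zeta> \<noteq> z" by (rule AE_lborel_singleton)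
        then show "AE \<zeta> in lborel. indicat_real A \<zeta> *\<^sub>R (f0 \<zeta> * ((\<zeta> - z0) / (\<zeta> - z))) - f0 z * (indicat_real A \<zeta> *\<^sub>R ((\<zeta> - z0) / (\<zeta> - z)))
            = indicat_real A \<zeta> *\<^sub>R ((\<zeta> - z0) * dq \<zeta> z)"
        proof (rule eventually_mono)
          fix \<zeta> assume ne: "\<zeta> \<noteq> z"
          have "f0 \<zeta> * ((\<zeta> - z0) / (\<zeta> - z)) - f0 z * ((\<zeta> - z0) / (\<zeta> - z)) = (\<zeta> - z0) * ((f0 z - f0 \<zeta>) / (z - \<zeta>))"
            using ne by (simp add: divide_simps) (simp add: algebra_simps)
          then show "indicat_real A \<zeta> *\<^sub>R (f0 \<zeta> * ((\<zeta> - z0) / (\<zeta> - z))) - f0 z * (indicat_real A \<zeta> *\<^sub>R ((\<zeta> - z0) / (\<zeta> - z)))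
            = indicat_real A \<zeta> *\<^sub>R ((\<zeta> - z0) * dq \<zeta> z)"
            using ne z by (cases "\<zeta> \<in> A") (auto simp: dq_def f0_def)
        qed
      qed
      finally show "(\<integral>\<zeta>. indicat_real A \<zeta> *\<^sub>R ((\<zeta> - z0) * dq \<zeta> z) \<partial>lborel) = F z" by simp
    qed
  qed
  define K where "K = P \<inter> cball z0 s2"
  have eqK: "{z. Some z \<notin> Some ` K} = - K" by auto
  have Fhol: "F holomorphic_on (- K)"
  proof -
    have "F holomorphic_on (- cball z0 s2)"
    proof (rule holomorphic_transform[OF Chol])
      show "C z = F z" if "z \<in> - cball z0 s2" for z
        using Xout[of z] that by (simp add: F_def dist_norm norm_minus_commute)
    qed (auto simp: dist_norm norm_minus_commute)
    then have "F holomorphic_on (\<Omega> \<union> - cball z0 s2)" using F\<Omega> \<Omega>(1) by (intro holomorphic_on_Un) auto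
    moreover have "- K \<subseteq> \<Omega> \<union> - cball z0 s2" using s by (auto simp: K_def \<Omega>(2))
    ultimately show ?thesis by (rule holomorphic_on_subset)
  qed
  have "F constant_on (- K)"
    unfolding eqK[symmetric]
  proof (rule null_set_NB_imp_constant)
    show "null_set_NB (Some ` K)" using NB by (simp add: K_def)
    show "F holomorphic_on {z. Some z \<notin> Some ` K}" using Fhol by (simp add: eqK)
    show "bounded (F ` {z. Some z \<notin> Some ` K})"
    proof (rule boundedI)
      fix y assume "y \<in> F ` {z. Some z \<notin> Some ` K}"
      then obtain z where y: "y = F z" by blast
      have "norm (F z) \<le> norm (C z) + norm (f0 z) * norm (X z)"
        unfolding F_def norm_mult[symmetric] by (rule norm_triangle_ineq4)
      also have "\<dots> \<le> M + B' * ((1 * s2) * (4 * pi + measure lborel A))"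
        by (intro add_mono mult_mono CM XM f0B) (auto simp: B'_def)
      finally show "norm y \<le> M + B' * ((1 * s2) * (4 * pi + measure lborel A))" by (simp add: y)
    qed
  qed
  then obtain c where c: "\<And>z. z \<in> - K \<Longrightarrow> F z = c" unfolding constant_on_def by blast
  have c0: "c = 0"
  proof (rule ccontr)
    assume "c \<noteq> 0"
    define N where "N = B' * s2 * measure lborel A"
    have N: "N \<ge> 0" using s by (simp add: N_def B'_def)
    \<comment> \<open>The transform decays at infinity: at distance t beyond the annulus it is at
      most \<open>N / t\<close>, and this t makes that value smaller than
      \<open>norm c\<close>.\<close>
    define t where "t = (N + 1) / norm c"
    have t: "t > 0" using N \<open>c \<noteq> 0\<close> by (simp add: t_def)
    define z where "z = z0 + of_real (s2 + t)"
    have nz: "norm (z - z0) = s2 + t" using t s by (simp add: z_def norm_of_real del: of_real_add)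
    have "z \<in> - K" using nz t by (auto simp: K_def dist_norm norm_minus_commute)
    then have "c = C z" using c[of z] Xout[of z] nz t by (simp add: F_def)
    then have "norm c = norm (\<integral>\<zeta>. indicat_real A \<zeta> *\<^sub>R (f0 \<zeta> * ((\<zeta> - z0) / (\<zeta> - z))) \<partial>lborel)"
      by (simp add: C_def set_lebesgue_integral_def)
    also have "\<dots> \<le> (\<integral>\<zeta>. norm (indicat_real A \<zeta> *\<^sub>R (f0 \<zeta> * ((\<zeta> - z0) / (\<zeta> - z)))) \<partial>lborel)"
      by (rule integral_norm_bound)
    also have "\<dots> \<le> (\<integral>\<zeta>. (B' * s2 * (1 / t)) * indicat_real A \<zeta> \<partial>lborel)"
    proof (rule integral_mono)
      show "integrable lborel (\<lambda>\<zeta>. norm (indicat_real A \<zeta> *\<^sub>R (f0 \<zeta> * ((\<zeta> - z0) / (\<zeta> - z)))))"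
        by (rule integrable_norm[OF kint[OF f0m f0B]])
      show "integrable lborel (\<lambda>\<zeta>. (B' * s2 * (1 / t)) * indicat_real A \<zeta>)" using A by simp
      fix \<zeta>
      show "norm (indicat_real A \<zeta> *\<^sub>R (f0 \<zeta> * ((\<zeta> - z0) / (\<zeta> - z)))) \<le> (B' * s2 * (1 / t)) * indicat_real A \<zeta>"
      proof (cases "\<zeta> \<in> A")
        case True
        then have "t \<le> norm (\<zeta> - z)"
          using nz norm_triangle_ineq[of "z - \<zeta>" "\<zeta> - z0"] by (simp add: A_def norm_minus_commute)
        then have "1 / norm (\<zeta> - z) \<le> 1 / t" using t by (intro divide_left_mono mult_pos_pos) auto
        then have "(B' * s2) * (1 / norm (\<zeta> - z)) \<le> (B' * s2) * (1 / t)"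
          using s by (intro mult_left_mono) (auto simp: B'_def)
        then show ?thesis using kbound[OF f0B, of \<zeta> \<zeta> z] True by (auto simp: norm_divide)
      qed simp
    qed
    also have "\<dots> = N / t" using A by (simp add: N_def)
    also have "\<dots> = N * norm c / (N + 1)" by (simp add: t_def)
    finally have "norm c * (N + 1) \<le> N * norm c" using N by (simp add: pos_le_divide_eq)
    then show False using \<open>c \<noteq> 0\<close> by (simp add: algebra_simps)
  qed
  \<comment> \<open>F vanishes, so in the inner disc C equals \<open>m * f\<close> on \<Omega>; and
    C is holomorphic on the whole inner disc.\<close>
  define h where "h = (\<lambda>z. C z / m)"
  show ?thesis
  proof (intro exI conjI ballI)
    show "h holomorphic_on ball z0 s1"
      unfolding h_def using m by (intro holomorphic_intros Chol) (auto simp: dist_norm norm_minus_commute)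
    fix z assume z: "z \<in> \<Omega> \<inter> ball z0 s1"
    then have "F z = 0" using c[of z] c0 by (auto simp: K_def \<Omega>(2))
    then have "C z = f z * m" using z Xin[of z] by (simp add: F_def f0_def dist_norm norm_minus_commute)
    then show "h z = f z" using m by (simp add: h_def)
  qed
qed

section \<open>Subharmonic functions and the Poisson integral\<close>

lemma continuous_on_circle [continuous_intros]: "continuous_on T (\<lambda>t. a + complex_of_real r * cis t)"
  by (intro continuous_intros)

lemma set_nn_integral_circle_measure:
  "(\<integral>\<^sup>+t\<in>{0..2 * pi}. f t \<partial>lborel) = (\<integral>\<^sup>+t. f t \<partial>circle_measure)"
  by (simp add: circle_measure_def nn_integral_restrict_space)

text \<open>For a function that is finite and integrable on the circle, the difference of extended
  integrals in \<open>circle_mean\<close> is an honest real integral; all later submean estimates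
  are made there.\<close>

lemma circle_mean_eq_integral:
  fixes v :: "complex \<Rightarrow> real"
  assumes int: "integrable circle_measure (\<lambda>t. v (a + r * cis t))"
    and eq: "\<And>t. t \<in> {0..2 * pi} \<Longrightarrow> u (a + r * cis t) = ereal (v (a + r * cis t))"
  shows "circle_mean u a r = ereal ((\<integral>t. v (a + r * cis t) \<partial>circle_measure) / (2 * pi))"
proof -
  let ?v = "\<lambda>t. v (a + r * cis t)"
  have p: "(\<integral>\<^sup>+t\<in>{0..2 * pi}. e2ennreal (u (a + of_real r * cis t)) \<partial>lborel) = (\<integral>\<^sup>+t. ennreal (?v t) \<partial>circle_measure)"
    unfolding set_nn_integral_circle_measure
    by (intro nn_integral_cong) (auto simp: eq ennreal_def)
  have n: "(\<integral>\<^sup>+t\<in>{0..2 * pi}. e2ennreal (- u (a + of_real r * cis t)) \<partial>lborel) = (\<integral>\<^sup>+t. ennreal (- ?v t) \<partial>circle_measure)"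
    unfolding set_nn_integral_circle_measure
    by (intro nn_integral_cong) (auto simp: eq ennreal_def)
  have fin: "(\<integral>\<^sup>+t. ennreal (?v t) \<partial>circle_measure) < \<infinity>" "(\<integral>\<^sup>+t. ennreal (- ?v t) \<partial>circle_measure) < \<infinity>"
    using int unfolding real_integrable_def by (auto simp: less_top)
  have 1: "enn2ereal X = ereal (enn2real X)" if "X < \<infinity>" for X
    using that by (cases X) auto
  have "enn2ereal (\<integral>\<^sup>+t. ennreal (?v t) \<partial>circle_measure) - enn2ereal (\<integral>\<^sup>+t. ennreal (- ?v t) \<partial>circle_measure) = ereal (\<integral>t. ?v t \<partial>circle_measure)"
    unfolding 1[OF fin(1)] 1[OF fin(2)] real_lebesgue_integral_def[OF int] by simp
  then show ?thesis unfolding circle_mean_def p n by simp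
qed

lemma circle_mean_mono:
  assumes "\<And>t. u (a + of_real r * cis t) \<le> v (a + of_real r * cis t)"
  shows "circle_mean u a r \<le> circle_mean v a r"
  unfolding circle_mean_def
proof (rule ereal_divide_right_mono)
  show "enn2ereal (\<integral>\<^sup>+t\<in>{0..2 * pi}. e2ennreal (u (a + of_real r * cis t)) \<partial>lborel) -
        enn2ereal (\<integral>\<^sup>+t\<in>{0..2 * pi}. e2ennreal (- u (a + of_real r * cis t)) \<partial>lborel)
      \<le> enn2ereal (\<integral>\<^sup>+t\<in>{0..2 * pi}. e2ennreal (v (a + of_real r * cis t)) \<partial>lborel) -
        enn2ereal (\<integral>\<^sup>+t\<in>{0..2 * pi}. e2ennreal (- v (a + of_real r * cis t)) \<partial>lborel)"
    using assms
    by (intro ereal_minus_mono) (auto simp flip: less_eq_ennreal.rep_eq intro!: nn_integral_mono mult_right_mono e2ennreal_mono)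
qed simp

text \<open>When b lies outside the closed disc, \<open>(z - b) / (a - b)\<close> stays in the right
  half-plane, so the principal branch of the logarithm is holomorphic and its real part has the mean
  value property.\<close>

lemma integral_ln_norm_circle:
  assumes "0 < r" "r < norm (a - b)"
  shows "integrable circle_measure (\<lambda>t. ln (norm (a + of_real r * cis t - b)))"
    and "(\<integral>t. ln (norm (a + of_real r * cis t - b)) \<partial>circle_measure) = 2 * pi * ln (norm (a - b))"
proof -
  define F where "F = (\<lambda>z. Ln ((z - b) / (a - b)))"
  have ne: "a \<noteq> b" using assms by auto
  have Re_pos: "Re ((z - b) / (a - b)) > 0" if "z \<in> cball a r" for z
  proof -
    have "(z - b) / (a - b) = 1 - (a - z) / (a - b)" using ne by (simp add: field_simps)
    moreover have "norm ((a - z) / (a - b)) < 1"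
      using that assms by (auto simp: norm_divide dist_norm divide_less_eq)
    ultimately show ?thesis
      using complex_Re_le_cmod[of "(a - z) / (a - b)"] by simp
  qed
  then have pos: "(z - b) / (a - b) \<notin> \<real>\<^sub>\<le>\<^sub>0" "z \<noteq> b" if "z \<in> cball a r" for z
    using that by (force simp: complex_nonpos_Reals_iff)+
  have c: "continuous_on (cball a r) F" unfolding F_def using pos ne by (intro continuous_intros) auto
  have h: "F holomorphic_on ball a r" unfolding F_def using pos ne by (intro holomorphic_intros) auto
  have on: "a + of_real r * cis t \<in> cball a r" for t using assms(1) by (simp add: dist_norm norm_mult)
  have cF: "continuous_on {0..2 * pi} (\<lambda>t. F (a + of_real r * cis t))"
    by (rule continuous_on_compose2[OF c continuous_on_circle]) (use on in auto)
  have iF: "integrable circle_measure (\<lambda>t. F (a + of_real r * cis t))"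
    by (rule continuous_imp_integrable_circle_measure(1)[OF cF])
  have RF: "Re (F z) = ln (norm (z - b)) - ln (norm (a - b))" if "z \<in> cball a r" for z
    using pos[OF that] ne by (simp add: F_def Re_Ln norm_divide ln_div)
  have "(\<integral>t. F (a + of_real r * cis t) \<partial>circle_measure) = 0"
    using mean_value_circle_measure[OF c h assms(1)] ne by (simp add: F_def)
  then have z: "(\<integral>t. Re (F (a + of_real r * cis t)) \<partial>circle_measure) = 0"
    using integral_Re[OF iF] by simp
  have i2: "integrable circle_measure (\<lambda>t. ln (norm (a + of_real r * cis t - b)) - ln (norm (a - b)))"
    using integrable_Re[OF iF] by (simp add: RF[OF on])
  from Bochner_Integration.integrable_add[OF i2, of "\<lambda>_. ln (norm (a - b))"]
  show i: "integrable circle_measure (\<lambda>t. ln (norm (a + of_real r * cis t - b)))" by simp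
  show "(\<integral>t. ln (norm (a + of_real r * cis t - b)) \<partial>circle_measure) = 2 * pi * ln (norm (a - b))"
    using z i by (simp add: RF[OF on])
qed

text \<open>The excess \<open>r\<^sup>2\<close> of the mean over the value at the centre supplies
  the strictness that rules out a maximum in \<open>subharmonic_le_poisson\<close>.\<close>

lemma integral_norm_square_circle:
  "integrable circle_measure (\<lambda>t. (norm (d + of_real r * cis t))\<^sup>2)"
  "(\<integral>t. (norm (d + of_real r * cis t))\<^sup>2 \<partial>circle_measure) = 2 * pi * ((norm d)\<^sup>2 + r\<^sup>2)"
proof -
  show i: "integrable circle_measure (\<lambda>t. (norm (d + of_real r * cis t))\<^sup>2)"
    by (intro continuous_imp_integrable_circle_measure(1) continuous_intros)
  have ic: "integrable circle_measure (\<lambda>t. cnj d * cis t)"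
    by (intro continuous_imp_integrable_circle_measure(1) continuous_intros)
  have "(\<integral>t. (\<lambda>u. cnj d * u) (0 + of_real 1 * cis t) \<partial>circle_measure) = 2 * pi * (\<lambda>u. cnj d * u) 0"
    by (rule mean_value_circle_measure) (auto intro!: continuous_intros holomorphic_intros)
  then have X0: "(\<integral>t. cnj d * cis t \<partial>circle_measure) = 0" by simp
  have 0: "(\<integral>t. Re (cnj d * cis t) \<partial>circle_measure) = 0"
    using integral_Re[OF ic] unfolding X0 by (simp only: zero_complex.sel)
  have "(norm (d + of_real r * cis t))\<^sup>2 = ((norm d)\<^sup>2 + r\<^sup>2) + 2 * r * Re (cnj d * cis t)" for t
  proof -
    have "(norm (d + of_real r * w))\<^sup>2 = (norm d)\<^sup>2 + r\<^sup>2 * (norm w)\<^sup>2 + 2 * r * Re (cnj d * w)" for w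
      unfolding cmod_power2 by (simp add: power2_eq_square algebra_simps)
    from this[of "cis t"] show ?thesis by simp
  qed
  then have "(\<integral>t. (norm (d + of_real r * cis t))\<^sup>2 \<partial>circle_measure) =
      (\<integral>t. ((norm d)\<^sup>2 + r\<^sup>2) + 2 * r * Re (cnj d * cis t) \<partial>circle_measure)" by simp
  also have "\<dots> = (\<integral>t. ((norm d)\<^sup>2 + r\<^sup>2) \<partial>circle_measure) + 2 * r * (\<integral>t. Re (cnj d * cis t) \<partial>circle_measure)"
    using integrable_Re[OF ic] by (subst Bochner_Integration.integral_add) auto
  finally show "(\<integral>t. (norm (d + of_real r * cis t))\<^sup>2 \<partial>circle_measure) = 2 * pi * ((norm d)\<^sup>2 + r\<^sup>2)"
    unfolding 0 by simp
qed

section \<open>Maximum principle\<close>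

text \<open>Submean inequalities enter only through \<open>sub\<close>, which says that no point of
  G is a maximum. If \<open>D z1\<close> exceeded m, upper semicontinuity and the boundary condition
  would make \<open>{z \<in> G. D z1 \<le> D z}\<close> compact, and a maximum would exist.\<close>

lemma usc_maximum_principle:
  fixes D :: "complex \<Rightarrow> real"
  assumes G: "open G" "bounded G"
    and usc: "\<And>c. open {z \<in> G. D z < c}"
    and bdry: "\<And>x c. x \<in> frontier G \<Longrightarrow> m < c \<Longrightarrow> \<forall>\<^sub>F z in at x within G. D z < c"
    and sub: "\<And>a. a \<in> G \<Longrightarrow> \<exists>S\<subseteq>G. \<exists>z\<in>S. D a < D z"
    and z1: "z1 \<in> G"
  shows "D z1 \<le> m"
proof (rule ccontr)
  assume "\<not> D z1 \<le> m"
  then have s: "m < D z1" by simp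
  define T where "T = {z \<in> G. D z1 \<le> D z}"
  have "closed T"
    unfolding closed_def
  proof (rule Topological_Spaces.openI)
    fix x assume x: "x \<in> - T"
    consider "x \<in> G" | "x \<in> frontier G" "x \<notin> G" | "x \<notin> closure G"
      using G(1) by (auto simp: frontier_def interior_open)
    then show "\<exists>U. open U \<and> x \<in> U \<and> U \<subseteq> - T"
    proof cases
      case 1
      then show ?thesis using usc[of "D z1"] x by (intro exI[of _ "{z \<in> G. D z < D z1}"]) (auto simp: T_def)
    next
      case 2
      obtain U where "open U" "x \<in> U" "\<And>z. z \<in> U \<Longrightarrow> z \<noteq> x \<Longrightarrow> z \<in> G \<Longrightarrow> D z < D z1"
        using bdry[OF 2(1) s] unfolding eventually_at_topological by blast
      then show ?thesis using 2 by (intro exI[of _ U]) (auto simp: T_def, fastforce)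
    next
      case 3
      then show ?thesis using closure_subset[of G] by (intro exI[of _ "- closure G"]) (auto simp: T_def)
    qed
  qed
  moreover have "bounded T" using G(2) by (rule bounded_subset) (auto simp: T_def)
  ultimately have cT: "compact T" by (simp add: compact_eq_bounded_closed)
  \<comment> \<open>Without a maximum, the open sets \<open>{z \<in> G. D z < D y}\<close> would
    cover T; a finite subcover fails at its largest \<open>D y\<close>.\<close>
  have "\<exists>x\<in>T. \<forall>y\<in>T. D y \<le> D x"
  proof (rule ccontr)
    assume no: "\<not> ?thesis"
    have cov: "T \<subseteq> (\<Union>y\<in>T. {z \<in> G. D z < D y})"
      using no by (auto simp: T_def not_le)
    obtain F where F: "F \<subseteq> T" "finite F" "T \<subseteq> (\<Union>y\<in>F. {z \<in> G. D z < D y})"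
      using compactE_image[OF cT _ cov] usc by blast
    have "F \<noteq> {}" using F(3) z1 by (auto simp: T_def)
    then have "Max (D ` F) \<in> D ` F" using F(2) by (intro Max_in) auto
    then obtain y where y: "y \<in> F" "D y = Max (D ` F)" by auto
    then obtain y' where y': "y' \<in> F" "D y < D y'" using F by blast
    then have "D y' \<le> Max (D ` F)" using F(2) by (intro Max_ge) auto
    then show False using y(2) y'(2) by simp
  qed
  then obtain x where x: "x \<in> T" "\<And>y. y \<in> T \<Longrightarrow> D y \<le> D x" by blast
  have max: "D z \<le> D x" if "z \<in> G" for z
    using x that by (cases "z \<in> T") (force simp: T_def)+
  obtain S z where "S \<subseteq> G" "z \<in> S" "D x < D z" using sub[of x] x(1) by (auto simp: T_def)
  then show False using max[of z] by auto
qed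

section \<open>The Poisson integral in a disc\<close>

text \<open>The kernel is written as the real part of the Herglotz kernel, so that the integral is
  the real part of a holomorphic function. The disc is centred at 0 and the boundary data are given
  as a function of the angle.\<close>

definition poisson :: "real \<Rightarrow> (real \<Rightarrow> real) \<Rightarrow> complex \<Rightarrow> real"
  where "poisson \<rho> \<phi> z = (\<integral>t. \<phi> t * Re ((\<rho> * cis t + z) / (\<rho> * cis t - z)) \<partial>circle_measure) / (2 * pi)"

lemma poisson_kernel_eq:
  assumes "norm z < \<rho>"
  shows "Re ((\<rho> * cis t + z) / (\<rho> * cis t - z)) = (\<rho>\<^sup>2 - (norm z)\<^sup>2) / (norm (\<rho> * cis t - z))\<^sup>2"
proof -
  define w where "w = \<rho> * cis t"
  have "\<rho> > 0" using le_less_trans[OF norm_ge_zero assms] .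
  then have nw: "norm w = \<rho>" by (simp add: w_def norm_mult)
  have "(w + z) / (w - z) = (w + z) * cnj (w - z) / of_real ((norm (w - z))\<^sup>2)"
    by (rule complex_div_cnj)
  then have "Re ((w + z) / (w - z)) = Re ((w + z) * cnj (w - z)) / (norm (w - z))\<^sup>2"
    by (simp only: Re_divide_of_real)
  also have "Re ((w + z) * cnj (w - z)) = (norm w)\<^sup>2 - (norm z)\<^sup>2"
    unfolding cmod_power2 by (simp add: power2_eq_square algebra_simps)
  finally have "Re ((w + z) / (w - z)) = (\<rho>\<^sup>2 - (norm z)\<^sup>2) / (norm (w - z))\<^sup>2" unfolding nw .
  then show ?thesis unfolding w_def .
qed

lemma poisson_kernel_nonneg:
  assumes "norm z < \<rho>"
  shows "0 \<le> Re ((\<rho> * cis t + z) / (\<rho> * cis t - z))"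
proof -
  have "(norm z)\<^sup>2 \<le> \<rho>\<^sup>2" using assms by (intro power_mono) auto
  then show ?thesis unfolding poisson_kernel_eq[OF assms] by (intro divide_nonneg_nonneg) auto
qed

lemma circle_minus_ne:
  assumes "norm z < \<rho>"
  shows "\<rho> * cis t - z \<noteq> 0" "\<rho> - norm z \<le> norm (\<rho> * cis t - z)"
proof -
  have "\<rho> > 0" using le_less_trans[OF norm_ge_zero assms] .
  then have "norm (\<rho> * cis t) = \<rho>" by (simp add: norm_mult)
  then show "\<rho> - norm z \<le> norm (\<rho> * cis t - z)" using norm_triangle_ineq2[of "\<rho> * cis t" z] by simp
  then show "\<rho> * cis t - z \<noteq> 0" using assms by auto
qed

lemma poisson_kernel_continuous:
  assumes "norm z < \<rho>"
  shows "continuous_on T (\<lambda>t. (\<rho> * cis t + z) / (\<rho> * cis t - z))"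
  using circle_minus_ne[OF assms] by (intro continuous_intros) auto

lemma poisson_kernel_integral:
  assumes "norm z < \<rho>"
  shows "(\<integral>t. Re ((\<rho> * cis t + z) / (\<rho> * cis t - z)) \<partial>circle_measure) = 2 * pi"
proof -
  have ne: "\<rho> * cis t - z \<noteq> 0" for t by (rule circle_minus_ne(1)[OF assms])
  have "(\<integral>t. (\<lambda>_. 1::complex) (0 + \<rho> * cis t) * (\<rho> * cis t) / (0 + \<rho> * cis t - z) \<partial>circle_measure) = 2 * pi * (\<lambda>_. 1::complex) z"
    by (rule Cauchy_integral_circle_measure) (use assms in auto)
  then have 1: "(\<integral>t. \<rho> * cis t / (\<rho> * cis t - z) \<partial>circle_measure) = 2 * pi" by simp
  have i: "integrable circle_measure (\<lambda>t. \<rho> * cis t / (\<rho> * cis t - z))"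
    using ne by (intro continuous_imp_integrable_circle_measure(1) continuous_intros) auto
  have eq: "(\<rho> * cis t + z) / (\<rho> * cis t - z) = 2 * (\<rho> * cis t / (\<rho> * cis t - z)) - 1" for t
    using ne[of t] by (simp add: field_simps)
  have ii: "integrable circle_measure (\<lambda>t. (\<rho> * cis t + z) / (\<rho> * cis t - z))"
    by (intro continuous_imp_integrable_circle_measure(1) poisson_kernel_continuous assms)
  have "(\<integral>t. (\<rho> * cis t + z) / (\<rho> * cis t - z) \<partial>circle_measure) = 2 * (2 * pi) - 2 * pi"
  proof -
    have "(\<integral>t. 2 * g t - 1 \<partial>circle_measure) = 2 * (\<integral>t. g t \<partial>circle_measure) - complex_of_real (2 * pi)"
      if "integrable circle_measure g" for g
      using that by (simp add: scaleR_conv_of_real)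
    from this[OF i] show ?thesis unfolding 1 eq by simp
  qed
  also have "\<dots> = of_real (2 * pi)" by simp
  finally have k: "(\<integral>t. (\<rho> * cis t + z) / (\<rho> * cis t - z) \<partial>circle_measure) = of_real (2 * pi)" .
  show ?thesis unfolding integral_Re[OF ii] k by (rule Re_complex_of_real)
qed

lemma poisson_integrable:
  assumes "norm z < \<rho>" "\<phi> \<in> borel_measurable circle_measure" "\<And>t. t \<in> {0..2 * pi} \<Longrightarrow> \<bar>\<phi> t\<bar> \<le> B"
  shows "integrable circle_measure (\<lambda>t. \<phi> t * Re ((\<rho> * cis t + z) / (\<rho> * cis t - z)))"
proof (rule Bochner_Integration.integrable_bound)
  have i: "integrable circle_measure (\<lambda>t. Re ((\<rho> * cis t + z) / (\<rho> * cis t - z)))"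
    by (intro integrable_Re continuous_imp_integrable_circle_measure(1) poisson_kernel_continuous assms)
  then show "integrable circle_measure (\<lambda>t. B * Re ((\<rho> * cis t + z) / (\<rho> * cis t - z)))" by simp
  show "(\<lambda>t. \<phi> t * Re ((\<rho> * cis t + z) / (\<rho> * cis t - z))) \<in> borel_measurable circle_measure"
    by (intro borel_measurable_times assms borel_measurable_integrable[OF i])
  show "AE t in circle_measure. norm (\<phi> t * Re ((\<rho> * cis t + z) / (\<rho> * cis t - z))) \<le> norm (B * Re ((\<rho> * cis t + z) / (\<rho> * cis t - z)))"
    using assms(3) by (intro AE_I2) (auto simp: abs_mult intro!: mult_right_mono order_trans[OF _ abs_ge_self] poisson_kernel_nonneg[OF assms(1)])
qed

lemma poisson_mono:
  assumes "norm z < \<rho>" "\<phi> \<in> borel_measurable circle_measure" "\<And>t. t \<in> {0..2 * pi} \<Longrightarrow> \<bar>\<phi> t\<bar> \<le> B"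
    and "\<psi> \<in> borel_measurable circle_measure" "\<And>t. t \<in> {0..2 * pi} \<Longrightarrow> \<bar>\<psi> t\<bar> \<le> B'"
    and "\<And>t. t \<in> {0..2 * pi} \<Longrightarrow> \<phi> t \<le> \<psi> t"
  shows "poisson \<rho> \<phi> z \<le> poisson \<rho> \<psi> z"
  unfolding poisson_def using assms
  by (intro divide_right_mono integral_mono poisson_integrable mult_right_mono poisson_kernel_nonneg) auto

lemma poisson_const: "norm z < \<rho> \<Longrightarrow> poisson \<rho> (\<lambda>_. c) z = c"
  by (simp add: poisson_def poisson_kernel_integral del: Re_divide_numeral)

lemma poisson_uminus: "poisson \<rho> (\<lambda>t. - \<phi> t) z = - poisson \<rho> \<phi> z"
  by (simp add: poisson_def)

text \<open>Harmonicity is used in this form: continuity and the mean value property of the Poisson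
  integral are inherited from F.\<close>

lemma poisson_eq_Re:
  assumes "\<rho> > 0" "\<phi> \<in> borel_measurable circle_measure" "\<And>t. t \<in> {0..2 * pi} \<Longrightarrow> \<bar>\<phi> t\<bar> \<le> B"
  obtains F where "F holomorphic_on ball 0 \<rho>" "\<And>z. z \<in> ball 0 \<rho> \<Longrightarrow> poisson \<rho> \<phi> z = Re (F z)"
proof
  define f where "f = (\<lambda>z t. \<phi> t *\<^sub>R ((\<rho> * cis t + z) / (\<rho> * cis t - z)))"
  have meas: "f z \<in> borel_measurable circle_measure" if "z \<in> ball 0 \<rho>" for z
  proof -
    have 1: "(\<lambda>t. (\<rho> * cis t + z) / (\<rho> * cis t - z)) \<in> borel_measurable circle_measure"
      using that by (intro borel_measurable_integrable continuous_imp_integrable_circle_measure(1) poisson_kernel_continuous) auto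
    show ?thesis unfolding f_def by (rule borel_measurable_scaleR[OF assms(2) 1])
  qed
  have bnd: "norm (f w t) \<le> B * (2 * \<rho> / ((\<rho> - norm z) / 2))"
    if "z \<in> ball 0 \<rho>" "w \<in> ball z ((\<rho> - norm z) / 2)" "t \<in> {0..2 * pi}" for z w t
  proof -
    have "norm w \<le> norm z + (\<rho> - norm z) / 2"
      using that(2) norm_triangle_ineq2[of w z] by (simp add: dist_norm norm_minus_commute field_simps)
    then have w: "(\<rho> - norm z) / 2 \<le> \<rho> - norm w" "norm w < \<rho>" using that(1) by (auto simp: field_simps)
    have "norm (\<rho> * cis t + w) \<le> 2 * \<rho>"
      using norm_triangle_ineq[of "\<rho> * cis t" w] w(2) assms(1) by (simp add: norm_mult)
    moreover have "(\<rho> - norm z) / 2 \<le> norm (\<rho> * cis t - w)" using circle_minus_ne(2)[OF w(2), of t] w(1) by linarith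
    ultimately have "norm ((\<rho> * cis t + w) / (\<rho> * cis t - w)) \<le> 2 * \<rho> / ((\<rho> - norm z) / 2)"
      unfolding norm_divide using that(1) assms(1) by (intro frac_le) auto
    moreover have "B \<ge> 0" using assms(3)[OF that(3)] by simp
    ultimately show ?thesis unfolding f_def norm_scaleR
      using assms(3)[OF that(3)] by (intro mult_mono) auto
  qed
  define F where "F = (\<lambda>z. (\<integral>t. f z t \<partial>circle_measure) / of_real (2 * pi))"
  have "(\<lambda>z. \<integral>t. f z t \<partial>circle_measure) holomorphic_on ball 0 \<rho>"
  proof (rule holomorphic_on_integral_parameter)
    fix z :: complex assume z: "z \<in> ball 0 \<rho>"
    show "f z \<in> borel_measurable circle_measure" by (rule meas[OF z])
    have "ball z ((\<rho> - norm z) / 2) \<subseteq> ball 0 \<rho>"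
    proof
      fix w assume "w \<in> ball z ((\<rho> - norm z) / 2)"
      then have "norm w < norm z + (\<rho> - norm z) / 2"
        using norm_triangle_ineq2[of w z] by (simp add: dist_norm norm_minus_commute field_simps)
      then show "w \<in> ball 0 \<rho>" using z by (simp add: field_simps)
    qed
    then show "\<exists>r>0. \<exists>g. integrable circle_measure g \<and> ball z r \<subseteq> ball 0 \<rho> \<and> (\<forall>w\<in>ball z r. \<forall>t\<in>space circle_measure. norm (f w t) \<le> g t)"
      using z bnd[OF z] by (intro exI[of _ "(\<rho> - norm z) / 2"] conjI exI[of _ "\<lambda>_. B * (2 * \<rho> / ((\<rho> - norm z) / 2))"]) auto
  next
    fix t assume "t \<in> space circle_measure"
    have "\<rho> * cis t - z \<noteq> 0" if "z \<in> ball 0 \<rho>" for z using circle_minus_ne(1) that by simp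
    then show "(\<lambda>z. f z t) holomorphic_on ball 0 \<rho>" unfolding f_def scaleR_conv_of_real by (intro holomorphic_intros)
  qed simp
  then show "F holomorphic_on ball 0 \<rho>" unfolding F_def by (intro holomorphic_intros) auto
  fix z :: complex assume z: "z \<in> ball 0 \<rho>"
  have "integrable circle_measure (f z)"
    using z by (intro circle_measure.integrable_const_bound[where B = "B * (2 * \<rho> / ((\<rho> - norm z) / 2))"] meas AE_I2 bnd[OF z]) auto
  from integral_Re[OF this] show "poisson \<rho> \<phi> z = Re (F z)"
    unfolding poisson_def F_def Re_divide_of_real by (simp only: f_def scaleR_complex.sel)
qed

text \<open>One-sided boundary behaviour, which suits upper semicontinuous data: near \<zeta> the
  data are at most c, and the kernel becomes uniformly small on the rest of the circle as z
  approaches \<zeta>.\<close>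

lemma poisson_boundary_le:
  assumes \<rho>: "\<rho> > 0" and \<phi>: "\<phi> \<in> borel_measurable circle_measure" "\<And>t. t \<in> {0..2 * pi} \<Longrightarrow> \<bar>\<phi> t\<bar> \<le> B"
    and \<zeta>: "norm \<zeta> = \<rho>" and \<delta>: "\<delta> > 0" and c: "\<And>t. t \<in> {0..2 * pi} \<Longrightarrow> norm (\<rho> * cis t - \<zeta>) < \<delta> \<Longrightarrow> \<phi> t \<le> c"
    and \<epsilon>: "\<epsilon> > 0"
  shows "\<exists>d>0. \<forall>z. norm z < \<rho> \<longrightarrow> norm (z - \<zeta>) < d \<longrightarrow> poisson \<rho> \<phi> z \<le> c + \<epsilon>"
proof -
  define B' where "B' = \<bar>B\<bar> + \<bar>c\<bar> + 1"
  have B': "B' > 0" "B + \<bar>c\<bar> \<le> B'" by (auto simp: B'_def)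
  \<comment> \<open>The first entry keeps the far arc at distance at least
    \<open>\<delta> / 2\<close> from z; the second makes the kernel there at most
    \<open>\<epsilon> / B'\<close>, where B' dominates the difference of the data and c.\<close>
  define d where "d = min (\<delta> / 2) (\<epsilon> * \<delta>\<^sup>2 / (8 * \<rho> * B'))"
  have d: "d > 0" "d \<le> \<delta> / 2" using \<delta> \<epsilon> \<rho> B' by (auto simp: d_def)
  have d': "8 * \<rho> * B' * d \<le> \<epsilon> * \<delta>\<^sup>2"
  proof -
    have "d \<le> \<epsilon> * \<delta>\<^sup>2 / (8 * \<rho> * B')" by (simp add: d_def)
    then show ?thesis using \<rho> B' by (simp add: pos_le_divide_eq mult.commute)
  qed
  have "poisson \<rho> \<phi> z \<le> c + \<epsilon>" if z: "norm z < \<rho>" "norm (z - \<zeta>) < d" for z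
  proof -
    let ?k = "\<lambda>t. Re ((\<rho> * cis t + z) / (\<rho> * cis t - z))"
    have q: "\<rho>\<^sup>2 - (norm z)\<^sup>2 \<le> 2 * \<rho> * d" "0 \<le> \<rho>\<^sup>2 - (norm z)\<^sup>2"
    proof -
      have "\<rho> - norm z \<le> d" using norm_triangle_ineq2[of \<zeta> z] z(2) \<zeta> by (simp add: norm_minus_commute)
      then have "(\<rho> + norm z) * (\<rho> - norm z) \<le> (2 * \<rho>) * d" using z(1) \<rho> by (intro mult_mono) auto
      then show "\<rho>\<^sup>2 - (norm z)\<^sup>2 \<le> 2 * \<rho> * d" by (simp add: power2_eq_square algebra_simps)
      show "0 \<le> \<rho>\<^sup>2 - (norm z)\<^sup>2" using z(1) by (simp add: power_mono)
    qed
    have pw: "\<phi> t * ?k t \<le> c * ?k t + \<epsilon>" if t: "t \<in> {0..2 * pi}" for t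
    proof (cases "norm (\<rho> * cis t - \<zeta>) < \<delta>")
      case True
      then have "\<phi> t * ?k t \<le> c * ?k t" using c[OF t] by (intro mult_right_mono poisson_kernel_nonneg[OF z(1)])
      then show ?thesis using \<epsilon> by linarith
    next
      case False
      then have far: "\<delta> / 2 \<le> norm (\<rho> * cis t - z)"
        using norm_triangle_ineq[of "\<rho> * cis t - z" "z - \<zeta>"] z(2) d(2) by simp
      have "?k t \<le> (2 * \<rho> * d) / (\<delta> / 2)\<^sup>2"
        unfolding poisson_kernel_eq[OF z(1)] using q far \<delta> \<rho> d(1) by (intro frac_le power_mono) auto
      then have "B' * ?k t \<le> B' * ((2 * \<rho> * d) / (\<delta> / 2)\<^sup>2)" using B'(1) by (intro mult_left_mono) auto
      also have "\<dots> = (8 * \<rho> * B' * d) / \<delta>\<^sup>2" by (simp add: power_divide)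
      also have "\<dots> \<le> \<epsilon>" using d' \<delta> by (simp add: pos_divide_le_eq)
      finally have "B' * ?k t \<le> \<epsilon>" .
      moreover have "(\<phi> t - c) * ?k t \<le> B' * ?k t"
        using \<phi>(2)[OF t] B' by (intro mult_right_mono poisson_kernel_nonneg[OF z(1)]) linarith
      ultimately have "(\<phi> t - c) * ?k t \<le> \<epsilon>" by linarith
      then show ?thesis by (simp add: left_diff_distrib)
    qed
    have i1: "integrable circle_measure (\<lambda>t. \<phi> t * ?k t)" by (rule poisson_integrable[OF z(1) \<phi>])
    have i2: "integrable circle_measure (\<lambda>t. c * ?k t)" by (rule poisson_integrable[OF z(1), of "\<lambda>_. c" "\<bar>c\<bar>"]) auto
    have "(\<integral>t. \<phi> t * ?k t \<partial>circle_measure) \<le> (\<integral>t. c * ?k t + \<epsilon> \<partial>circle_measure)"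
      using i1 i2 pw by (intro integral_mono) auto
    also have "\<dots> = (\<integral>t. c * ?k t \<partial>circle_measure) + 2 * pi * \<epsilon>"
      using i2 by (subst Bochner_Integration.integral_add) auto
    also have "\<dots> = 2 * pi * (c + \<epsilon>)"
      unfolding integral_mult_right_zero poisson_kernel_integral[OF z(1)] by (simp add: algebra_simps)
    finally show ?thesis unfolding poisson_def by (simp add: pos_divide_le_eq mult.commute)
  qed
  then show ?thesis using d(1) by blast
qed

text \<open>The estimate depends on the data only through their bound B. It is therefore uniform
  over all competitors for Green's function, and this forces the limit at \<open>z0\<close> to
  exist.\<close>

lemma poisson_center_diff:
  assumes z: "norm z < \<rho>" and \<phi>: "\<phi> \<in> borel_measurable circle_measure" "\<And>t. t \<in> {0..2 * pi} \<Longrightarrow> \<bar>\<phi> t\<bar> \<le> B"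
  shows "\<bar>poisson \<rho> \<phi> z - poisson \<rho> \<phi> 0\<bar> \<le> B * (2 * norm z / (\<rho> - norm z))"
proof -
  have \<rho>: "\<rho> > 0" using le_less_trans[OF norm_ge_zero z] .
  let ?k = "\<lambda>z t. Re ((\<rho> * cis t + z) / (\<rho> * cis t - z))"
  have k0: "?k 0 t = 1" for t using \<rho> by simp
  have kd: "\<bar>?k z t - ?k 0 t\<bar> \<le> 2 * norm z / (\<rho> - norm z)" for t
  proof -
    have "(\<rho> * cis t + z) / (\<rho> * cis t - z) - 1 = 2 * z / (\<rho> * cis t - z)"
      using circle_minus_ne(1)[OF z] by (simp add: field_simps)
    then have "?k z t - 1 = Re (2 * z / (\<rho> * cis t - z))" by (metis minus_complex.sel(1) one_complex.sel(1))
    then have "\<bar>?k z t - 1\<bar> \<le> norm (2 * z / (\<rho> * cis t - z))" using abs_Re_le_cmod by metis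
    also have "\<dots> \<le> 2 * norm z / (\<rho> - norm z)"
      unfolding norm_divide norm_mult using circle_minus_ne(2)[OF z] z by (intro frac_le) auto
    finally show ?thesis unfolding k0 .
  qed
  have i: "integrable circle_measure (\<lambda>t. \<phi> t * ?k z t)" "integrable circle_measure (\<lambda>t. \<phi> t * ?k 0 t)"
    using z \<rho> by (intro poisson_integrable[OF _ \<phi>]; simp)+
  have "\<bar>(\<integral>t. \<phi> t * ?k z t \<partial>circle_measure) - (\<integral>t. \<phi> t * ?k 0 t \<partial>circle_measure)\<bar> = \<bar>\<integral>t. \<phi> t * ?k z t - \<phi> t * ?k 0 t \<partial>circle_measure\<bar>"
    using i by (subst Bochner_Integration.integral_diff) auto
  also have "\<dots> \<le> (\<integral>t. \<bar>\<phi> t * ?k z t - \<phi> t * ?k 0 t\<bar> \<partial>circle_measure)" by (rule integral_abs_bound)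
  also have "\<dots> \<le> (\<integral>t. B * (2 * norm z / (\<rho> - norm z)) \<partial>circle_measure)"
  proof (rule integral_mono)
    show "integrable circle_measure (\<lambda>t. \<bar>\<phi> t * ?k z t - \<phi> t * ?k 0 t\<bar>)"
      by (intro integrable_abs Bochner_Integration.integrable_diff i)
    fix t assume "t \<in> space circle_measure"
    then have "\<bar>\<phi> t\<bar> \<le> B" using \<phi>(2) by simp
    then have "\<bar>\<phi> t\<bar> * \<bar>?k z t - ?k 0 t\<bar> \<le> B * (2 * norm z / (\<rho> - norm z))"
      by (intro mult_mono kd) auto
    then show "\<bar>\<phi> t * ?k z t - \<phi> t * ?k 0 t\<bar> \<le> B * (2 * norm z / (\<rho> - norm z))"
      by (simp only: abs_mult[symmetric] right_diff_distrib)
  qed simp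
  also have "\<dots> = 2 * pi * (B * (2 * norm z / (\<rho> - norm z)))" by simp
  finally have le: "\<bar>(\<integral>t. \<phi> t * ?k z t \<partial>circle_measure) - (\<integral>t. \<phi> t * ?k 0 t \<partial>circle_measure)\<bar> \<le> 2 * pi * (B * (2 * norm z / (\<rho> - norm z)))" .
  have "X / (2 * pi) \<le> Y" if "X \<le> 2 * pi * Y" for X Y :: real
    using that by (simp add: pos_divide_le_eq mult.commute)
  from this[OF le] have "\<bar>(\<integral>t. \<phi> t * ?k z t \<partial>circle_measure) - (\<integral>t. \<phi> t * ?k 0 t \<partial>circle_measure)\<bar> / (2 * pi) \<le> B * (2 * norm z / (\<rho> - norm z))" .
  moreover have "poisson \<rho> \<phi> z - poisson \<rho> \<phi> 0 = ((\<integral>t. \<phi> t * ?k z t \<partial>circle_measure) - (\<integral>t. \<phi> t * ?k 0 t \<partial>circle_measure)) / (2 * pi)"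
    by (simp only: poisson_def diff_divide_distrib)
  ultimately show ?thesis by (simp only: abs_divide) simp
qed

lemma poisson_mean_value:
  assumes \<rho>: "\<rho> > 0" and \<phi>: "\<phi> \<in> borel_measurable circle_measure" "\<And>t. t \<in> {0..2 * pi} \<Longrightarrow> \<bar>\<phi> t\<bar> \<le> B"
  shows "continuous_on (ball 0 \<rho>) (poisson \<rho> \<phi>)"
    and "0 < r \<Longrightarrow> norm a + r < \<rho> \<Longrightarrow> integrable circle_measure (\<lambda>t. poisson \<rho> \<phi> (a + of_real r * cis t))"
    and "0 < r \<Longrightarrow> norm a + r < \<rho> \<Longrightarrow> (\<integral>t. poisson \<rho> \<phi> (a + of_real r * cis t) \<partial>circle_measure) = 2 * pi * poisson \<rho> \<phi> a"
proof -
  obtain F where F: "F holomorphic_on ball 0 \<rho>" "\<And>z. z \<in> ball 0 \<rho> \<Longrightarrow> poisson \<rho> \<phi> z = Re (F z)"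
    using poisson_eq_Re[OF \<rho> \<phi>] by metis
  have cF: "continuous_on (ball 0 \<rho>) F" using F(1) by (rule holomorphic_on_imp_continuous_on)
  have "continuous_on (ball 0 \<rho>) (\<lambda>z. Re (F z))" by (intro continuous_intros cF)
  then show "continuous_on (ball 0 \<rho>) (poisson \<rho> \<phi>)"
    using F(2) by (subst continuous_on_cong[OF refl]) auto
  assume r: "0 < r" "norm a + r < \<rho>"
  have sub: "cball a r \<subseteq> ball 0 \<rho>"
  proof
    fix x assume "x \<in> cball a r"
    then have "norm x \<le> norm a + r" using norm_triangle_ineq2[of x a] by (simp add: dist_norm norm_minus_commute)
    then show "x \<in> ball 0 \<rho>" using r by simp
  qed
  have on: "a + of_real r * cis t \<in> cball a r" for t using r by (simp add: dist_norm norm_mult)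
  have "continuous_on {0..2 * pi} (\<lambda>t. F (a + of_real r * cis t))"
    by (rule continuous_on_compose2[OF cF continuous_on_circle]) (use on sub in auto)
  then have i: "integrable circle_measure (\<lambda>t. F (a + of_real r * cis t))"
    by (rule continuous_imp_integrable_circle_measure(1))
  have eq: "poisson \<rho> \<phi> (a + of_real r * cis t) = Re (F (a + of_real r * cis t))" for t
    using F(2) on sub by blast
  show "integrable circle_measure (\<lambda>t. poisson \<rho> \<phi> (a + of_real r * cis t))"
    unfolding eq by (rule integrable_Re[OF i])
  have "(\<integral>t. F (a + of_real r * cis t) \<partial>circle_measure) = 2 * pi * F a"
  proof (rule mean_value_circle_measure)
    show "continuous_on (cball a r) F" by (rule continuous_on_subset[OF cF sub])
    show "F holomorphic_on ball a r" by (rule holomorphic_on_subset[OF F(1)]) (use sub in auto)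
  qed fact
  moreover have "poisson \<rho> \<phi> a = Re (F a)" using F(2)[of a] r by simp
  ultimately show "(\<integral>t. poisson \<rho> \<phi> (a + of_real r * cis t) \<partial>circle_measure) = 2 * pi * poisson \<rho> \<phi> a"
    unfolding eq integral_Re[OF i] by simp
qed

section \<open>Poisson majorants of subharmonic functions\<close>

text \<open>Sup-convolution with the cones \<open>real k * dist x y\<close> gives k-Lipschitz
  majorants. For large k, points at distance at least \<delta> no longer compete, since V varies by
  at most \<open>2 * B\<close>; upper semicontinuity handles the near ones.\<close>

lemma usc_limit_of_continuous:
  fixes V :: "'a::metric_space \<Rightarrow> real"
  assumes ne: "S \<noteq> {}" and B: "\<And>x. x \<in> S \<Longrightarrow> \<bar>V x\<bar> \<le> B"
    and usc: "\<And>x c. x \<in> S \<Longrightarrow> V x < c \<Longrightarrow> \<exists>\<delta>>0. \<forall>y\<in>S. dist x y < \<delta> \<longrightarrow> V y < c"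
  obtains \<phi> :: "nat \<Rightarrow> 'a \<Rightarrow> real" where "\<And>k. continuous_on UNIV (\<phi> k)"
    "\<And>k x. x \<in> S \<Longrightarrow> V x \<le> \<phi> k x" "\<And>k x. x \<in> S \<Longrightarrow> \<bar>\<phi> k x\<bar> \<le> B" "\<And>x. x \<in> S \<Longrightarrow> (\<lambda>k. \<phi> k x) \<longlonglongrightarrow> V x"
proof -
  define \<phi> where "\<phi> = (\<lambda>(k::nat) x. SUP y\<in>S. V y - real k * dist x y)"
  have le: "V y - real k * dist x y \<le> B" if "y \<in> S" for x y k
  proof -
    have "0 \<le> real k * dist x y" by simp
    then show ?thesis using abs_le_D1[OF B[OF that]] by linarith
  qed
  have bdd: "bdd_above ((\<lambda>y. V y - real k * dist x y) ` S)" for x k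
    by (rule bdd_aboveI2[OF le])
  have ub: "V y - real k * dist x y \<le> \<phi> k x" if "y \<in> S" for x y k
    unfolding \<phi>_def by (rule cSUP_upper[OF that bdd])
  have lb: "\<phi> k x \<le> c" if "\<And>y. y \<in> S \<Longrightarrow> V y - real k * dist x y \<le> c" for x k c
    unfolding \<phi>_def by (rule cSUP_least[OF ne that])
  have lip: "\<phi> k x \<le> \<phi> k x' + real k * dist x x'" for k x x'
  proof (rule lb)
    fix y assume y: "y \<in> S"
    have "real k * dist x' y \<le> real k * (dist x x' + dist x y)"
      by (intro mult_left_mono dist_triangle3) simp
    then show "V y - real k * dist x y \<le> \<phi> k x' + real k * dist x x'"
      using ub[OF y, of k x'] by (simp add: algebra_simps)
  qed
  have cont: "continuous_on UNIV (\<phi> k)" for k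
    unfolding continuous_on_iff
  proof (intro ballI allI impI)
    fix x :: 'a and e :: real assume e: "0 < e"
    show "\<exists>d>0. \<forall>x'\<in>UNIV. dist x' x < d \<longrightarrow> dist (\<phi> k x') (\<phi> k x) < e"
    proof (intro exI[of _ "e / (real k + 1)"] conjI ballI impI)
      fix x' assume "dist x' x < e / (real k + 1)"
      then have "(real k + 1) * dist x' x < e" by (simp add: pos_less_divide_eq mult.commute add_nonneg_pos)
      then have "real k * dist x' x < e" by (simp add: algebra_simps) (smt (verit) zero_le_dist)
      then show "dist (\<phi> k x') (\<phi> k x) < e"
        using lip[of k x x'] lip[of k x' x] by (simp add: dist_real_def dist_commute abs_less_iff)
    qed (use e in \<open>simp add: add_nonneg_pos\<close>)
  qed
  have V: "V x \<le> \<phi> k x" if "x \<in> S" for k x using ub[OF that, of k x] by simp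
  have B\<phi>: "\<bar>\<phi> k x\<bar> \<le> B" if "x \<in> S" for k x
    using V[OF that, of k] B[OF that] lb[of k x B] le by (auto simp: abs_le_iff)
  have conv: "(\<lambda>k. \<phi> k x) \<longlonglongrightarrow> V x" if x: "x \<in> S" for x
  proof (rule order_tendstoI)
    fix a assume "a < V x"
    then show "\<forall>\<^sub>F k in sequentially. a < \<phi> k x" using V[OF x] by (intro always_eventually allI) (rule less_le_trans)
  next
    fix a assume "V x < a"
    then obtain c where c: "V x < c" "c < a" using dense by blast
    obtain \<delta> where \<delta>: "\<delta> > 0" "\<And>y. y \<in> S \<Longrightarrow> dist x y < \<delta> \<Longrightarrow> V y < c" using usc[OF x c(1)] by blast
    have "\<forall>\<^sub>F k in sequentially. 2 * B / \<delta> \<le> real k" using eventually_ge_at_top[of "nat \<lceil>2 * B / \<delta>\<rceil>"]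
      by eventually_elim linarith
    then show "\<forall>\<^sub>F k in sequentially. \<phi> k x < a"
    proof eventually_elim
      case (elim k)
      have "\<phi> k x \<le> c"
      proof (rule lb)
        fix y assume y: "y \<in> S"
        show "V y - real k * dist x y \<le> c"
        proof (cases "dist x y < \<delta>")
          case True
          then show ?thesis using \<delta>(2)[OF y] mult_nonneg_nonneg[of "real k" "dist x y"] by (smt (verit) of_nat_0_le_iff zero_le_dist)
        next
          case False
          then have "2 * B \<le> real k * \<delta>" using elim \<delta>(1) by (simp add: pos_divide_le_eq)
          also have "\<dots> \<le> real k * dist x y" using False by (intro mult_left_mono) auto
          finally show ?thesis using B[OF y] B[OF x] c(1) by linarith
        qed
      qed
      then show ?case using c(2) by simp
    qed
  qed
  show ?thesis using that[OF cont V B\<phi> conv] .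
qed

lemma usc_circle_measurable:
  fixes U :: "complex \<Rightarrow> real"
  assumes usc: "\<And>c. open {z \<in> G. U z < c}" and sub: "\<And>t. a + of_real r * cis t \<in> G"
  shows "(\<lambda>t. U (a + of_real r * cis t)) \<in> borel_measurable circle_measure"
  unfolding borel_measurable_iff_less
proof
  fix c
  have m: "(\<lambda>t. a + of_real r * cis t) \<in> borel_measurable circle_measure"
    by (intro borel_measurable_circle_measure borel_measurable_continuous_onI continuous_on_circle)
  have "{w \<in> space circle_measure. U (a + of_real r * cis w) < c} = (\<lambda>t. a + of_real r * cis t) -` {z \<in> G. U z < c} \<inter> space circle_measure"
    using sub by auto
  also have "\<dots> \<in> sets circle_measure" using usc by (intro measurable_sets[OF m]) auto
  finally show "{w \<in> space circle_measure. U (a + of_real r * cis w) < c} \<in> sets circle_measure" .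
qed

lemma usc_add_continuous:
  fixes U g :: "complex \<Rightarrow> real"
  assumes usc: "\<And>c. open {z \<in> G. U z < c}" and G: "open G" and g: "continuous_on G g"
  shows "open {z \<in> G. U z + g z < c}"
proof -
  have "{z \<in> G. U z + g z < c} = (\<Union>q. {z \<in> G. U z < q} \<inter> (G \<inter> g -` {..<c - q}))"
  proof (intro equalityI subsetI)
    fix z assume z: "z \<in> {z \<in> G. U z + g z < c}"
    then obtain q where "U z < q" "q < c - g z" using dense[of "U z" "c - g z"] by auto
    then show "z \<in> (\<Union>q. {z \<in> G. U z < q} \<inter> (G \<inter> g -` {..<c - q}))" using z by auto
  qed auto
  moreover have op: "open (G \<inter> g -` {..<c - q})" for q by (rule continuous_open_preimage[OF g G]) simp
  ultimately show ?thesis by (simp only:) (intro open_UN ballI, rule open_Int[OF usc op])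
qed

lemma bounded_measurable_circle_integrable:
  assumes "f \<in> borel_measurable circle_measure" "\<And>t. t \<in> {0..2 * pi} \<Longrightarrow> \<bar>f t\<bar> \<le> (B::real)"
  shows "integrable circle_measure f"
  by (rule circle_measure.integrable_const_bound[where B = B]) (use assms in \<open>auto intro!: AE_I2\<close>)

text \<open>V is subharmonic off \<open>z0\<close> and bounded above near it. It is compared with
  Poisson integrals \<open>H k\<close> of continuous majorants of its boundary values, after a
  perturbation of size \<epsilon> that controls the puncture and makes the submean inequality
  strict. Then \<epsilon> tends to 0, and the majorants tend to V on the circle.\<close>

lemma subharmonic_le_poisson:
  fixes U :: "complex \<Rightarrow> real"
  assumes \<rho>: "0 < \<rho>" "\<rho> < \<rho>'" and R: "R > 0"
    and usc: "\<And>c. open {z \<in> ball z0 \<rho>' - {z0}. U z < c}"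
    and low: "\<And>z. z \<in> ball z0 \<rho>' - {z0} \<Longrightarrow> ln (norm (z - z0) / R) \<le> U z"
    and up: "\<And>z. z \<in> ball z0 \<rho>' - {z0} \<Longrightarrow> U z \<le> 0"
    and sub: "\<And>a. a \<in> ball z0 \<rho>' - {z0} \<Longrightarrow> \<exists>\<eta>>0. \<forall>r. 0 < r \<and> r < \<eta> \<longrightarrow>
         2 * pi * U a \<le> (\<integral>t. U (a + of_real r * cis t) \<partial>circle_measure)"
    and pole: "\<forall>\<^sub>F z in at z0. U z - ln (norm (z - z0)) \<le> C"
    and z: "z \<in> ball z0 \<rho> - {z0}"
  shows "U z - ln (norm (z - z0)) \<le> poisson \<rho> (\<lambda>t. U (z0 + of_real \<rho> * cis t) - ln \<rho>) (z - z0)"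
proof -
  define V where "V = (\<lambda>z. U z - ln (norm (z - z0)))"
  define G where "G = ball z0 \<rho> - {z0}"
  define S where "S = sphere z0 \<rho>"
  have SG: "S \<subseteq> ball z0 \<rho>' - {z0}" using \<rho> by (auto simp: S_def)
  have oG: "open G" by (simp add: G_def open_delete)
  define B where "B = \<bar>ln R\<bar> + \<bar>ln \<rho>\<bar>"
  have VB: "\<bar>V x\<bar> \<le> B" if "x \<in> S" for x
  proof -
    have n: "norm (x - z0) = \<rho>" using that by (simp add: S_def dist_norm norm_minus_commute)
    have "x \<in> ball z0 \<rho>' - {z0}" using that SG by blast
    then have "ln (\<rho> / R) \<le> U x" "U x \<le> 0" using low[of x] up[of x] n by auto
    then show ?thesis using n \<rho> R by (simp add: V_def B_def ln_div)
  qed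
  have oV: "open {z \<in> ball z0 \<rho>' - {z0}. U z + - ln (norm (z - z0)) < c}" for c
    by (rule usc_add_continuous[OF usc]) (auto intro!: continuous_intros open_delete)
  have usV: "\<exists>\<delta>>0. ball x \<delta> \<subseteq> {z \<in> ball z0 \<rho>' - {z0}. V z < c}" if "x \<in> S" "V x < c" for x c
  proof -
    have "open {z \<in> ball z0 \<rho>' - {z0}. V z < c}" using oV[of c] by (simp add: V_def)
    moreover have "x \<in> {z \<in> ball z0 \<rho>' - {z0}. V z < c}" using SG that by blast
    ultimately show ?thesis using openE by blast
  qed
  have "S \<noteq> {}" using \<rho> by (simp add: S_def)
  moreover have "\<exists>\<delta>>0. \<forall>y\<in>S. dist x y < \<delta> \<longrightarrow> V y < c" if "x \<in> S" "V x < c" for x c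
    using usV[OF that] by (auto simp: subset_iff)
  ultimately obtain \<phi> where \<phi>: "\<And>k. continuous_on UNIV (\<phi> k)" "\<And>k x. x \<in> S \<Longrightarrow> V x \<le> \<phi> k x"
    "\<And>k x. x \<in> S \<Longrightarrow> \<bar>\<phi> k x\<bar> \<le> B" "\<And>x. x \<in> S \<Longrightarrow> (\<lambda>k. \<phi> k x) \<longlonglongrightarrow> V x"
    using usc_limit_of_continuous[of S V B] VB by metis
  define c where "c = (\<lambda>t. z0 + of_real \<rho> * cis t)"
  have cS: "c t \<in> S" for t using \<rho> by (simp add: c_def S_def dist_norm norm_mult)
  have \<phi>m: "(\<lambda>t. \<phi> k (c t)) \<in> borel_measurable circle_measure" for k
  proof -
    have "continuous_on {0..2 * pi} (\<lambda>t. \<phi> k (c t))"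
      unfolding c_def by (rule continuous_on_compose2[OF \<phi>(1) continuous_on_circle]) auto
    then show ?thesis by (intro borel_measurable_integrable continuous_imp_integrable_circle_measure(1))
  qed
  have \<phi>B: "\<bar>\<phi> k (c t)\<bar> \<le> B" for k t by (rule \<phi>(3)[OF cS])
  have B0: "B \<ge> 0" by (simp add: B_def)
  define H where "H = (\<lambda>k. poisson \<rho> (\<lambda>t. \<phi> k (c t)))"
  have HB: "\<bar>H k w\<bar> \<le> B" if w: "norm w < \<rho>" for k w
  proof -
    have "H k w \<le> poisson \<rho> (\<lambda>_. B) w"
      unfolding H_def by (rule poisson_mono[OF w \<phi>m \<phi>B, of _ B]) (use \<phi>B B0 abs_le_D1 in auto)
    moreover have "poisson \<rho> (\<lambda>_. - B) w \<le> H k w"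
      unfolding H_def
      by (rule poisson_mono[OF w _ _ \<phi>m \<phi>B, of _ B]) (use \<phi>B B0 in \<open>auto simp: abs_le_iff minus_le_iff\<close>)
    ultimately show ?thesis using poisson_const[OF w] by (simp add: abs_le_iff)
  qed
  have main: "V z \<le> H k (z - z0) + \<epsilon> * (\<rho>\<^sup>2 - ln (norm (z - z0) / \<rho>))" if \<epsilon>: "\<epsilon> > 0" for k \<epsilon>
  proof -
    \<comment> \<open>The term \<open>\<epsilon> * ln (norm (z - z0) / \<rho>)\<close> is at most 0
      and tends to \<open>-\<infinity>\<close> at the puncture, where V is only bounded above; the
      square makes D strictly subharmonic.\<close>
    define g where "g = (\<lambda>z. - ln (norm (z - z0)) - H k (z - z0) + \<epsilon> * ln (norm (z - z0) / \<rho>) + \<epsilon> * (norm (z - z0))\<^sup>2)"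
    define D where "D = (\<lambda>z. U z + g z)"
    have cH: "continuous_on (ball 0 \<rho>) (H k)"
      unfolding H_def by (rule poisson_mean_value(1)[OF \<rho>(1) \<phi>m \<phi>B])
    have cg: "continuous_on G g"
      unfolding g_def
      by (intro continuous_intros continuous_on_compose2[OF cH]) (use \<rho> in \<open>auto simp: G_def dist_norm norm_minus_commute\<close>)
    have "D z \<le> \<epsilon> * \<rho>\<^sup>2"
    proof (rule usc_maximum_principle[OF oG])
      show "bounded G" using bounded_ball by (rule bounded_subset) (auto simp: G_def)
      have uG: "open {z \<in> G. U z < c}" for c
      proof -
        have "{z \<in> G. U z < c} = {z \<in> ball z0 \<rho>' - {z0}. U z < c} \<inter> G" using \<rho> by (auto simp: G_def)
        then show ?thesis using usc oG by auto
      qed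
      show "open {z \<in> G. D z < c}" for c
        unfolding D_def by (rule usc_add_continuous[OF uG oG cg])
      show "z \<in> G" using z by (simp add: G_def)
    next
      fix x m assume x: "x \<in> frontier G" and m: "\<epsilon> * \<rho>\<^sup>2 < m"
      have "closure G \<subseteq> cball z0 \<rho>" by (rule closure_minimal) (auto simp: G_def)
      then have "x = z0 \<or> x \<in> S"
        using x oG by (auto simp: frontier_def interior_open G_def S_def dist_norm)
      then show "\<forall>\<^sub>F z in at x within G. D z < m"
      proof
        assume [simp]: "x = z0"
        have ev: "\<forall>\<^sub>F z in at z0 within G. V z \<le> C"
          using pole unfolding V_def by (rule filter_leD[OF at_le[OF subset_UNIV]])
        \<comment> \<open>Chosen so that \<open>\<epsilon> * K\<close> absorbs the bounds C on V, B
          on \<open>H k\<close> and \<open>\<epsilon> * \<rho>\<^sup>2\<close> on the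
          square.\<close>
        define K where "K = (m - C - B - \<epsilon> * \<rho>\<^sup>2) / \<epsilon>"
        have "0 < \<rho> * exp K" using \<rho> by simp
        then have "\<forall>\<^sub>F z in at z0 within G. dist z z0 < \<rho> * exp K"
          by (intro eventually_at_topological[THEN iffD2] exI[of _ "ball z0 (\<rho> * exp K)"]) (auto simp: dist_commute)
        moreover have "\<forall>\<^sub>F z in at z0 within G. z \<in> G" by (simp add: eventually_at_filter)
        ultimately have "\<forall>\<^sub>F z in at z0 within G. D z < m"
          using ev
        proof eventually_elim
          case (elim z)
          have nz: "0 < norm (z - z0)" "norm (z - z0) < \<rho>" using elim(2) by (auto simp: G_def dist_norm norm_minus_commute)
          have "norm (z - z0) / \<rho> < exp K" using elim(1) \<rho> by (simp add: dist_norm pos_divide_less_eq mult.commute)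
          then have "ln (norm (z - z0) / \<rho>) < K" using nz \<rho> by (metis divide_pos_pos exp_less_cancel_iff exp_ln)
          then have "\<epsilon> * ln (norm (z - z0) / \<rho>) < \<epsilon> * K" using \<epsilon> by simp
          then have 1: "\<epsilon> * ln (norm (z - z0) / \<rho>) < m - C - B - \<epsilon> * \<rho>\<^sup>2" using \<epsilon> by (simp add: K_def)
          have 2: "\<epsilon> * (norm (z - z0))\<^sup>2 \<le> \<epsilon> * \<rho>\<^sup>2" using nz \<epsilon> by (intro mult_left_mono power_mono) auto
          have 3: "- H k (z - z0) \<le> B" using HB[OF nz(2), of k] by simp
          show ?case using 1 2 3 elim(3) by (simp add: D_def g_def V_def)
        qed
        then show ?thesis by simp
      next
        assume xS: "x \<in> S"
        \<comment> \<open>One portion of the slack is spent on the upper semicontinuity of V and two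
          on the boundary values of \<open>- H k\<close>.\<close>
        define \<eta> where "\<eta> = (m - \<epsilon> * \<rho>\<^sup>2) / 4"
        have \<eta>: "\<eta> > 0" "m = \<epsilon> * \<rho>\<^sup>2 + 4 * \<eta>" using m by (simp_all add: \<eta>_def field_simps)
        have nx: "norm (x - z0) = \<rho>" using xS by (simp add: S_def dist_norm norm_minus_commute)
        obtain \<delta> where \<delta>: "\<delta> > 0" "ball x \<delta> \<subseteq> {z \<in> ball z0 \<rho>' - {z0}. V z < V x + \<eta>}"
          using usV[OF xS, of "V x + \<eta>"] \<eta>(1) by auto
        have "isCont (\<phi> k) x" using \<phi>(1) by (simp add: continuous_on_eq_continuous_at)
        then obtain \<delta>' where \<delta>': "\<delta>' > 0" "\<And>y. dist y x < \<delta>' \<Longrightarrow> dist (\<phi> k y) (\<phi> k x) < \<eta>"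
          using \<eta>(1) unfolding continuous_at_eps_delta by blast
        have near: "- \<phi> k (c t) \<le> - \<phi> k x + \<eta>" if "norm (\<rho> * cis t - (x - z0)) < \<delta>'" for t
          using \<delta>'(2)[of "c t"] that by (simp add: c_def dist_norm algebra_simps abs_less_iff)
        obtain d where d: "d > 0" "\<And>w. norm w < \<rho> \<Longrightarrow> norm (w - (x - z0)) < d \<Longrightarrow>
            poisson \<rho> (\<lambda>t. - \<phi> k (c t)) w \<le> (- \<phi> k x + \<eta>) + \<eta>"
          using poisson_boundary_le[OF \<rho>(1) _ _ nx \<delta>'(1) _ \<eta>(1), of "\<lambda>t. - \<phi> k (c t)" B "- \<phi> k x + \<eta>"] \<phi>m \<phi>B near
          by (auto intro: borel_measurable_uminus)
        have "\<forall>\<^sub>F z in at x within G. dist z x < min \<delta> d"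
          using \<delta>(1) d(1)
          by (intro eventually_at_topological[THEN iffD2] exI[of _ "ball x (min \<delta> d)"]) (auto simp: dist_commute)
        moreover have "\<forall>\<^sub>F z in at x within G. z \<in> G" by (simp add: eventually_at_filter)
        ultimately show ?thesis
        proof eventually_elim
          case (elim z)
          have nz: "0 < norm (z - z0)" "norm (z - z0) < \<rho>" using elim(2) by (auto simp: G_def dist_norm norm_minus_commute)
          have 1: "V z < V x + \<eta>" using \<delta>(2) elim(1) by (auto simp: dist_commute subset_iff)
          have 2: "- H k (z - z0) \<le> - \<phi> k x + \<eta> + \<eta>"
            using d(2)[OF nz(2)] elim(1) by (simp add: H_def poisson_uminus dist_norm)
          have 3: "V x \<le> \<phi> k x" by (rule \<phi>(2)[OF xS])
          have 4: "\<epsilon> * ln (norm (z - z0) / \<rho>) \<le> 0" using nz \<epsilon> \<rho> by (intro mult_nonneg_nonpos) auto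
          have 5: "\<epsilon> * (norm (z - z0))\<^sup>2 \<le> \<epsilon> * \<rho>\<^sup>2" using nz \<epsilon> by (intro mult_left_mono power_mono) auto
          show ?case using 1 2 3 4 5 \<eta> by (simp add: D_def g_def V_def)
        qed
      qed
    next
      fix a assume a: "a \<in> G"
      then have na: "0 < norm (a - z0)" "norm (a - z0) < \<rho>" by (auto simp: G_def dist_norm norm_minus_commute)
      have aR: "a \<in> ball z0 \<rho>' - {z0}" using a \<rho> by (auto simp: G_def)
      obtain \<eta> where \<eta>: "\<eta> > 0" "\<And>r. 0 < r \<Longrightarrow> r < \<eta> \<Longrightarrow> 2 * pi * U a \<le> (\<integral>t. U (a + of_real r * cis t) \<partial>circle_measure)"
        using sub[OF aR] by blast
      have "0 < min \<eta> (min (norm (a - z0)) (\<rho> - norm (a - z0)))" using \<eta> na by simp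
      then obtain r where r: "0 < r" "r < min \<eta> (min (norm (a - z0)) (\<rho> - norm (a - z0)))" using dense by blast
      let ?p = "\<lambda>t. a + of_real r * cis t"
      have pG: "?p t \<in> G" and pn: "norm (a - z0) - r \<le> norm (?p t - z0)" for t
      proof -
        have "norm (?p t - z0) \<le> norm (a - z0) + r" using norm_triangle_ineq[of "a - z0" "of_real r * cis t"] r by (simp add: norm_mult algebra_simps)
        moreover show "norm (a - z0) - r \<le> norm (?p t - z0)"
          using norm_triangle_ineq2[of "a - z0" "- (of_real r * cis t)"] r by (simp add: norm_mult algebra_simps)
        ultimately show "?p t \<in> G" using r by (auto simp: G_def dist_norm norm_minus_commute)
      qed
      \<comment> \<open>If no point of the circle exceeded \<open>D a\<close>, integration would
        leave only the excess of the square: the logarithm and \<open>H k\<close> have exact mean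
        values and U satisfies the submean inequality, so
        \<open>\<epsilon> * r\<^sup>2 \<le> 0\<close>.\<close>
      show "\<exists>S\<subseteq>G. \<exists>z\<in>S. D a < D z"
      proof (rule ccontr)
        assume no: "\<not> ?thesis"
        have le: "D (?p t) \<le> D a" for t
          using no pG[of t] by (auto simp: not_less dest!: spec[of _ "{?p t}"])
        have pR: "?p t \<in> ball z0 \<rho>' - {z0}" for t using pG[of t] \<rho> by (auto simp: G_def)
        have mU: "(\<lambda>t. U (?p t)) \<in> borel_measurable circle_measure"
          by (rule usc_circle_measurable[OF usc pR])
        have UB: "\<bar>U (?p t)\<bar> \<le> \<bar>ln ((norm (a - z0) - r) / R)\<bar>" for t
        proof -
          have "ln ((norm (a - z0) - r) / R) \<le> ln (norm (?p t - z0) / R)"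
            using r R pn[of t] by (intro ln_mono divide_right_mono divide_pos_pos) auto
          then show ?thesis using low[OF pR[of t]] up[OF pR[of t]] by linarith
        qed
        have iU: "integrable circle_measure (\<lambda>t. U (?p t))" by (rule bounded_measurable_circle_integrable[OF mU UB])
        have ra: "r < norm (a - z0)" using r by simp
        note iln = integral_ln_norm_circle[OF r(1) ra]
        have nar: "norm (a - z0) + r < \<rho>" using r by simp
        have iH: "integrable circle_measure (\<lambda>t. H k (a - z0 + of_real r * cis t))"
          and eH: "(\<integral>t. H k (a - z0 + of_real r * cis t) \<partial>circle_measure) = 2 * pi * H k (a - z0)"
          unfolding H_def using poisson_mean_value(2,3)[OF \<rho>(1) \<phi>m \<phi>B r(1) nar] by auto
        note isq = integral_norm_square_circle[of "a - z0" r]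
        have sh: "?p t - z0 = a - z0 + of_real r * cis t" for t by simp
        define L where "L = (\<lambda>t. ln (norm (?p t - z0)))"
        define h where "h = (\<lambda>t. H k (a - z0 + of_real r * cis t))"
        define q where "q = (\<lambda>t. (norm (a - z0 + of_real r * cis t))\<^sup>2)"
        have Ub: "U (?p t) \<le> (D a + \<epsilon> * ln \<rho>) + (1 - \<epsilon>) * L t + h t - \<epsilon> * q t" for t
        proof -
          have "norm (?p t - z0) > 0" using pG[of t] by (auto simp: G_def)
          then have "D (?p t) = U (?p t) - L t - h t + \<epsilon> * (L t - ln \<rho>) + \<epsilon> * q t"
            unfolding D_def g_def L_def h_def q_def sh using \<rho> by (simp add: ln_div)
          then show ?thesis using le[of t] by (simp add: algebra_simps)
        qed
        have i: "integrable circle_measure L" "integrable circle_measure h" "integrable circle_measure q"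
          unfolding L_def h_def q_def using iln(1) iH isq(1) by auto
        have e: "(\<integral>t. L t \<partial>circle_measure) = 2 * pi * ln (norm (a - z0))" "(\<integral>t. h t \<partial>circle_measure) = 2 * pi * H k (a - z0)"
          "(\<integral>t. q t \<partial>circle_measure) = 2 * pi * ((norm (a - z0))\<^sup>2 + r\<^sup>2)"
          unfolding L_def h_def q_def using iln(2) eH isq(2) by auto
        have "2 * pi * U a \<le> (\<integral>t. U (?p t) \<partial>circle_measure)" using \<eta>(2) r by simp
        also have "\<dots> \<le> (\<integral>t. (D a + \<epsilon> * ln \<rho>) + (1 - \<epsilon>) * L t + h t - \<epsilon> * q t \<partial>circle_measure)"
          using iU i Ub by (intro integral_mono) auto
        also have "\<dots> = 2 * pi * (D a + \<epsilon> * ln \<rho>) + (1 - \<epsilon>) * (\<integral>t. L t \<partial>circle_measure) + (\<integral>t. h t \<partial>circle_measure) - \<epsilon> * (\<integral>t. q t \<partial>circle_measure)"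
          using i by simp
        also have "\<dots> = 2 * pi * ((D a + \<epsilon> * ln \<rho>) + (1 - \<epsilon>) * ln (norm (a - z0)) + H k (a - z0) - \<epsilon> * ((norm (a - z0))\<^sup>2 + r\<^sup>2))"
          unfolding e by (simp add: algebra_simps)
        finally have "U a \<le> (D a + \<epsilon> * ln \<rho>) + (1 - \<epsilon>) * ln (norm (a - z0)) + H k (a - z0) - \<epsilon> * ((norm (a - z0))\<^sup>2 + r\<^sup>2)"
          by simp
        moreover have "D a = U a - ln (norm (a - z0)) - H k (a - z0) + \<epsilon> * (ln (norm (a - z0)) - ln \<rho>) + \<epsilon> * (norm (a - z0))\<^sup>2"
          unfolding D_def g_def using na \<rho> by (simp add: ln_div)
        ultimately have "\<epsilon> * r\<^sup>2 \<le> 0" by (simp add: algebra_simps)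
        then show False using \<epsilon> r(1) by (simp add: mult_le_0_iff)
      qed
    qed
    moreover have "0 \<le> \<epsilon> * (norm (z - z0))\<^sup>2" using \<epsilon> by simp
    ultimately show ?thesis by (simp add: D_def g_def V_def algebra_simps)
  qed
  have nz: "0 < norm (z - z0)" "norm (z - z0) < \<rho>" using z by (auto simp: dist_norm norm_minus_commute)
  have le_k: "V z \<le> H k (z - z0)" for k
  proof (rule field_le_epsilon)
    fix e :: real assume e: "0 < e"
    define X where "X = \<rho>\<^sup>2 - ln (norm (z - z0) / \<rho>)"
    have "ln (norm (z - z0) / \<rho>) \<le> 0" using nz \<rho> by auto
    moreover have "\<rho>\<^sup>2 > 0" using \<rho>(1) by simp
    ultimately have X: "X > 0" unfolding X_def by linarith
    have "V z \<le> H k (z - z0) + (e / X) * X" using main[of "e / X" k] e X by (simp add: X_def)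
    then show "V z \<le> H k (z - z0) + e" using X by simp
  qed
  have "(\<lambda>k. H k (z - z0)) \<longlonglongrightarrow> poisson \<rho> (\<lambda>t. V (c t)) (z - z0)"
    unfolding H_def poisson_def
  proof (intro tendsto_divide tendsto_const integral_dominated_convergence)
    let ?k = "\<lambda>t. Re ((\<rho> * cis t + (z - z0)) / (\<rho> * cis t - (z - z0)))"
    show i: "integrable circle_measure (\<lambda>t. B * ?k t)"
      by (rule poisson_integrable[OF nz(2), of "\<lambda>_. B" B]) (use B0 in auto)
    show m: "(\<lambda>t. \<phi> k (c t) * ?k t) \<in> borel_measurable circle_measure" for k
      by (rule borel_measurable_integrable[OF poisson_integrable[OF nz(2) \<phi>m \<phi>B]])
    have lim: "(\<lambda>k. \<phi> k (c t) * ?k t) \<longlonglongrightarrow> V (c t) * ?k t" for t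
      by (intro tendsto_mult tendsto_const \<phi>(4)[OF cS])
    then show "AE t in circle_measure. (\<lambda>k. \<phi> k (c t) * ?k t) \<longlonglongrightarrow> V (c t) * ?k t" by (intro AE_I2)
    show "(\<lambda>t. V (c t) * ?k t) \<in> borel_measurable circle_measure"
      by (rule borel_measurable_LIMSEQ_real[OF lim m])
    show "AE t in circle_measure. norm (\<phi> k (c t) * ?k t) \<le> B * ?k t" for k
      unfolding real_norm_def abs_mult abs_of_nonneg[OF poisson_kernel_nonneg[OF nz(2)]]
      by (intro AE_I2 mult_right_mono \<phi>B poisson_kernel_nonneg[OF nz(2)])
  qed simp
  then have "V z \<le> poisson \<rho> (\<lambda>t. V (c t)) (z - z0)"
    by (rule LIMSEQ_le_const) (use le_k in auto)
  moreover have "V (c t) = U (z0 + of_real \<rho> * cis t) - ln \<rho>" for t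
    using \<rho> by (simp add: V_def c_def norm_mult)
  ultimately show ?thesis by (simp add: V_def)
qed

section \<open>Green's function and logarithmic capacity\<close>

definition green_competitors :: "complex set \<Rightarrow> complex \<Rightarrow> (complex \<Rightarrow> ereal) set"
  where "green_competitors \<Omega> z0 = {u. subharmonic_on u \<Omega> \<and> (\<forall>z\<in>\<Omega>. u z < 0) \<and>
    Limsup (at z0) (\<lambda>z. u z - ereal (ln (cmod (z - z0)))) < \<infinity>}"

lemma Limsup_less_infinity_iff:
  fixes f :: "'a \<Rightarrow> ereal"
  shows "Limsup F f < \<infinity> \<longleftrightarrow> (\<exists>C. \<forall>\<^sub>F x in F. f x \<le> ereal C)"
proof
  assume "Limsup F f < \<infinity>"
  then obtain n :: nat where "Limsup F f < ereal (real n)" using less_PInf_Ex_of_nat by auto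
  then have "\<forall>\<^sub>F x in F. f x < ereal (real n)" by (rule Limsup_lessD)
  then show "\<exists>C. \<forall>\<^sub>F x in F. f x \<le> ereal C" by (auto elim!: eventually_mono intro!: exI[of _ "real n"])
next
  assume "\<exists>C. \<forall>\<^sub>F x in F. f x \<le> ereal C"
  then obtain C where "\<forall>\<^sub>F x in F. f x \<le> ereal C" by blast
  then have "Limsup F f \<le> ereal C" by (rule Limsup_bounded)
  then show "Limsup F f < \<infinity>" by (rule le_less_trans) simp
qed

text \<open>Upper semicontinuity at the pole costs only an upper bound on h: within distance
  \<open>exp (c - B)\<close> of \<open>z0\<close> the logarithm alone pushes the value below
  c.\<close>

lemma open_punctured_sublevel:
  assumes \<Omega>: "open \<Omega>" and eq: "\<And>z. z \<in> \<Omega> - {z0} \<Longrightarrow> u z = ereal (ln (norm (z - z0)) + h z)" and u0: "u z0 = -\<infinity>"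
    and h: "\<And>c. open {z \<in> \<Omega> - {z0}. ln (norm (z - z0)) + h z < c}"
    and B: "\<And>z. z \<in> \<Omega> - {z0} \<Longrightarrow> h z \<le> B"
  shows "open {z \<in> \<Omega>. u z < ereal c}"
proof -
  define e where "e = exp (c - B)"
  have "{z \<in> \<Omega>. u z < ereal c} = {z \<in> \<Omega> - {z0}. ln (norm (z - z0)) + h z < c} \<union> (\<Omega> \<inter> ball z0 e)"
  proof (intro equalityI subsetI)
    fix z assume z: "z \<in> {z \<in> \<Omega>. u z < ereal c}"
    then show "z \<in> {z \<in> \<Omega> - {z0}. ln (norm (z - z0)) + h z < c} \<union> (\<Omega> \<inter> ball z0 e)"
      using eq[of z] by (cases "z = z0") (auto simp: e_def)
  next
    fix z assume z: "z \<in> {z \<in> \<Omega> - {z0}. ln (norm (z - z0)) + h z < c} \<union> (\<Omega> \<inter> ball z0 e)"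
    show "z \<in> {z \<in> \<Omega>. u z < ereal c}"
    proof (cases "z \<in> \<Omega> \<inter> ball z0 e \<and> z \<noteq> z0")
      case True
      then have "0 < norm (z - z0)" "norm (z - z0) < exp (c - B)" by (auto simp: e_def dist_norm norm_minus_commute)
      then have "ln (norm (z - z0)) < ln (exp (c - B))" by (subst ln_less_cancel_iff) auto
      then have "ln (norm (z - z0)) < c - B" by simp
      then show ?thesis using True eq[of z] B[of z] by auto
    next
      case False
      then show ?thesis using z eq[of z] u0 by (cases "z = z0") auto
    qed
  qed
  moreover have "open (\<Omega> \<inter> ball z0 e)" using \<Omega> by auto
  ultimately show ?thesis using h[of c] by auto
qed

lemma circle_in_punctured_ball:
  assumes "0 < r" "r < norm (a - z0)" "norm (a - z0) + r < \<rho>"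
  shows "a + of_real r * cis t \<in> ball z0 \<rho> - {z0}" "norm (a - z0) - r \<le> norm (a + of_real r * cis t - z0)"
proof -
  have "norm (a + of_real r * cis t - z0) \<le> norm (a - z0) + r"
    using norm_triangle_ineq[of "a - z0" "of_real r * cis t"] assms(1) by (simp add: norm_mult algebra_simps)
  moreover show "norm (a - z0) - r \<le> norm (a + of_real r * cis t - z0)"
    using norm_triangle_ineq2[of "a - z0" "- (of_real r * cis t)"] assms(1) by (simp add: norm_mult algebra_simps)
  ultimately show "a + of_real r * cis t \<in> ball z0 \<rho> - {z0}" using assms by (auto simp: dist_norm norm_minus_commute)
qed

text \<open>Adding a bounded continuous function with the submean property to the logarithm keeps it
  subharmonic: at \<open>z0\<close> the value \<open>-\<infinity>\<close> makes the inequality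
  trivial, and circles about other points are chosen to avoid \<open>z0\<close>.\<close>

lemma green_competitor_intro:
  assumes \<Omega>: "open \<Omega>" "z0 \<in> \<Omega>" "R > 0"
    and cont: "continuous_on \<Omega> h" and B: "\<And>z. z \<in> \<Omega> \<Longrightarrow> \<bar>h z\<bar> \<le> B"
    and sub: "\<And>a. a \<in> \<Omega> \<Longrightarrow> \<exists>\<eta>>0. \<forall>r. 0 < r \<and> r < \<eta> \<longrightarrow> 2 * pi * h a \<le> (\<integral>t. h (a + of_real r * cis t) \<partial>circle_measure)"
    and neg: "\<And>z. z \<in> \<Omega> - {z0} \<Longrightarrow> ln (norm (z - z0) / R) + h z < 0"
  shows "(\<lambda>z. if z = z0 then -\<infinity> else ereal (ln (norm (z - z0) / R) + h z)) \<in> green_competitors \<Omega> z0"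
proof -
  let ?u = "\<lambda>z. if z = z0 then -\<infinity> else ereal (ln (norm (z - z0) / R) + h z)"
  have eq: "?u z = ereal (ln (norm (z - z0)) + (h z - ln R))" if "z \<in> \<Omega> - {z0}" for z
    using that \<Omega>(3) by (simp add: ln_div)
  have "subharmonic_on ?u \<Omega>"
    unfolding subharmonic_on_def
  proof (intro conjI ballI allI)
    show "?u z < \<infinity>" if "z \<in> \<Omega>" for z by simp
    show "open {z \<in> \<Omega>. ?u z < ereal c}" for c :: real
    proof (rule open_punctured_sublevel[OF \<Omega>(1) eq])
      have "open (\<Omega> - {z0})" using \<Omega>(1) by (rule open_delete)
      moreover have "continuous_on (\<Omega> - {z0}) (\<lambda>z. ln (norm (z - z0)) + (h z - ln R))"
        by (intro continuous_intros continuous_on_subset[OF cont]) auto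
      ultimately have "open ((\<Omega> - {z0}) \<inter> (\<lambda>z. ln (norm (z - z0)) + (h z - ln R)) -` {..<c})" for c
        by (intro continuous_open_preimage) auto
      moreover have "(\<Omega> - {z0}) \<inter> (\<lambda>z. ln (norm (z - z0)) + (h z - ln R)) -` {..<c} =
          {z \<in> \<Omega> - {z0}. ln (norm (z - z0)) + (h z - ln R) < c}" for c by auto
      ultimately show "open {z \<in> \<Omega> - {z0}. ln (norm (z - z0)) + (h z - ln R) < c}" for c by simp
      show "h z - ln R \<le> B - ln R" if "z \<in> \<Omega> - {z0}" for z using B[of z] that by auto
    qed auto
  next
    fix a assume a: "a \<in> \<Omega>"
    obtain d where d: "d > 0" "ball a d \<subseteq> \<Omega>" using a \<Omega>(1) openE by blast
    show "\<exists>\<rho>>0. ball a \<rho> \<subseteq> \<Omega> \<and> (\<forall>r. 0 < r \<and> r < \<rho> \<longrightarrow> ?u a \<le> circle_mean ?u a r)"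
    proof (cases "a = z0")
      case True
      then show ?thesis using d by auto
    next
      case False
      obtain \<eta> where \<eta>: "\<eta> > 0" "\<And>r. 0 < r \<Longrightarrow> r < \<eta> \<Longrightarrow> 2 * pi * h a \<le> (\<integral>t. h (a + of_real r * cis t) \<partial>circle_measure)"
        using sub[OF a] by blast
      define m where "m = min d (min \<eta> (norm (a - z0)))"
      have m: "0 < m" "m \<le> d" "m \<le> \<eta>" "m \<le> norm (a - z0)" using d \<eta> False by (auto simp: m_def)
      show ?thesis
      proof (intro exI[of _ m] conjI allI impI)
        show "ball a m \<subseteq> \<Omega>" using d m by auto
        fix r assume r: "0 < r \<and> r < m"
        have ra: "0 < r" "r < norm (a - z0)" using r m by auto
        have on: "a + of_real r * cis t \<in> \<Omega>" for t using d m r by (auto simp: dist_norm norm_mult subset_iff)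
        have nz: "a + of_real r * cis t \<noteq> z0" for t
          using circle_in_punctured_ball(1)[OF ra less_add_one[of "norm (a - z0) + r"]] by blast
        have "continuous_on {0..2 * pi} (\<lambda>t. h (a + of_real r * cis t))"
          by (rule continuous_on_compose2[OF cont continuous_on_circle]) (use on in auto)
        then have ih: "integrable circle_measure (\<lambda>t. h (a + of_real r * cis t))"
          by (rule continuous_imp_integrable_circle_measure(1))
        note il = integral_ln_norm_circle[OF ra]
        define v where "v = (\<lambda>z. ln (norm (z - z0)) + (h z - ln R))"
        have iv: "integrable circle_measure (\<lambda>t. v (a + of_real r * cis t))"
          unfolding v_def using il(1) ih by auto
        have "(\<integral>t. v (a + of_real r * cis t) \<partial>circle_measure) =
            2 * pi * ln (norm (a - z0)) + ((\<integral>t. h (a + of_real r * cis t) \<partial>circle_measure) - 2 * pi * ln R)"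
          unfolding v_def using il ih by simp
        also have "\<dots> \<ge> 2 * pi * ln (norm (a - z0)) + (2 * pi * h a - 2 * pi * ln R)"
          using \<eta>(2) r m by simp
        finally have "2 * pi * v a \<le> (\<integral>t. v (a + of_real r * cis t) \<partial>circle_measure)"
          by (simp add: v_def algebra_simps)
        moreover have "circle_mean ?u a r = ereal ((\<integral>t. v (a + of_real r * cis t) \<partial>circle_measure) / (2 * pi))"
          by (rule circle_mean_eq_integral[OF iv]) (use nz on eq in \<open>simp add: v_def\<close>)
        ultimately show "?u a \<le> circle_mean ?u a r"
        proof -
          assume le: "2 * pi * v a \<le> (\<integral>t. v (a + of_real r * cis t) \<partial>circle_measure)"
            and mean: "circle_mean ?u a r = ereal ((\<integral>t. v (a + of_real r * cis t) \<partial>circle_measure) / (2 * pi))"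
          have "v a \<le> (\<integral>t. v (a + of_real r * cis t) \<partial>circle_measure) / (2 * pi)"
            using le by (simp add: pos_le_divide_eq mult.commute)
          moreover have "?u a = ereal (v a)" unfolding v_def by (rule eq) (use a False in simp)
          ultimately show ?thesis unfolding mean by simp
        qed
      qed (use m in simp)
    qed
  qed
  moreover have "\<forall>z\<in>\<Omega>. ?u z < 0" using neg by auto
  moreover have "\<forall>\<^sub>F z in at z0. ?u z - ereal (ln (norm (z - z0))) \<le> ereal (B - ln R)"
    using eventually_at_in_open[OF \<Omega>(1,2)]
  proof eventually_elim
    case (elim z)
    then have "?u z - ereal (ln (norm (z - z0))) = ereal (h z - ln R)" using eq[of z] by simp
    then show ?case using B[of z] elim by auto
  qed
  then have "Limsup (at z0) (\<lambda>z. ?u z - ereal (ln (norm (z - z0)))) < \<infinity>"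
    unfolding Limsup_less_infinity_iff by blast
  ultimately show ?thesis by (simp add: green_competitors_def)
qed

lemma subharmonic_on_max:
  assumes u: "subharmonic_on u \<Omega>" and v: "subharmonic_on v \<Omega>"
  shows "subharmonic_on (\<lambda>z. max (u z) (v z)) \<Omega>"
  unfolding subharmonic_on_def
proof (intro conjI ballI allI)
  show "max (u z) (v z) < \<infinity>" if "z \<in> \<Omega>" for z
  proof -
    have "u z < \<infinity>" "v z < \<infinity>" using u v that unfolding subharmonic_on_def by blast+
    then show ?thesis by (simp add: max_def)
  qed
  show "open {z \<in> \<Omega>. max (u z) (v z) < ereal c}" for c :: real
  proof -
    have "{z \<in> \<Omega>. max (u z) (v z) < ereal c} = {z \<in> \<Omega>. u z < ereal c} \<inter> {z \<in> \<Omega>. v z < ereal c}" by auto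
    moreover have "open {z \<in> \<Omega>. u z < ereal c}" "open {z \<in> \<Omega>. v z < ereal c}"
      using u v unfolding subharmonic_on_def by blast+
    ultimately show ?thesis by (simp only: open_Int)
  qed
  fix a assume a: "a \<in> \<Omega>"
  obtain d1 where d1: "d1 > 0" "ball a d1 \<subseteq> \<Omega>" "\<And>r. 0 < r \<Longrightarrow> r < d1 \<Longrightarrow> u a \<le> circle_mean u a r"
    using u a unfolding subharmonic_on_def by blast
  obtain d2 where d2: "d2 > 0" "\<And>r. 0 < r \<Longrightarrow> r < d2 \<Longrightarrow> v a \<le> circle_mean v a r"
    using v a unfolding subharmonic_on_def by blast
  show "\<exists>\<rho>>0. ball a \<rho> \<subseteq> \<Omega> \<and> (\<forall>r. 0 < r \<and> r < \<rho> \<longrightarrow> max (u a) (v a) \<le> circle_mean (\<lambda>z. max (u z) (v z)) a r)"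
  proof (intro exI[of _ "min d1 d2"] conjI allI impI)
    show "ball a (min d1 d2) \<subseteq> \<Omega>" using d1 by auto
    fix r assume r: "0 < r \<and> r < min d1 d2"
    have "u a \<le> circle_mean u a r" using d1(3) r by simp
    also have "\<dots> \<le> circle_mean (\<lambda>z. max (u z) (v z)) a r" by (rule circle_mean_mono) simp
    finally have "u a \<le> circle_mean (\<lambda>z. max (u z) (v z)) a r" .
    moreover have "v a \<le> circle_mean v a r" using d2(2) r by simp
    then have "v a \<le> circle_mean (\<lambda>z. max (u z) (v z)) a r"
      by (rule order_trans) (rule circle_mean_mono, simp)
    ultimately show "max (u a) (v a) \<le> circle_mean (\<lambda>z. max (u z) (v z)) a r" by simp
  qed (use d1 d2 in simp)
qed

lemma green_competitors_max:
  assumes "u \<in> green_competitors \<Omega> z0" "v \<in> green_competitors \<Omega> z0"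
  shows "(\<lambda>z. max (u z) (v z)) \<in> green_competitors \<Omega> z0"
proof -
  obtain C1 where 1: "\<forall>\<^sub>F z in at z0. u z - ereal (ln (cmod (z - z0))) \<le> ereal C1"
    using assms(1) unfolding green_competitors_def Limsup_less_infinity_iff by blast
  obtain C2 where 2: "\<forall>\<^sub>F z in at z0. v z - ereal (ln (cmod (z - z0))) \<le> ereal C2"
    using assms(2) unfolding green_competitors_def Limsup_less_infinity_iff by blast
  have "\<forall>\<^sub>F z in at z0. max (u z) (v z) - ereal (ln (cmod (z - z0))) \<le> ereal (max C1 C2)"
    using 1 2
  proof eventually_elim
    case (elim z)
    have "ereal C1 \<le> ereal (max C1 C2)" "ereal C2 \<le> ereal (max C1 C2)" by simp_all
    then have "u z - ereal (ln (cmod (z - z0))) \<le> ereal (max C1 C2)" "v z - ereal (ln (cmod (z - z0))) \<le> ereal (max C1 C2)"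
      using elim order_trans by blast+
    then show ?case unfolding max_def[of "u z"] by simp
  qed
  then have "Limsup (at z0) (\<lambda>z. max (u z) (v z) - ereal (ln (cmod (z - z0)))) < \<infinity>"
    unfolding Limsup_less_infinity_iff by blast
  moreover have "max (u z) (v z) < 0" if "z \<in> \<Omega>" for z
  proof -
    have "u z < 0" "v z < 0" using assms that unfolding green_competitors_def by blast+
    then show ?thesis by (simp add: max_def)
  qed
  moreover have "subharmonic_on (\<lambda>z. max (u z) (v z)) \<Omega>"
    using assms by (intro subharmonic_on_max) (simp_all add: green_competitors_def)
  ultimately show ?thesis unfolding green_competitors_def by blast
qed

section \<open>Poisson modification of a competitor\<close>

context
  fixes \<Omega> :: "complex set" and z0 :: complex and R \<rho> :: real and u :: "complex \<Rightarrow> ereal"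
  assumes \<Omega>: "open \<Omega>" "z0 \<in> \<Omega>" "\<Omega> \<subseteq> ball z0 R"
    and \<rho>: "0 < \<rho>" "ball z0 (2 * \<rho>) \<subseteq> \<Omega>"
    and u: "u \<in> green_competitors \<Omega> z0"
    and low: "\<And>z. z \<in> \<Omega> - {z0} \<Longrightarrow> ereal (ln (norm (z - z0) / R)) \<le> u z"
begin

text \<open>Near \<open>z0\<close> a competitor is replaced by the logarithm plus a harmonic function. This does not decrease
  it, and the harmonic parts control the supremum of all competitors near \<open>z0\<close>, which yields the limit
  in the definition of the logarithmic capacity.\<close>

definition poisson_part :: "complex \<Rightarrow> real"
  where "poisson_part = poisson \<rho> (\<lambda>t. real_of_ereal (u (z0 + of_real \<rho> * cis t)) - ln \<rho>)"

definition poisson_modification :: "complex \<Rightarrow> ereal"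
  where "poisson_modification z = (if z = z0 then -\<infinity> else if norm (z - z0) < \<rho>
     then ereal (ln (norm (z - z0)) + poisson_part (z - z0)) else u z)"

private lemma R: "R > 0" using \<Omega>(2,3) by (auto intro: le_less_trans[OF zero_le_dist])

text \<open>Negativity and the logarithmic lower bound make u finite off \<open>z0\<close>, with
  bounds on the circle that involve only R and \<rho>.\<close>

private lemma u_real: "z \<in> \<Omega> - {z0} \<Longrightarrow> u z = ereal (real_of_ereal (u z))"
  and u_bounds: "z \<in> \<Omega> - {z0} \<Longrightarrow> ln (norm (z - z0) / R) \<le> real_of_ereal (u z) \<and> real_of_ereal (u z) \<le> 0"
proof -
  assume z: "z \<in> \<Omega> - {z0}"
  have "u z < 0" using u z by (auto simp: green_competitors_def)
  then have fin: "\<bar>u z\<bar> \<noteq> \<infinity>" using low[OF z] by (cases "u z") auto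
  then show eq: "u z = ereal (real_of_ereal (u z))" by (simp add: ereal_real)
  show "ln (norm (z - z0) / R) \<le> real_of_ereal (u z) \<and> real_of_ereal (u z) \<le> 0"
    using low[OF z] \<open>u z < 0\<close> by (cases "u z") auto
qed

private lemma usc: "open {z \<in> ball z0 (2 * \<rho>) - {z0}. real_of_ereal (u z) < c}"
proof -
  have "{z \<in> ball z0 (2 * \<rho>) - {z0}. real_of_ereal (u z) < c} = {z \<in> \<Omega>. u z < ereal c} \<inter> (ball z0 (2 * \<rho>) - {z0})"
  proof (intro set_eqI)
    fix z
    show "z \<in> {z \<in> ball z0 (2 * \<rho>) - {z0}. real_of_ereal (u z) < c} \<longleftrightarrow> z \<in> {z \<in> \<Omega>. u z < ereal c} \<inter> (ball z0 (2 * \<rho>) - {z0})"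
    proof (cases "z \<in> ball z0 (2 * \<rho>) - {z0}")
      case True
      then have "z \<in> \<Omega> - {z0}" using \<rho> by auto
      then obtain x where "u z = ereal x" using u_real by blast
      then show ?thesis using True \<rho> by auto
    qed auto
  qed
  moreover have "open {z \<in> \<Omega>. u z < ereal c}" using u by (auto simp: green_competitors_def subharmonic_on_def)
  ultimately show ?thesis by (auto intro: open_delete)
qed

private lemma boundary_measurable:
  "(\<lambda>t. real_of_ereal (u (z0 + of_real \<rho> * cis t)) - ln \<rho>) \<in> borel_measurable circle_measure"
proof -
  have "z0 + of_real \<rho> * cis t \<in> ball z0 (2 * \<rho>) - {z0}" for t using \<rho>(1) by (auto simp: dist_norm norm_mult)
  then have "(\<lambda>t. real_of_ereal (u (z0 + of_real \<rho> * cis t))) \<in> borel_measurable circle_measure"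
    by (rule usc_circle_measurable[OF usc])
  then show ?thesis by simp
qed

private lemma boundary_bounds:
  "real_of_ereal (u (z0 + of_real \<rho> * cis t)) - ln \<rho> \<le> - ln \<rho>"
  "\<bar>real_of_ereal (u (z0 + of_real \<rho> * cis t)) - ln \<rho>\<bar> \<le> \<bar>ln R\<bar> + \<bar>ln \<rho>\<bar>"
proof -
  have "z0 + of_real \<rho> * cis t \<in> ball z0 (2 * \<rho>) - {z0}" using \<rho>(1) by (auto simp: dist_norm norm_mult)
  then have "z0 + of_real \<rho> * cis t \<in> \<Omega> - {z0}" using \<rho>(2) by auto
  moreover have "norm (z0 + of_real \<rho> * cis t - z0) = \<rho>" using \<rho>(1) by (simp add: norm_mult)
  moreover have "ln (\<rho> / R) = ln \<rho> - ln R" using \<rho>(1) R by (simp add: ln_div)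
  ultimately have "ln \<rho> - ln R \<le> real_of_ereal (u (z0 + of_real \<rho> * cis t))"
    "real_of_ereal (u (z0 + of_real \<rho> * cis t)) \<le> 0"
    using u_bounds by metis+
  then show "real_of_ereal (u (z0 + of_real \<rho> * cis t)) - ln \<rho> \<le> - ln \<rho>"
    "\<bar>real_of_ereal (u (z0 + of_real \<rho> * cis t)) - ln \<rho>\<bar> \<le> \<bar>ln R\<bar> + \<bar>ln \<rho>\<bar>"
    by linarith+
qed

text \<open>The constant involves R and \<rho> but not the competitor u.\<close>

lemma poisson_part_center_diff:
  "norm z < \<rho> \<Longrightarrow> \<bar>poisson_part z - poisson_part 0\<bar> \<le> (\<bar>ln R\<bar> + \<bar>ln \<rho>\<bar>) * (2 * norm z / (\<rho> - norm z))"
  unfolding poisson_part_def by (rule poisson_center_diff[OF _ boundary_measurable boundary_bounds(2)])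

lemma poisson_part_le: "norm z < \<rho> \<Longrightarrow> poisson_part z \<le> - ln \<rho>"
proof -
  assume z: "norm z < \<rho>"
  have "poisson_part z \<le> poisson \<rho> (\<lambda>_. - ln \<rho>) z"
    unfolding poisson_part_def
    by (rule poisson_mono[OF z boundary_measurable boundary_bounds(2), of _ "\<bar>ln \<rho>\<bar>"]) (use boundary_bounds(1) in auto)
  then show "poisson_part z \<le> - ln \<rho>" by (simp add: poisson_const[OF z])
qed

private lemma u_submean:
  assumes a: "a \<in> ball z0 (2 * \<rho>) - {z0}"
  shows "\<exists>\<eta>>0. \<forall>r. 0 < r \<and> r < \<eta> \<longrightarrow>
    2 * pi * real_of_ereal (u a) \<le> (\<integral>t. real_of_ereal (u (a + of_real r * cis t)) \<partial>circle_measure)"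
proof -
  have a\<Omega>: "a \<in> \<Omega>" "a \<in> \<Omega> - {z0}" using a \<rho> by auto
  have na: "0 < norm (a - z0)" "norm (a - z0) < 2 * \<rho>" using a by (auto simp: dist_norm norm_minus_commute)
  obtain d where d: "d > 0" "\<And>r. 0 < r \<Longrightarrow> r < d \<Longrightarrow> u a \<le> circle_mean u a r"
    using u a\<Omega> unfolding green_competitors_def subharmonic_on_def by blast
  define m where "m = min d (min (norm (a - z0)) (2 * \<rho> - norm (a - z0)))"
  have "0 < m" using d na by (simp add: m_def)
  moreover have "2 * pi * real_of_ereal (u a) \<le> (\<integral>t. real_of_ereal (u (a + of_real r * cis t)) \<partial>circle_measure)"
    if "0 < r \<and> r < m" for r
  proof -
    have r: "0 < r" "r < d" "r < norm (a - z0)" "norm (a - z0) + r < 2 * \<rho>" using that by (auto simp: m_def)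
    note on = circle_in_punctured_ball[OF r(1,3,4)]
    have on\<Omega>: "a + of_real r * cis t \<in> \<Omega> - {z0}" for t using on(1)[of t] \<rho>(2) by auto
    have "\<bar>real_of_ereal (u (a + of_real r * cis t))\<bar> \<le> \<bar>ln ((norm (a - z0) - r) / R)\<bar>" for t
    proof -
      have "ln ((norm (a - z0) - r) / R) \<le> ln (norm (a + of_real r * cis t - z0) / R)"
        using r R on(2)[of t] by (intro ln_mono divide_right_mono divide_pos_pos) auto
      then show ?thesis using u_bounds[OF on\<Omega>[of t]] by linarith
    qed
    then have i: "integrable circle_measure (\<lambda>t. real_of_ereal (u (a + of_real r * cis t)))"
      by (intro bounded_measurable_circle_integrable[OF usc_circle_measurable[OF usc on(1)]])
    have "circle_mean u a r = ereal ((\<integral>t. real_of_ereal (u (a + of_real r * cis t)) \<partial>circle_measure) / (2 * pi))"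
      by (rule circle_mean_eq_integral[OF i u_real[OF on\<Omega>]])
    then have "ereal (real_of_ereal (u a)) \<le> ereal ((\<integral>t. real_of_ereal (u (a + of_real r * cis t)) \<partial>circle_measure) / (2 * pi))"
      using d(2)[OF r(1,2)] u_real[OF a\<Omega>(2)] by simp
    then show ?thesis by (simp add: pos_le_divide_eq mult.commute)
  qed
  ultimately show ?thesis by blast
qed

lemma le_poisson_modification: "u z \<le> poisson_modification z" if z: "z \<in> \<Omega> - {z0}"
proof (cases "norm (z - z0) < \<rho>")
  case True
  then have zb: "z \<in> ball z0 \<rho> - {z0}" using z by (auto simp: dist_norm norm_minus_commute)
  obtain C where C: "\<forall>\<^sub>F z in at z0. u z - ereal (ln (cmod (z - z0))) \<le> ereal C"
    using u unfolding green_competitors_def Limsup_less_infinity_iff by blast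
  have sub: "w \<in> \<Omega> - {z0}" if "w \<in> ball z0 (2 * \<rho>) - {z0}" for w using that \<rho>(2) by auto
  have pole: "\<forall>\<^sub>F w in at z0. real_of_ereal (u w) - ln (norm (w - z0)) \<le> C"
    using C eventually_at_in_open[OF \<Omega>(1,2)]
  proof eventually_elim
    case (elim w)
    then obtain x where "u w = ereal x" using u_real by blast
    then show ?case using elim(1) by simp
  qed
  have "real_of_ereal (u z) - ln (norm (z - z0)) \<le> poisson_part (z - z0)"
    unfolding poisson_part_def
    by (rule subharmonic_le_poisson[OF \<rho>(1) _ R usc _ _ u_submean pole zb]) (use \<rho> u_bounds sub in auto)
  then have "ereal (real_of_ereal (u z)) \<le> ereal (ln (norm (z - z0)) + poisson_part (z - z0))" by simp
  then show ?thesis using u_real[OF z] True z by (simp add: poisson_modification_def)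
next
  case False
  then show ?thesis using z by (simp add: poisson_modification_def)
qed

text \<open>Inside the circle the modification is a logarithm plus a harmonic function; elsewhere it
  equals u and dominates u on nearby circles, so submean inequalities for u persist. The bound
  \<open>- ln \<rho>\<close> on the harmonic part yields negativity and control of the pole.\<close>

lemma poisson_modification_competitor: "poisson_modification \<in> green_competitors \<Omega> z0"
proof -
  define B where "B = \<bar>ln R\<bar> + \<bar>ln \<rho>\<bar>"
  note bb = boundary_measurable boundary_bounds(2)
  have cP: "continuous_on (ball 0 \<rho>) poisson_part"
    unfolding poisson_part_def by (rule poisson_mean_value(1)[OF \<rho>(1) bb])
  have ball\<Omega>: "ball z0 \<rho> \<subseteq> \<Omega>" using \<rho> by auto
  have u\<Omega>: "open {z \<in> \<Omega>. u z < ereal c}" for c :: real using u by (auto simp: green_competitors_def subharmonic_on_def)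
  have inner_open: "open {z \<in> ball z0 \<rho>. poisson_modification z < ereal c}" for c :: real
  proof (rule open_punctured_sublevel[of "ball z0 \<rho>" z0 poisson_modification "\<lambda>z. poisson_part (z - z0)" "- ln \<rho>"])
    show "poisson_modification z = ereal (ln (norm (z - z0)) + poisson_part (z - z0))" if "z \<in> ball z0 \<rho> - {z0}" for z
      using that by (auto simp: poisson_modification_def dist_norm norm_minus_commute)
    show "poisson_part (z - z0) \<le> - ln \<rho>" if "z \<in> ball z0 \<rho> - {z0}" for z
      using that by (intro poisson_part_le) (auto simp: dist_norm norm_minus_commute)
    show "open {z \<in> ball z0 \<rho> - {z0}. ln (norm (z - z0)) + poisson_part (z - z0) < c}" for c
    proof -
      have "continuous_on (ball z0 \<rho> - {z0}) (\<lambda>z. ln (norm (z - z0)) + poisson_part (z - z0))"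
        by (intro continuous_intros continuous_on_compose2[OF cP]) (auto simp: dist_norm norm_minus_commute)
      then have "open ((ball z0 \<rho> - {z0}) \<inter> (\<lambda>z. ln (norm (z - z0)) + poisson_part (z - z0)) -` {..<c})"
        by (intro continuous_open_preimage) (auto intro: open_delete)
      moreover have "(ball z0 \<rho> - {z0}) \<inter> (\<lambda>z. ln (norm (z - z0)) + poisson_part (z - z0)) -` {..<c} =
          {z \<in> ball z0 \<rho> - {z0}. ln (norm (z - z0)) + poisson_part (z - z0) < c}" by auto
      ultimately show ?thesis by simp
    qed
  qed (simp_all add: poisson_modification_def)
  have "subharmonic_on poisson_modification \<Omega>"
    unfolding subharmonic_on_def
  proof (intro conjI ballI allI)
    show "poisson_modification z < \<infinity>" if "z \<in> \<Omega>" for z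
      using u that by (auto simp: poisson_modification_def green_competitors_def subharmonic_on_def)
    show "open {z \<in> \<Omega>. poisson_modification z < ereal c}" for c :: real
    proof (rule Topological_Spaces.openI)
      fix x assume x: "x \<in> {z \<in> \<Omega>. poisson_modification z < ereal c}"
      consider "norm (x - z0) < \<rho>" | "norm (x - z0) = \<rho>" | "norm (x - z0) > \<rho>" by linarith
      then show "\<exists>T. open T \<and> x \<in> T \<and> T \<subseteq> {z \<in> \<Omega>. poisson_modification z < ereal c}"
      proof cases
        case 1
        then show ?thesis using inner_open[of c] x ball\<Omega>
          by (intro exI[of _ "{z \<in> ball z0 \<rho>. poisson_modification z < ereal c}"]) (auto simp: dist_norm norm_minus_commute)
      next
        case 3
        have "open ({z \<in> \<Omega>. u z < ereal c} \<inter> (- cball z0 \<rho>))" using u\<Omega> by auto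
        moreover have pm: "poisson_modification z = u z" if "norm (z - z0) > \<rho>" for z
          using that \<rho>(1) by (auto simp: poisson_modification_def)
        then have "x \<in> {z \<in> \<Omega>. u z < ereal c} \<inter> (- cball z0 \<rho>)"
          using x 3 by (simp add: dist_norm norm_minus_commute)
        moreover have "{z \<in> \<Omega>. u z < ereal c} \<inter> (- cball z0 \<rho>) \<subseteq> {z \<in> \<Omega>. poisson_modification z < ereal c}"
          using pm by (auto simp: dist_norm norm_minus_commute)
        ultimately show ?thesis by blast
      next
        case 2
        \<comment> \<open>On the circle both definitions meet. Upper semicontinuity of u gives
          \<open>u < c1\<close> near x, which handles outside points directly and, through
          \<open>poisson_boundary_le\<close>, inside points at the cost of half the gap between
          \<open>c1\<close> and c.\<close>
        have xne: "x \<noteq> z0" using 2 \<rho>(1) by auto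
        have x\<Omega>: "x \<in> \<Omega> - {z0}" using x xne by simp
        have "u x < ereal c" using x 2 xne by (simp add: poisson_modification_def)
        then have "real_of_ereal (u x) < c" using u_real[OF x\<Omega>] by (metis ereal_less_eq(3) not_le)
        then obtain c1 where c1: "real_of_ereal (u x) < c1" "c1 < c" using dense by blast
        have "u x < ereal c1" using c1(1) u_real[OF x\<Omega>] by (metis ereal_less(2) less_ereal.simps(1))
        then obtain \<delta> where \<delta>: "\<delta> > 0" "ball x \<delta> \<subseteq> {z \<in> \<Omega>. u z < ereal c1}"
          using u\<Omega>[of c1] x openE[OF u\<Omega>[of c1], of x] by auto
        have near: "real_of_ereal (u (z0 + of_real \<rho> * cis t)) - ln \<rho> \<le> c1 - ln \<rho>" if "norm (\<rho> * cis t - (x - z0)) < \<delta>" for t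
        proof -
          have "z0 + of_real \<rho> * cis t \<in> ball x \<delta>" using that by (simp add: dist_norm norm_minus_commute algebra_simps)
          then have lt: "z0 + of_real \<rho> * cis t \<in> \<Omega>" "u (z0 + of_real \<rho> * cis t) < ereal c1" using \<delta>(2) by auto
          have "z0 + of_real \<rho> * cis t \<in> \<Omega> - {z0}" using lt \<rho>(1) by auto
          then obtain y where "u (z0 + of_real \<rho> * cis t) = ereal y" using u_real by blast
          then show ?thesis using lt(2) by simp
        qed
        have "(c - c1) / 2 > 0" using c1 by simp
        then obtain d where d: "d > 0" "\<And>w. norm w < \<rho> \<Longrightarrow> norm (w - (x - z0)) < d \<Longrightarrow> poisson_part w \<le> (c1 - ln \<rho>) + (c - c1) / 2"
          using poisson_boundary_le[OF \<rho>(1) bb 2 \<delta>(1) near] unfolding poisson_part_def by blast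
        have mid: "c1 + (c - c1) / 2 < c" using c1 by (simp add: field_simps)
        show ?thesis
        proof (intro exI[of _ "ball x (min \<delta> (min d \<rho>))"] conjI subsetI)
          fix z assume z: "z \<in> ball x (min \<delta> (min d \<rho>))"
          have z\<Omega>: "z \<in> \<Omega>" "u z < ereal c1" using z \<delta>(2) by auto
          have zne: "z \<noteq> z0" using z 2 by (auto simp: dist_norm)
          have "poisson_modification z < ereal c"
          proof (cases "norm (z - z0) < \<rho>")
            case True
            have "norm ((z - z0) - (x - z0)) < d" using z by (simp add: dist_norm norm_minus_commute)
            then have "poisson_part (z - z0) \<le> (c1 - ln \<rho>) + (c - c1) / 2" using d(2)[OF True] by blast
            moreover have "ln (norm (z - z0)) \<le> ln \<rho>" using True zne \<rho> by simp
            ultimately have "ln (norm (z - z0)) + poisson_part (z - z0) < c" using mid by linarith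
            then show ?thesis using True zne by (simp add: poisson_modification_def)
          next
            case False
            have "u z < ereal c" using z\<Omega>(2) c1(2) by (meson less_ereal.simps(1) less_trans)
            then show ?thesis using False zne by (simp add: poisson_modification_def)
          qed
          then show "z \<in> {z \<in> \<Omega>. poisson_modification z < ereal c}" using z\<Omega> by simp
        qed (use \<delta> d \<rho> in auto)
      qed
    qed
  next
    fix a assume a: "a \<in> \<Omega>"
    show "\<exists>\<eta>>0. ball a \<eta> \<subseteq> \<Omega> \<and> (\<forall>r. 0 < r \<and> r < \<eta> \<longrightarrow> poisson_modification a \<le> circle_mean poisson_modification a r)"
    proof (cases "norm (a - z0) < \<rho>")
      case True
      show ?thesis
      proof (cases "a = z0")
        case True
        then show ?thesis using \<rho> by (intro exI[of _ "2 * \<rho>"]) (simp add: poisson_modification_def)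
      next
        case False
        define m where "m = min (norm (a - z0)) (\<rho> - norm (a - z0))"
        have m: "0 < m" using False True by (simp add: m_def)
        show ?thesis
        proof (intro exI[of _ m] conjI allI impI m)
          show "ball a m \<subseteq> \<Omega>"
          proof
            fix y assume "y \<in> ball a m"
            then have "dist z0 y < \<rho>" using dist_triangle[of z0 y a] by (simp add: m_def dist_norm norm_minus_commute)
            then show "y \<in> \<Omega>" using ball\<Omega> by auto
          qed
          fix r assume r: "0 < r \<and> r < m"
          then have rr: "0 < r" "r < norm (a - z0)" "norm (a - z0) + r < \<rho>" by (auto simp: m_def)
          note on = circle_in_punctured_ball[OF rr]
          define v where "v = (\<lambda>z. ln (norm (z - z0)) + poisson_part (z - z0))"
          have sh: "a + of_real r * cis t - z0 = (a - z0) + of_real r * cis t" for t by simp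
          have iP: "integrable circle_measure (\<lambda>t. poisson_part (a + of_real r * cis t - z0))"
            and eP: "(\<integral>t. poisson_part (a + of_real r * cis t - z0) \<partial>circle_measure) = 2 * pi * poisson_part (a - z0)"
            unfolding sh poisson_part_def using poisson_mean_value(2,3)[OF \<rho>(1) bb rr(1,3)] by auto
          note il = integral_ln_norm_circle[OF rr(1,2)]
          have iv: "integrable circle_measure (\<lambda>t. v (a + of_real r * cis t))"
            unfolding v_def by (intro Bochner_Integration.integrable_add il(1) iP)
          have "(\<integral>t. v (a + of_real r * cis t) \<partial>circle_measure) = 2 * pi * v a"
            unfolding v_def Bochner_Integration.integral_add[OF il(1) iP] il(2) eP by (simp add: algebra_simps)
          moreover have "circle_mean poisson_modification a r = ereal ((\<integral>t. v (a + of_real r * cis t) \<partial>circle_measure) / (2 * pi))"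
          proof (rule circle_mean_eq_integral[OF iv])
            fix t
            show "poisson_modification (a + of_real r * cis t) = ereal (v (a + of_real r * cis t))"
              using on(1)[of t] unfolding poisson_modification_def v_def by (auto simp: dist_norm norm_minus_commute)
          qed
          ultimately show "poisson_modification a \<le> circle_mean poisson_modification a r"
            using True False by (simp add: poisson_modification_def v_def)
        qed
      qed
    next
      case False
      \<comment> \<open>Radii below \<rho> keep circles about a away from \<open>z0\<close>, as a
        has distance at least \<rho> from it; off \<open>z0\<close> the modification dominates
        u.\<close>
      obtain d where d: "d > 0" "ball a d \<subseteq> \<Omega>" "\<And>r. 0 < r \<Longrightarrow> r < d \<Longrightarrow> u a \<le> circle_mean u a r"
        using u a unfolding green_competitors_def subharmonic_on_def by blast
      show ?thesis
      proof (intro exI[of _ "min d \<rho>"] conjI allI impI)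
        show "ball a (min d \<rho>) \<subseteq> \<Omega>" using d by auto
        fix r assume r: "0 < r \<and> r < min d \<rho>"
        have "poisson_modification a = u a" using False \<rho>(1) by (auto simp: poisson_modification_def)
        also have "u a \<le> circle_mean u a r" using d(3) r by simp
        also have "\<dots> \<le> circle_mean poisson_modification a r"
        proof (rule circle_mean_mono)
          fix t
          have "a + of_real r * cis t \<in> \<Omega>" using d(2) r by (auto simp: dist_norm norm_mult subset_iff)
          moreover have "a + of_real r * cis t \<noteq> z0"
          proof
            assume "a + of_real r * cis t = z0"
            then have "a - z0 = - (of_real r * cis t)" by (simp add: algebra_simps)
            then have "norm (a - z0) = r" using r by (simp add: norm_mult)
            then show False using False r by simp
          qed
          ultimately show "u (a + of_real r * cis t) \<le> poisson_modification (a + of_real r * cis t)"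
            by (intro le_poisson_modification) auto
        qed
        finally show "poisson_modification a \<le> circle_mean poisson_modification a r" .
      qed (use d \<rho> in auto)
    qed
  qed
  moreover have "poisson_modification z < 0" if z: "z \<in> \<Omega>" for z
  proof (cases "norm (z - z0) < \<rho> \<and> z \<noteq> z0")
    case True
    then have "ln (norm (z - z0)) < ln \<rho>" using \<rho>(1) by simp
    then show ?thesis using True poisson_part_le[of "z - z0"] by (simp add: poisson_modification_def)
  next
    case False
    then show ?thesis using z u by (auto simp: poisson_modification_def green_competitors_def)
  qed
  moreover have "\<forall>\<^sub>F z in at z0. poisson_modification z - ereal (ln (cmod (z - z0))) \<le> ereal (- ln \<rho>)"
    unfolding eventually_at
    using \<rho>(1) poisson_part_le
    by (intro exI[of _ \<rho>]) (auto simp: poisson_modification_def dist_norm)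
  ultimately show ?thesis
    unfolding green_competitors_def Limsup_less_infinity_iff by blast
qed

end

section \<open>Existence of the limit defining the logarithmic capacity\<close>

lemma green_function_eq_SUP: "green_function \<Omega> z z0 = (SUP u\<in>green_competitors \<Omega> z0. u z)"
  by (simp add: green_function_def green_competitors_def)

lemma log_competitor:
  assumes \<Omega>: "open \<Omega>" "z0 \<in> \<Omega>" "\<Omega> \<subseteq> ball z0 R"
  shows "(\<lambda>z. if z = z0 then -\<infinity> else ereal (ln (norm (z - z0) / R))) \<in> green_competitors \<Omega> z0"
proof -
  have R: "R > 0" using \<Omega>(2,3) by (auto intro: le_less_trans[OF zero_le_dist])
  have "ln (norm (z - z0) / R) + 0 < 0" if "z \<in> \<Omega> - {z0}" for z
  proof -
    have "norm (z - z0) < R" "norm (z - z0) > 0" using that \<Omega>(3) by (auto simp: dist_norm norm_minus_commute subset_iff)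
    then show ?thesis using R by (simp add: ln_div)
  qed
  then have "(\<lambda>z. if z = z0 then -\<infinity> else ereal (ln (norm (z - z0) / R) + 0)) \<in> green_competitors \<Omega> z0"
    by (intro green_competitor_intro[OF \<Omega>(1,2) R, of "\<lambda>_. 0" 0]) (auto intro!: exI[of _ 1])
  then show ?thesis by (simp only: add_0_right)
qed

text \<open>Near \<open>z0\<close> each competitor lies below its modification, a competitor again,
  whose harmonic part differs from its central value by at most \<open>E z\<close>. Hence Green's
  function minus the logarithm is squeezed between \<open>W - E z\<close> and
  \<open>W + E z\<close>, where W is the supremum of the central values.\<close>

lemma log_capacity_eq_exp:
  assumes \<Omega>: "open \<Omega>" "z0 \<in> \<Omega>" "\<Omega> \<subseteq> ball z0 R"
  shows "\<exists>W. log_capacity \<Omega> z0 = exp W \<and>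
    ((\<lambda>z. real_of_ereal (green_function \<Omega> z z0) - ln (cmod (z - z0))) \<longlongrightarrow> W) (at z0) \<and>
    (\<forall>\<^sub>F z in at z0. \<bar>green_function \<Omega> z z0\<bar> \<noteq> \<infinity>)"
proof -
  have R: "R > 0" using \<Omega>(2,3) by (auto intro: le_less_trans[OF zero_le_dist])
  obtain d where d: "d > 0" "ball z0 d \<subseteq> \<Omega>" using \<Omega> openE by blast
  define \<rho> where "\<rho> = d / 2"
  have \<rho>: "0 < \<rho>" "ball z0 (2 * \<rho>) \<subseteq> \<Omega>" using d by (auto simp: \<rho>_def)
  define C where "C = green_competitors \<Omega> z0"
  define b where "b = (\<lambda>z. if z = z0 then -\<infinity> else ereal (ln (norm (z - z0) / R)))"
  have b: "b \<in> C" unfolding C_def b_def by (rule log_competitor[OF \<Omega>])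
  \<comment> \<open>The maximum with the logarithm of the enclosing disc enforces the lower bound
    required for the Poisson modification, and it does not decrease u.\<close>
  define up where "up = (\<lambda>(u :: complex \<Rightarrow> ereal) z. max (u z) (b z))"
  have up: "up u \<in> green_competitors \<Omega> z0" if "u \<in> C" for u
    unfolding up_def using that b unfolding C_def by (rule green_competitors_max)
  have low: "ereal (ln (norm (z - z0) / R)) \<le> up u z" if "z \<in> \<Omega> - {z0}" for u z
    using that by (simp add: up_def b_def)
  define P where "P = (\<lambda>u. poisson_part z0 \<rho> (up u))"
  define B where "B = \<bar>ln R\<bar> + \<bar>ln \<rho>\<bar>"
  define E where "E = (\<lambda>z. B * (2 * norm (z - z0) / (\<rho> - norm (z - z0))))"
  define W where "W = Sup ((\<lambda>u. P u 0) ` C)"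
  have P0: "P u 0 \<le> - ln \<rho>" if "u \<in> C" for u
    unfolding P_def by (rule poisson_part_le[OF \<Omega> \<rho> up[OF that] low]) (use \<rho> in auto)
  have bdd: "bdd_above ((\<lambda>u. P u 0) ` C)" using P0 by (rule bdd_aboveI2)
  have main: "ereal (ln (norm (z - z0)) + W - E z) \<le> green_function \<Omega> z z0"
    "green_function \<Omega> z z0 \<le> ereal (ln (norm (z - z0)) + W + E z)" if z: "z \<in> ball z0 \<rho> - {z0}" for z
  proof -
    have nz: "norm (z - z0) < \<rho>" "z \<noteq> z0" and z\<Omega>: "z \<in> \<Omega> - {z0}" using z \<rho> by (auto simp: dist_norm norm_minus_commute)
    have cd: "\<bar>P u (z - z0) - P u 0\<bar> \<le> E z" if "u \<in> C" for u
      unfolding P_def E_def B_def by (rule poisson_part_center_diff[OF \<Omega> \<rho> up[OF that] low nz(1)])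
    have mod: "poisson_modification z0 \<rho> (up u) z = ereal (ln (norm (z - z0)) + P u (z - z0))" if "u \<in> C" for u
      using nz poisson_modification_def[OF \<Omega> \<rho> up[OF that] low, of z] by (simp add: P_def)
    show "green_function \<Omega> z z0 \<le> ereal (ln (norm (z - z0)) + W + E z)"
      unfolding green_function_eq_SUP
    proof (rule SUP_least)
      fix u assume u: "u \<in> green_competitors \<Omega> z0"
      then have uC: "u \<in> C" by (simp add: C_def)
      have "u z \<le> up u z" by (simp add: up_def)
      also have "\<dots> \<le> poisson_modification z0 \<rho> (up u) z" by (rule le_poisson_modification[OF \<Omega> \<rho> up[OF uC] low z\<Omega>])
      also have "\<dots> \<le> ereal (ln (norm (z - z0)) + W + E z)"
        unfolding mod[OF uC] using cd[OF uC] cSUP_upper[OF uC bdd] by (simp add: W_def abs_le_iff)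
      finally show "u z \<le> ereal (ln (norm (z - z0)) + W + E z)" .
    qed
    have lb: "ereal (ln (norm (z - z0)) + P u 0 - E z) \<le> green_function \<Omega> z z0" if u: "u \<in> C" for u
    proof -
      have "ereal (ln (norm (z - z0)) + P u 0 - E z) \<le> poisson_modification z0 \<rho> (up u) z"
        unfolding mod[OF u] using cd[OF u] by (simp add: abs_le_iff)
      also have "\<dots> \<le> green_function \<Omega> z z0"
        unfolding green_function_eq_SUP
        by (rule SUP_upper[OF poisson_modification_competitor[OF \<Omega> \<rho> up[OF u] low]])
      finally show ?thesis .
    qed
    from lb[OF b] \<open>green_function \<Omega> z z0 \<le> ereal (ln (norm (z - z0)) + W + E z)\<close>
    have "\<bar>green_function \<Omega> z z0\<bar> \<noteq> \<infinity>" by (cases "green_function \<Omega> z z0") auto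
    then obtain x where x: "green_function \<Omega> z z0 = ereal x" by (cases "green_function \<Omega> z z0") auto
    have "W \<le> x - ln (norm (z - z0)) + E z"
      unfolding W_def by (rule cSUP_least) (use b lb x in \<open>auto simp: algebra_simps\<close>)
    then show "ereal (ln (norm (z - z0)) + W - E z) \<le> green_function \<Omega> z z0" by (simp add: x)
  qed
  have ev: "\<forall>\<^sub>F z in at z0. z \<in> ball z0 \<rho> - {z0}"
    unfolding eventually_at using \<rho> by (intro exI[of _ \<rho>]) (auto simp: dist_commute)
  have fin: "\<forall>\<^sub>F z in at z0. \<bar>green_function \<Omega> z z0\<bar> \<noteq> \<infinity>"
    using ev
  proof eventually_elim
    case (elim z)
    then show ?case using main[of z] by (cases "green_function \<Omega> z z0") auto
  qed
  have E0: "(E \<longlongrightarrow> 0) (at z0)"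
  proof -
    have "((\<lambda>z. B * (2 * norm (z - z0) / (\<rho> - norm (z - z0)))) \<longlongrightarrow> B * (2 * norm (z0 - z0) / (\<rho> - norm (z0 - z0)))) (at z0)"
      by (intro tendsto_intros) (use \<rho> in auto)
    then show ?thesis by (simp add: E_def[abs_def])
  qed
  have lim: "((\<lambda>z. real_of_ereal (green_function \<Omega> z z0) - ln (cmod (z - z0))) \<longlongrightarrow> W) (at z0)"
  proof (rule tendsto_sandwich)
    show "\<forall>\<^sub>F z in at z0. W - E z \<le> real_of_ereal (green_function \<Omega> z z0) - ln (cmod (z - z0))"
      using ev fin
    proof eventually_elim
      case (elim z)
      then obtain x where "green_function \<Omega> z z0 = ereal x" by (cases "green_function \<Omega> z z0") auto
      then show ?case using main[of z] elim by simp
    qed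
    show "\<forall>\<^sub>F z in at z0. real_of_ereal (green_function \<Omega> z z0) - ln (cmod (z - z0)) \<le> W + E z"
      using ev fin
    proof eventually_elim
      case (elim z)
      then obtain x where "green_function \<Omega> z z0 = ereal x" by (cases "green_function \<Omega> z z0") auto
      then show ?case using main[of z] elim by simp
    qed
    show "((\<lambda>z. W - E z) \<longlongrightarrow> W) (at z0)" using tendsto_diff[OF tendsto_const E0, of W] by simp
    show "((\<lambda>z. W + E z) \<longlongrightarrow> W) (at z0)" using tendsto_add[OF tendsto_const E0, of W] by simp
  qed
  have "((\<lambda>z. exp (real_of_ereal (green_function \<Omega> z z0) - ln (cmod (z - z0)))) \<longlongrightarrow> exp W) (at z0)"
    by (rule tendsto_exp[OF lim])
  moreover have "\<forall>\<^sub>F z in at z0. exp (real_of_ereal (green_function \<Omega> z z0) - ln (cmod (z - z0))) =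
      (if green_function \<Omega> z z0 = -\<infinity> then 0 else exp (real_of_ereal (green_function \<Omega> z z0) - ln (cmod (z - z0))))"
    using fin by eventually_elim auto
  ultimately have "((\<lambda>z. if green_function \<Omega> z z0 = -\<infinity> then 0
      else exp (real_of_ereal (green_function \<Omega> z z0) - ln (cmod (z - z0)))) \<longlongrightarrow> exp W) (at z0)"
    using tendsto_cong by fast
  then have "log_capacity \<Omega> z0 = exp W"
    unfolding log_capacity_def by (intro tendsto_Lim) simp_all
  then show ?thesis using lim fin by blast
qed

text \<open>The logarithm plus h is itself a competitor; after subtraction of
  \<open>ln (cmod (z - z0))\<close> it tends to \<open>h z0 - ln R\<close>.\<close>

lemma log_capacity_ge:
  assumes \<Omega>: "open \<Omega>" "z0 \<in> \<Omega>" "\<Omega> \<subseteq> ball z0 R"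
    and cont: "continuous_on \<Omega> h" and B: "\<And>z. z \<in> \<Omega> \<Longrightarrow> \<bar>h z\<bar> \<le> B"
    and sub: "\<And>a. a \<in> \<Omega> \<Longrightarrow> \<exists>\<eta>>0. \<forall>r. 0 < r \<and> r < \<eta> \<longrightarrow> 2 * pi * h a \<le> (\<integral>t. h (a + of_real r * cis t) \<partial>circle_measure)"
    and neg: "\<And>z. z \<in> \<Omega> - {z0} \<Longrightarrow> ln (norm (z - z0) / R) + h z < 0"
  shows "exp (h z0) / R \<le> log_capacity \<Omega> z0"
proof -
  have R: "R > 0" using \<Omega>(2,3) by (auto intro: le_less_trans[OF zero_le_dist])
  obtain W where W: "log_capacity \<Omega> z0 = exp W"
    and lim: "((\<lambda>z. real_of_ereal (green_function \<Omega> z z0) - ln (cmod (z - z0))) \<longlongrightarrow> W) (at z0)"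
    and fin: "\<forall>\<^sub>F z in at z0. \<bar>green_function \<Omega> z z0\<bar> \<noteq> \<infinity>"
    using log_capacity_eq_exp[OF \<Omega>] by blast
  define v where "v = (\<lambda>z. if z = z0 then -\<infinity> else ereal (ln (norm (z - z0) / R) + h z))"
  have v: "v \<in> green_competitors \<Omega> z0"
    unfolding v_def by (rule green_competitor_intro[OF \<Omega>(1,2) R cont B sub neg])
  have "isCont h z0" using cont \<Omega>(1,2) continuous_on_eq_continuous_at by blast
  then have "(h \<longlongrightarrow> h z0) (at z0)" by (simp add: isCont_def)
  then have hl: "((\<lambda>z. h z - ln R) \<longlongrightarrow> h z0 - ln R) (at z0)" by (intro tendsto_diff tendsto_const)
  have "\<forall>\<^sub>F z in at z0. h z - ln R \<le> real_of_ereal (green_function \<Omega> z z0) - ln (cmod (z - z0))"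
    using fin eventually_at_in_open[OF \<Omega>(1,2)]
  proof eventually_elim
    case (elim z)
    then obtain x where x: "green_function \<Omega> z z0 = ereal x" by (cases "green_function \<Omega> z z0") auto
    have "v z \<le> green_function \<Omega> z z0" unfolding green_function_eq_SUP by (rule SUP_upper[OF v])
    then show ?case using elim(2) R x by (simp add: v_def ln_div)
  qed
  then have "h z0 - ln R \<le> W" using tendsto_le[OF _ lim hl] by simp
  then have "exp (h z0 - ln R) \<le> exp W" by simp
  then show ?thesis using R by (simp add: W exp_diff)
qed

section \<open>Logarithmic potentials and polar sets\<close>

text \<open>Moving the single point \<open>a i\<close> to x changes only its interactions, each
  counted twice in the energy. Near-minimality bounds the gain by 1, so the potential at a
  configuration point exceeds the potential anywhere in S by little more than the diagonal value M.
  This is a discrete form of Frostman's theorem.\<close>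

lemma almost_minimal_configuration:
  fixes k :: "'a \<Rightarrow> 'a \<Rightarrow> real" and n :: nat
  assumes S: "S \<noteq> {}" and sym: "\<And>x y. k x y = k y x" and nonneg: "\<And>x y. x \<in> S \<Longrightarrow> y \<in> S \<Longrightarrow> 0 \<le> k x y"
    and diag: "\<And>x. k x x = M"
  shows "\<exists>a. (\<forall>i<n. a i \<in> S) \<and>
    (\<forall>i<n. \<forall>x\<in>S. (\<Sum>j<n. k (a i) (a j)) \<le> (\<Sum>j<n. k x (a j)) + M + 1)"
proof -
  define E where "E = (\<lambda>a :: nat \<Rightarrow> 'a. \<Sum>i<n. \<Sum>j<n. k (a i) (a j))"
  define A where "A = {a :: nat \<Rightarrow> 'a. \<forall>i<n. a i \<in> S}"
  obtain s where "s \<in> S" using S by blast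
  then have "(\<lambda>_. s) \<in> A" by (simp add: A_def)
  then have ne: "E ` A \<noteq> {}" by blast
  have bdd: "bdd_below (E ` A)"
    by (rule bdd_belowI2[of _ 0]) (auto simp: E_def A_def intro!: sum_nonneg nonneg)
  \<comment> \<open>The infimum of the energy need not be attained; an error of 1 is negligible
    against the n summands of the potential.\<close>
  have "Inf (E ` A) < Inf (E ` A) + 1" by simp
  then obtain a where a: "a \<in> A" "E a < Inf (E ` A) + 1"
    using cInf_lessD[OF ne] by blast
  have min: "E a \<le> E b + 1" if "b \<in> A" for b
    using a(2) cINF_lower[OF bdd that] by simp
  have "(\<Sum>j<n. k (a i) (a j)) \<le> (\<Sum>j<n. k x (a j)) + M + 1" if i: "i < n" and x: "x \<in> S" for i x
  proof -
    define N where "N = {..<n} - {i}"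
    have split: "(\<Sum>j<n. f j) = f i + (\<Sum>j\<in>N. f j)" for f :: "nat \<Rightarrow> real"
      unfolding N_def using i by (intro sum.remove) auto
    have E: "E c = M + 2 * (\<Sum>j\<in>N. k (c i) (c j)) + (\<Sum>p\<in>N. \<Sum>j\<in>N. k (c p) (c j))" for c
    proof -
      have "(\<Sum>p\<in>N. k (c p) (c i)) = (\<Sum>p\<in>N. k (c i) (c p))" by (intro sum.cong refl sym)
      then show ?thesis unfolding E_def split by (simp add: sum.distrib diag)
    qed
    define b where "b = a(i := x)"
    have bA: "b \<in> A" using a(1) x by (auto simp: A_def b_def)
    have bN: "b j = a j" if "j \<in> N" for j using that by (simp add: b_def N_def)
    have "E b = M + 2 * (\<Sum>j\<in>N. k x (a j)) + (\<Sum>p\<in>N. \<Sum>j\<in>N. k (a p) (a j))"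
    proof -
      have "(\<Sum>j\<in>N. k (b i) (b j)) = (\<Sum>j\<in>N. k x (a j))" by (intro sum.cong) (auto simp: bN, simp add: b_def)
      moreover have "(\<Sum>p\<in>N. \<Sum>j\<in>N. k (b p) (b j)) = (\<Sum>p\<in>N. \<Sum>j\<in>N. k (a p) (a j))"
        by (intro sum.cong refl) (simp add: bN)
      ultimately show ?thesis unfolding E by simp
    qed
    then have "2 * (\<Sum>j\<in>N. k (a i) (a j)) \<le> 2 * (\<Sum>j\<in>N. k x (a j)) + 1"
      using min[OF bA] unfolding E[of a] by simp
    moreover have "0 \<le> k x (a i)" using a(1) x i by (intro nonneg) (auto simp: A_def)
    ultimately show ?thesis unfolding split by (simp add: diag)
  qed
  then show ?thesis using a(1) by (intro exI[of _ a]) (auto simp: A_def)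
qed

text \<open>A configuration may repeat a point; the value \<open>M\<close> on the diagonal keeps its energy finite.\<close>

definition log_kernel :: "real \<Rightarrow> real \<Rightarrow> complex \<Rightarrow> complex \<Rightarrow> real"
  where "log_kernel L M x y = (if x = y then M else min M (ln (L / norm (x - y))))"

text \<open>A discrete maximum principle: if b is the configuration point nearest to z, every other
  point a satisfies \<open>norm (b - a) \<le> 2 * norm (z - a)\<close>, so passing from z to b loses
  at most \<open>ln 2\<close> per summand.\<close>

lemma log_kernel_nearest:
  assumes L: "L > 0" and b: "norm (z - b) \<le> norm (z - a)"
  shows "log_kernel L M z a \<le> log_kernel L M b a + ln 2"
proof -
  have ln2: "(0::real) \<le> ln 2" by simp
  have min_le: "min M x \<le> min M y + c" if "x \<le> c + y" "0 \<le> c" for x y c :: real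
    using that by (auto simp: min_def)
  consider "z = a" | "z \<noteq> a" "b = a" | "z \<noteq> a" "b \<noteq> a" by blast
  then show ?thesis
  proof cases
    case 1
    then have "b = a" using b by simp
    then show ?thesis using 1 ln2 by (simp add: log_kernel_def)
  next
    case 2
    then show ?thesis using ln2 by (auto simp: log_kernel_def intro: order_trans[OF min.cobounded1])
  next
    case 3
    have "norm (b - a) \<le> norm (z - b) + norm (z - a)"
      using norm_triangle_ineq4[of "z - a" "z - b"] by simp
    then have "norm (b - a) \<le> 2 * norm (z - a)" using b by simp
    then have "L / norm (z - a) \<le> 2 * (L / norm (b - a))"
      using 3 L by (simp add: field_simps)
    then have "ln (L / norm (z - a)) \<le> ln (2 * (L / norm (b - a)))"
      using 3 L by (intro ln_mono) auto
    also have "\<dots> = ln 2 + ln (L / norm (b - a))" using 3 L by (intro ln_mult_pos) auto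
    finally show ?thesis using 3 min_le[OF _ ln2] by (simp add: log_kernel_def)
  qed
qed

text \<open>An almost minimal configuration of \<open>n\<close> points replaces the equilibrium measure of \<open>K\<close>: the first
  alternative holds for polar \<open>K\<close>, the second for nonpolar \<open>K\<close>.\<close>

lemma log_potential_dichotomy:
  assumes K: "K \<noteq> {}" "K \<subseteq> ball z0 R"
  shows "(\<forall>V. \<exists>n>0. \<exists>a. (\<forall>i<n. a i \<in> K) \<and>
            (\<forall>x\<in>K. x \<in> a ` {..<n} \<or> real n * V \<le> (\<Sum>j<n. ln (2 * R / norm (x - a j))))) \<or>
         (\<exists>V. \<forall>n>0. \<exists>a. (\<forall>i<n. a i \<in> K) \<and> (\<forall>z. (\<Sum>j<n. log_kernel (2 * R) (real n) z (a j)) \<le> real n * V))"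
proof -
  obtain k0 where "k0 \<in> K" using K by blast
  then have "dist z0 k0 < R" using K(2) by auto
  then have R: "R > 0" using zero_le_dist[of z0 k0] by linarith
  have "\<exists>a. (\<forall>i<n. a i \<in> K) \<and> (\<forall>i<n. \<forall>x\<in>K. (\<Sum>j<n. log_kernel (2 * R) (real n) (a i) (a j)) \<le>
      (\<Sum>j<n. log_kernel (2 * R) (real n) x (a j)) + real n + 1)" for n
  proof (rule almost_minimal_configuration[OF K(1)])
    show "log_kernel (2 * R) (real n) x y = log_kernel (2 * R) (real n) y x" for x y
      by (simp add: log_kernel_def norm_minus_commute)
    show "0 \<le> log_kernel (2 * R) (real n) x y" if "x \<in> K" "y \<in> K" for x y
    proof -
      have "dist x y \<le> dist x z0 + dist z0 y" by (rule dist_triangle)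
      moreover have "dist z0 x < R" "dist z0 y < R" using that K(2) by auto
      ultimately have "norm (x - y) \<le> 2 * R" by (simp add: dist_norm norm_minus_commute)
      then show ?thesis by (auto simp: log_kernel_def min_def intro!: ln_ge_zero simp: le_divide_eq)
    qed
    show "log_kernel (2 * R) (real n) x x = real n" for x by (simp add: log_kernel_def)
  qed
  then obtain a where aK: "\<And>n i. i < n \<Longrightarrow> a n i \<in> K"
    and a: "\<And>n i x. i < n \<Longrightarrow> x \<in> K \<Longrightarrow> (\<Sum>j<n. log_kernel (2 * R) (real n) (a n i) (a n j)) \<le>
      (\<Sum>j<n. log_kernel (2 * R) (real n) x (a n j)) + real n + 1"
    by metis
  show ?thesis
  \<comment> \<open>The question is whether the minimum over K of the averaged potentials is
    unbounded as n varies.\<close>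
  proof (cases "\<forall>V. \<exists>n>0. \<forall>x\<in>K. real n * V \<le> (\<Sum>j<n. log_kernel (2 * R) (real n) x (a n j))")
    case True
    have "\<exists>n>0. \<exists>a. (\<forall>i<n. a i \<in> K) \<and> (\<forall>x\<in>K. x \<in> a ` {..<n} \<or> real n * V \<le> (\<Sum>j<n. ln (2 * R / norm (x - a j))))" for V
    proof -
      obtain n where n: "n > 0" "\<And>x. x \<in> K \<Longrightarrow> real n * V \<le> (\<Sum>j<n. log_kernel (2 * R) (real n) x (a n j))"
        using True by blast
      have "real n * V \<le> (\<Sum>j<n. ln (2 * R / norm (x - a n j)))" if x: "x \<in> K" "x \<notin> a n ` {..<n}" for x
      proof -
        have "(\<Sum>j<n. log_kernel (2 * R) (real n) x (a n j)) \<le> (\<Sum>j<n. ln (2 * R / norm (x - a n j)))"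
        proof (rule sum_mono)
          fix j assume "j \<in> {..<n}"
          then have "x \<noteq> a n j" using x(2) by blast
          then show "log_kernel (2 * R) (real n) x (a n j) \<le> ln (2 * R / norm (x - a n j))"
            by (simp add: log_kernel_def)
        qed
        then show ?thesis using n(2)[OF x(1)] by linarith
      qed
      then show ?thesis using n(1) aK by (intro exI[of _ n] conjI exI[of _ "a n"]) auto
    qed
    then show ?thesis by blast
  next
    case False
    then obtain V where V: "\<And>n. n > 0 \<Longrightarrow> \<exists>x\<in>K. (\<Sum>j<n. log_kernel (2 * R) (real n) x (a n j)) < real n * V"
      by (meson not_le)
    \<comment> \<open>V bounds the average at some point x of K, near-minimality carries this to the
      nearest configuration point for at most \<open>n + 1 \<le> 2 * n\<close>, and going on to an
      arbitrary z costs \<open>ln 2\<close> per summand.\<close>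
    have "(\<Sum>j<n. log_kernel (2 * R) (real n) z (a n j)) \<le> real n * (V + 2 + ln 2)" if n: "n > 0" for n z
    proof -
      obtain x where x: "x \<in> K" "(\<Sum>j<n. log_kernel (2 * R) (real n) x (a n j)) < real n * V" using V[OF n] by blast
      define D where "D = (\<lambda>i. norm (z - a n i)) ` {..<n}"
      have "finite D" "D \<noteq> {}" using n by (auto simp: D_def)
      then have "Min D \<in> D" by (rule Min_in)
      then obtain i where i: "i < n" "norm (z - a n i) = Min D" unfolding D_def by auto
      have near: "norm (z - a n i) \<le> norm (z - a n j)" if "j < n" for j
        unfolding i(2) using that \<open>finite D\<close> by (intro Min_le) (auto simp: D_def)
      have "(\<Sum>j<n. log_kernel (2 * R) (real n) z (a n j)) \<le> (\<Sum>j<n. log_kernel (2 * R) (real n) (a n i) (a n j) + ln 2)"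
        using R near by (intro sum_mono log_kernel_nearest) auto
      also have "\<dots> = (\<Sum>j<n. log_kernel (2 * R) (real n) (a n i) (a n j)) + real n * ln 2"
        by (simp add: sum.distrib)
      also have "\<dots> \<le> real n * V + real n + 1 + real n * ln 2" using a[OF i(1) x(1)] x(2) by linarith
      also have "\<dots> \<le> real n * V + real n + real n + real n * ln 2" using n by linarith
      also have "\<dots> = real n * (V + 2 + ln 2)" by (simp add: algebra_simps)
      finally show ?thesis .
    qed
    then have "\<forall>n>0. \<exists>a. (\<forall>i<n. a i \<in> K) \<and> (\<forall>z. (\<Sum>j<n. log_kernel (2 * R) (real n) z (a j)) \<le> real n * (V + 2 + ln 2))"
      using aK by (intro allI impI exI[of _ "a _"]) auto
    then show ?thesis by blast
  qed
qed

section \<open>Logarithmic potentials with values in the extended half-line\<close>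

text \<open>Values in \<open>ennreal\<close> allow infinite sums and monotone limits without
  integrability conditions. Negative logarithms are truncated to 0, which does not happen as long as
  \<open>norm (z - b) \<le> L\<close>.\<close>

definition elog :: "real \<Rightarrow> complex \<Rightarrow> complex \<Rightarrow> ennreal"
  where "elog L b z = (if z = b then \<infinity> else ennreal (ln (L / norm (z - b))))"

lemma continuous_on_elog:
  assumes L: "L > 0"
  shows "continuous_on T (elog L b)"
proof (rule continuous_at_imp_continuous_on, rule ballI)
  fix z
  show "isCont (elog L b) z"
  proof (cases "z = b")
    case False
    have "((\<lambda>w. ennreal (ln (L / norm (w - b)))) \<longlongrightarrow> ennreal (ln (L / norm (z - b)))) (at z)"
      using False L by (intro tendsto_ennrealI tendsto_intros) auto
    moreover have "\<forall>\<^sub>F w in at z. w \<in> - {b}" by (rule eventually_at_in_open') (use False in auto)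
    then have "\<forall>\<^sub>F w in at z. ennreal (ln (L / norm (w - b))) = elog L b w"
      by eventually_elim (simp add: elog_def)
    ultimately have "(elog L b \<longlongrightarrow> ennreal (ln (L / norm (z - b)))) (at z)"
      using tendsto_cong by fast
    then show ?thesis using False by (simp add: isCont_def elog_def)
  next
    case True
    have n0: "((\<lambda>w. norm (w - b)) \<longlongrightarrow> 0) (at b)" by (intro tendsto_norm_zero LIM_zero tendsto_ident_at)
    have pos: "\<forall>\<^sub>F w in at b. 0 < norm (w - b)" by (simp add: eventually_at_filter)
    have "filterlim (\<lambda>w. norm (w - b)) (at_right 0) (at b)"
      using n0 pos by (simp add: filterlim_at eventually_mono)
    then have "filterlim (\<lambda>w. L * inverse (norm (w - b))) at_top (at b)"
      by (intro filterlim_tendsto_pos_mult_at_top[OF tendsto_const L] filterlim_compose[OF filterlim_inverse_at_top_right])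
    then have "filterlim (\<lambda>w. ln (L / norm (w - b))) at_top (at b)"
      by (intro filterlim_compose[OF ln_at_top]) (simp add: divide_inverse)
    then have "((\<lambda>w. ennreal (ln (L / norm (w - b)))) \<longlongrightarrow> top) (at b)"
      by (simp add: ennreal_tendsto_top_eq_at_top)
    moreover have "\<forall>\<^sub>F w in at b. ennreal (ln (L / norm (w - b))) = elog L b w"
      using pos by eventually_elim (simp add: elog_def)
    ultimately have "(elog L b \<longlongrightarrow> top) (at b)" using tendsto_cong by fast
    then show ?thesis using True by (simp add: isCont_def elog_def)
  qed
qed

lemma elog_measurable_circle:
  assumes "L > 0"
  shows "(\<lambda>t. elog L b (a + of_real r * cis t)) \<in> borel_measurable circle_measure"
  by (intro borel_measurable_circle_measure borel_measurable_continuous_onI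
      continuous_on_compose2[OF continuous_on_elog[OF assms, of UNIV] continuous_on_circle]) auto

lemma nn_integral_elog_outside:
  assumes L: "L > 0" and r: "0 < r" "r < norm (a - b)" and le: "\<And>t. norm (a + of_real r * cis t - b) \<le> L"
  shows "(\<integral>\<^sup>+t. elog L b (a + of_real r * cis t) \<partial>circle_measure) = ennreal (2 * pi) * elog L b a"
proof -
  note il = integral_ln_norm_circle[OF r]
  have ne: "a + of_real r * cis t \<noteq> b" for t
  proof
    assume "a + of_real r * cis t = b"
    then have "a - b = - (of_real r * cis t)" by (simp add: algebra_simps)
    then show False using r by (simp add: norm_mult)
  qed
  have lnd: "ln (L / norm (a + of_real r * cis t - b)) = ln L - ln (norm (a + of_real r * cis t - b))" for t
    using ne[of t] L by (simp add: ln_div)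
  have i: "integrable circle_measure (\<lambda>t. ln (L / norm (a + of_real r * cis t - b)))"
    unfolding lnd using il(1) by simp
  have "(\<integral>\<^sup>+t. elog L b (a + of_real r * cis t) \<partial>circle_measure) = (\<integral>\<^sup>+t. ennreal (ln (L / norm (a + of_real r * cis t - b))) \<partial>circle_measure)"
    by (simp add: elog_def ne)
  also have "\<dots> = ennreal (\<integral>t. ln (L / norm (a + of_real r * cis t - b)) \<partial>circle_measure)"
    using le ne by (intro nn_integral_eq_integral[OF i] AE_I2 ln_ge_zero) (simp add: le_divide_eq)
  also have "(\<integral>t. ln (L / norm (a + of_real r * cis t - b)) \<partial>circle_measure) = 2 * pi * (ln L - ln (norm (a - b)))"
    unfolding lnd by (subst Bochner_Integration.integral_diff[OF _ il(1)]) (simp_all add: il(2) right_diff_distrib)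
  also have "\<dots> = 2 * pi * ln (L / norm (a - b))" using r L by (subst ln_div) auto
  also have "ennreal \<dots> = ennreal (2 * pi) * elog L b a"
    using r by (auto simp: elog_def ennreal_mult')
  finally show ?thesis .
qed

text \<open>Superharmonicity across the pole. With the pole outside the circle there is equality, on
  the circle Fatou's lemma applies to smaller radii, and inside the mean is
  \<open>ln (L / r)\<close>, below the central value.\<close>

lemma nn_integral_elog_le:
  assumes L: "L > 0" and r: "0 < r" and le: "\<And>\<rho> t. 0 < \<rho> \<Longrightarrow> \<rho> \<le> r \<Longrightarrow> norm (a + of_real \<rho> * cis t - b) \<le> L"
  shows "(\<integral>\<^sup>+t. elog L b (a + of_real r * cis t) \<partial>circle_measure) \<le> ennreal (2 * pi) * elog L b a"
proof -
  consider "r < norm (a - b)" | "r = norm (a - b)" | "a = b" | "norm (a - b) < r" "a \<noteq> b" by linarith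
  then show ?thesis
  proof cases
    case 1
    then show ?thesis using nn_integral_elog_outside[OF L r 1] le[OF r order_refl] by simp
  next
    case 2
    \<comment> \<open>Positive radii increasing to r: for them the pole is outside and the mean
      value is exact.\<close>
    define \<rho> where "\<rho> = (\<lambda>k::nat. r * (1 - 1 / real (k + 2)))"
    have \<rho>: "0 < \<rho> k" "\<rho> k < r" for k
      using r by (auto simp: \<rho>_def field_simps intro: add_pos_nonneg)
    have \<rho>lim: "\<rho> \<longlonglongrightarrow> r"
    proof -
      have "(\<lambda>k. r * (1 - 1 / real (k + 2))) \<longlonglongrightarrow> r * (1 - 0)"
        by (intro tendsto_mult tendsto_diff tendsto_const LIMSEQ_ignore_initial_segment[OF lim_1_over_n])
      then show ?thesis by (simp add: \<rho>_def[abs_def])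
    qed
    have int: "(\<integral>\<^sup>+t. elog L b (a + of_real (\<rho> k) * cis t) \<partial>circle_measure) = ennreal (2 * pi) * elog L b a" for k
      using \<rho>[of k] 2 le by (intro nn_integral_elog_outside[OF L]) auto
    have lim: "(\<lambda>k. elog L b (a + of_real (\<rho> k) * cis t)) \<longlonglongrightarrow> elog L b (a + of_real r * cis t)" for t
      by (rule continuous_on_tendsto_compose[OF continuous_on_elog[OF L, of UNIV]]) (auto intro!: tendsto_intros \<rho>lim)
    have "(\<integral>\<^sup>+t. elog L b (a + of_real r * cis t) \<partial>circle_measure) = (\<integral>\<^sup>+t. liminf (\<lambda>k. elog L b (a + of_real (\<rho> k) * cis t)) \<partial>circle_measure)"
      by (intro nn_integral_cong lim_imp_Liminf[symmetric] lim) simp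
    also have "\<dots> \<le> liminf (\<lambda>k. \<integral>\<^sup>+t. elog L b (a + of_real (\<rho> k) * cis t) \<partial>circle_measure)"
      by (intro nn_integral_liminf elog_measurable_circle L)
    also have "\<dots> = ennreal (2 * pi) * elog L b a" unfolding int by (simp add: Liminf_const)
    finally show ?thesis .
  next
    case 3
    then show ?thesis by (simp add: elog_def ennreal_mult_top)
  next
    case 4
    define c where "c = a - b"
    have c: "c \<noteq> 0" "norm c < r" using 4 by (auto simp: c_def)
    \<comment> \<open>Up to the factor \<open>norm c\<close>, distances from the circle to the pole
      inside equal distances from the unit circle to the reflected point q outside, where the
      logarithm has the mean value property.\<close>
    define q where "q = - (of_real r / cnj c)"
    have q: "norm (0 - q) > 1" using c r by (simp add: q_def norm_divide)
    have eq: "norm (a + of_real r * cis t - b) = norm c * norm (0 + of_real 1 * cis t - q)" for t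
    proof -
      have "norm (a + of_real r * cis t - b) = norm (c + of_real r * cis t) * norm (cis (- t))" by (simp add: c_def algebra_simps)
      also have "\<dots> = norm ((c + of_real r * cis t) * cis (- t))" by (simp only: norm_mult)
      also have "(c + of_real r * cis t) * cis (- t) = c * cis (- t) + of_real r"
        by (simp add: distrib_right cis_mult mult.assoc)
      also have "norm \<dots> = norm (cnj (c * cis (- t) + of_real r))" by (simp only: complex_mod_cnj)
      also have "cnj (c * cis (- t) + of_real r) = cnj c * (0 + of_real 1 * cis t - q)"
        using c by (simp add: q_def cis_cnj field_simps)
      finally show ?thesis by (simp add: norm_mult)
    qed
    have one: "(0::real) < 1" by simp
    note il = integral_ln_norm_circle[OF one q]
    have pos: "norm (0 + of_real 1 * cis t - q) > 0" for t
    proof -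
      have "norm (cis t) < norm q" using q by simp
      then have "cis t \<noteq> q" by auto
      then show ?thesis by simp
    qed
    have ne: "a + of_real r * cis t \<noteq> b" for t
      using eq[of t] pos[of t] c by (metis mult_pos_pos norm_zero order_less_irrefl right_minus_eq zero_less_norm_iff)
    have lnd: "ln (L / norm (a + of_real r * cis t - b)) = (ln L - ln (norm c)) - ln (norm (0 + of_real 1 * cis t - q))" for t
      unfolding eq using pos[of t] L c by (simp add: ln_div ln_mult_pos)
    have i: "integrable circle_measure (\<lambda>t. ln (L / norm (a + of_real r * cis t - b)))"
      unfolding lnd using il(1) by simp
    have lnq: "ln (norm (0 - q)) = ln r - ln (norm c)" using c r by (simp add: q_def norm_divide ln_div)
    have "(\<integral>\<^sup>+t. elog L b (a + of_real r * cis t) \<partial>circle_measure) = (\<integral>\<^sup>+t. ennreal (ln (L / norm (a + of_real r * cis t - b))) \<partial>circle_measure)"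
      by (simp add: elog_def ne)
    also have "\<dots> = ennreal (\<integral>t. ln (L / norm (a + of_real r * cis t - b)) \<partial>circle_measure)"
      using le[OF r order_refl] ne by (intro nn_integral_eq_integral[OF i] AE_I2 ln_ge_zero) (simp add: le_divide_eq)
    also have "(\<integral>t. ln (L / norm (a + of_real r * cis t - b)) \<partial>circle_measure) = 2 * pi * (ln L - ln r)"
    proof -
      have "(\<integral>t. ln (L / norm (a + of_real r * cis t - b)) \<partial>circle_measure) = 2 * pi * (ln L - ln (norm c)) - 2 * pi * ln (norm (0 - q))"
        unfolding lnd il(2)[symmetric] using il(1) by (subst Bochner_Integration.integral_diff) auto
      then show ?thesis unfolding lnq by (simp add: algebra_simps)
    qed
    also have "ennreal \<dots> \<le> ennreal (2 * pi * ln (L / norm (a - b)))"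
    proof (rule ennreal_leI)
      have "ln L - ln r \<le> ln L - ln (norm c)" using c r by simp
      also have "\<dots> = ln (L / norm (a - b))" using c L by (simp add: c_def ln_div)
      finally show "2 * pi * (ln L - ln r) \<le> 2 * pi * ln (L / norm (a - b))" by (intro mult_left_mono) auto
    qed
    also have "\<dots> = ennreal (2 * pi) * elog L b a" using 4 by (simp add: elog_def ennreal_mult')
    finally show ?thesis .
  qed
qed

text \<open>Nonnegative terms do both jobs: partial sums increase, so the sum is lower
  semicontinuous, and integration commutes with the infinite sum, so the supermean inequality passes
  to it.\<close>

lemma subharmonic_on_neg_suminf:
  fixes Q :: "nat \<Rightarrow> complex \<Rightarrow> ennreal"
  assumes U: "open U" and cont: "\<And>m. continuous_on U (Q m)"
    and meas: "\<And>m a r. (\<lambda>t. Q m (a + of_real r * cis t)) \<in> borel_measurable circle_measure"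
    and super: "\<And>m a r. 0 < r \<Longrightarrow> cball a r \<subseteq> U \<Longrightarrow> (\<integral>\<^sup>+t. Q m (a + of_real r * cis t) \<partial>circle_measure) \<le> ennreal (2 * pi) * Q m a"
  shows "subharmonic_on (\<lambda>z. - enn2ereal (\<Sum>m. Q m z)) U"
  unfolding subharmonic_on_def
proof (intro conjI ballI allI)
  let ?S = "\<lambda>z. \<Sum>m. Q m z"
  show "- enn2ereal (?S z) < \<infinity>" for z
    using enn2ereal_nonneg[of "?S z"] by (cases "enn2ereal (?S z)") auto
  show "open {z \<in> U. - enn2ereal (?S z) < ereal c}" for c :: real
  proof -
    have "{z \<in> U. - enn2ereal (?S z) < ereal c} = (\<Union>N. {z \<in> U. ereal (- c) < enn2ereal (\<Sum>m<N. Q m z)})"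
    proof (intro equalityI subsetI)
      fix z assume z: "z \<in> {z \<in> U. - enn2ereal (?S z) < ereal c}"
      then have lt: "ereal (- c) < enn2ereal (?S z)" by (simp add: ereal_uminus_less_reorder)
      have "(\<lambda>N. enn2ereal (\<Sum>m<N. Q m z)) \<longlonglongrightarrow> enn2ereal (?S z)"
        by (intro tendsto_enn2erealI summable_LIMSEQ) simp
      from order_tendstoD(1)[OF this lt] obtain N where "ereal (- c) < enn2ereal (\<Sum>m<N. Q m z)"
        unfolding eventually_sequentially by blast
      then show "z \<in> (\<Union>N. {z \<in> U. ereal (- c) < enn2ereal (\<Sum>m<N. Q m z)})" using z by blast
    next
      fix z assume "z \<in> (\<Union>N. {z \<in> U. ereal (- c) < enn2ereal (\<Sum>m<N. Q m z)})"
      then obtain N where N: "z \<in> U" "ereal (- c) < enn2ereal (\<Sum>m<N. Q m z)" by blast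
      have "(\<Sum>m<N. Q m z) \<le> ?S z" by (rule sum_le_suminf) auto
      then have "ereal (- c) < enn2ereal (?S z)" using N(2) by (simp add: less_eq_ennreal.rep_eq less_le_trans)
      then show "z \<in> {z \<in> U. - enn2ereal (?S z) < ereal c}" using N(1) by (simp add: ereal_uminus_less_reorder)
    qed
    moreover have "open {z \<in> U. ereal (- c) < enn2ereal (\<Sum>m<N. Q m z)}" for N
    proof -
      have "continuous_on U (\<lambda>z. \<Sum>m<N. Q m z)"
        by (induction N) (auto intro!: continuous_intros continuous_on_add_ennreal cont)
      then have "continuous_on U (\<lambda>z. enn2ereal (\<Sum>m<N. Q m z))"
        by (rule continuous_on_compose2[OF continuous_on_enn2ereal]) auto
      then have "open (U \<inter> (\<lambda>z. enn2ereal (\<Sum>m<N. Q m z)) -` {ereal (- c)<..})"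
        by (rule continuous_open_preimage) (use U in auto)
      moreover have "U \<inter> (\<lambda>z. enn2ereal (\<Sum>m<N. Q m z)) -` {ereal (- c)<..} = {z \<in> U. ereal (- c) < enn2ereal (\<Sum>m<N. Q m z)}" by auto
      ultimately show ?thesis by simp
    qed
    ultimately show ?thesis by (simp only:) (intro open_UN ballI)
  qed
  fix a assume "a \<in> U"
  then obtain d where d: "d > 0" "ball a d \<subseteq> U" using U openE by blast
  have "- enn2ereal (?S a) \<le> circle_mean (\<lambda>z. - enn2ereal (?S z)) a r" if r: "0 < r" "r < d" for r
  proof -
    have cb: "cball a r \<subseteq> U" using r d by (auto simp: subset_iff)
    define I where "I = (\<integral>\<^sup>+t. ?S (a + of_real r * cis t) \<partial>circle_measure)"
    \<comment> \<open>The function is nonpositive, so the positive part in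
      \<open>circle_mean\<close> vanishes and no difference of infinities can occur.\<close>
    have p: "(\<integral>\<^sup>+t\<in>{0..2 * pi}. e2ennreal (- enn2ereal (?S (a + of_real r * cis t))) \<partial>lborel) = 0"
    proof -
      have "e2ennreal (- enn2ereal x) = 0" for x by (rule e2ennreal_neg) simp
      then show ?thesis by simp
    qed
    have n: "(\<integral>\<^sup>+t\<in>{0..2 * pi}. e2ennreal (- (- enn2ereal (?S (a + of_real r * cis t)))) \<partial>lborel) = I"
      unfolding set_nn_integral_circle_measure I_def by simp
    have "I = (\<Sum>m. \<integral>\<^sup>+t. Q m (a + of_real r * cis t) \<partial>circle_measure)"
      unfolding I_def by (rule nn_integral_suminf[OF meas])
    also have "\<dots> \<le> (\<Sum>m. ennreal (2 * pi) * Q m a)" by (intro suminf_le super r cb) auto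
    also have "\<dots> = ennreal (2 * pi) * ?S a" by (rule ennreal_suminf_cmult)
    finally have I: "I \<le> ennreal (2 * pi) * ?S a" .
    have cm: "circle_mean (\<lambda>z. - enn2ereal (?S z)) a r = (enn2ereal 0 - enn2ereal I) / ereal (2 * pi)"
      unfolding circle_mean_def p n ..
    show ?thesis
    proof (cases "?S a")
      case top
      then show ?thesis by simp
    next
      case (real s)
      then have "I \<le> ennreal (2 * pi * s)" using I by (simp add: ennreal_mult)
      then obtain q where q: "I = ennreal q" "0 \<le> q" "q \<le> 2 * pi * s"
        using real by (cases I) (auto simp: ennreal_le_iff top_unique)
      have "q / (2 * pi) \<le> s" using q(3) by (simp add: pos_divide_le_eq mult.commute)
      then show ?thesis unfolding cm using real q by (simp add: enn2ereal_ennreal zero_ennreal.rep_eq)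
    qed
  qed
  then show "\<exists>\<rho>>0. ball a \<rho> \<subseteq> U \<and> (\<forall>r. 0 < r \<and> r < \<rho> \<longrightarrow> - enn2ereal (?S a) \<le> circle_mean (\<lambda>z. - enn2ereal (?S z)) a r)"
    using d by blast
qed

lemma continuous_on_elog_sum:
  fixes n :: nat
  assumes "L > 0" "c < top"
  shows "continuous_on T (\<lambda>z. \<Sum>j<n. c * elog L (a j) z)"
  by (induction n) (auto intro!: continuous_on_add_ennreal ennreal_continuous_on_cmult continuous_on_elog assms)

text \<open>A weighted sum of configuration potentials, in the spirit of Evans' theorem: the term
  for \<open>K m\<close> is at least 1 on \<open>K m\<close> but at most a constant times
  \<open>(1 / 2) ^ m\<close> at \<open>z0\<close>. Each point of P lies in all but finitely many
  \<open>K m\<close>, so the sum is infinite on P and finite at \<open>z0\<close>.\<close>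

lemma polar_of_log_potentials:
  assumes \<Omega>: "open \<Omega>" "z0 \<in> \<Omega>" and R: "R > 0"
    and A: "\<And>s V. s < R \<Longrightarrow> (ball z0 R - \<Omega>) \<inter> cball z0 s \<noteq> {} \<Longrightarrow>
      \<exists>n>0. \<exists>a. (\<forall>i<n. a i \<in> (ball z0 R - \<Omega>) \<inter> cball z0 s) \<and>
            (\<forall>x\<in>(ball z0 R - \<Omega>) \<inter> cball z0 s. x \<in> a ` {..<n} \<or> real n * V \<le> (\<Sum>j<n. ln (2 * R / norm (x - a j))))"
  shows "polar (ball z0 R - \<Omega>)"
proof -
  let ?P = "ball z0 R - \<Omega>"
  define L where "L = 2 * R"
  have L: "L > 0" using R by (simp add: L_def)
  define K where "K = (\<lambda>m::nat. ?P \<inter> cball z0 (R * (1 - 1 / real (m + 2))))"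
  have Km: "R * (1 - 1 / real (m + 2)) < R" for m :: nat using R by (simp add: field_simps)
  have "\<exists>n a. (\<forall>i<n. a i \<in> ?P) \<and> (\<forall>x\<in>K m. ennreal (2 ^ m * real n) \<le> (\<Sum>j<n. elog L (a j) x)) \<and> (K m \<noteq> {} \<longrightarrow> n > 0)" for m
  proof (cases "K m = {}")
    case True
    then show ?thesis by (intro exI[of _ 0]) auto
  next
    case False
    obtain n a where n: "n > 0" and a: "\<forall>i<n. a i \<in> K m"
      and p: "\<forall>x\<in>K m. x \<in> a ` {..<n} \<or> real n * 2 ^ m \<le> (\<Sum>j<n. ln (L / norm (x - a j)))"
      using A[OF Km, of m "2 ^ m"] False unfolding K_def L_def by blast
    have "ennreal (2 ^ m * real n) \<le> (\<Sum>j<n. elog L (a j) x)" if x: "x \<in> K m" for x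
    proof (cases "x \<in> a ` {..<n}")
      case True
      then obtain j where j: "j < n" "x = a j" by auto
      have "(\<infinity>::ennreal) = elog L (a j) x" using j by (simp add: elog_def)
      also have "\<dots> \<le> (\<Sum>j<n. elog L (a j) x)" using j by (intro member_le_sum) auto
      finally have "(\<Sum>j<n. elog L (a j) x) = top" by (simp only: top_unique infinity_ennreal_def)
      then show ?thesis by (simp only: top_greatest)
    next
      case False
      then have "2 ^ m * real n \<le> (\<Sum>j<n. ln (L / norm (x - a j)))" using p x by (auto simp: mult.commute)
      then have "ennreal (2 ^ m * real n) \<le> ennreal (\<Sum>j<n. ln (L / norm (x - a j)))" by (rule ennreal_leI)
      also have "\<dots> = (\<Sum>j<n. ennreal (ln (L / norm (x - a j))))"
      proof (rule sum_ennreal[symmetric])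
        fix j assume j: "j \<in> {..<n}"
        then have ne: "x \<noteq> a j" using False by blast
        have "dist z0 x < R" "dist z0 (a j) < R" using x a j by (auto simp: K_def)
        then have "dist x (a j) \<le> L" using dist_triangle3[of x "a j" z0] unfolding L_def by linarith
        then show "0 \<le> ln (L / norm (x - a j))" using ne by (intro ln_ge_zero) (simp add: le_divide_eq dist_norm)
      qed
      also have "\<dots> = (\<Sum>j<n. elog L (a j) x)"
        using False by (intro sum.cong refl) (auto simp: elog_def)
      finally show ?thesis .
    qed
    then show ?thesis using n a by (intro exI[of _ n] exI[of _ a]) (auto simp: K_def)
  qed
  then obtain n a where aP: "\<And>m i. i < n m \<Longrightarrow> a m i \<in> ?P"
    and pot: "\<And>m x. x \<in> K m \<Longrightarrow> ennreal (2 ^ m * real (n m)) \<le> (\<Sum>j<n m. elog L (a m j) x)"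
    and npos: "\<And>m. K m \<noteq> {} \<Longrightarrow> n m > 0"
    by metis
  \<comment> \<open>Dividing by n averages, and dividing by \<open>2 ^ m\<close> uses up the
    potential level on \<open>K m\<close> while making the series converge at \<open>z0\<close>. If
    \<open>K m\<close> is empty then n may be 0, and the term is an empty sum.\<close>
  define c where "c = (\<lambda>m. 1 / (2 ^ m * real (n m)))"
  have c0: "0 \<le> c m" for m by (simp add: c_def)
  define Q where "Q = (\<lambda>m z. \<Sum>j<n m. ennreal (c m) * elog L (a m j) z)"
  have sub: "subharmonic_on (\<lambda>z. - enn2ereal (\<Sum>m. Q m z)) (ball z0 R)"
  proof (rule subharmonic_on_neg_suminf)
    show "continuous_on (ball z0 R) (Q m)" for m
      unfolding Q_def by (rule continuous_on_elog_sum[OF L]) simp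
    show "(\<lambda>t. Q m (b + of_real r * cis t)) \<in> borel_measurable circle_measure" for m b r
      unfolding Q_def by (intro borel_measurable_sum borel_measurable_times_ennreal borel_measurable_const elog_measurable_circle L)
    show "(\<integral>\<^sup>+t. Q m (b + of_real r * cis t) \<partial>circle_measure) \<le> ennreal (2 * pi) * Q m b"
      if r: "0 < r" "cball b r \<subseteq> ball z0 R" for m b r
    proof -
      have one: "(\<integral>\<^sup>+t. elog L (a m j) (b + of_real r * cis t) \<partial>circle_measure) \<le> ennreal (2 * pi) * elog L (a m j) b"
        if j: "j < n m" for j
      proof (rule nn_integral_elog_le[OF L r(1)])
        fix \<rho> t :: real assume \<rho>: "0 < \<rho>" "\<rho> \<le> r"
        have "b + of_real \<rho> * cis t \<in> cball b r" using \<rho> by (simp add: dist_norm norm_mult)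
        then have "dist z0 (b + of_real \<rho> * cis t) < R" using r(2) by auto
        moreover have "dist z0 (a m j) < R" using aP[OF j] by auto
        ultimately have "dist (b + of_real \<rho> * cis t) (a m j) \<le> L"
          using dist_triangle3[of "b + of_real \<rho> * cis t" "a m j" z0] unfolding L_def by linarith
        then show "norm (b + of_real \<rho> * cis t - a m j) \<le> L" by (simp add: dist_norm)
      qed
      have "(\<integral>\<^sup>+t. Q m (b + of_real r * cis t) \<partial>circle_measure) =
          (\<Sum>j<n m. ennreal (c m) * (\<integral>\<^sup>+t. elog L (a m j) (b + of_real r * cis t) \<partial>circle_measure))"
        unfolding Q_def
        by (subst nn_integral_sum)
          (auto intro!: sum.cong nn_integral_cmult borel_measurable_times_ennreal borel_measurable_const elog_measurable_circle L)
      also have "\<dots> \<le> (\<Sum>j<n m. ennreal (c m) * (ennreal (2 * pi) * elog L (a m j) b))"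
        using one by (intro sum_mono mult_left_mono) auto
      also have "\<dots> = ennreal (2 * pi) * Q m b" unfolding Q_def by (simp add: sum_distrib_left mult_ac)
      finally show ?thesis .
    qed
  qed simp
  have inf: "(\<Sum>m. Q m x) = top" if x: "x \<in> ?P" for x
  proof -
    have xR: "dist z0 x < R" using x by auto
    obtain m0 where m0: "R / (R - dist z0 x) < real m0" using reals_Archimedean2 by blast
    have mem: "x \<in> K m" if m: "m \<ge> m0" for m
    proof -
      have "R / (R - dist z0 x) < real (m + 2)" using m0 m by simp
      then have "R < real (m + 2) * (R - dist z0 x)" using xR by (simp only: pos_divide_less_eq diff_gt_0_iff_gt)
      then have "R / real (m + 2) < R - dist z0 x" by (simp add: pos_divide_less_eq mult.commute)
      then have "dist z0 x \<le> R * (1 - 1 / real (m + 2))" by (simp add: right_diff_distrib)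
      then show ?thesis using x by (simp add: K_def)
    qed
    have Q1: "1 \<le> Q m x" if m: "m \<ge> m0" for m
    proof -
      have n: "n m > 0" using mem[OF m] npos by blast
      have "1 = ennreal (c m * (2 ^ m * real (n m)))" using n by (simp add: c_def)
      also have "\<dots> = ennreal (c m) * ennreal (2 ^ m * real (n m))" using c0 by (rule ennreal_mult')
      also have "\<dots> \<le> ennreal (c m) * (\<Sum>j<n m. elog L (a m j) x)" using pot[OF mem[OF m]] by (intro mult_left_mono) auto
      also have "\<dots> = Q m x" by (simp add: Q_def sum_distrib_left)
      finally show ?thesis .
    qed
    have ge: "of_nat N \<le> (\<Sum>m. Q m x)" for N
    proof -
      have "(of_nat N :: ennreal) = (\<Sum>m\<in>{m0..<m0 + N}. 1)" by simp
      also have "\<dots> \<le> (\<Sum>m\<in>{m0..<m0 + N}. Q m x)" by (intro sum_mono Q1) simp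
      also have "\<dots> \<le> (\<Sum>m. Q m x)" by (rule sum_le_suminf) auto
      finally show ?thesis .
    qed
    show ?thesis
    proof (rule ccontr)
      assume "(\<Sum>m. Q m x) \<noteq> top"
      then obtain y where y: "(\<Sum>m. Q m x) = ennreal y" "0 \<le> y" by (cases "\<Sum>m. Q m x") auto
      obtain N where "y < real N" using reals_Archimedean2 by blast
      then have "ennreal y < ennreal (real N)" using y(2) by (simp add: ennreal_less_iff)
      then show False using ge[of N] y(1) by (simp add: ennreal_of_nat_eq_real_of_nat)
    qed
  qed
  obtain d where d: "d > 0" "ball z0 d \<subseteq> \<Omega>" using \<Omega> openE by blast
  have fin: "(\<Sum>m. Q m z0) < top"
  proof -
    \<comment> \<open>All configuration points lie outside \<Omega>, hence at distance at least d
      from \<open>z0\<close>, which bounds every summand uniformly.\<close>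
    define D where "D = max 0 (ln (L / d))"
    have el: "elog L (a m j) z0 \<le> ennreal D" if j: "j < n m" for m j
    proof -
      have "a m j \<notin> ball z0 d" using aP[OF j] d by blast
      then have nd: "d \<le> norm (z0 - a m j)" by (simp add: dist_norm)
      then have "L / norm (z0 - a m j) \<le> L / d" using d L
        by (intro divide_left_mono mult_pos_pos) auto
      then have "ln (L / norm (z0 - a m j)) \<le> ln (L / d)" using nd d L by (intro ln_mono divide_pos_pos) auto
      then show ?thesis using nd d by (auto simp: elog_def D_def intro!: ennreal_leI)
    qed
    have "Q m z0 \<le> ennreal ((1 / 2) ^ m * D)" for m
    proof -
      have "Q m z0 \<le> (\<Sum>j<n m. ennreal (c m) * ennreal D)" unfolding Q_def
        using el by (intro sum_mono mult_left_mono) auto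
      also have "\<dots> = (\<Sum>j<n m. ennreal (c m * D))" by (simp add: ennreal_mult' c0)
      also have "\<dots> = ennreal (\<Sum>j<n m. c m * D)" by (rule sum_ennreal) (simp add: c0 D_def)
      also have "(\<Sum>j<n m. c m * D) = (real (n m) * c m) * D" by simp
      also have "ennreal \<dots> \<le> ennreal ((1 / 2) ^ m * D)"
        by (intro ennreal_leI mult_right_mono) (auto simp: c_def D_def power_divide)
      finally show ?thesis .
    qed
    then have "(\<Sum>m. Q m z0) \<le> (\<Sum>m. ennreal ((1 / 2) ^ m * D))" by (intro suminf_le) auto
    also have "\<dots> = ennreal (\<Sum>m. (1 / 2) ^ m * D)"
      by (rule suminf_ennreal2) (auto simp: D_def intro!: summable_mult2 summable_geometric)
    also have "\<dots> < top" by simp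
    finally show ?thesis .
  qed
  show ?thesis unfolding polar_def
  proof (intro conjI exI)
    show "?P \<in> sets borel" using \<Omega>(1) by (intro sets.Diff) auto
    show "subharmonic_on (\<lambda>z. - enn2ereal (\<Sum>m. Q m z)) (ball z0 R)" by (rule sub)
    show "\<forall>C\<in>components (ball z0 R). \<exists>z\<in>C. - enn2ereal (\<Sum>m. Q m z) \<noteq> - \<infinity>"
    proof
      fix C assume "C \<in> components (ball z0 R)"
      then have "C = ball z0 R" using connected_ball[of z0 R] connected_eq_connected_components_eq components_eq_sing_iff R
        by (metis centre_in_ball empty_iff singletonD)
      moreover have "- enn2ereal (\<Sum>m. Q m z0) \<noteq> - \<infinity>"
        using fin by (cases "\<Sum>m. Q m z0") (auto simp: enn2ereal_ennreal)
      ultimately show "\<exists>z\<in>C. - enn2ereal (\<Sum>m. Q m z) \<noteq> - \<infinity>" using R by auto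
    qed
    show "\<forall>z\<in>?P. - enn2ereal (\<Sum>m. Q m z) = - \<infinity>" using inf by (simp add: top_ennreal.rep_eq)
  qed auto
qed

section \<open>Green potentials in a disc\<close>

text \<open>The Green function of \<open>ball z0 R\<close> with pole b, taken with positive sign,
  opposite to \<open>green_function\<close>.\<close>

definition disk_green :: "complex \<Rightarrow> real \<Rightarrow> complex \<Rightarrow> complex \<Rightarrow> real"
  where "disk_green z0 R b z = ln (norm (of_real (R\<^sup>2) - cnj (b - z0) * (z - z0)) / (R * norm (z - b)))"

text \<open>The source of both positivity and boundary decay: the second summand is a product of the
  defects of b and z from the boundary circle.\<close>

lemma norm_square_disk_green_numerator:
  "(norm (of_real (R\<^sup>2) - cnj (b - z0) * (z - z0)))\<^sup>2 =
     R\<^sup>2 * (norm (z - b))\<^sup>2 + (R\<^sup>2 - (norm (b - z0))\<^sup>2) * (R\<^sup>2 - (norm (z - z0))\<^sup>2)"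
proof -
  have "norm (z - b) = norm ((z - z0) - (b - z0))" by simp
  moreover have "(norm (of_real (R\<^sup>2) - cnj \<alpha> * \<zeta>))\<^sup>2 = R\<^sup>2 * (norm (\<zeta> - \<alpha>))\<^sup>2 + (R\<^sup>2 - (norm \<alpha>)\<^sup>2) * (R\<^sup>2 - (norm \<zeta>)\<^sup>2)" for \<alpha> \<zeta>
    unfolding cmod_power2 by (simp add: power2_eq_square algebra_simps)
  ultimately show ?thesis by (simp only:)
qed

context
  fixes z0 b :: complex and R :: real
  assumes b: "b \<in> ball z0 R"
begin

lemma disk_green_R: "R > 0"
  using b by (auto intro: le_less_trans[OF zero_le_dist])

lemma disk_green_b: "norm (b - z0) < R"
  using b by (simp add: dist_norm norm_minus_commute)

lemma disk_green_numerator_ge: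
  assumes "norm (z - z0) < R"
  shows "R * norm (z - b) \<le> norm (of_real (R\<^sup>2) - cnj (b - z0) * (z - z0))"
proof (rule power2_le_imp_le)
  have "(norm (b - z0))\<^sup>2 \<le> R\<^sup>2" "(norm (z - z0))\<^sup>2 \<le> R\<^sup>2"
    using assms disk_green_b by (auto intro!: power_mono)
  then have "0 \<le> (R\<^sup>2 - (norm (b - z0))\<^sup>2) * (R\<^sup>2 - (norm (z - z0))\<^sup>2)" by simp
  then show "(R * norm (z - b))\<^sup>2 \<le> (norm (of_real (R\<^sup>2) - cnj (b - z0) * (z - z0)))\<^sup>2"
    unfolding norm_square_disk_green_numerator by (simp add: power_mult_distrib)
qed simp

lemma disk_green_nonneg:
  assumes "norm (z - z0) < R" "z \<noteq> b"
  shows "0 \<le> disk_green z0 R b z"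
  unfolding disk_green_def using disk_green_numerator_ge[OF assms(1)] assms(2) disk_green_R
  by (intro ln_ge_zero) (simp add: le_divide_eq)

lemma disk_green_numerator_pos:
  assumes "norm (z - z0) < R" "z \<noteq> b"
  shows "norm (of_real (R\<^sup>2) - cnj (b - z0) * (z - z0)) > 0"
proof -
  have "R * norm (z - b) > 0" using assms disk_green_R by simp
  then show ?thesis using disk_green_numerator_ge[OF assms(1)] by linarith
qed

lemma disk_green_le_log:
  assumes "norm (z - z0) < R" "z \<noteq> b"
  shows "disk_green z0 R b z \<le> ln (2 * R / norm (z - b))"
proof -
  have "norm (of_real (R\<^sup>2) - cnj (b - z0) * (z - z0)) \<le> norm (of_real (R\<^sup>2) :: complex) + norm (cnj (b - z0) * (z - z0))"
    by (rule norm_triangle_ineq4)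
  also have "norm (cnj (b - z0) * (z - z0)) = norm (b - z0) * norm (z - z0)" by (simp only: norm_mult complex_mod_cnj)
  also have "norm (of_real (R\<^sup>2) :: complex) + norm (b - z0) * norm (z - z0) \<le> R\<^sup>2 + R * R"
    using assms(1) disk_green_b disk_green_R by (intro add_mono mult_mono) (auto simp: norm_power)
  finally have "norm (of_real (R\<^sup>2) - cnj (b - z0) * (z - z0)) \<le> (2 * R) * R" by (simp add: power2_eq_square)
  then have "norm (of_real (R\<^sup>2) - cnj (b - z0) * (z - z0)) / (R * norm (z - b)) \<le> (2 * R * R) / (R * norm (z - b))"
    using disk_green_R by (intro divide_right_mono) auto
  also have "\<dots> = 2 * R / norm (z - b)" using disk_green_R by simp
  finally show ?thesis unfolding disk_green_def
    using disk_green_numerator_pos[OF assms] assms disk_green_R by (intro ln_mono divide_pos_pos) auto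
qed

lemma disk_green_center:
  assumes "b \<noteq> z0"
  shows "disk_green z0 R b z0 = ln (R / norm (b - z0))"
  using disk_green_R by (simp add: disk_green_def norm_minus_commute power2_eq_square norm_mult)

text \<open>The decay is linear in \<open>ln (R / norm (z - z0))\<close>, uniformly over poles with
  \<open>norm (b - z0) \<le> s\<close>. A small multiple of any average of such functions is thus
  absorbed by the logarithm near the boundary. Both comparisons are instances of
  \<open>ln x \<le> x - 1\<close>.\<close>

lemma disk_green_near_boundary:
  assumes s: "norm (b - z0) \<le> s" and r: "s < r" "r \<le> norm (z - z0)" and z: "norm (z - z0) < R"
  shows "disk_green z0 R b z \<le> R\<^sup>2 / (r - s)\<^sup>2 * ln (R / norm (z - z0))"
proof -
  have R: "R > 0" by (rule disk_green_R)
  define N where "N = norm (of_real (R\<^sup>2) - cnj (b - z0) * (z - z0))"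
  define \<rho> where "\<rho> = norm (z - z0)"
  have s0: "0 \<le> s" using s norm_ge_zero order_trans by blast
  have \<rho>: "0 < \<rho>" "\<rho> < R" using s0 r z by (auto simp: \<rho>_def)
  have "\<rho> \<le> norm (z - b) + norm (b - z0)" unfolding \<rho>_def using norm_triangle_ineq[of "z - b" "b - z0"] by simp
  then have zb: "r - s \<le> norm (z - b)" using s r unfolding \<rho>_def by linarith
  then have zb0: "0 < norm (z - b)" using r by linarith
  then have ne: "z \<noteq> b" by auto
  have Npos: "N > 0" unfolding N_def by (rule disk_green_numerator_pos[OF z ne])
  define q where "q = N / (R * norm (z - b))"
  have q: "q > 0" using Npos R zb0 by (simp add: q_def)
  have Rb: "0 \<le> R\<^sup>2 - (norm (b - z0))\<^sup>2" "R\<^sup>2 - (norm (b - z0))\<^sup>2 \<le> R\<^sup>2"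
    using disk_green_b by (auto intro!: power_mono)
  have R\<rho>: "0 \<le> R\<^sup>2 - \<rho>\<^sup>2" using \<rho> by (auto intro!: power_mono)
  have "2 * ln q = ln (q\<^sup>2)" using q by (simp add: ln_realpow)
  also have "\<dots> \<le> q\<^sup>2 - 1" using q by (intro ln_le_minus_one) simp
  also have "q\<^sup>2 = 1 + ((R\<^sup>2 - (norm (b - z0))\<^sup>2) * (R\<^sup>2 - \<rho>\<^sup>2)) / (R\<^sup>2 * (norm (z - b))\<^sup>2)"
    unfolding q_def power_divide N_def norm_square_disk_green_numerator \<rho>_def[symmetric]
    using R zb0 by (simp add: add_divide_distrib power_mult_distrib)
  also have "((R\<^sup>2 - (norm (b - z0))\<^sup>2) * (R\<^sup>2 - \<rho>\<^sup>2)) / (R\<^sup>2 * (norm (z - b))\<^sup>2) \<le> (R\<^sup>2 * (R\<^sup>2 - \<rho>\<^sup>2)) / (R\<^sup>2 * (r - s)\<^sup>2)"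
    using Rb R\<rho> R r zb by (intro frac_le mult_mono mult_pos_pos power_mono) auto
  also have "\<dots> = (R\<^sup>2 / (r - s)\<^sup>2) * (1 - (\<rho> / R)\<^sup>2)" using R r by (simp add: field_simps)
  also have "\<dots> \<le> (R\<^sup>2 / (r - s)\<^sup>2) * (2 * ln (R / \<rho>))"
  proof (rule mult_left_mono)
    have "ln ((\<rho> / R)\<^sup>2) \<le> (\<rho> / R)\<^sup>2 - 1" using \<rho> R by (intro ln_le_minus_one) simp
    moreover have "ln ((\<rho> / R)\<^sup>2) = - (2 * ln (R / \<rho>))" using \<rho> R by (simp add: ln_realpow ln_div)
    ultimately show "1 - (\<rho> / R)\<^sup>2 \<le> 2 * ln (R / \<rho>)" by linarith
  qed simp
  finally have "2 * ln q \<le> 2 * (R\<^sup>2 / (r - s)\<^sup>2 * ln (R / \<rho>))" by (simp add: mult_ac)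
  then show ?thesis by (simp add: disk_green_def q_def N_def \<rho>_def)
qed

lemma disk_green_eq_diff:
  assumes "norm (z - z0) < R" "z \<noteq> b"
  shows "disk_green z0 R b z = ln (norm (of_real (R\<^sup>2) - cnj (b - z0) * (z - z0))) - ln R - ln (norm (z - b))"
  unfolding disk_green_def using disk_green_numerator_pos[OF assms] assms disk_green_R
  by (simp add: ln_div ln_mult_pos)

lemma disk_green_mean_value:
  assumes r: "0 < r" "r < norm (z - b)" and sub: "cball z r \<subseteq> ball z0 R"
  shows "integrable circle_measure (\<lambda>t. disk_green z0 R b (z + of_real r * cis t))"
    and "(\<integral>t. disk_green z0 R b (z + of_real r * cis t) \<partial>circle_measure) = 2 * pi * disk_green z0 R b z"
proof -
  define N where "N = (\<lambda>w. ln (norm (of_real (R\<^sup>2) - cnj (b - z0) * (w - z0))))"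
  have ne: "z \<noteq> b" using r by auto
  have "z \<in> ball z0 R" using r(1) by (intro subsetD[OF sub]) simp
  then have zR: "norm (z - z0) < R" by (simp add: dist_norm norm_minus_commute)
  have in_ball: "norm (z + of_real r * cis t - z0) < R" for t
  proof -
    have "z + of_real r * cis t \<in> cball z r" using r by (simp add: dist_norm norm_mult)
    from subsetD[OF sub this] show ?thesis by (simp only: mem_ball dist_norm norm_minus_commute)
  qed
  have ne': "z + of_real r * cis t \<noteq> b" for t
  proof
    assume "z + of_real r * cis t = b"
    then have "z - b = - (of_real r * cis t)" by (simp add: algebra_simps)
    then show False using r by (simp add: norm_mult)
  qed
  have eq: "disk_green z0 R b (z + of_real r * cis t) = N (z + of_real r * cis t) - ln R - ln (norm (z + of_real r * cis t - b))" for t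
    unfolding N_def by (rule disk_green_eq_diff[OF in_ball ne'])
  have eqz: "disk_green z0 R b z = N z - ln R - ln (norm (z - b))"
    unfolding N_def by (rule disk_green_eq_diff[OF zR ne])
  have N: "integrable circle_measure (\<lambda>t. N (z + of_real r * cis t)) \<and>
    (\<integral>t. N (z + of_real r * cis t) \<partial>circle_measure) = 2 * pi * N z"
  proof (cases "b = z0")
    case True
    then show ?thesis by (simp add: N_def)
  next
    case False
    define \<beta> where "\<beta> = cnj (b - z0)"
    \<comment> \<open>The reflection of b in the boundary circle; it is the zero of the numerator
      and lies outside the disc, so the numerator contributes an exact mean value.\<close>
    define p where "p = z0 + of_real (R\<^sup>2) / \<beta>"
    have \<beta>: "\<beta> \<noteq> 0" "norm \<beta> < R" using False disk_green_b by (auto simp: \<beta>_def simp del: complex_cnj_diff)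
    have "R < R\<^sup>2 / norm \<beta>" using \<beta> disk_green_R by (simp add: power2_eq_square less_divide_eq)
    then have pz0: "R < norm (p - z0)" by (simp add: p_def norm_divide del: of_real_power)
    have fac: "of_real (R\<^sup>2) - cnj (b - z0) * (w - z0) = \<beta> * (p - w)" for w
      unfolding \<beta>_def[symmetric] p_def using \<beta>(1) by (simp add: algebra_simps)
    have rp: "r < norm (z - p)"
    proof (rule ccontr)
      assume "\<not> r < norm (z - p)"
      then have "p \<in> cball z r" by (simp add: dist_norm)
      from subsetD[OF sub this] show False using pz0 by (simp add: dist_norm norm_minus_commute)
    qed
    have N_eq: "N w = ln (norm \<beta>) + ln (norm (w - p))" if "norm (w - z0) < R" for w
    proof -
      have "w \<noteq> p" using that pz0 by auto
      then show ?thesis unfolding N_def fac using \<beta> by (simp add: norm_mult ln_mult_pos norm_minus_commute)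
    qed
    note il = integral_ln_norm_circle[OF r(1) rp]
    show ?thesis unfolding N_eq[OF in_ball] N_eq[OF zR]
      by (subst Bochner_Integration.integral_add) (simp_all add: il distrib_left)
  qed
  note il = integral_ln_norm_circle[OF r]
  show "integrable circle_measure (\<lambda>t. disk_green z0 R b (z + of_real r * cis t))"
    unfolding eq using N il(1) by simp
  have "(\<integral>t. disk_green z0 R b (z + of_real r * cis t) \<partial>circle_measure) = 2 * pi * N z - 2 * pi * ln R - 2 * pi * ln (norm (z - b))"
    unfolding eq using N il by simp
  then show "(\<integral>t. disk_green z0 R b (z + of_real r * cis t) \<partial>circle_measure) = 2 * pi * disk_green z0 R b z"
    unfolding eqz by (simp add: algebra_simps)
qed

text \<open>The constant depends on the pole only through s and d, so it survives averaging over
  configurations and the limsup. The first summand comes from the numerator, which is at least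
  \<open>R * (R - s)\<close>, the second from the distance to the pole.\<close>

lemma disk_green_Lipschitz:
  assumes s: "norm (b - z0) \<le> s" "s < R" and d: "d > 0" "d \<le> norm (z - b)" "d \<le> norm (w - b)"
    and z: "norm (z - z0) < R" and w: "norm (w - z0) < R"
  shows "disk_green z0 R b z \<le> disk_green z0 R b w + (s / (R * (R - s)) + 1 / d) * norm (z - w)"
proof -
  have R: "R > 0" by (rule disk_green_R)
  have s0: "0 \<le> s" using s(1) norm_ge_zero order_trans by blast
  have ln_le: "ln x \<le> ln y + e / c" if "c > 0" "c \<le> y" "0 < x" "x - y \<le> e" "0 \<le> e" for x y c e :: real
  proof -
    have y: "y > 0" using that by linarith
    have "ln x - ln y = ln (x / y)" using that y by (simp add: ln_div)
    also have "\<dots> \<le> x / y - 1" using that y by (intro ln_le_minus_one) simp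
    also have "\<dots> = (x - y) / y" using y by (simp add: diff_divide_distrib)
    also have "\<dots> \<le> e / y" using y that by (intro divide_right_mono) auto
    also have "\<dots> \<le> e / c" using that y by (intro divide_left_mono mult_pos_pos) auto
    finally show ?thesis by simp
  qed
  define N where "N = (\<lambda>w. norm (of_real (R\<^sup>2) - cnj (b - z0) * (w - z0)))"
  have zb: "z \<noteq> b" "w \<noteq> b" using d by auto
  have Nge: "R * (R - s) \<le> N u" if u: "norm (u - z0) < R" for u
  proof -
    have "norm (of_real (R\<^sup>2) :: complex) - norm (cnj (b - z0) * (u - z0)) \<le> N u"
      unfolding N_def by (rule norm_triangle_ineq2)
    moreover have "norm (cnj (b - z0) * (u - z0)) = norm (b - z0) * norm (u - z0)"
      by (simp only: norm_mult complex_mod_cnj)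
    moreover have "norm (b - z0) * norm (u - z0) \<le> s * R" using s s0 u by (intro mult_mono) auto
    moreover have "norm (of_real (R\<^sup>2) :: complex) = R * R" by (simp add: power2_eq_square norm_mult)
    ultimately show ?thesis by (simp add: algebra_simps)
  qed
  have Ndiff: "N z - N w \<le> s * norm (z - w)"
  proof -
    have "N z - N w \<le> norm ((of_real (R\<^sup>2) - cnj (b - z0) * (z - z0)) - (of_real (R\<^sup>2) - cnj (b - z0) * (w - z0)))"
      unfolding N_def by (rule norm_triangle_ineq2)
    also have "(of_real (R\<^sup>2) - cnj (b - z0) * (z - z0)) - (of_real (R\<^sup>2) - cnj (b - z0) * (w - z0)) = cnj (b - z0) * (w - z)"
      by (simp add: algebra_simps)
    also have "norm \<dots> = norm (b - z0) * norm (z - w)" by (simp only: norm_mult complex_mod_cnj norm_minus_commute)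
    also have "\<dots> \<le> s * norm (z - w)" using s by (intro mult_right_mono) auto
    finally show ?thesis .
  qed
  have c: "0 < R * (R - s)" using R s by simp
  have 1: "ln (N z) \<le> ln (N w) + s * norm (z - w) / (R * (R - s))"
    using Nge[OF w] Nge[OF z] c Ndiff s0 by (intro ln_le) auto
  have "norm (w - b) - norm (z - b) \<le> norm (w - z)" using norm_triangle_ineq2[of "w - b" "z - b"] by simp
  then have 2: "ln (norm (w - b)) \<le> ln (norm (z - b)) + norm (z - w) / d"
    using d zb by (intro ln_le) (auto simp: norm_minus_commute)
  show ?thesis unfolding disk_green_eq_diff[OF z zb(1)] disk_green_eq_diff[OF w zb(2)]
    using 1[unfolded N_def] 2 by (simp only: distrib_right) (simp del: complex_cnj_diff)
qed

end

section \<open>Bounded potentials and the logarithmic capacity\<close>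

text \<open>The limsup h of averaged Green functions is bounded, continuous and satisfies the
  submean inequality on \<Omega>; it is dominated by \<open>ln (R / norm (z - z0))\<close> near the
  boundary and positive at \<open>z0\<close>. Adding a small multiple to the logarithm gives a
  competitor that is strictly larger at the pole.\<close>

lemma log_capacity_gt_of_bounded_potential:
  assumes \<Omega>: "open \<Omega>" "z0 \<in> \<Omega>" "\<Omega> \<subseteq> ball z0 R"
    and K: "compact K" "K \<noteq> {}" "K \<subseteq> ball z0 R - \<Omega>"
    and pot: "\<forall>n>0. \<exists>a. (\<forall>i<n. a i \<in> K) \<and> (\<forall>z. (\<Sum>j<n. log_kernel (2 * R) (real n) z (a j)) \<le> real n * V)"
  shows "1 / R < log_capacity \<Omega> z0"
proof -
  have R: "R > 0" using \<Omega> by (auto intro: le_less_trans[OF zero_le_dist])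
  have "\<exists>x\<in>K. \<forall>y\<in>K. dist z0 y \<le> dist z0 x"
    by (rule continuous_attains_sup[OF K(1,2)]) (intro continuous_intros)
  then obtain b0 where b0: "b0 \<in> K" "\<And>b. b \<in> K \<Longrightarrow> dist z0 b \<le> dist z0 b0" by blast
  define s where "s = norm (b0 - z0)"
  have Ks: "norm (b - z0) \<le> s" if "b \<in> K" for b using b0(2)[OF that] by (simp add: s_def dist_norm norm_minus_commute)
  have "b0 \<in> ball z0 R" "b0 \<noteq> z0" using b0(1) K(3) \<Omega>(2) by auto
  then have s: "0 < s" "s < R" by (auto simp: s_def dist_norm norm_minus_commute)
  have "\<exists>a. (\<forall>i<Suc k. a i \<in> K) \<and> (\<forall>z. (\<Sum>j<Suc k. log_kernel (2 * R) (real (Suc k)) z (a j)) \<le> real (Suc k) * V)" for k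
    using pot by blast
  then obtain a where aK: "\<And>k i. i < Suc k \<Longrightarrow> a k i \<in> K"
    and aV: "\<And>k z. (\<Sum>j<Suc k. log_kernel (2 * R) (real (Suc k)) z (a k j)) \<le> real (Suc k) * V"
    by metis
  have ball: "a k i \<in> ball z0 R" if "i < Suc k" for k i using aK[OF that] K(3) by blast
  define G where "G = (\<lambda>k z. (\<Sum>j<Suc k. disk_green z0 R (a k j) z) / real (Suc k))"
  have G_le: "G k z \<le> c" if "\<And>b. b \<in> K \<Longrightarrow> b \<in> ball z0 R \<Longrightarrow> disk_green z0 R b z \<le> c" for k z c
  proof -
    have "(\<Sum>j<Suc k. disk_green z0 R (a k j) z) \<le> of_nat (card {..<Suc k}) * c"
      using that aK ball by (intro sum_bounded_above) auto
    then show ?thesis unfolding G_def by (simp only: pos_divide_le_eq of_nat_0_less_iff zero_less_Suc card_lessThan mult.commute)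
  qed
  have G_ge: "c \<le> G k z" if "\<And>b. b \<in> K \<Longrightarrow> b \<in> ball z0 R \<Longrightarrow> c \<le> disk_green z0 R b z" for k z c
  proof -
    have "of_nat (card {..<Suc k}) * c \<le> (\<Sum>j<Suc k. disk_green z0 R (a k j) z)"
      using that aK ball by (intro sum_bounded_below) auto
    then show ?thesis unfolding G_def by (simp only: pos_le_divide_eq of_nat_0_less_iff zero_less_Suc card_lessThan mult.commute)
  qed
  have zR: "norm (z - z0) < R" if "z \<in> \<Omega>" for z using that \<Omega>(3) by (auto simp: dist_norm norm_minus_commute)
  have zK: "z \<noteq> b" if "z \<in> \<Omega>" "b \<in> K" for z b using that K(3) by auto
  have G0: "0 \<le> G k z" if "z \<in> \<Omega>" for k z
    using that by (intro G_ge disk_green_nonneg zR zK)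
  have G_log: "G k z \<le> ln (2 * R / d)" if z: "z \<in> \<Omega>" and d: "d > 0" "\<And>b. b \<in> K \<Longrightarrow> d \<le> norm (z - b)" for k z d
  proof (rule G_le)
    fix b assume b: "b \<in> K" "b \<in> ball z0 R"
    have "disk_green z0 R b z \<le> ln (2 * R / norm (z - b))" using disk_green_le_log[OF b(2) zR[OF z] zK[OF z b(1)]] .
    also have "\<dots> \<le> ln (2 * R / d)"
    proof (rule ln_mono)
      show "2 * R / norm (z - b) \<le> 2 * R / d" using d d(2)[OF b(1)] R by (intro divide_left_mono mult_pos_pos) auto
      show "0 < 2 * R / norm (z - b)" using R zK[OF z b(1)] by simp
    qed
    finally show "disk_green z0 R b z \<le> ln (2 * R / d)" .
  qed
  have far: "d / 2 \<le> norm (w - b)" if "ball z d \<subseteq> \<Omega>" "norm (w - z) \<le> d / 2" "b \<in> K" for z w b d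
  proof -
    have "b \<notin> ball z d" using that K(3) by blast
    then have "d \<le> norm (b - z)" by (simp add: dist_norm norm_minus_commute)
    also have "\<dots> \<le> norm (w - z) + norm (w - b)" using norm_triangle_ineq4[of "w - z" "w - b"] by simp
    finally show ?thesis using that(2) by (simp add: field_simps)
  qed
  \<comment> \<open>The limsup takes the role of the potential of a limit measure. On \<Omega> it is
    finite, so \<open>enn2real\<close> loses nothing there (\<open>lim_h\<close>).\<close>
  define h where "h = (\<lambda>z. enn2real (limsup (\<lambda>k. ennreal (G k z))))"
  have h0: "0 \<le> h z" for z by (simp add: h_def)
  have lim_le: "limsup (\<lambda>k. ennreal (G k z)) \<le> ennreal c" if "\<forall>\<^sub>F k in sequentially. G k z \<le> c" for z c
    using that by (intro Limsup_bounded) (auto elim!: eventually_mono intro: ennreal_leI)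
  have h_le: "h z \<le> c" if "\<forall>\<^sub>F k in sequentially. G k z \<le> c" "0 \<le> c" for z c
    unfolding h_def using enn2real_mono[OF lim_le[OF that(1)]] that(2) by simp
  have lim_h: "limsup (\<lambda>k. ennreal (G k z)) = ennreal (h z)" if z: "z \<in> \<Omega>" for z
  proof -
    obtain d where d: "d > 0" "ball z d \<subseteq> \<Omega>" using \<Omega>(1) z openE by blast
    have "d / 2 \<le> norm (z - b)" if "b \<in> K" for b using far[OF d(2) _ that, of z] d(1) by simp
    then have "G k z \<le> ln (2 * R / (d / 2))" for k using d by (intro G_log z) auto
    then have "limsup (\<lambda>k. ennreal (G k z)) \<le> ennreal (ln (2 * R / (d / 2)))" by (intro lim_le) auto
    then have "limsup (\<lambda>k. ennreal (G k z)) < top" using ennreal_less_top le_less_trans by blast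
    then show ?thesis by (simp add: h_def)
  qed
  \<comment> \<open>Away from K the logarithms are bounded, so for large k the cutoff
    \<open>real (Suc k)\<close> is inactive at z and the bound V on the capped potentials applies to
    the Green functions.\<close>
  have GV: "\<forall>\<^sub>F k in sequentially. G k z \<le> V" if z: "z \<in> \<Omega>" for z
  proof -
    obtain d where d: "d > 0" "ball z d \<subseteq> \<Omega>" using \<Omega>(1) z openE by blast
    have dK: "d / 2 \<le> norm (z - b)" if "b \<in> K" for b using far[OF d(2) _ that, of z] d(1) by simp
    obtain k0 where k0: "ln (2 * R / (d / 2)) \<le> real k0" using real_arch_simple by blast
    have "G k z \<le> V" if k: "k \<ge> k0" for k
    proof -
      have "disk_green z0 R (a k j) z \<le> log_kernel (2 * R) (real (Suc k)) z (a k j)" if j: "j < Suc k" for j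
      proof -
        have ne: "z \<noteq> a k j" using zK[OF z aK[OF j]] .
        have "ln (2 * R / norm (z - a k j)) \<le> ln (2 * R / (d / 2))"
        proof (rule ln_mono)
          show "2 * R / norm (z - a k j) \<le> 2 * R / (d / 2)"
            using d dK[OF aK[OF j]] R ne by (intro divide_left_mono mult_pos_pos) auto
          show "0 < 2 * R / norm (z - a k j)" using R ne by simp
        qed
        then have "ln (2 * R / norm (z - a k j)) \<le> real (Suc k)" using k0 k by linarith
        then show ?thesis using disk_green_le_log[OF ball[OF j] zR[OF z] ne] ne by (simp add: log_kernel_def)
      qed
      then have "(\<Sum>j<Suc k. disk_green z0 R (a k j) z) \<le> (\<Sum>j<Suc k. log_kernel (2 * R) (real (Suc k)) z (a k j))"
        by (intro sum_mono) simp
      also have "\<dots> \<le> real (Suc k) * V" by (rule aV)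
      finally show ?thesis unfolding G_def by (simp only: pos_divide_le_eq of_nat_0_less_iff zero_less_Suc mult.commute)
    qed
    then show ?thesis unfolding eventually_sequentially by blast
  qed
  have V: "0 \<le> V"
  proof -
    obtain k where "G k z0 \<le> V" using GV[OF \<Omega>(2)] unfolding eventually_sequentially by blast
    then show ?thesis using G0[OF \<Omega>(2), of k] by linarith
  qed
  have hV: "h z \<le> V" if "z \<in> \<Omega>" for z using h_le[OF GV[OF that] V] .
  have hz0: "ln (R / s) \<le> h z0"
  proof -
    have "ln (R / s) \<le> G k z0" for k
    proof (rule G_ge)
      fix b assume b: "b \<in> K" "b \<in> ball z0 R"
      have ne: "b \<noteq> z0" using zK[OF \<Omega>(2) b(1)] by simp
      have "ln (R / s) \<le> ln (R / norm (b - z0))"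
        using ne s R Ks[OF b(1)] by (intro ln_mono divide_left_mono mult_pos_pos divide_pos_pos) auto
      then show "ln (R / s) \<le> disk_green z0 R b z0" unfolding disk_green_center[OF b(2) ne] .
    qed
    then have "ennreal (ln (R / s)) \<le> limsup (\<lambda>k. ennreal (G k z0))"
      by (intro le_Limsup always_eventually allI ennreal_leI) auto
    then show ?thesis unfolding lim_h[OF \<Omega>(2)] using h0 by (simp add: ennreal_le_iff)
  qed
  have hpos: "0 < h z0"
  proof -
    have "0 < ln (R / s)" using s by (intro ln_gt_zero) simp
    then show ?thesis using hz0 by linarith
  qed
  \<comment> \<open>A circle between K and the boundary: beyond it the boundary decay of the Green
    functions is used, inside it only the bound V.\<close>
  define r where "r = (s + R) / 2"
  have r: "s < r" "r < R" using s by (auto simp: r_def field_simps)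
  define C where "C = R\<^sup>2 / (r - s)\<^sup>2"
  have C: "C > 0" using R r by (simp add: C_def)
  have h_bd: "h z \<le> C * ln (R / norm (z - z0))" if z: "z \<in> \<Omega>" "r \<le> norm (z - z0)" for z
  proof (rule h_le)
    have "G k z \<le> C * ln (R / norm (z - z0))" for k
      unfolding C_def using disk_green_near_boundary[OF _ Ks r(1) z(2) zR[OF z(1)]] by (intro G_le)
    then show "\<forall>\<^sub>F k in sequentially. G k z \<le> C * ln (R / norm (z - z0))" by simp
    have "0 < norm (z - z0)" using z(2) r s by linarith
    then have "0 \<le> ln (R / norm (z - z0))" using zR[OF z(1)] by (intro ln_ge_zero) (simp add: le_divide_eq)
    then show "0 \<le> C * ln (R / norm (z - z0))" using C by simp
  qed
  have cont: "continuous_on \<Omega> h"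
  proof (rule continuous_at_imp_continuous_on, rule ballI)
    fix z assume z: "z \<in> \<Omega>"
    obtain d where d: "d > 0" "ball z d \<subseteq> \<Omega>" using \<Omega>(1) z openE by blast
    define E where "E = s / (R * (R - s)) + 1 / (d / 2)"
    have E: "0 \<le> E" using s d by (simp add: E_def)
    have lip: "h v \<le> h w + E * norm (v - w)" if v: "norm (v - z) < d / 2" and w: "norm (w - z) < d / 2" for v w
    proof -
      have "v \<in> ball z d" "w \<in> ball z d" using v w d(1) by (auto simp: dist_norm norm_minus_commute)
      then have in\<Omega>: "v \<in> \<Omega>" "w \<in> \<Omega>" using d(2) by auto
      have "G k v \<le> E * norm (v - w) + G k w" for k
      proof -
        have "disk_green z0 R (a k j) v \<le> disk_green z0 R (a k j) w + E * norm (v - w)" if j: "j < Suc k" for j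
          unfolding E_def
          using disk_green_Lipschitz[OF ball[OF j] Ks[OF aK[OF j]] s(2), of "d / 2" v w]
            far[OF d(2) _ aK[OF j]] v w d(1) zR[OF in\<Omega>(1)] zR[OF in\<Omega>(2)] by simp
        then have "(\<Sum>j<Suc k. disk_green z0 R (a k j) v) \<le> (\<Sum>j<Suc k. disk_green z0 R (a k j) w + E * norm (v - w))"
          by (intro sum_mono) simp
        also have "\<dots> = (\<Sum>j<Suc k. disk_green z0 R (a k j) w) + real (Suc k) * (E * norm (v - w))"
          by (simp only: sum.distrib sum_constant card_lessThan)
        finally have "G k v \<le> ((\<Sum>j<Suc k. disk_green z0 R (a k j) w) + real (Suc k) * (E * norm (v - w))) / real (Suc k)"
          unfolding G_def by (intro divide_right_mono) auto
        also have "\<dots> = E * norm (v - w) + G k w" unfolding G_def add_divide_distrib by simp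
        finally show ?thesis .
      qed
      then have "ennreal (G k v) \<le> ennreal (E * norm (v - w)) + ennreal (G k w)" for k
        using E G0[OF in\<Omega>(2)] by (simp add: ennreal_plus[symmetric] ennreal_leI del: ennreal_plus)
      then have "limsup (\<lambda>k. ennreal (G k v)) \<le> limsup (\<lambda>k. ennreal (E * norm (v - w)) + ennreal (G k w))"
        by (intro Limsup_mono always_eventually allI)
      also have "\<dots> = ennreal (E * norm (v - w)) + limsup (\<lambda>k. ennreal (G k w))" by (rule Limsup_const_add) simp
      finally have le: "ennreal (h v) \<le> ennreal (E * norm (v - w) + h w)"
        unfolding lim_h[OF in\<Omega>(1)] lim_h[OF in\<Omega>(2)] using E h0 by (simp add: ennreal_plus)
      have "0 \<le> E * norm (v - w) + h w" using E h0[of w] by simp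
      from iffD1[OF ennreal_le_iff[OF this] le] show ?thesis by simp
    qed
    have "((\<lambda>w. h w - h z) \<longlongrightarrow> 0) (at z)"
    proof (rule Lim_null_comparison)
      have "\<forall>\<^sub>F w in at z. w \<in> ball z (d / 2)" using d(1) by (intro eventually_at_in_open') auto
      then show "\<forall>\<^sub>F w in at z. norm (h w - h z) \<le> E * norm (w - z)"
      proof eventually_elim
        case (elim w)
        then have w: "norm (w - z) < d / 2" by (simp add: dist_norm norm_minus_commute)
        show ?case using lip[OF w, of z] lip[OF _ w, of z] d(1) by (simp add: norm_minus_commute abs_le_iff)
      qed
      show "((\<lambda>w. E * norm (w - z)) \<longlongrightarrow> 0) (at z)"
        by (intro tendsto_mult_right_zero tendsto_norm_zero LIM_zero tendsto_ident_at)
    qed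
    then show "isCont h z" unfolding isCont_def by (rule LIM_zero_cancel)
  qed
  have submean: "2 * pi * h z \<le> (\<integral>t. h (z + of_real \<rho> * cis t) \<partial>circle_measure)"
    if z: "z \<in> \<Omega>" and d: "ball z d \<subseteq> \<Omega>" and \<rho>: "0 < \<rho>" "\<rho> < d / 2" for z d \<rho>
  proof -
    have d0: "d > 0" using \<rho> by linarith
    have cb: "cball z \<rho> \<subseteq> \<Omega>" using \<rho> d0 by (intro order_trans[OF _ d]) auto
    have cbR: "cball z \<rho> \<subseteq> ball z0 R" using cb \<Omega>(3) by blast
    let ?p = "\<lambda>t. z + of_real \<rho> * cis t"
    have p_cb: "?p t \<in> cball z \<rho>" for t using \<rho> by (simp add: dist_norm norm_mult)
    have p\<Omega>: "?p t \<in> \<Omega>" for t using p_cb cb by blast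
    have aout: "\<rho> < norm (z - a k j)" if "j < Suc k" for k j
    proof -
      have "a k j \<notin> cball z \<rho>" using aK[OF that] K(3) cb by blast
      then show ?thesis by (simp add: dist_norm)
    qed
    note mv = disk_green_mean_value[OF ball \<rho>(1) aout cbR]
    have Gi: "integrable circle_measure (\<lambda>t. G k (?p t))" for k
      unfolding G_def by (intro integrable_divide Bochner_Integration.integrable_sum mv) auto
    have Gm: "(\<integral>t. G k (?p t) \<partial>circle_measure) = 2 * pi * G k z" for k
    proof -
      have "(\<integral>t. G k (?p t) \<partial>circle_measure) = (\<Sum>j<Suc k. \<integral>t. disk_green z0 R (a k j) (?p t) \<partial>circle_measure) / real (Suc k)"
        unfolding G_def integral_divide_zero using mv(1) by (subst Bochner_Integration.integral_sum) auto
      also have "(\<Sum>j<Suc k. \<integral>t. disk_green z0 R (a k j) (?p t) \<partial>circle_measure) = (\<Sum>j<Suc k. 2 * pi * disk_green z0 R (a k j) z)"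
        using mv(2) by (intro sum.cong) auto
      finally show ?thesis by (simp only: G_def sum_distrib_left times_divide_eq_right)
    qed
    have hi: "integrable circle_measure (\<lambda>t. h (?p t))"
      using p\<Omega> by (intro continuous_imp_integrable_circle_measure continuous_on_compose2[OF cont] continuous_on_circle) auto
    have nn: "(\<integral>\<^sup>+t. ennreal (G k (?p t)) \<partial>circle_measure) = ennreal (2 * pi) * ennreal (G k z)" for k
      using nn_integral_eq_integral[OF Gi, of k] G0[OF p\<Omega>] by (simp add: Gm ennreal_mult')
    have cmult: "limsup (\<lambda>k. ennreal (2 * pi) * ennreal (G k z)) = ennreal (2 * pi) * limsup (\<lambda>k. ennreal (G k z))"
      by (rule Limsup_compose_continuous_mono) (auto intro!: ennreal_continuous_on_cmult continuous_intros monoI mult_left_mono)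
    have "ennreal (2 * pi * h z) = limsup (\<lambda>k. ennreal (2 * pi) * ennreal (G k z))"
      unfolding cmult lim_h[OF z] by (simp add: ennreal_mult')
    also have "\<dots> = limsup (\<lambda>k. \<integral>\<^sup>+t. ennreal (G k (?p t)) \<partial>circle_measure)" unfolding nn ..
    \<comment> \<open>The reverse Fatou lemma, with the constant bound valid away from K; its
      direction is that of a submean inequality.\<close>
    also have "\<dots> \<le> (\<integral>\<^sup>+t. limsup (\<lambda>k. ennreal (G k (?p t))) \<partial>circle_measure)"
    proof (rule nn_integral_limsup[where w = "\<lambda>_. ennreal (ln (2 * R / (d / 2)))"])
      show "(\<lambda>t. ennreal (G k (?p t))) \<in> borel_measurable circle_measure" for k
        using Gi[of k] by (intro measurable_compose[OF _ measurable_ennreal] borel_measurable_integrable)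
      have "G k (?p t) \<le> ln (2 * R / (d / 2))" for k t
        using d0 \<rho> far[OF d, of "?p t"] by (intro G_log p\<Omega>) (auto simp: norm_mult)
      then show "AE t in circle_measure. ennreal (G k (?p t)) \<le> ennreal (ln (2 * R / (d / 2)))" for k
        by (intro AE_I2 ennreal_leI)
      show "(\<integral>\<^sup>+t. ennreal (ln (2 * R / (d / 2))) \<partial>circle_measure) < \<infinity>"
        by (simp add: emeasure_circle_measure[unfolded space_circle_measure] ennreal_mult_less_top)
    qed simp
    also have "\<dots> = (\<integral>\<^sup>+t. ennreal (h (?p t)) \<partial>circle_measure)" unfolding lim_h[OF p\<Omega>] ..
    also have "\<dots> = ennreal (\<integral>t. h (?p t) \<partial>circle_measure)" using h0 by (intro nn_integral_eq_integral[OF hi]) auto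
    finally show ?thesis using h0 by (subst (asm) ennreal_le_iff) (auto intro: integral_nonneg_AE)
  qed
  \<comment> \<open>The first entry gives \<open>\<delta> * C < 1\<close>, so the sum stays negative
    near the boundary; the second gives \<open>\<delta> * V < ln (R / r)\<close>, which does the
    same inside. \<open>V + 1\<close> avoids division by 0.\<close>
  define \<delta> where "\<delta> = min (1 / (2 * C)) (ln (R / r) / (2 * (V + 1)))"
  have lnr: "0 < ln (R / r)" using r s by (intro ln_gt_zero) simp
  have \<delta>: "\<delta> > 0" using C V lnr by (simp add: \<delta>_def)
  have \<delta>C: "\<delta> * C < 1"
  proof -
    have "\<delta> * C \<le> 1 / (2 * C) * C" using C by (intro mult_right_mono) (auto simp: \<delta>_def)
    then show ?thesis using C by simp
  qed
  have \<delta>V: "\<delta> * V < ln (R / r)"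
  proof -
    have "\<delta> * V < \<delta> * (2 * (V + 1))" using \<delta> V by (intro mult_strict_left_mono) auto
    also have "\<dots> \<le> ln (R / r) / (2 * (V + 1)) * (2 * (V + 1))" using V by (intro mult_right_mono) (auto simp: \<delta>_def)
    finally show ?thesis using V by simp
  qed
  have "exp (\<delta> * h z0) / R \<le> log_capacity \<Omega> z0"
  proof (rule log_capacity_ge[OF \<Omega>, where h = "\<lambda>z. \<delta> * h z" and B = "\<delta> * V"])
    show "continuous_on \<Omega> (\<lambda>z. \<delta> * h z)" by (intro continuous_intros cont)
    show "\<bar>\<delta> * h z\<bar> \<le> \<delta> * V" if "z \<in> \<Omega>" for z using hV[OF that] h0[of z] \<delta> by (simp add: abs_mult)
    show "\<exists>\<eta>>0. \<forall>\<rho>. 0 < \<rho> \<and> \<rho> < \<eta> \<longrightarrow> 2 * pi * (\<delta> * h z) \<le> (\<integral>t. \<delta> * h (z + of_real \<rho> * cis t) \<partial>circle_measure)"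
      if z: "z \<in> \<Omega>" for z
    proof -
      obtain d where d: "d > 0" "ball z d \<subseteq> \<Omega>" using \<Omega>(1) z openE by blast
      have "2 * pi * (\<delta> * h z) \<le> (\<integral>t. \<delta> * h (z + of_real \<rho> * cis t) \<partial>circle_measure)" if "0 < \<rho>" "\<rho> < d / 2" for \<rho>
      proof -
        have "\<delta> * (2 * pi * h z) \<le> \<delta> * (\<integral>t. h (z + of_real \<rho> * cis t) \<partial>circle_measure)"
          using submean[OF z d(2) that] \<delta> by (intro mult_left_mono) auto
        then show ?thesis by (simp add: mult_ac)
      qed
      then show ?thesis using d(1) by (intro exI[of _ "d / 2"]) auto
    qed
    show "ln (norm (z - z0) / R) + \<delta> * h z < 0" if z: "z \<in> \<Omega> - {z0}" for z
    proof -
      have nz: "0 < norm (z - z0)" "norm (z - z0) < R" using z zR by auto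
      have eq: "ln (norm (z - z0) / R) = - ln (R / norm (z - z0))" using nz R by (simp add: ln_div)
      have lnp: "0 < ln (R / norm (z - z0))" using nz by (intro ln_gt_zero) simp
      have "\<delta> * h z < ln (R / norm (z - z0))"
      proof (cases "r \<le> norm (z - z0)")
        case True
        have "\<delta> * h z \<le> \<delta> * (C * ln (R / norm (z - z0)))" using h_bd[OF _ True] z \<delta> by (intro mult_left_mono) auto
        also have "\<dots> = (\<delta> * C) * ln (R / norm (z - z0))" by simp
        also have "\<dots> < 1 * ln (R / norm (z - z0))" using \<delta>C lnp by (rule mult_strict_right_mono)
        finally show ?thesis by simp
      next
        case False
        have "\<delta> * h z \<le> \<delta> * V" using hV z \<delta> by (intro mult_left_mono) auto
        also have "\<dots> < ln (R / r)" by (rule \<delta>V)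
        also have "\<dots> \<le> ln (R / norm (z - z0))" using False nz r s R
          by (intro ln_mono divide_left_mono mult_pos_pos divide_pos_pos) auto
        finally show ?thesis .
      qed
      then show ?thesis unfolding eq by simp
    qed
  qed
  moreover have "1 / R < exp (\<delta> * h z0) / R" using \<delta> hpos R by (intro divide_strict_right_mono) auto
  ultimately show ?thesis by linarith
qed

text \<open>A bounded potential on any nonempty compact piece would raise the capacity above
  \<open>1 / R\<close>, so every such piece falls under the first alternative of the
  dichotomy.\<close>

lemma polar_of_log_capacity_le:
  assumes \<Omega>: "open \<Omega>" "z0 \<in> \<Omega>" "\<Omega> \<subseteq> ball z0 R" and le: "log_capacity \<Omega> z0 \<le> 1 / R"
  shows "polar (ball z0 R - \<Omega>)"
proof (rule polar_of_log_potentials[OF \<Omega>(1,2)])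
  show "R > 0" using \<Omega> by (auto intro: le_less_trans[OF zero_le_dist])
  fix s V :: real
  let ?K = "(ball z0 R - \<Omega>) \<inter> cball z0 s"
  assume s: "s < R" and ne: "?K \<noteq> {}"
  have "?K = cball z0 s - \<Omega>" using s by auto
  then have K: "compact ?K" "?K \<subseteq> ball z0 R" "?K \<subseteq> ball z0 R - \<Omega>" using \<Omega>(1) by (auto simp: compact_diff)
  show "\<exists>n>0. \<exists>a. (\<forall>i<n. a i \<in> ?K) \<and>
      (\<forall>x\<in>?K. x \<in> a ` {..<n} \<or> real n * V \<le> (\<Sum>j<n. ln (2 * R / norm (x - a j))))"
    using log_potential_dichotomy[OF ne K(2)]
  proof
    assume "\<exists>V. \<forall>n>0. \<exists>a. (\<forall>i<n. a i \<in> ?K) \<and> (\<forall>z. (\<Sum>j<n. log_kernel (2 * R) (real n) z (a j)) \<le> real n * V)"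
    then obtain W where "\<forall>n>0. \<exists>a. (\<forall>i<n. a i \<in> ?K) \<and> (\<forall>z. (\<Sum>j<n. log_kernel (2 * R) (real n) z (a j)) \<le> real n * W)" ..
    from log_capacity_gt_of_bounded_potential[OF \<Omega> K(1) ne K(3) this] le show ?thesis by linarith
  qed (rule spec)
qed

section \<open>Assembly of the equality case\<close>

text \<open>A competitor extends across P in each smaller concentric disc, so Cauchy's estimate
  holds with radius \<open>s = t * R\<close>; then t tends to 1. The radii
  \<open>s < s1 < s2 < R\<close> leave room for the annulus used in the localization.\<close>

lemma analytic_capacity_le_of_removable:
  assumes \<Omega>: "open \<Omega>" "z0 \<in> \<Omega>" "\<Omega> = ball z0 R - P" and null: "emeasure lborel (ball z0 R - \<Omega>) = 0"
    and NB: "\<And>s. s < R \<Longrightarrow> null_set_NB (Some ` (P \<inter> cball z0 s))"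
  shows "analytic_capacity \<Omega> z0 \<le> 1 / R"
proof (rule analytic_capacity_least)
  fix f assume f: "f holomorphic_on \<Omega>" "f ` \<Omega> \<subseteq> ball 0 1" "f z0 = 0"
  have "z0 \<in> ball z0 R" using \<Omega> by blast
  then have R: "R > 0" by simp
  have f1: "norm (f z) \<le> 1" if "z \<in> \<Omega>" for z using f(2) that by (auto simp: image_subset_iff less_imp_le)
  have "cmod (deriv f z0) * R \<le> 1"
  proof (rule field_le_mult_one_interval)
    fix t :: real assume t: "0 < t" "t < 1"
    define s where "s = t * R"
    have s: "0 < s" "s < R" using t R by (auto simp: s_def)
    obtain s1 where s1: "s < s1" "s1 < R" using dense[OF s(2)] by blast
    obtain s2 where s2: "s1 < s2" "s2 < R" using dense[OF s1(2)] by blast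
    have s10: "0 < s1" using s s1 by linarith
    obtain h where h: "h holomorphic_on ball z0 s1" "\<And>z. z \<in> \<Omega> \<inter> ball z0 s1 \<Longrightarrow> h z = f z"
      using removable_of_null_set_NB[OF \<Omega>(1,3) s10 s2 NB[OF s2(2)] f(1) f1] by blast
    have hc: "continuous_on (ball z0 s1) h" using h(1) by (rule holomorphic_on_imp_continuous_on)
    have cl: "ball z0 s1 \<subseteq> closure (ball z0 s1 \<inter> \<Omega>)"
    proof (rule ball_subset_closure_of_null_complement)
      show "\<Omega> \<in> sets borel" using \<Omega>(1) by simp
      have "emeasure lborel (ball z0 s1 - \<Omega>) \<le> emeasure lborel (ball z0 R - \<Omega>)"
        using \<Omega>(1) s1(2) by (intro emeasure_mono) (auto intro!: sets.Diff)
      then show "emeasure lborel (ball z0 s1 - \<Omega>) = 0" using null by simp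
    qed
    \<comment> \<open>The extension is bounded by 1 first on \<Omega> and then, by density and
      continuity, on the whole disc.\<close>
    have h1: "norm (h z) \<le> 1" if z: "z \<in> ball z0 s1" for z
    proof (rule ccontr)
      assume "\<not> norm (h z) \<le> 1"
      then have "z \<in> ball z0 s1 \<inter> h -` (- cball 0 1)" using z by simp
      moreover have "open (ball z0 s1 \<inter> h -` (- cball 0 1))" using hc by (intro continuous_open_preimage) auto
      ultimately have "\<exists>y\<in>ball z0 s1 \<inter> \<Omega>. y \<in> ball z0 s1 \<inter> h -` (- cball 0 1)"
        using cl z by (meson subsetD closure_iff_nhds_not_empty disjoint_iff order_refl)
      then show False using h(2) f1 by fastforce
    qed
    have sub: "cball z0 s \<subseteq> ball z0 s1" using s1 by auto
    have "norm ((deriv ^^ 1) h z0) \<le> fact 1 * 1 / s ^ 1"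
    proof (rule Cauchy_inequality)
      show "h holomorphic_on ball z0 s" using h(1) sub ball_subset_cball by (blast intro: holomorphic_on_subset)
      show "continuous_on (cball z0 s) h" using hc sub by (rule continuous_on_subset)
      show "norm (h x) \<le> 1" if "norm (z0 - x) = s" for x using that s1 by (intro h1) (simp add: dist_norm)
    qed (rule s)
    moreover have "deriv h z0 = deriv f z0"
    proof (rule complex_derivative_transform_within_open)
      show "h holomorphic_on \<Omega> \<inter> ball z0 s1" using h(1) by (rule holomorphic_on_subset) auto
      show "f holomorphic_on \<Omega> \<inter> ball z0 s1" using f(1) by (rule holomorphic_on_subset) auto
    qed (use \<Omega> s10 h(2) in auto)
    ultimately have "cmod (deriv f z0) \<le> 1 / s" by simp
    then show "t * (cmod (deriv f z0) * R) \<le> 1" using s by (simp add: s_def le_divide_eq mult_ac)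
  qed
  then show "cmod (deriv f z0) \<le> 1 / R" using R by (simp add: le_divide_eq)
qed

theorem theorem1p2:
  fixes \<Omega> :: "complex set"
  assumes "open \<Omega>" and "connected \<Omega>" and "\<Omega> \<noteq> {}"
  shows "(\<forall>z\<in>\<Omega>. (analytic_capacity \<Omega> z)\<^sup>2 \<ge> pi * inv_area \<Omega>) \<and>
    (\<forall>z0\<in>\<Omega>.
      ((analytic_capacity \<Omega> z0)\<^sup>2 = pi * inv_area \<Omega> \<longleftrightarrow>
        (emeasure lborel \<Omega> < \<infinity> \<and>
          (\<exists>P. P \<subseteq> ball z0 (sqrt (measure lborel \<Omega> / pi)) \<and>
               \<Omega> = ball z0 (sqrt (measure lborel \<Omega> / pi)) - P \<and>
               (\<forall>s < sqrt (measure lborel \<Omega> / pi). null_set_NB (Some ` (P \<inter> cball z0 s)))))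
        \<or>
        (emeasure lborel \<Omega> = \<infinity> \<and>
          (\<exists>P. null_set_NB P \<and> \<Omega> = {z. Some z \<notin> P})))
      \<and>
      (\<forall>P. emeasure lborel \<Omega> < \<infinity> \<and>
           P \<subseteq> ball z0 (sqrt (measure lborel \<Omega> / pi)) \<and>
           \<Omega> = ball z0 (sqrt (measure lborel \<Omega> / pi)) - P \<and>
           (\<forall>s < sqrt (measure lborel \<Omega> / pi). null_set_NB (Some ` (P \<inter> cball z0 s))) \<and>
           (log_capacity \<Omega> z0)\<^sup>2 = pi * inv_area \<Omega>
         \<longrightarrow> closedin (top_of_set (ball z0 (sqrt (measure lborel \<Omega> / pi)))) P \<and> polar P))"
proof (intro conjI ballI)
  define R where "R = sqrt (measure lborel \<Omega> / pi)"
  have area: "measure lborel \<Omega> > 0 \<and> R > 0 \<and> pi * inv_area \<Omega> = pi / measure lborel \<Omega> \<and> pi / measure lborel \<Omega> = (1 / R)\<^sup>2"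
    if fin: "emeasure lborel \<Omega> < \<infinity>"
  proof -
    obtain w d where d: "d > 0" "ball w d \<subseteq> \<Omega>" using assms openE by blast
    have "0 < emeasure lborel (ball w d)" using d(1) by (simp add: emeasure_ball_complex)
    also have "\<dots> \<le> emeasure lborel \<Omega>" using d(2) assms(1) by (intro emeasure_mono) auto
    finally have "measure lborel \<Omega> > 0" using fin by (simp add: measure_def enn2real_positive_iff zero_less_iff_neq_zero)
    then show ?thesis using fin by (simp add: R_def inv_area_def power_divide)
  qed
  show "pi * inv_area \<Omega> \<le> (analytic_capacity \<Omega> z)\<^sup>2" if z: "z \<in> \<Omega>" for z
  proof (cases "emeasure lborel \<Omega> = \<infinity>")
    case True
    then show ?thesis by (simp add: inv_area_def)
  next
    case False
    then have fin: "emeasure lborel \<Omega> < \<infinity>" by (simp add: top.not_eq_extremum)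
    show ?thesis using analytic_capacity_ge_area(1)[OF assms(1) z fin] area[OF fin] by simp
  qed
  fix z0 assume z0: "z0 \<in> \<Omega>"
  show "(analytic_capacity \<Omega> z0)\<^sup>2 = pi * inv_area \<Omega> \<longleftrightarrow>
        (emeasure lborel \<Omega> < \<infinity> \<and>
          (\<exists>P. P \<subseteq> ball z0 (sqrt (measure lborel \<Omega> / pi)) \<and>
               \<Omega> = ball z0 (sqrt (measure lborel \<Omega> / pi)) - P \<and>
               (\<forall>s < sqrt (measure lborel \<Omega> / pi). null_set_NB (Some ` (P \<inter> cball z0 s)))))
        \<or>
        (emeasure lborel \<Omega> = \<infinity> \<and>
          (\<exists>P. null_set_NB P \<and> \<Omega> = {z. Some z \<notin> P}))"
  proof (cases "emeasure lborel \<Omega> = \<infinity>")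
    case True
    then show ?thesis using analytic_capacity_eq_0_iff[OF assms(1,2) z0] by (simp add: inv_area_def)
  next
    case False
    then have fin: "emeasure lborel \<Omega> < \<infinity>" by (simp add: top.not_eq_extremum)
    note a = area[OF fin]
    have R: "R > 0" using a by blast
    have bdd: "emeasure lborel S = ennreal (measure lborel S)" if "S \<subseteq> ball z0 R" for S
      using emeasure_bounded_finite[OF bounded_subset[OF bounded_ball that]]
      by (intro emeasure_eq_ennreal_measure) simp
    have "(analytic_capacity \<Omega> z0)\<^sup>2 = pi * inv_area \<Omega> \<longleftrightarrow>
        (\<exists>P. P \<subseteq> ball z0 R \<and> \<Omega> = ball z0 R - P \<and> (\<forall>s<R. null_set_NB (Some ` (P \<inter> cball z0 s))))"
    proof
      assume eq: "(analytic_capacity \<Omega> z0)\<^sup>2 = pi * inv_area \<Omega>"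
      then have eq': "(analytic_capacity \<Omega> z0)\<^sup>2 = pi / measure lborel \<Omega>" using a by simp
      have m0: "measure lborel (ball z0 R - \<Omega>) = 0" "\<Omega> \<subseteq> ball z0 R"
        using analytic_capacity_ge_area(2)[OF assms(1) z0 fin eq'] unfolding R_def by auto
      have "(analytic_capacity \<Omega> z0)\<^sup>2 = (1 / R)\<^sup>2" using eq' a by simp
      then have "analytic_capacity \<Omega> z0 = 1 / R"
        by (rule power2_eq_imp_eq) (use analytic_capacity_nonneg[OF assms(1) z0] R in auto)
      then have "null_set_NB (Some ` ((ball z0 R - \<Omega>) \<inter> cball z0 s))" if "s < R" for s
        using bdd[of "ball z0 R - \<Omega>"] m0 that by (intro null_set_NB_of_extremal[OF assms(1,2) z0 R]) auto
      then show "\<exists>P. P \<subseteq> ball z0 R \<and> \<Omega> = ball z0 R - P \<and> (\<forall>s<R. null_set_NB (Some ` (P \<inter> cball z0 s)))"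
        using m0(2) by (intro exI[of _ "ball z0 R - \<Omega>"]) auto
    next
      assume "\<exists>P. P \<subseteq> ball z0 R \<and> \<Omega> = ball z0 R - P \<and> (\<forall>s<R. null_set_NB (Some ` (P \<inter> cball z0 s)))"
      then obtain P where P: "P \<subseteq> ball z0 R" "\<Omega> = ball z0 R - P" "\<And>s. s < R \<Longrightarrow> null_set_NB (Some ` (P \<inter> cball z0 s))"
        by blast
      have sub: "\<Omega> \<subseteq> ball z0 R" using P(2) by blast
      \<comment> \<open>R is defined so that the disc has the area of \<Omega>; this alone makes the
        removed set P null.\<close>
      have "measure lborel (ball z0 R) = measure lborel \<Omega>"
        using R a by (simp add: measure_ball_complex R_def)
      moreover have "emeasure lborel (ball z0 R - \<Omega>) = emeasure lborel (ball z0 R) - emeasure lborel \<Omega>"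
        using assms(1) fin sub by (intro emeasure_Diff) auto
      ultimately have null: "emeasure lborel (ball z0 R - \<Omega>) = 0" using bdd[OF sub] bdd[OF order_refl] by simp
      have "analytic_capacity \<Omega> z0 \<le> 1 / R" by (rule analytic_capacity_le_of_removable[OF assms(1) z0 P(2) null P(3)])
      then have "(analytic_capacity \<Omega> z0)\<^sup>2 \<le> (1 / R)\<^sup>2"
        using analytic_capacity_nonneg[OF assms(1) z0] by (intro power_mono)
      then show "(analytic_capacity \<Omega> z0)\<^sup>2 = pi * inv_area \<Omega>"
        using analytic_capacity_ge_area(1)[OF assms(1) z0 fin] a by simp
    qed
    then show ?thesis using False fin unfolding R_def by blast
  qed
  show "\<forall>P. emeasure lborel \<Omega> < \<infinity> \<and>
           P \<subseteq> ball z0 (sqrt (measure lborel \<Omega> / pi)) \<and>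
           \<Omega> = ball z0 (sqrt (measure lborel \<Omega> / pi)) - P \<and>
           (\<forall>s < sqrt (measure lborel \<Omega> / pi). null_set_NB (Some ` (P \<inter> cball z0 s))) \<and>
           (log_capacity \<Omega> z0)\<^sup>2 = pi * inv_area \<Omega>
         \<longrightarrow> closedin (top_of_set (ball z0 (sqrt (measure lborel \<Omega> / pi)))) P \<and> polar P"
    unfolding R_def[symmetric]
  proof (intro allI impI; elim conjE)
    fix P
    assume fin: "emeasure lborel \<Omega> < \<infinity>" and P: "P \<subseteq> ball z0 R" "\<Omega> = ball z0 R - P"
      and cap: "(log_capacity \<Omega> z0)\<^sup>2 = pi * inv_area \<Omega>"
    have P_eq: "P = ball z0 R - \<Omega>" using P by blast
    have R: "R > 0" "(log_capacity \<Omega> z0)\<^sup>2 = (1 / R)\<^sup>2" using area[OF fin] cap by auto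
    have "log_capacity \<Omega> z0 \<le> 1 / R" by (rule power2_le_imp_le) (use R in auto)
    moreover have "\<Omega> \<subseteq> ball z0 R" using P(2) by blast
    ultimately have "polar P" unfolding P_eq using assms(1) z0 by (intro polar_of_log_capacity_le)
    moreover have "closedin (top_of_set (ball z0 R)) P"
      unfolding P_eq closedin_closed using assms(1) by (intro exI[of _ "- \<Omega>"]) auto
    ultimately show "closedin (top_of_set (ball z0 R)) P \<and> polar P" by blast
  qed
qed

end
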